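(* Let $\mathscr D$ be a pointed derivator, $n\ge 1$, $1\le k\le n$, and $X\in\mathscr D^{\square^n}$. (i) If $X$ is $k$-cotruncated, then $C^{\underline m}(X)$ vanishes for all $\underline m\in\{0,1\}^n$ with $|\underline m|=k+1$. (ii) If $\mathscr D$ is stable, then $X$ is $k$-cotruncated if and only if $C^{\underline m}(X)$ vanishes for all $\underline m\in\{0,1\}^n$ with $|\underline m|=k+1$.
   Context: Derivators. $\mathrm{Cat}$ is the 2-category of small categories, $\mathrm{CAT}$ that of not necessarily small categories, $\mathbb 1$ the terminal category. A prederivator is a strict 2-functor $\mathscr D\colon\mathrm{Cat}^{\mathrm{op}}\to\mathrm{CAT}$ (1-cells reversed); write $u^*=\mathscr D(u)$. It is a derivator if: (Der1) $\mathscr D(\coprod_i A_i)\to\prod_i\mathscr D(A_i)$ is an equivalence; (Der2) a morphism $f$ of $\mathscr D(A)$ is invertible iff $f_a:=a^*f$ is invertible for all objects $a\colon\mathbb 1\to A$; (Der3) every $u^*$ has a left adjoint $u_!$ and a right adjoint $u_*$; (Der4) for $u\colon A\to B$ and $b\in B$ the canonical maps $\operatorname{colim}_{(u/b)}p^*X\to (u_!X)_b$ and $(u_*X)_b\to\lim_{(b/u)}q^*X$ are isomorphisms, where $p\colon(u/b)\to A$, $q\colon (b/u)\to A$ are the projections and $\operatorname{colim}_A=\pi_!$, $\lim_A=\pi_*$ for $\pi\colon A\to\mathbb 1$. Morphisms of derivators are pseudo-natural transformations; natural transformations between them are modifications. For $A\in\mathrm{Cat}$, $\mathscr D^A$ is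 the derivator $B\mapsto\mathscr D(A\times B)$; a functor $u\colon A\to B$ induces morphisms of derivators $u^*\colon\mathscr D^B\to\mathscr D^A$ and $u_!,u_*\colon\mathscr D^A\to\mathscr D^B$. "$X\in\mathscr D^A$" means $X\in\mathscr D^A(B)$ for some $B\in\mathrm{Cat}$. $\mathscr D$ is pointed if $\mathscr D(\mathbb 1)$ has a zero object. Cofibers, cones, stability. Let $[1]=(0<1)$, $\square=[1]^2$, $\ulcorner=\square\setminus\{(1,1)\}$, $i_\ulcorner\colon\ulcorner\to\square$ the inclusion, and $i\colon[1]\to\ulcorner$ the functor $0\mapsto(0,0)$, $1\mapsto(1,0)$. For $\mathscr D$ pointed, $\mathsf{cof}\colon\mathscr D^{[1]}\to\mathscr D^{[1]}$ is $(i_\ulcorner)_!\,i_*$ followed by restriction to the edge $(1,0)\to(1,1)$; it sends $f\colon x\to y$ to $y\to Cf$. The cone is $C=1^*\circ\mathsf{cof}$. A pointed derivator is stable if $\mathsf{cof}\colon\mathscr D^{[1]}\to\mathscr D^{[1]}$ is an equivalence (equivalently, squares are cocartesian iff they are cartesian). Cubes. $\square^n$ is the power set of $\{1,\dots,n\}$, identified with $[1]^n$; $\iota_{\le k}\colon\square^n_{\le k}\to\square^n$ is the inclusion of the full subposet of subsets with at most $k$ elements. $X\in\mathscr D^{\square^n}$ is $k$-cotruncated if it lies in the essential image of $(\iota_{\le k})_!$. For $1\le i\le n$, $\mathsf{cof}^{e_i}$ applies $\mathsf{cof}$ in the $i$-th coordinate of an $n$-cube. For $\underline m=(m_1,\dots,m_n)\in\{0,1\}^n$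 put $|\underline m|=\sum_i m_i$, $\mathsf{cof}^{\underline m}=(\mathsf{cof}^{e_n})^{m_n}\circ\cdots\circ(\mathsf{cof}^{e_1})^{m_1}$, and let $1_{\underline m}\colon\square^{n-|\underline m|}\to\square^n$ be the functor which inserts a $1$ at every coordinate $i$ with $m_i=1$ and is the identity on the remaining coordinates. Then $C^{\underline m}=(1_{\underline m})^*\circ\mathsf{cof}^{\underline m}\colon\mathscr D^{\square^n}\to\mathscr D^{\square^{n-|\underline m|}}$. *)

theory Defs
  imports "HOL-Library.FuncSet"
begin

text \<open>
  Categories have carrier sets. All structure maps are \<^const>\<open>undefined\<close> outside their
  domain, and functors and natural transformations carry their boundary, so that HOL equality is
  equality of categories, functors and transformations. \<open>Cmp C g f\<close> is \<open>g\<close> after \<open>f\<close>.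
\<close>

record ('o, 'm) cat =
  Ob :: "'o set"
  Ar :: "'m set"
  Dom :: "'m \<Rightarrow> 'o"
  Cod :: "'m \<Rightarrow> 'o"
  Id :: "'o \<Rightarrow> 'm"
  Cmp :: "'m \<Rightarrow> 'm \<Rightarrow> 'm"

definition Hom :: "('o, 'm) cat \<Rightarrow> 'o \<Rightarrow> 'o \<Rightarrow> 'm set" where
  "Hom C x y = {f \<in> Ar C. Dom C f = x \<and> Cod C f = y}"

definition category :: "('o, 'm) cat \<Rightarrow> bool" where
  "category C \<longleftrightarrow>
     Dom C \<in> Ar C \<rightarrow>\<^sub>E Ob C \<and> Cod C \<in> Ar C \<rightarrow>\<^sub>E Ob C \<and> Id C \<in> extensional (Ob C) \<and>
     (\<forall>x\<in>Ob C. Id C x \<in> Hom C x x) \<and>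
     (\<forall>f\<in>Ar C. \<forall>g\<in>Ar C. Cod C f = Dom C g \<longrightarrow> Cmp C g f \<in> Hom C (Dom C f) (Cod C g)) \<and>
     (\<forall>g f. \<not> (f \<in> Ar C \<and> g \<in> Ar C \<and> Cod C f = Dom C g) \<longrightarrow> Cmp C g f = undefined) \<and>
     (\<forall>f\<in>Ar C. Cmp C f (Id C (Dom C f)) = f \<and> Cmp C (Id C (Cod C f)) f = f) \<and>
     (\<forall>f\<in>Ar C. \<forall>g\<in>Ar C. \<forall>h\<in>Ar C. Cod C f = Dom C g \<and> Cod C g = Dom C h \<longrightarrow>
        Cmp C h (Cmp C g f) = Cmp C (Cmp C h g) f)"

definition mk_cat ::
  "'o set \<Rightarrow> 'm set \<Rightarrow> ('m \<Rightarrow> 'o) \<Rightarrow> ('m \<Rightarrow> 'o) \<Rightarrow> ('o \<Rightarrow> 'm) \<Rightarrow> ('m \<Rightarrow> 'm \<Rightarrow> 'm) \<Rightarrow> ('o, 'm) cat" where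
  "mk_cat X M d c i m =
     \<lparr>Ob = X, Ar = M, Dom = restrict d M, Cod = restrict c M, Id = restrict i X,
      Cmp = (\<lambda>g f. if f \<in> M \<and> g \<in> M \<and> c f = d g then m g f else undefined)\<rparr>"

definition inverse_arrows :: "('o, 'm) cat \<Rightarrow> 'm \<Rightarrow> 'm \<Rightarrow> bool" where
  "inverse_arrows C f g \<longleftrightarrow>
     f \<in> Ar C \<and> g \<in> Hom C (Cod C f) (Dom C f) \<and>
     Cmp C g f = Id C (Dom C f) \<and> Cmp C f g = Id C (Cod C f)"

definition invertible :: "('o, 'm) cat \<Rightarrow> 'm \<Rightarrow> bool" where
  "invertible C f \<longleftrightarrow> (\<exists>g. inverse_arrows C f g)"

definition inv_arrow :: "('o, 'm) cat \<Rightarrow> 'm \<Rightarrow> 'm" where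
  "inv_arrow C f = (THE g. inverse_arrows C f g)"

definition isomorphic :: "('o, 'm) cat \<Rightarrow> 'o \<Rightarrow> 'o \<Rightarrow> bool" where
  "isomorphic C x y \<longleftrightarrow> (\<exists>f\<in>Hom C x y. invertible C f)"

definition zero_object :: "('o, 'm) cat \<Rightarrow> 'o \<Rightarrow> bool" where
  "zero_object C z \<longleftrightarrow>
     z \<in> Ob C \<and> (\<forall>x\<in>Ob C. \<exists>!f. f \<in> Hom C z x) \<and> (\<forall>x\<in>Ob C. \<exists>!f. f \<in> Hom C x z)"

record ('o, 'm, 'p, 'q) func =
  Src :: "('o, 'm) cat"
  Tgt :: "('p, 'q) cat"
  FO :: "'o \<Rightarrow> 'p"
  FA :: "'m \<Rightarrow> 'q"

definition is_functor :: "('o, 'm, 'p, 'q) func \<Rightarrow> bool" where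
  "is_functor F \<longleftrightarrow>
     category (Src F) \<and> category (Tgt F) \<and>
     FO F \<in> Ob (Src F) \<rightarrow>\<^sub>E Ob (Tgt F) \<and> FA F \<in> extensional (Ar (Src F)) \<and>
     (\<forall>f\<in>Ar (Src F). FA F f \<in> Hom (Tgt F) (FO F (Dom (Src F) f)) (FO F (Cod (Src F) f))) \<and>
     (\<forall>x\<in>Ob (Src F). FA F (Id (Src F) x) = Id (Tgt F) (FO F x)) \<and>
     (\<forall>f\<in>Ar (Src F). \<forall>g\<in>Ar (Src F). Cod (Src F) f = Dom (Src F) g \<longrightarrow>
        FA F (Cmp (Src F) g f) = Cmp (Tgt F) (FA F g) (FA F f))"

definition mk_fun ::
  "('o, 'm) cat \<Rightarrow> ('p, 'q) cat \<Rightarrow> ('o \<Rightarrow> 'p) \<Rightarrow> ('m \<Rightarrow> 'q) \<Rightarrow> ('o, 'm, 'p, 'q) func" where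
  "mk_fun C D h k = \<lparr>Src = C, Tgt = D, FO = restrict h (Ob C), FA = restrict k (Ar C)\<rparr>"

definition id_fun :: "('o, 'm) cat \<Rightarrow> ('o, 'm, 'o, 'm) func" where
  "id_fun C = mk_fun C C (\<lambda>x. x) (\<lambda>f. f)"

definition comp_fun ::
  "('p, 'q, 'r, 's) func \<Rightarrow> ('o, 'm, 'p, 'q) func \<Rightarrow> ('o, 'm, 'r, 's) func" where
  "comp_fun G F = mk_fun (Src F) (Tgt G) (\<lambda>x. FO G (FO F x)) (\<lambda>f. FA G (FA F f))"

record ('o, 'm, 'p, 'q) nt =
  NSrc :: "('o, 'm, 'p, 'q) func"
  NTgt :: "('o, 'm, 'p, 'q) func"
  NC :: "'o \<Rightarrow> 'q"

definition is_nt :: "('o, 'm, 'p, 'q) nt \<Rightarrow> bool" where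
  "is_nt \<alpha> \<longleftrightarrow>
     is_functor (NSrc \<alpha>) \<and> is_functor (NTgt \<alpha>) \<and>
     Src (NSrc \<alpha>) = Src (NTgt \<alpha>) \<and> Tgt (NSrc \<alpha>) = Tgt (NTgt \<alpha>) \<and>
     NC \<alpha> \<in> extensional (Ob (Src (NSrc \<alpha>))) \<and>
     (\<forall>x\<in>Ob (Src (NSrc \<alpha>)). NC \<alpha> x \<in> Hom (Tgt (NSrc \<alpha>)) (FO (NSrc \<alpha>) x) (FO (NTgt \<alpha>) x)) \<and>
     (\<forall>f\<in>Ar (Src (NSrc \<alpha>)).
        Cmp (Tgt (NSrc \<alpha>)) (NC \<alpha> (Cod (Src (NSrc \<alpha>)) f)) (FA (NSrc \<alpha>) f) =
        Cmp (Tgt (NSrc \<alpha>)) (FA (NTgt \<alpha>) f) (NC \<alpha> (Dom (Src (NSrc \<alpha>)) f)))"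

definition mk_nt ::
  "('o, 'm, 'p, 'q) func \<Rightarrow> ('o, 'm, 'p, 'q) func \<Rightarrow> ('o \<Rightarrow> 'q) \<Rightarrow> ('o, 'm, 'p, 'q) nt" where
  "mk_nt F G c = \<lparr>NSrc = F, NTgt = G, NC = restrict c (Ob (Src F))\<rparr>"

definition id_nt :: "('o, 'm, 'p, 'q) func \<Rightarrow> ('o, 'm, 'p, 'q) nt" where
  "id_nt F = mk_nt F F (\<lambda>x. Id (Tgt F) (FO F x))"

definition vcomp ::
  "('o, 'm, 'p, 'q) nt \<Rightarrow> ('o, 'm, 'p, 'q) nt \<Rightarrow> ('o, 'm, 'p, 'q) nt" where
  "vcomp \<beta> \<alpha> = mk_nt (NSrc \<alpha>) (NTgt \<beta>) (\<lambda>x. Cmp (Tgt (NSrc \<alpha>)) (NC \<beta> x) (NC \<alpha> x))"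

definition hcomp ::
  "('p, 'q, 'r, 's) nt \<Rightarrow> ('o, 'm, 'p, 'q) nt \<Rightarrow> ('o, 'm, 'r, 's) nt" where
  "hcomp \<beta> \<alpha> =
     mk_nt (comp_fun (NSrc \<beta>) (NSrc \<alpha>)) (comp_fun (NTgt \<beta>) (NTgt \<alpha>))
       (\<lambda>x. Cmp (Tgt (NSrc \<beta>)) (NC \<beta> (FO (NTgt \<alpha>) x)) (FA (NSrc \<beta>) (NC \<alpha> x)))"

definition inv_nt :: "('o, 'm, 'p, 'q) nt \<Rightarrow> ('o, 'm, 'p, 'q) nt" where
  "inv_nt \<alpha> = mk_nt (NTgt \<alpha>) (NSrc \<alpha>) (\<lambda>x. inv_arrow (Tgt (NSrc \<alpha>)) (NC \<alpha> x))"

definition is_nat_iso :: "('o, 'm, 'p, 'q) nt \<Rightarrow> bool" where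
  "is_nat_iso \<alpha> \<longleftrightarrow>
     is_nt \<alpha> \<and> (\<forall>x\<in>Ob (Src (NSrc \<alpha>)). invertible (Tgt (NSrc \<alpha>)) (NC \<alpha> x))"

definition adjunction ::
  "('o, 'm, 'p, 'q) func \<Rightarrow> ('p, 'q, 'o, 'm) func \<Rightarrow>
   ('o, 'm, 'o, 'm) nt \<Rightarrow> ('p, 'q, 'p, 'q) nt \<Rightarrow> bool" where
  "adjunction F G \<eta> \<epsilon> \<longleftrightarrow>
     is_functor F \<and> is_functor G \<and> Src G = Tgt F \<and> Tgt G = Src F \<and>
     is_nt \<eta> \<and> NSrc \<eta> = id_fun (Src F) \<and> NTgt \<eta> = comp_fun G F \<and>
     is_nt \<epsilon> \<and> NSrc \<epsilon> = comp_fun F G \<and> NTgt \<epsilon> = id_fun (Tgt F) \<and>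
     (\<forall>x\<in>Ob (Src F). Cmp (Tgt F) (NC \<epsilon> (FO F x)) (FA F (NC \<eta> x)) = Id (Tgt F) (FO F x)) \<and>
     (\<forall>y\<in>Ob (Tgt F). Cmp (Src F) (FA G (NC \<epsilon> y)) (NC \<eta> (FO G y)) = Id (Src F) (FO G y))"

definition is_equivalence :: "('o, 'm, 'p, 'q) func \<Rightarrow> bool" where
  "is_equivalence F \<longleftrightarrow>
     is_functor F \<and>
     (\<exists>G \<eta> \<epsilon>. is_functor G \<and> Src G = Tgt F \<and> Tgt G = Src F \<and>
        is_nat_iso \<eta> \<and> NSrc \<eta> = id_fun (Src F) \<and> NTgt \<eta> = comp_fun G F \<and>
        is_nat_iso \<epsilon> \<and> NSrc \<epsilon> = comp_fun F G \<and> NTgt \<epsilon> = id_fun (Tgt F))"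

definition family_product :: "'i set \<Rightarrow> ('i \<Rightarrow> ('o, 'm) cat) \<Rightarrow> ('i \<Rightarrow> 'o, 'i \<Rightarrow> 'm) cat" where
  "family_product I C =
     mk_cat (\<Pi>\<^sub>E i\<in>I. Ob (C i)) (\<Pi>\<^sub>E i\<in>I. Ar (C i))
       (\<lambda>f. \<lambda>i\<in>I. Dom (C i) (f i)) (\<lambda>f. \<lambda>i\<in>I. Cod (C i) (f i)) (\<lambda>x. \<lambda>i\<in>I. Id (C i) (x i))
       (\<lambda>g f. \<lambda>i\<in>I. Cmp (C i) (g i) (f i))"

text \<open>
  Objects and arrows of small categories are codes: atoms of an arbitrary type, vertices of cubes,
  and formal pairs. Pairs keep products, coproducts and comma categories inside one type.
\<close>

datatype 'a code = Atom 'a | Vx (vtx: "bool list") | Pr (pfst: "'a code") (psnd: "'a code")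

type_synonym 'a scat = "('a code, 'a code) cat"
type_synonym 'a sfun = "('a code, 'a code, 'a code, 'a code) func"
type_synonym 'a snt = "('a code, 'a code, 'a code, 'a code) nt"

text \<open>
  Which sets of codes are small is a parameter, required to behave like membership in a universe.
  For a Grothendieck universe \<open>V\<close> (with an infinite element) take atoms indexed by \<open>V\<close> and call a
  set of codes small if it is equipotent to an element of \<open>V\<close>. The category of small categories
  is then, up to isomorphism of its objects, the one formed in \<open>V\<close>. Power sets of small sets are
  not required to be equipotent to small sets, so that declaring every set of codes small is also
  possible.
\<close>

definition universe :: "('a code set \<Rightarrow> bool) \<Rightarrow> bool" where
  "universe small \<longleftrightarrow>
     (\<exists>S. infinite S \<and> small S) \<and>
     (\<forall>S T. small S \<and> T \<subseteq> S \<longrightarrow> small T) \<and>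
     (\<forall>S f. small S \<longrightarrow> small (f ` S)) \<and>
     (\<forall>I A. small I \<and> (\<forall>i\<in>I. small (A i)) \<longrightarrow> small (\<Union>i\<in>I. A i))"

definition small_cat :: "('a code set \<Rightarrow> bool) \<Rightarrow> 'a scat \<Rightarrow> bool" where
  "small_cat U A \<longleftrightarrow> category A \<and> U (Ob A) \<and> U (Ar A)"

definition small_fun :: "('a code set \<Rightarrow> bool) \<Rightarrow> 'a sfun \<Rightarrow> bool" where
  "small_fun U u \<longleftrightarrow> is_functor u \<and> small_cat U (Src u) \<and> small_cat U (Tgt u)"

definition small_nt :: "('a code set \<Rightarrow> bool) \<Rightarrow> 'a snt \<Rightarrow> bool" where
  "small_nt U \<alpha> \<longleftrightarrow> is_nt \<alpha> \<and> small_fun U (NSrc \<alpha>) \<and> small_fun U (NTgt \<alpha>)"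

definition prod_cat :: "'a scat \<Rightarrow> 'a scat \<Rightarrow> 'a scat" where
  "prod_cat A B =
     mk_cat {Pr a b | a b. a \<in> Ob A \<and> b \<in> Ob B} {Pr f g | f g. f \<in> Ar A \<and> g \<in> Ar B}
       (\<lambda>f. Pr (Dom A (pfst f)) (Dom B (psnd f))) (\<lambda>f. Pr (Cod A (pfst f)) (Cod B (psnd f)))
       (\<lambda>x. Pr (Id A (pfst x)) (Id B (psnd x)))
       (\<lambda>g f. Pr (Cmp A (pfst g) (pfst f)) (Cmp B (psnd g) (psnd f)))"

definition prod_fun :: "'a sfun \<Rightarrow> 'a sfun \<Rightarrow> 'a sfun" where
  "prod_fun u v =
     mk_fun (prod_cat (Src u) (Src v)) (prod_cat (Tgt u) (Tgt v))
       (\<lambda>x. Pr (FO u (pfst x)) (FO v (psnd x))) (\<lambda>f. Pr (FA u (pfst f)) (FA v (psnd f)))"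

definition prod_nt :: "'a snt \<Rightarrow> 'a snt \<Rightarrow> 'a snt" where
  "prod_nt \<alpha> \<beta> =
     mk_nt (prod_fun (NSrc \<alpha>) (NSrc \<beta>)) (prod_fun (NTgt \<alpha>) (NTgt \<beta>))
       (\<lambda>x. Pr (NC \<alpha> (pfst x)) (NC \<beta> (psnd x)))"

definition coprod :: "'a code set \<Rightarrow> ('a code \<Rightarrow> 'a scat) \<Rightarrow> 'a scat" where
  "coprod I A =
     mk_cat {Pr i a | i a. i \<in> I \<and> a \<in> Ob (A i)} {Pr i f | i f. i \<in> I \<and> f \<in> Ar (A i)}
       (\<lambda>f. Pr (pfst f) (Dom (A (pfst f)) (psnd f))) (\<lambda>f. Pr (pfst f) (Cod (A (pfst f)) (psnd f)))
       (\<lambda>x. Pr (pfst x) (Id (A (pfst x)) (psnd x)))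
       (\<lambda>g f. Pr (pfst f) (Cmp (A (pfst f)) (psnd g) (psnd f)))"

definition coprod_incl :: "'a code set \<Rightarrow> ('a code \<Rightarrow> 'a scat) \<Rightarrow> 'a code \<Rightarrow> 'a sfun" where
  "coprod_incl I A i = mk_fun (A i) (coprod I A) (Pr i) (Pr i)"

text \<open>
  Full subposets of cubes. The vertices of \<open>[1]\<^sup>n\<close> are the Boolean lists of length \<open>n\<close>, ordered
  componentwise with \<open>False < True\<close>; the arrow \<open>p \<le> q\<close> is the pair of its endpoints.
\<close>

definition poset_cat :: "bool list set \<Rightarrow> 'a scat" where
  "poset_cat P =
     mk_cat (Vx ` P) {Pr (Vx p) (Vx q) | p q. p \<in> P \<and> q \<in> P \<and> list_all2 (\<le>) p q}
       pfst psnd (\<lambda>x. Pr x x) (\<lambda>g f. Pr (pfst f) (psnd g))"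

definition vmap :: "(bool list \<Rightarrow> bool list) \<Rightarrow> 'a code \<Rightarrow> 'a code" where
  "vmap h x = Vx (h (vtx x))"

definition emap :: "(bool list \<Rightarrow> bool list) \<Rightarrow> 'a code \<Rightarrow> 'a code" where
  "emap h f = Pr (vmap h (pfst f)) (vmap h (psnd f))"

definition poset_fun ::
  "bool list set \<Rightarrow> bool list set \<Rightarrow> (bool list \<Rightarrow> bool list) \<Rightarrow> 'a sfun" where
  "poset_fun P Q h = mk_fun (poset_cat P) (poset_cat Q) (vmap h) (emap h)"

definition cube_pts :: "nat \<Rightarrow> bool list set" where
  "cube_pts n = {p. length p = n}"

abbreviation cube :: "nat \<Rightarrow> 'a scat" where
  "cube n \<equiv> poset_cat (cube_pts n)"

abbreviation term_cat :: "'a scat" where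
  "term_cat \<equiv> cube 0"

definition to_term :: "'a scat \<Rightarrow> 'a sfun" where
  "to_term A = mk_fun A term_cat (\<lambda>_. Vx []) (\<lambda>_. Pr (Vx []) (Vx []))"

definition pt_fun :: "'a scat \<Rightarrow> 'a code \<Rightarrow> 'a sfun" where
  "pt_fun A a = mk_fun term_cat A (\<lambda>_. a) (\<lambda>_. Id A a)"

text \<open>
  The comma categories \<open>(u/b)\<close> and \<open>(b/u)\<close>. Objects are pairs \<open>(a, f)\<close> with \<open>f : u a \<rightarrow> b\<close>
  (resp. \<open>f : b \<rightarrow> u a\<close>), and an arrow is coded as \<open>((source, target), h)\<close>.
\<close>

definition comma_cat ::
  "'a scat \<Rightarrow> 'a code set \<Rightarrow> ('a code \<Rightarrow> 'a code \<Rightarrow> 'a code \<Rightarrow> bool) \<Rightarrow> 'a scat" where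
  "comma_cat A X R =
     mk_cat X {Pr (Pr x y) h | x y h. x \<in> X \<and> y \<in> X \<and> h \<in> Hom A (pfst x) (pfst y) \<and> R x y h}
       (\<lambda>f. pfst (pfst f)) (\<lambda>f. psnd (pfst f)) (\<lambda>x. Pr (Pr x x) (Id A (pfst x)))
       (\<lambda>g f. Pr (Pr (pfst (pfst f)) (psnd (pfst g))) (Cmp A (psnd g) (psnd f)))"

definition over_cat :: "'a sfun \<Rightarrow> 'a code \<Rightarrow> 'a scat" where
  "over_cat u b =
     comma_cat (Src u) {Pr a f | a f. a \<in> Ob (Src u) \<and> f \<in> Hom (Tgt u) (FO u a) b}
       (\<lambda>x y h. Cmp (Tgt u) (psnd y) (FA u h) = psnd x)"

definition under_cat :: "'a code \<Rightarrow> 'a sfun \<Rightarrow> 'a scat" where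
  "under_cat b u =
     comma_cat (Src u) {Pr a f | a f. a \<in> Ob (Src u) \<and> f \<in> Hom (Tgt u) b (FO u a)}
       (\<lambda>x y h. Cmp (Tgt u) (FA u h) (psnd x) = psnd y)"

definition over_proj :: "'a sfun \<Rightarrow> 'a code \<Rightarrow> 'a sfun" where
  "over_proj u b = mk_fun (over_cat u b) (Src u) pfst psnd"

definition under_proj :: "'a code \<Rightarrow> 'a sfun \<Rightarrow> 'a sfun" where
  "under_proj b u = mk_fun (under_cat b u) (Src u) pfst psnd"

definition over_cell :: "'a sfun \<Rightarrow> 'a code \<Rightarrow> 'a snt" where
  "over_cell u b =
     mk_nt (comp_fun u (over_proj u b)) (comp_fun (pt_fun (Tgt u) b) (to_term (over_cat u b))) psnd"

definition under_cell :: "'a code \<Rightarrow> 'a sfun \<Rightarrow> 'a snt" where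
  "under_cell b u =
     mk_nt (comp_fun (pt_fun (Tgt u) b) (to_term (under_cat b u))) (comp_fun u (under_proj b u)) psnd"

text \<open>
  All values of a prederivator are categories with carriers in the same two (arbitrary) types;
  no smallness is imposed on them.
\<close>

record ('a, 'o, 'm) pder =
  V0 :: "'a scat \<Rightarrow> ('o, 'm) cat"
  V1 :: "'a sfun \<Rightarrow> ('o, 'm, 'o, 'm) func"
  V2 :: "'a snt \<Rightarrow> ('o, 'm, 'o, 'm) nt"

definition prederivator :: "('a code set \<Rightarrow> bool) \<Rightarrow> ('a, 'o, 'm) pder \<Rightarrow> bool" where
  "prederivator U D \<longleftrightarrow>
     (\<forall>A. small_cat U A \<longrightarrow> category (V0 D A)) \<and>
     (\<forall>u. small_fun U u \<longrightarrow>
        is_functor (V1 D u) \<and> Src (V1 D u) = V0 D (Tgt u) \<and> Tgt (V1 D u) = V0 D (Src u)) \<and>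
     (\<forall>\<alpha>. small_nt U \<alpha> \<longrightarrow>
        is_nt (V2 D \<alpha>) \<and> NSrc (V2 D \<alpha>) = V1 D (NSrc \<alpha>) \<and> NTgt (V2 D \<alpha>) = V1 D (NTgt \<alpha>)) \<and>
     (\<forall>A. small_cat U A \<longrightarrow> V1 D (id_fun A) = id_fun (V0 D A)) \<and>
     (\<forall>u v. small_fun U u \<and> small_fun U v \<and> Tgt u = Src v \<longrightarrow>
        V1 D (comp_fun v u) = comp_fun (V1 D u) (V1 D v)) \<and>
     (\<forall>u. small_fun U u \<longrightarrow> V2 D (id_nt u) = id_nt (V1 D u)) \<and>
     (\<forall>\<alpha> \<beta>. small_nt U \<alpha> \<and> small_nt U \<beta> \<and> NTgt \<alpha> = NSrc \<beta> \<longrightarrow>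
        V2 D (vcomp \<beta> \<alpha>) = vcomp (V2 D \<beta>) (V2 D \<alpha>)) \<and>
     (\<forall>\<alpha> \<beta>. small_nt U \<alpha> \<and> small_nt U \<beta> \<and> Tgt (NSrc \<alpha>) = Src (NSrc \<beta>) \<longrightarrow>
        V2 D (hcomp \<beta> \<alpha>) = hcomp (V2 D \<alpha>) (V2 D \<beta>))"

definition shift :: "'a scat \<Rightarrow> ('a, 'o, 'm) pder \<Rightarrow> ('a, 'o, 'm) pder" where
  "shift A D =
     \<lparr>V0 = (\<lambda>B. V0 D (prod_cat A B)),
      V1 = (\<lambda>u. V1 D (prod_fun (id_fun A) u)),
      V2 = (\<lambda>\<alpha>. V2 D (prod_nt (id_nt (id_fun A)) \<alpha>))\<rparr>"

text \<open>
  A chosen left (right) adjoint of \<open>u\<^sup>*\<close> with its unit and counit; the choice is meaningful under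
  \<open>der3\<close> below.
\<close>

definition lkan_data ::
  "('a, 'o, 'm) pder \<Rightarrow> 'a sfun \<Rightarrow>
   ('o, 'm, 'o, 'm) func \<times> ('o, 'm, 'o, 'm) nt \<times> ('o, 'm, 'o, 'm) nt" where
  "lkan_data D u = (SOME (F, \<eta>, \<epsilon>). adjunction F (V1 D u) \<eta> \<epsilon>)"

definition rkan_data ::
  "('a, 'o, 'm) pder \<Rightarrow> 'a sfun \<Rightarrow>
   ('o, 'm, 'o, 'm) func \<times> ('o, 'm, 'o, 'm) nt \<times> ('o, 'm, 'o, 'm) nt" where
  "rkan_data D u = (SOME (G, \<eta>, \<epsilon>). adjunction (V1 D u) G \<eta> \<epsilon>)"

definition "lkan D u = fst (lkan_data D u)"
definition "lkan_unit D u = fst (snd (lkan_data D u))"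
definition "lkan_counit D u = snd (snd (lkan_data D u))"
definition "rkan D u = fst (rkan_data D u)"
definition "rkan_unit D u = fst (snd (rkan_data D u))"
definition "rkan_counit D u = snd (snd (rkan_data D u))"

text \<open>
  Mates. For \<open>\<alpha> : u p \<Rightarrow> v q\<close> the first is \<open>q\<^sub>! p\<^sup>* \<Rightarrow> v\<^sup>* u\<^sub>!\<close>, the composite
  \<open>q\<^sub>! p\<^sup>* \<rightarrow> q\<^sub>! p\<^sup>* u\<^sup>* u\<^sub>! \<rightarrow> q\<^sub>! q\<^sup>* v\<^sup>* u\<^sub>! \<rightarrow> v\<^sup>* u\<^sub>!\<close>; for \<open>\<alpha> : v q \<Rightarrow> u p\<close> the second is \<open>v\<^sup>* u\<^sub>* \<Rightarrow> q\<^sub>* p\<^sup>*\<close>,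
  the composite \<open>v\<^sup>* u\<^sub>* \<rightarrow> q\<^sub>* q\<^sup>* v\<^sup>* u\<^sub>* \<rightarrow> q\<^sub>* p\<^sup>* u\<^sup>* u\<^sub>* \<rightarrow> q\<^sub>* p\<^sup>*\<close>.
\<close>

definition lkan_mate ::
  "('a, 'o, 'm) pder \<Rightarrow> 'a sfun \<Rightarrow> 'a sfun \<Rightarrow> 'a sfun \<Rightarrow> 'a sfun \<Rightarrow> 'a snt \<Rightarrow> ('o, 'm, 'o, 'm) nt" where
  "lkan_mate D u p v q \<alpha> =
     mk_nt (comp_fun (lkan D q) (V1 D p)) (comp_fun (V1 D v) (lkan D u))
       (\<lambda>X. Cmp (V0 D (Tgt q))
              (NC (lkan_counit D q) (FO (V1 D v) (FO (lkan D u) X)))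
              (FA (lkan D q)
                 (Cmp (V0 D (Src q))
                    (NC (V2 D \<alpha>) (FO (lkan D u) X)) (FA (V1 D p) (NC (lkan_unit D u) X)))))"

definition rkan_mate ::
  "('a, 'o, 'm) pder \<Rightarrow> 'a sfun \<Rightarrow> 'a sfun \<Rightarrow> 'a sfun \<Rightarrow> 'a sfun \<Rightarrow> 'a snt \<Rightarrow> ('o, 'm, 'o, 'm) nt" where
  "rkan_mate D u p v q \<alpha> =
     mk_nt (comp_fun (V1 D v) (rkan D u)) (comp_fun (rkan D q) (V1 D p))
       (\<lambda>X. Cmp (V0 D (Tgt q))
              (FA (rkan D q)
                 (Cmp (V0 D (Src q))
                    (FA (V1 D p) (NC (rkan_counit D u) X)) (NC (V2 D \<alpha>) (FO (rkan D u) X))))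
              (NC (rkan_unit D q) (FO (V1 D v) (FO (rkan D u) X))))"

definition der1 :: "('a code set \<Rightarrow> bool) \<Rightarrow> ('a, 'o, 'm) pder \<Rightarrow> bool" where
  "der1 U D \<longleftrightarrow>
     (\<forall>I A. U I \<and> (\<forall>i\<in>I. small_cat U (A i)) \<longrightarrow>
        is_equivalence
          (mk_fun (V0 D (coprod I A)) (family_product I (\<lambda>i. V0 D (A i)))
             (\<lambda>X. \<lambda>i\<in>I. FO (V1 D (coprod_incl I A i)) X)
             (\<lambda>f. \<lambda>i\<in>I. FA (V1 D (coprod_incl I A i)) f)))"

definition der2 :: "('a code set \<Rightarrow> bool) \<Rightarrow> ('a, 'o, 'm) pder \<Rightarrow> bool" where
  "der2 U D \<longleftrightarrow>
     (\<forall>A f. small_cat U A \<and> f \<in> Ar (V0 D A) \<longrightarrow>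
        (invertible (V0 D A) f \<longleftrightarrow>
         (\<forall>a\<in>Ob A. invertible (V0 D term_cat) (FA (V1 D (pt_fun A a)) f))))"

definition der3 :: "('a code set \<Rightarrow> bool) \<Rightarrow> ('a, 'o, 'm) pder \<Rightarrow> bool" where
  "der3 U D \<longleftrightarrow>
     (\<forall>u. small_fun U u \<longrightarrow>
        (\<exists>F \<eta> \<epsilon>. adjunction F (V1 D u) \<eta> \<epsilon>) \<and> (\<exists>G \<eta> \<epsilon>. adjunction (V1 D u) G \<eta> \<epsilon>))"

definition der4 :: "('a code set \<Rightarrow> bool) \<Rightarrow> ('a, 'o, 'm) pder \<Rightarrow> bool" where
  "der4 U D \<longleftrightarrow>
     (\<forall>u b X. small_fun U u \<and> b \<in> Ob (Tgt u) \<and> X \<in> Ob (V0 D (Src u)) \<longrightarrow>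
        invertible (V0 D term_cat)
          (NC (lkan_mate D u (over_proj u b) (pt_fun (Tgt u) b) (to_term (over_cat u b))
                 (over_cell u b)) X) \<and>
        invertible (V0 D term_cat)
          (NC (rkan_mate D u (under_proj b u) (pt_fun (Tgt u) b) (to_term (under_cat b u))
                 (under_cell b u)) X))"

definition derivator :: "('a code set \<Rightarrow> bool) \<Rightarrow> ('a, 'o, 'm) pder \<Rightarrow> bool" where
  "derivator U D \<longleftrightarrow> prederivator U D \<and> der1 U D \<and> der2 U D \<and> der3 U D \<and> der4 U D"

definition pointed :: "('a, 'o, 'm) pder \<Rightarrow> bool" where
  "pointed D \<longleftrightarrow> (\<exists>z. zero_object (V0 D term_cat) z)"

text \<open>
  A pseudo-natural transformation \<open>F : D \<rightarrow> E\<close> consists of functors \<open>F\<^sub>A : D(A) \<rightarrow> E(A)\<close> and, for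
  \<open>v : A \<rightarrow> B\<close>, isomorphisms \<open>v\<^sup>* F\<^sub>B \<Rightarrow> F\<^sub>A v\<^sup>*\<close>, stored in \<open>MI\<close>.
\<close>

record ('a, 'o, 'm, 'p, 'q) dmor =
  MF :: "'a scat \<Rightarrow> ('o, 'm, 'p, 'q) func"
  MI :: "'a sfun \<Rightarrow> ('o, 'm, 'p, 'q) nt"

definition dmorphism ::
  "('a code set \<Rightarrow> bool) \<Rightarrow> ('a, 'o, 'm) pder \<Rightarrow> ('a, 'p, 'q) pder \<Rightarrow>
   ('a, 'o, 'm, 'p, 'q) dmor \<Rightarrow> bool" where
  "dmorphism U D E F \<longleftrightarrow>
     (\<forall>A. small_cat U A \<longrightarrow>
        is_functor (MF F A) \<and> Src (MF F A) = V0 D A \<and> Tgt (MF F A) = V0 E A) \<and>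
     (\<forall>v. small_fun U v \<longrightarrow>
        is_nat_iso (MI F v) \<and>
        NSrc (MI F v) = comp_fun (V1 E v) (MF F (Tgt v)) \<and>
        NTgt (MI F v) = comp_fun (MF F (Src v)) (V1 D v)) \<and>
     (\<forall>A. small_cat U A \<longrightarrow> MI F (id_fun A) = id_nt (MF F A)) \<and>
     (\<forall>v w. small_fun U v \<and> small_fun U w \<and> Tgt v = Src w \<longrightarrow>
        MI F (comp_fun w v) =
        vcomp (hcomp (MI F v) (id_nt (V1 D w))) (hcomp (id_nt (V1 E v)) (MI F w))) \<and>
     (\<forall>\<alpha>. small_nt U \<alpha> \<longrightarrow>
        vcomp (hcomp (id_nt (MF F (Src (NSrc \<alpha>)))) (V2 D \<alpha>)) (MI F (NSrc \<alpha>)) =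
        vcomp (MI F (NTgt \<alpha>)) (hcomp (V2 E \<alpha>) (id_nt (MF F (Tgt (NSrc \<alpha>))))))"

definition mid :: "('a, 'o, 'm) pder \<Rightarrow> ('a, 'o, 'm, 'o, 'm) dmor" where
  "mid D = \<lparr>MF = (\<lambda>A. id_fun (V0 D A)), MI = (\<lambda>v. id_nt (V1 D v))\<rparr>"

definition mcomp ::
  "('a, 'p, 'q, 'r, 's) dmor \<Rightarrow> ('a, 'o, 'm, 'p, 'q) dmor \<Rightarrow> ('a, 'o, 'm, 'r, 's) dmor" where
  "mcomp G F =
     \<lparr>MF = (\<lambda>A. comp_fun (MF G A) (MF F A)),
      MI = (\<lambda>v. vcomp (hcomp (id_nt (MF G (Src v))) (MI F v))
                       (hcomp (MI G v) (id_nt (MF F (Tgt v)))))\<rparr>"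

definition modification ::
  "('a code set \<Rightarrow> bool) \<Rightarrow> ('a, 'o, 'm) pder \<Rightarrow> ('a, 'p, 'q) pder \<Rightarrow>
   ('a, 'o, 'm, 'p, 'q) dmor \<Rightarrow> ('a, 'o, 'm, 'p, 'q) dmor \<Rightarrow>
   ('a scat \<Rightarrow> ('o, 'm, 'p, 'q) nt) \<Rightarrow> bool" where
  "modification U D E F G \<tau> \<longleftrightarrow>
     (\<forall>A. small_cat U A \<longrightarrow> is_nt (\<tau> A) \<and> NSrc (\<tau> A) = MF F A \<and> NTgt (\<tau> A) = MF G A) \<and>
     (\<forall>v. small_fun U v \<longrightarrow>
        vcomp (MI G v) (hcomp (id_nt (V1 E v)) (\<tau> (Tgt v))) =
        vcomp (hcomp (\<tau> (Src v)) (id_nt (V1 D v))) (MI F v))"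

definition inv_modification ::
  "('a code set \<Rightarrow> bool) \<Rightarrow> ('a, 'o, 'm) pder \<Rightarrow> ('a, 'p, 'q) pder \<Rightarrow>
   ('a, 'o, 'm, 'p, 'q) dmor \<Rightarrow> ('a, 'o, 'm, 'p, 'q) dmor \<Rightarrow>
   ('a scat \<Rightarrow> ('o, 'm, 'p, 'q) nt) \<Rightarrow> bool" where
  "inv_modification U D E F G \<tau> \<longleftrightarrow>
     modification U D E F G \<tau> \<and> (\<forall>A. small_cat U A \<longrightarrow> is_nat_iso (\<tau> A))"

definition derivator_equivalence ::
  "('a code set \<Rightarrow> bool) \<Rightarrow> ('a, 'o, 'm) pder \<Rightarrow> ('a, 'p, 'q) pder \<Rightarrow>
   ('a, 'o, 'm, 'p, 'q) dmor \<Rightarrow> bool" where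
  "derivator_equivalence U D E F \<longleftrightarrow>
     dmorphism U D E F \<and>
     (\<exists>G \<eta> \<epsilon>. dmorphism U E D G \<and>
        inv_modification U D D (mid D) (mcomp G F) \<eta> \<and>
        inv_modification U E E (mcomp F G) (mid E) \<epsilon>)"

text \<open>
  Write \<open>D\<^sup>A\<close> for \<open>shift A D\<close>. For \<open>u : A \<rightarrow> B\<close> the morphisms \<open>u\<^sup>* : D\<^sup>B \<rightarrow> D\<^sup>A\<close> and \<open>u\<^sub>!, u\<^sub>* : D\<^sup>A \<rightarrow> D\<^sup>B\<close>. The coherence
  isomorphisms of the latter two come from the mates of the commutative squares
  \<open>(u \<times> C')(A \<times> v) = (B \<times> v)(u \<times> C)\<close> for \<open>v : C \<rightarrow> C'\<close>.
\<close>

definition mres :: "('a, 'o, 'm) pder \<Rightarrow> 'a sfun \<Rightarrow> ('a, 'o, 'm, 'o, 'm) dmor" where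
  "mres D u =
     \<lparr>MF = (\<lambda>C. V1 D (prod_fun u (id_fun C))),
      MI = (\<lambda>v. id_nt (comp_fun (V1 (shift (Src u) D) v) (V1 D (prod_fun u (id_fun (Tgt v))))))\<rparr>"

definition mlan :: "('a, 'o, 'm) pder \<Rightarrow> 'a sfun \<Rightarrow> ('a, 'o, 'm, 'o, 'm) dmor" where
  "mlan D u =
     \<lparr>MF = (\<lambda>C. lkan D (prod_fun u (id_fun C))),
      MI = (\<lambda>v. inv_nt
              (lkan_mate D (prod_fun u (id_fun (Tgt v))) (prod_fun (id_fun (Src u)) v)
                 (prod_fun (id_fun (Tgt u)) v) (prod_fun u (id_fun (Src v)))
                 (id_nt (prod_fun u v))))\<rparr>"

definition mran :: "('a, 'o, 'm) pder \<Rightarrow> 'a sfun \<Rightarrow> ('a, 'o, 'm, 'o, 'm) dmor" where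
  "mran D u =
     \<lparr>MF = (\<lambda>C. rkan D (prod_fun u (id_fun C))),
      MI = (\<lambda>v. rkan_mate D (prod_fun u (id_fun (Tgt v))) (prod_fun (id_fun (Src u)) v)
                 (prod_fun (id_fun (Tgt u)) v) (prod_fun u (id_fun (Src v)))
                 (id_nt (prod_fun u v)))\<rparr>"

definition corner_pts :: "bool list set" where
  "corner_pts = cube_pts 2 - {[True, True]}"

definition cof_i :: "'a sfun" where
  "cof_i = poset_fun (cube_pts 1) corner_pts (\<lambda>p. [p ! 0, False])"

definition cof_corner :: "'a sfun" where
  "cof_corner = poset_fun corner_pts (cube_pts 2) (\<lambda>p. p)"

definition cof_edge :: "'a sfun" where
  "cof_edge = poset_fun (cube_pts 1) (cube_pts 2) (\<lambda>p. [True, p ! 0])"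

definition cof :: "('a, 'o, 'm) pder \<Rightarrow> ('a, 'o, 'm, 'o, 'm) dmor" where
  "cof D = mcomp (mres D cof_edge) (mcomp (mlan D cof_corner) (mran D cof_i))"

definition stable_derivator :: "('a code set \<Rightarrow> bool) \<Rightarrow> ('a, 'o, 'm) pder \<Rightarrow> bool" where
  "stable_derivator U D \<longleftrightarrow>
     derivator U D \<and> pointed D \<and>
     derivator_equivalence U (shift (cube 1) D) (shift (cube 1) D) (cof D)"

definition weight :: "bool list \<Rightarrow> nat" where
  "weight p = count_list p True"

definition trunc_pts :: "nat \<Rightarrow> nat \<Rightarrow> bool list set" where
  "trunc_pts n k = {p \<in> cube_pts n. weight p \<le> k}"

definition trunc_incl :: "nat \<Rightarrow> nat \<Rightarrow> 'a sfun" where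
  "trunc_incl n k = poset_fun (trunc_pts n k) (cube_pts n) (\<lambda>p. p)"

definition cotruncated ::
  "('a, 'o, 'm) pder \<Rightarrow> nat \<Rightarrow> nat \<Rightarrow> 'a scat \<Rightarrow> 'o \<Rightarrow> bool" where
  "cotruncated D n k B X \<longleftrightarrow>
     (\<exists>Y\<in>Ob (V0 (shift (poset_cat (trunc_pts n k)) D) B).
        isomorphic (V0 (shift (cube n) D) B) (FO (MF (mlan D (trunc_incl n k)) B) Y) X)"

text \<open>
  Coordinates are numbered from \<open>0\<close>. The isomorphism
  \<open>[1]\<^sup>n \<times> B \<cong> [1]\<^bsup>n-1\<^esup> \<times> ([1] \<times> B)\<close> singling out coordinate \<open>i\<close> identifies \<open>D\<^bsup>[1]^n\<^esup>(B)\<close> with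
  \<open>E\<^bsup>[1]\<^esup>(B)\<close> for \<open>E = D\<^bsup>[1]^(n-1)\<^esup>\<close>; the functor \<open>cof\<close> in coordinate \<open>i\<close> is that of \<open>E\<close>.
\<close>

definition del_coord :: "nat \<Rightarrow> bool list \<Rightarrow> bool list" where
  "del_coord i p = take i p @ drop (Suc i) p"

definition ins_coord :: "nat \<Rightarrow> bool list \<Rightarrow> bool list \<Rightarrow> bool list" where
  "ins_coord i b p = take i p @ b @ drop i p"

definition split_cube :: "nat \<Rightarrow> nat \<Rightarrow> 'a scat \<Rightarrow> 'a sfun" where
  "split_cube n i B =
     mk_fun (prod_cat (cube n) B) (prod_cat (cube (n - 1)) (prod_cat (cube 1) B))
       (\<lambda>x. Pr (vmap (del_coord i) (pfst x)) (Pr (vmap (\<lambda>p. [p ! i]) (pfst x)) (psnd x)))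
       (\<lambda>f. Pr (emap (del_coord i) (pfst f)) (Pr (emap (\<lambda>p. [p ! i]) (pfst f)) (psnd f)))"

definition merge_vx :: "nat \<Rightarrow> 'a code \<Rightarrow> 'a code \<Rightarrow> 'a code" where
  "merge_vx i x b = Vx (ins_coord i (vtx b) (vtx x))"

definition merge_cube :: "nat \<Rightarrow> nat \<Rightarrow> 'a scat \<Rightarrow> 'a sfun" where
  "merge_cube n i B =
     mk_fun (prod_cat (cube (n - 1)) (prod_cat (cube 1) B)) (prod_cat (cube n) B)
       (\<lambda>x. Pr (merge_vx i (pfst x) (pfst (psnd x))) (psnd (psnd x)))
       (\<lambda>f. Pr (Pr (merge_vx i (pfst (pfst f)) (pfst (pfst (psnd f))))
                   (merge_vx i (psnd (pfst f)) (psnd (pfst (psnd f)))))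
               (psnd (psnd f)))"

definition cof_coord ::
  "('a, 'o, 'm) pder \<Rightarrow> nat \<Rightarrow> nat \<Rightarrow> 'a scat \<Rightarrow> ('o, 'm, 'o, 'm) func" where
  "cof_coord D n i B =
     comp_fun (V1 D (split_cube n i B))
       (comp_fun (MF (cof (shift (cube (n - 1)) D)) B) (V1 D (merge_cube n i B)))"

text \<open>A multi-index \<open>m \<in> {0,1}\<^sup>n\<close> is a Boolean list, and \<open>n = length m\<close>.\<close>

definition cof_multi ::
  "('a, 'o, 'm) pder \<Rightarrow> bool list \<Rightarrow> 'a scat \<Rightarrow> ('o, 'm, 'o, 'm) func" where
  "cof_multi D m B =
     fold (\<lambda>i F. if m ! i then comp_fun (cof_coord D (length m) i B) F else F) [0..<length m]
       (id_fun (V0 (shift (cube (length m)) D) B))"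

fun insert_ones :: "bool list \<Rightarrow> bool list \<Rightarrow> bool list" where
  "insert_ones [] p = []"
| "insert_ones (True # m) p = True # insert_ones m p"
| "insert_ones (False # m) p = hd p # insert_ones m (tl p)"

definition ones_fun :: "bool list \<Rightarrow> 'a sfun" where
  "ones_fun m = poset_fun (cube_pts (length m - weight m)) (cube_pts (length m)) (insert_ones m)"

definition cone_multi ::
  "('a, 'o, 'm) pder \<Rightarrow> bool list \<Rightarrow> 'a scat \<Rightarrow> ('o, 'm, 'o, 'm) func" where
  "cone_multi D m B = comp_fun (MF (mres D (ones_fun m)) B) (cof_multi D m B)"

definition cone_vanishes ::
  "('a, 'o, 'm) pder \<Rightarrow> bool list \<Rightarrow> 'a scat \<Rightarrow> 'o \<Rightarrow> bool" where
  "cone_vanishes D m B X \<longleftrightarrow>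
     zero_object (V0 (shift (cube (length m - weight m)) D) B) (FO (cone_multi D m B) X)"

end

theory Submission
  imports Defs
begin

text \<open>
  Write \<open>\<iota>\<close> for the inclusion of the vertices of weight at most \<open>k\<close>. In a pointed derivator the total
  cone \<open>C\<^sup>m\<close> is left adjoint to extension by zero from the face \<open>{p. m \<le> p}\<close>. If \<open>X = \<iota>\<^sub>! Y\<close> and
  \<open>|m| = k + 1\<close>, then maps from \<open>X\<close> to an extension by zero \<open>Z\<close> from that face are maps
  \<open>Y \<rightarrow> \<iota>\<^sup>* Z = 0\<close>, so \<open>C\<^sup>m X = 0\<close>.

  Conversely, let \<open>D\<close> be stable and let all these cones of \<open>X\<close> vanish; by the first part they vanish
  for \<open>\<iota>\<^sub>! \<iota>\<^sup>* X\<close> as well. The counit \<open>\<epsilon> : \<iota>\<^sub>! \<iota>\<^sup>* X \<rightarrow> X\<close> is invertible at the vertices of weight at most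
  \<open>k\<close>. At a minimal vertex \<open>p\<close> where it might not be, choose \<open>m \<le> p\<close> of weight \<open>k + 1\<close>: then \<open>\<epsilon>\<close> is
  invertible at all vertices below \<open>p\<close> and becomes invertible at \<open>p\<close> after taking cofibers in the
  directions of \<open>m\<close>, and in the stable case a map of arrows which is invertible on sources and on cones
  is invertible on targets. The latter holds because \<open>cof\<close> is conservative and the cone of \<open>cof f\<close>
  depends only on the source of \<open>f\<close>.
\<close>

section \<open>Categories\<close>

text \<open>Kan extensions are arbitrary choices, so functors that are canonically isomorphic, such
  as Kan extensions before and after a permutation of factors, are unrelated as chosen, and a chain
  of adjunctions would need its comparison arrows written out. Most comparisons therefore construct
  no inverse: an arrow h is tested against an object u by asking whether composition with h is
  bijective on arrows to u (\<open>local_at\<close>). This property crosses an adjunction in one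
  step, and an arrow that is local at its source and its target is invertible. That Hom(X, V) is a
  singleton is the same test for 0 -> X. The functor \<open>cof\<close> keeps y next to the cone of
  x -> y, so it is not the reflection onto arrows with source zero. The functor with value 0 -> C
  is, and it agrees with \<open>cof\<close> at the vertices where the total cone is read off;
  zigzags of arrows invertible there connect the two. Each step in one coordinate has the other
  coordinates and B as parameters, so pointwise statements are proved for a parameter category and
  at a single parameter object. The induction over vertices relies on this, as it knows
  invertibility at some vertices only.\<close>

lemma HomD: "f \<in> Hom C x y \<Longrightarrow> f \<in> Ar C" "f \<in> Hom C x y \<Longrightarrow> Dom C f = x" "f \<in> Hom C x y \<Longrightarrow> Cod C f = y"
  by (simp_all add: Hom_def)

lemma Ar_Hom: "f \<in> Ar C \<Longrightarrow> f \<in> Hom C (Dom C f) (Cod C f)"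
  by (simp add: Hom_def)

lemma Dom_Ob: "category C \<Longrightarrow> f \<in> Ar C \<Longrightarrow> Dom C f \<in> Ob C"
  by (auto simp: category_def)

lemma Cod_Ob: "category C \<Longrightarrow> f \<in> Ar C \<Longrightarrow> Cod C f \<in> Ob C"
  by (auto simp: category_def)

lemma Hom_Ob: "category C \<Longrightarrow> f \<in> Hom C x y \<Longrightarrow> x \<in> Ob C" "category C \<Longrightarrow> f \<in> Hom C x y \<Longrightarrow> y \<in> Ob C"
  by (auto simp: category_def Hom_def)

lemma Cmp_Hom: "category C \<Longrightarrow> g \<in> Hom C y z \<Longrightarrow> f \<in> Hom C x y \<Longrightarrow> Cmp C g f \<in> Hom C x z"
  unfolding category_def Hom_def by auto

lemma Id_Hom: "category C \<Longrightarrow> x \<in> Ob C \<Longrightarrow> Id C x \<in> Hom C x x"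
  by (simp add: category_def)

lemma Cmp_Id_right: "category C \<Longrightarrow> f \<in> Hom C x y \<Longrightarrow> Cmp C f (Id C x) = f"
  by (auto simp: category_def Hom_def)

lemma Cmp_Id_left: "category C \<Longrightarrow> f \<in> Hom C x y \<Longrightarrow> Cmp C (Id C y) f = f"
  by (auto simp: category_def Hom_def)

lemma Cmp_assoc:
  "category C \<Longrightarrow> h \<in> Hom C z w \<Longrightarrow> g \<in> Hom C y z \<Longrightarrow> f \<in> Hom C x y \<Longrightarrow>
   Cmp C (Cmp C h g) f = Cmp C h (Cmp C g f)"
  unfolding category_def Hom_def by auto

section \<open>Isomorphisms in a category\<close>

lemma invertibleI:
  "f \<in> Hom C x y \<Longrightarrow> g \<in> Hom C y x \<Longrightarrow> Cmp C g f = Id C x \<Longrightarrow> Cmp C f g = Id C y \<Longrightarrow> invertible C f"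
  unfolding invertible_def inverse_arrows_def Hom_def by auto

lemma invertibleE:
  assumes "invertible C f" "f \<in> Hom C x y"
  obtains g where "g \<in> Hom C y x" "Cmp C g f = Id C x" "Cmp C f g = Id C y"
  using assms unfolding invertible_def inverse_arrows_def Hom_def by auto

lemma invertible_Id: "category C \<Longrightarrow> x \<in> Ob C \<Longrightarrow> invertible C (Id C x)"
  by (rule invertibleI[OF Id_Hom Id_Hom]) (auto intro: Cmp_Id_left Id_Hom)

lemma invertible_Cmp:
  assumes C: "category C" and g: "g \<in> Hom C y z" and f: "f \<in> Hom C x y"
    and ig: "invertible C g" and if': "invertible C f"
  shows "invertible C (Cmp C g f)"
proof -
  obtain g' where g': "g' \<in> Hom C z y" "Cmp C g' g = Id C y" "Cmp C g g' = Id C z"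
    using invertibleE[OF ig g] .
  obtain f' where f': "f' \<in> Hom C y x" "Cmp C f' f = Id C x" "Cmp C f f' = Id C y"
    using invertibleE[OF if' f] .
  show ?thesis
  proof (rule invertibleI)
    show "Cmp C g f \<in> Hom C x z" "Cmp C f' g' \<in> Hom C z x"
      using C g f g' f' by (auto intro: Cmp_Hom)
    have "Cmp C (Cmp C f' g') (Cmp C g f) = Cmp C f' (Cmp C (Cmp C g' g) f)"
      using Cmp_assoc[OF C f'(1) g'(1) Cmp_Hom[OF C g f]] Cmp_assoc[OF C g'(1) g f] by simp
    thus "Cmp C (Cmp C f' g') (Cmp C g f) = Id C x"
      using g' f' f Cmp_Id_left[OF C f] by simp
    have "Cmp C (Cmp C g f) (Cmp C f' g') = Cmp C g (Cmp C (Cmp C f f') g')"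
      using Cmp_assoc[OF C g f Cmp_Hom[OF C f'(1) g'(1)]] Cmp_assoc[OF C f f'(1) g'(1)] by simp
    thus "Cmp C (Cmp C g f) (Cmp C f' g') = Id C z"
      using g' f' f Cmp_Id_left[OF C g'(1)] by simp
  qed
qed

lemma invertible_inverse:
  assumes "category C" "f \<in> Hom C x y" "invertible C f"
  obtains g where "g \<in> Hom C y x" "invertible C g" "Cmp C g f = Id C x" "Cmp C f g = Id C y"
  using assms by (metis invertibleE invertibleI)

lemma invertible_cancel_left:
  assumes C: "category C" and g: "g \<in> Hom C y z" and f: "f \<in> Hom C x y"
    and ig: "invertible C g" and gf: "invertible C (Cmp C g f)"
  shows "invertible C f"
proof -
  obtain g' where g': "g' \<in> Hom C z y" "invertible C g'" "Cmp C g' g = Id C y"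
    using invertible_inverse[OF C g ig] by metis
  have "f = Cmp C g' (Cmp C g f)"
    using Cmp_assoc[OF C g'(1) g f] Cmp_Id_left[OF C f] g'(3) by simp
  thus ?thesis using invertible_Cmp[OF C g'(1) Cmp_Hom[OF C g f] g'(2) gf] by simp
qed

lemma invertible_cancel_right:
  assumes C: "category C" and g: "g \<in> Hom C y z" and f: "f \<in> Hom C x y"
    and if': "invertible C f" and gf: "invertible C (Cmp C g f)"
  shows "invertible C g"
proof -
  obtain f' where f': "f' \<in> Hom C y x" "invertible C f'" "Cmp C f f' = Id C y"
    using invertible_inverse[OF C f if'] by metis
  have "g = Cmp C (Cmp C g f) f'"
    using Cmp_assoc[OF C g f f'(1)] Cmp_Id_right[OF C g] f'(3) by simp
  thus ?thesis using invertible_Cmp[OF C Cmp_Hom[OF C g f] f'(1) gf f'(2)] by simp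
qed

text \<open>Used for naturality squares whose sides \<open>k\<close> and \<open>k'\<close> are
  units, counits or mates: invertibility passes from the values of a functor to those of an
  isomorphic one.\<close>

lemma invertible_square:
  assumes C: "category C" and h: "h \<in> Hom C x y" and h': "h' \<in> Hom C x' y'"
    and k: "k \<in> Hom C x' x" and k': "k' \<in> Hom C y' y" and ik: "invertible C k" and ik': "invertible C k'"
    and sq: "Cmp C k' h' = Cmp C h k"
  shows "invertible C h \<longleftrightarrow> invertible C h'"
proof
  assume "invertible C h"
  hence "invertible C (Cmp C k' h')" using invertible_Cmp[OF C h k _ ik] sq by simp
  thus "invertible C h'" using invertible_cancel_left[OF C k' h' ik'] by simp
next
  assume "invertible C h'"
  hence "invertible C (Cmp C h k)" using invertible_Cmp[OF C k' h' ik'] sq by simp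
  thus "invertible C h" using invertible_cancel_right[OF C h k ik] by simp
qed

section \<open>Zero objects\<close>

lemma zero_objectD:
  assumes "zero_object C z"
  shows "z \<in> Ob C" "x \<in> Ob C \<Longrightarrow> \<exists>f. f \<in> Hom C z x" "x \<in> Ob C \<Longrightarrow> \<exists>f. f \<in> Hom C x z"
    "x \<in> Ob C \<Longrightarrow> f \<in> Hom C z x \<Longrightarrow> g \<in> Hom C z x \<Longrightarrow> f = g"
    "x \<in> Ob C \<Longrightarrow> f \<in> Hom C x z \<Longrightarrow> g \<in> Hom C x z \<Longrightarrow> f = g"
  using assms unfolding zero_object_def by auto

lemma zero_object_arrow_invertible:
  assumes C: "category C" and z: "zero_object C z" "zero_object C z'" and f: "f \<in> Hom C z z'"
  shows "invertible C f"
proof -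
  obtain g where g: "g \<in> Hom C z' z" using zero_objectD[OF z(2)] zero_objectD(1)[OF z(1)] by blast
  show ?thesis
    by (rule invertibleI[OF f g])
      (rule zero_objectD(4)[OF z(1)] zero_objectD(4)[OF z(2)];
        auto intro: Cmp_Hom[OF C] f g Id_Hom[OF C] zero_objectD(1) z)+
qed

lemma zero_object_invertible:
  assumes C: "category C" and z: "zero_object C z" and f: "f \<in> Hom C z x" and i: "invertible C f"
  shows "zero_object C x"
proof -
  obtain g where g: "g \<in> Hom C x z" "Cmp C g f = Id C z" "Cmp C f g = Id C x"
    using invertibleE[OF i f] .
  have x: "x \<in> Ob C" using Hom_Ob[OF C f] by simp
  have 1: "\<exists>!h. h \<in> Hom C x y" if y: "y \<in> Ob C" for y
  proof -
    obtain h where h: "h \<in> Hom C z y" using zero_objectD(2)[OF z y] ..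
    have "h1 = h2" if "h1 \<in> Hom C x y" "h2 \<in> Hom C x y" for h1 h2
    proof -
      have "Cmp C h1 f = Cmp C h2 f" using zero_objectD(4)[OF z y] Cmp_Hom[OF C _ f] that by blast
      hence "Cmp C (Cmp C h1 f) g = Cmp C (Cmp C h2 f) g" by simp
      thus ?thesis using Cmp_assoc[OF C _ f g(1)] that g(3) Cmp_Id_right[OF C] by metis
    qed
    thus ?thesis using Cmp_Hom[OF C h g(1)] by auto
  qed
  have 2: "\<exists>!h. h \<in> Hom C y x" if y: "y \<in> Ob C" for y
  proof -
    obtain h where h: "h \<in> Hom C y z" using zero_objectD(3)[OF z y] ..
    have "h1 = h2" if "h1 \<in> Hom C y x" "h2 \<in> Hom C y x" for h1 h2
    proof -
      have "Cmp C g h1 = Cmp C g h2" using zero_objectD(5)[OF z y] Cmp_Hom[OF C g(1)] that by blast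
      hence "Cmp C f (Cmp C g h1) = Cmp C f (Cmp C g h2)" by simp
      thus ?thesis using Cmp_assoc[OF C f g(1)] that g(3) Cmp_Id_left[OF C] by metis
    qed
    thus ?thesis using Cmp_Hom[OF C f h] by auto
  qed
  show ?thesis unfolding zero_object_def using x 1 2 by blast
qed

lemma zero_object_isomorphic:
  assumes C: "category C" and f: "f \<in> Hom C x y" and i: "invertible C f"
  shows "zero_object C x \<longleftrightarrow> zero_object C y"
  using zero_object_invertible[OF C] f i invertible_inverse[OF C f i] by metis

section \<open>Functors\<close>

lemma functorD:
  assumes "is_functor F"
  shows "category (Src F)" "category (Tgt F)"
    "x \<in> Ob (Src F) \<Longrightarrow> FO F x \<in> Ob (Tgt F)"
    "f \<in> Hom (Src F) x y \<Longrightarrow> FA F f \<in> Hom (Tgt F) (FO F x) (FO F y)"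
    "x \<in> Ob (Src F) \<Longrightarrow> FA F (Id (Src F) x) = Id (Tgt F) (FO F x)"
    "g \<in> Hom (Src F) y z \<Longrightarrow> f \<in> Hom (Src F) x y \<Longrightarrow>
       FA F (Cmp (Src F) g f) = Cmp (Tgt F) (FA F g) (FA F f)"
  using assms unfolding is_functor_def Hom_def by auto

lemma functorI:
  assumes "category C" "category D"
    and "\<And>x. x \<in> Ob C \<Longrightarrow> h x \<in> Ob D"
    and "\<And>f. f \<in> Ar C \<Longrightarrow> k f \<in> Hom D (h (Dom C f)) (h (Cod C f))"
    and "\<And>x. x \<in> Ob C \<Longrightarrow> k (Id C x) = Id D (h x)"
    and "\<And>f g. f \<in> Ar C \<Longrightarrow> g \<in> Ar C \<Longrightarrow> Cod C f = Dom C g \<Longrightarrow> k (Cmp C g f) = Cmp D (k g) (k f)"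
  shows "is_functor (mk_fun C D h k)"
proof -
  have [simp]: "Cmp C g f \<in> Ar C" if "f \<in> Ar C" "g \<in> Ar C" "Cod C f = Dom C g" for f g
    using Cmp_Hom[OF assms(1), of g "Dom C g" "Cod C g" f "Dom C f"] that by (simp add: Hom_def)
  have [simp]: "Id C x \<in> Ar C" if "x \<in> Ob C" for x
    using Id_Hom[OF assms(1) that] by (simp add: Hom_def)
  show ?thesis
    unfolding is_functor_def mk_fun_def using assms Dom_Ob[OF assms(1)] Cod_Ob[OF assms(1)]
    by (auto simp: PiE_def extensional_def)
qed

text \<open>Both maps of a functor are \<open>undefined\<close> outside their domain, so agreement
  on the objects and arrows of the source gives equality of records. Strict equations between
  functors matter because a prederivator respects composition on the nose.\<close>

lemma functor_eqI:
  assumes "is_functor F" "is_functor G" "Src F = Src G" "Tgt F = Tgt G"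
    and "\<And>x. x \<in> Ob (Src F) \<Longrightarrow> FO F x = FO G x" "\<And>f. f \<in> Ar (Src F) \<Longrightarrow> FA F f = FA G f"
  shows "F = G"
proof (rule func.equality)
  show "FO F = FO G"
    using assms unfolding is_functor_def by (auto intro!: extensionalityI[of _ "Ob (Src F)"] simp: PiE_def)
  show "FA F = FA G"
    using assms unfolding is_functor_def by (auto intro!: extensionalityI[of _ "Ar (Src F)"])
qed (use assms in auto)

lemma mk_fun_simps [simp]:
  "Src (mk_fun C D h k) = C" "Tgt (mk_fun C D h k) = D"
  "x \<in> Ob C \<Longrightarrow> FO (mk_fun C D h k) x = h x" "f \<in> Ar C \<Longrightarrow> FA (mk_fun C D h k) f = k f"
  by (simp_all add: mk_fun_def)

lemma id_fun_simps [simp]: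
  "Src (id_fun C) = C" "Tgt (id_fun C) = C"
  "x \<in> Ob C \<Longrightarrow> FO (id_fun C) x = x" "f \<in> Ar C \<Longrightarrow> FA (id_fun C) f = f"
  by (simp_all add: id_fun_def)

lemma comp_fun_simps [simp]:
  "Src (comp_fun G F) = Src F" "Tgt (comp_fun G F) = Tgt G"
  "x \<in> Ob (Src F) \<Longrightarrow> FO (comp_fun G F) x = FO G (FO F x)"
  "f \<in> Ar (Src F) \<Longrightarrow> FA (comp_fun G F) f = FA G (FA F f)"
  by (simp_all add: comp_fun_def)

lemma functor_id_fun: "category C \<Longrightarrow> is_functor (id_fun C)"
  unfolding id_fun_def by (rule functorI) (auto simp: Ar_Hom)

lemma functor_Ar: "is_functor F \<Longrightarrow> f \<in> Ar (Src F) \<Longrightarrow> FA F f \<in> Ar (Tgt F)"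
  using functorD(4) HomD(1) Ar_Hom by metis

lemma functor_comp_fun:
  assumes F: "is_functor F" and G: "is_functor G" and FG: "Tgt F = Src G"
  shows "is_functor (comp_fun G F)"
  unfolding comp_fun_def
proof (rule functorI)
  fix f assume f: "f \<in> Ar (Src F)"
  show "FA G (FA F f) \<in> Hom (Tgt G) (FO G (FO F (Dom (Src F) f))) (FO G (FO F (Cod (Src F) f)))"
    by (rule functorD(4)[OF G]) (use functorD(4)[OF F Ar_Hom[OF f]] FG in simp)
next
  fix f g assume f: "f \<in> Ar (Src F)" and g: "g \<in> Ar (Src F)" and fg: "Cod (Src F) f = Dom (Src F) g"
  have f': "f \<in> Hom (Src F) (Dom (Src F) f) (Dom (Src F) g)" using Ar_Hom[OF f] fg by simp
  show "FA G (FA F (Cmp (Src F) g f)) = Cmp (Tgt G) (FA G (FA F g)) (FA G (FA F f))"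
    using functorD(6)[OF F Ar_Hom[OF g] f'] functorD(4)[OF F f'] functorD(4)[OF F Ar_Hom[OF g]]
      functorD(6)[OF G, of "FA F g" _ _ "FA F f"] FG by simp
qed (use functorD(1,2,3,5)[OF F] functorD(1,2,3,5)[OF G] FG in auto)

lemma comp_fun_assoc:
  assumes F: "is_functor F" and G: "is_functor G" and H: "is_functor H" and "Tgt F = Src G" "Tgt G = Src H"
  shows "comp_fun (comp_fun H G) F = comp_fun H (comp_fun G F)"
  by (rule functor_eqI)
    (use assms functorD(3)[OF F] functor_Ar[OF F] in \<open>auto intro!: functor_comp_fun\<close>)

lemma comp_fun_id_right: "is_functor F \<Longrightarrow> comp_fun F (id_fun (Src F)) = F"
  by (rule functor_eqI) (auto intro!: functor_comp_fun functor_id_fun functorD)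

lemma comp_fun_id_left: "is_functor F \<Longrightarrow> comp_fun (id_fun (Tgt F)) F = F"
  by (rule functor_eqI)
    (auto intro!: functor_comp_fun functor_id_fun functorD simp: functorD(3) functor_Ar)

lemma functor_invertible:
  assumes F: "is_functor F" and f: "f \<in> Hom (Src F) x y" and i: "invertible (Src F) f"
  shows "invertible (Tgt F) (FA F f)"
proof -
  obtain g where g: "g \<in> Hom (Src F) y x" "Cmp (Src F) g f = Id (Src F) x" "Cmp (Src F) f g = Id (Src F) y"
    using invertibleE[OF i f] .
  show ?thesis
    by (rule invertibleI[OF functorD(4)[OF F f] functorD(4)[OF F g(1)]])
      (use functorD(6)[OF F g(1) f] functorD(6)[OF F f g(1)] g functorD(5)[OF F]
        Hom_Ob[OF functorD(1)[OF F] f] in auto)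
qed

section \<open>Natural transformations and horizontal composition\<close>

lemma ntD:
  assumes "is_nt \<alpha>"
  shows "is_functor (NSrc \<alpha>)" "is_functor (NTgt \<alpha>)" "Src (NTgt \<alpha>) = Src (NSrc \<alpha>)"
    "Tgt (NTgt \<alpha>) = Tgt (NSrc \<alpha>)"
    "x \<in> Ob (Src (NSrc \<alpha>)) \<Longrightarrow> NC \<alpha> x \<in> Hom (Tgt (NSrc \<alpha>)) (FO (NSrc \<alpha>) x) (FO (NTgt \<alpha>) x)"
    "f \<in> Hom (Src (NSrc \<alpha>)) x y \<Longrightarrow>
       Cmp (Tgt (NSrc \<alpha>)) (NC \<alpha> y) (FA (NSrc \<alpha>) f) = Cmp (Tgt (NSrc \<alpha>)) (FA (NTgt \<alpha>) f) (NC \<alpha> x)"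
  using assms unfolding is_nt_def Hom_def by auto

lemma mk_nt_simps [simp]:
  "NSrc (mk_nt F G c) = F" "NTgt (mk_nt F G c) = G" "x \<in> Ob (Src F) \<Longrightarrow> NC (mk_nt F G c) x = c x"
  by (simp_all add: mk_nt_def)

lemma ntI:
  assumes "is_functor F" "is_functor G" "Src F = Src G" "Tgt F = Tgt G"
    and "\<And>x. x \<in> Ob (Src F) \<Longrightarrow> c x \<in> Hom (Tgt F) (FO F x) (FO G x)"
    and "\<And>f. f \<in> Ar (Src F) \<Longrightarrow>
      Cmp (Tgt F) (c (Cod (Src F) f)) (FA F f) = Cmp (Tgt F) (FA G f) (c (Dom (Src F) f))"
  shows "is_nt (mk_nt F G c)"
  unfolding is_nt_def mk_nt_def using assms functorD(1)[OF assms(1)]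
  by (auto simp: Dom_Ob Cod_Ob)

lemma nt_eqI:
  assumes "is_nt \<alpha>" "is_nt \<beta>" "NSrc \<alpha> = NSrc \<beta>" "NTgt \<alpha> = NTgt \<beta>"
    and "\<And>x. x \<in> Ob (Src (NSrc \<alpha>)) \<Longrightarrow> NC \<alpha> x = NC \<beta> x"
  shows "\<alpha> = \<beta>"
proof (rule nt.equality)
  show "NC \<alpha> = NC \<beta>"
    using assms unfolding is_nt_def by (auto intro!: extensionalityI[of _ "Ob (Src (NSrc \<alpha>))"])
qed (use assms in auto)

lemma id_nt_simps [simp]:
  "NSrc (id_nt F) = F" "NTgt (id_nt F) = F" "x \<in> Ob (Src F) \<Longrightarrow> NC (id_nt F) x = Id (Tgt F) (FO F x)"
  by (simp_all add: id_nt_def)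

lemma nt_id_nt: "is_functor F \<Longrightarrow> is_nt (id_nt F)"
  unfolding id_nt_def
  by (rule ntI)
    (auto intro!: Id_Hom functorD simp: Cmp_Id_left[OF functorD(2) functorD(4)[OF _ Ar_Hom]]
      Cmp_Id_right[OF functorD(2) functorD(4)[OF _ Ar_Hom]])

lemma hcomp_simps [simp]:
  "NSrc (hcomp \<beta> \<alpha>) = comp_fun (NSrc \<beta>) (NSrc \<alpha>)" "NTgt (hcomp \<beta> \<alpha>) = comp_fun (NTgt \<beta>) (NTgt \<alpha>)"
  "x \<in> Ob (Src (NSrc \<alpha>)) \<Longrightarrow>
     NC (hcomp \<beta> \<alpha>) x = Cmp (Tgt (NSrc \<beta>)) (NC \<beta> (FO (NTgt \<alpha>) x)) (FA (NSrc \<beta>) (NC \<alpha> x))"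
  by (simp_all add: hcomp_def)

lemma nt_hcomp:
  assumes a: "is_nt \<alpha>" and b: "is_nt \<beta>" and ab: "Tgt (NSrc \<alpha>) = Src (NSrc \<beta>)"
  shows "is_nt (hcomp \<beta> \<alpha>)"
  unfolding hcomp_def
proof (rule ntI)
  let ?F = "NSrc \<alpha>" and ?G = "NTgt \<alpha>" and ?H = "NSrc \<beta>" and ?K = "NTgt \<beta>"
  note A = ntD[OF a] and B = ntD[OF b]
  note cat = functorD(1)[OF A(1)] functorD(1)[OF B(1)] functorD(2)[OF B(1)]
  show "is_functor (comp_fun ?H ?F)" "is_functor (comp_fun ?K ?G)"
    using A(1-4) B(1-4) ab by (auto intro!: functor_comp_fun)
  have H1: "FA ?H (NC \<alpha> x) \<in> Hom (Tgt ?H) (FO ?H (FO ?F x)) (FO ?H (FO ?G x))" if "x \<in> Ob (Src ?F)" for x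
    by (rule functorD(4)[OF B(1)]) (use A(5)[OF that] ab in simp)
  have H2: "NC \<beta> (FO ?G x) \<in> Hom (Tgt ?H) (FO ?H (FO ?G x)) (FO ?K (FO ?G x))" if "x \<in> Ob (Src ?F)" for x
    by (rule B(5)) (use functorD(3)[OF A(2), of x] that A(3,4) ab in simp)
  show "Cmp (Tgt ?H) (NC \<beta> (FO ?G x)) (FA ?H (NC \<alpha> x)) \<in>
      Hom (Tgt (comp_fun ?H ?F)) (FO (comp_fun ?H ?F) x) (FO (comp_fun ?K ?G) x)"
    if "x \<in> Ob (Src (comp_fun ?H ?F))" for x
    using Cmp_Hom[OF cat(3) H2 H1] that A(3) by simp
  fix f assume "f \<in> Ar (Src (comp_fun ?H ?F))"
  hence f: "f \<in> Ar (Src ?F)" by simp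
  let ?x = "Dom (Src ?F) f" and ?y = "Cod (Src ?F) f"
  have f': "f \<in> Hom (Src ?F) ?x ?y" using f by (rule Ar_Hom)
  have x: "?x \<in> Ob (Src ?F)" and y: "?y \<in> Ob (Src ?F)" using Dom_Ob[OF cat(1) f] Cod_Ob[OF cat(1) f] by simp_all
  have Ff: "FA ?F f \<in> Hom (Src ?H) (FO ?F ?x) (FO ?F ?y)" using functorD(4)[OF A(1) f'] ab by simp
  have Gf: "FA ?G f \<in> Hom (Src ?H) (FO ?G ?x) (FO ?G ?y)" using functorD(4)[OF A(2), of f] f' A ab by simp
  have ax: "NC \<alpha> ?x \<in> Hom (Src ?H) (FO ?F ?x) (FO ?G ?x)" using A(5)[OF x] ab by simp
  have ay: "NC \<alpha> ?y \<in> Hom (Src ?H) (FO ?F ?y) (FO ?G ?y)" using A(5)[OF y] ab by simp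
  have HGf: "FA ?H (FA ?G f) \<in> Hom (Tgt ?H) (FO ?H (FO ?G ?x)) (FO ?H (FO ?G ?y))" by (rule functorD(4)[OF B(1) Gf])
  have KGf: "FA ?K (FA ?G f) \<in> Hom (Tgt ?H) (FO ?K (FO ?G ?x)) (FO ?K (FO ?G ?y))"
    using functorD(4)[OF B(2), of "FA ?G f"] Gf B by simp
  have "Cmp (Tgt ?H) (Cmp (Tgt ?H) (NC \<beta> (FO ?G ?y)) (FA ?H (NC \<alpha> ?y))) (FA ?H (FA ?F f)) =
     Cmp (Tgt ?H) (NC \<beta> (FO ?G ?y)) (FA ?H (Cmp (Src ?H) (NC \<alpha> ?y) (FA ?F f)))"
    using Cmp_assoc[OF cat(3) H2[OF y] H1[OF y] functorD(4)[OF B(1) Ff]] functorD(6)[OF B(1) ay Ff] by simp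
  also have "\<dots> = Cmp (Tgt ?H) (NC \<beta> (FO ?G ?y)) (FA ?H (Cmp (Src ?H) (FA ?G f) (NC \<alpha> ?x)))"
    using A(6)[OF f'] ab by simp
  also have "\<dots> = Cmp (Tgt ?H) (Cmp (Tgt ?H) (NC \<beta> (FO ?G ?y)) (FA ?H (FA ?G f))) (FA ?H (NC \<alpha> ?x))"
    using Cmp_assoc[OF cat(3) H2[OF y] HGf H1[OF x]] functorD(6)[OF B(1) Gf ax] by simp
  also have "\<dots> = Cmp (Tgt ?H) (Cmp (Tgt ?H) (FA ?K (FA ?G f)) (NC \<beta> (FO ?G ?x))) (FA ?H (NC \<alpha> ?x))"
    using B(6)[OF Gf] by simp
  also have "\<dots> = Cmp (Tgt ?H) (FA ?K (FA ?G f)) (Cmp (Tgt ?H) (NC \<beta> (FO ?G ?x)) (FA ?H (NC \<alpha> ?x)))"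
    using Cmp_assoc[OF cat(3) KGf H2[OF x] H1[OF x]] by simp
  finally show "Cmp (Tgt (comp_fun ?H ?F)) (Cmp (Tgt ?H) (NC \<beta> (FO ?G (Cod (Src (comp_fun ?H ?F)) f)))
        (FA ?H (NC \<alpha> (Cod (Src (comp_fun ?H ?F)) f)))) (FA (comp_fun ?H ?F) f) =
     Cmp (Tgt (comp_fun ?H ?F)) (FA (comp_fun ?K ?G) f) (Cmp (Tgt ?H) (NC \<beta> (FO ?G (Dom (Src (comp_fun ?H ?F)) f)))
        (FA ?H (NC \<alpha> (Dom (Src (comp_fun ?H ?F)) f))))"
    using f A(3) by simp
qed (use ntD[OF a] ntD[OF b] ab in auto)

section \<open>Adjunctions and local arrows\<close>

text \<open>An adjunction given by its natural bijection of Hom sets instead of unit and counit. In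
  this form adjunctions compose by composing bijections, and uniqueness of adjoints is the Yoneda
  argument.\<close>

definition hom_adj ::
  "('o, 'm, 'p, 'q) func \<Rightarrow> ('p, 'q, 'o, 'm) func \<Rightarrow> ('o \<Rightarrow> 'q \<Rightarrow> 'm) \<Rightarrow> bool" where
  "hom_adj F G \<phi> \<longleftrightarrow>
     is_functor F \<and> is_functor G \<and> Src G = Tgt F \<and> Tgt G = Src F \<and>
     (\<forall>x\<in>Ob (Src F). \<forall>y\<in>Ob (Tgt F). bij_betw (\<phi> x) (Hom (Tgt F) (FO F x) y) (Hom (Src F) x (FO G y))) \<and>
     (\<forall>x x' y f a. a \<in> Hom (Src F) x' x \<and> f \<in> Hom (Tgt F) (FO F x) y \<longrightarrow>
        \<phi> x' (Cmp (Tgt F) f (FA F a)) = Cmp (Src F) (\<phi> x f) a) \<and>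
     (\<forall>x y y' f b. x \<in> Ob (Src F) \<and> f \<in> Hom (Tgt F) (FO F x) y \<and> b \<in> Hom (Tgt F) y y' \<longrightarrow>
        \<phi> x (Cmp (Tgt F) b f) = Cmp (Src F) (FA G b) (\<phi> x f))"

lemma hom_adjD:
  assumes "hom_adj F G \<phi>"
  shows "is_functor F" "is_functor G" "Src G = Tgt F" "Tgt G = Src F"
    "x \<in> Ob (Src F) \<Longrightarrow> f \<in> Hom (Tgt F) (FO F x) y \<Longrightarrow> \<phi> x f \<in> Hom (Src F) x (FO G y)"
    "x \<in> Ob (Src F) \<Longrightarrow> y \<in> Ob (Tgt F) \<Longrightarrow> k \<in> Hom (Src F) x (FO G y) \<Longrightarrow>
       \<exists>f. f \<in> Hom (Tgt F) (FO F x) y \<and> \<phi> x f = k"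
    "x \<in> Ob (Src F) \<Longrightarrow> f \<in> Hom (Tgt F) (FO F x) y \<Longrightarrow> f' \<in> Hom (Tgt F) (FO F x) y \<Longrightarrow>
       \<phi> x f = \<phi> x f' \<Longrightarrow> f = f'"
    "a \<in> Hom (Src F) x' x \<Longrightarrow> f \<in> Hom (Tgt F) (FO F x) y \<Longrightarrow>
        \<phi> x' (Cmp (Tgt F) f (FA F a)) = Cmp (Src F) (\<phi> x f) a"
    "x \<in> Ob (Src F) \<Longrightarrow> f \<in> Hom (Tgt F) (FO F x) y \<Longrightarrow> b \<in> Hom (Tgt F) y y' \<Longrightarrow>
        \<phi> x (Cmp (Tgt F) b f) = Cmp (Src F) (FA G b) (\<phi> x f)"
proof -
  note A = assms[unfolded hom_adj_def]
  show "is_functor F" "is_functor G" "Src G = Tgt F" "Tgt G = Src F" using A by auto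
  have ob: "y \<in> Ob (Tgt F)" if "f \<in> Hom (Tgt F) (FO F x) y" for f x y
    using A Hom_Ob(2)[OF functorD(2) that] by auto
  have bij: "bij_betw (\<phi> x) (Hom (Tgt F) (FO F x) y) (Hom (Src F) x (FO G y))"
    if "x \<in> Ob (Src F)" "y \<in> Ob (Tgt F)" for x y using A that by auto
  show "x \<in> Ob (Src F) \<Longrightarrow> f \<in> Hom (Tgt F) (FO F x) y \<Longrightarrow> \<phi> x f \<in> Hom (Src F) x (FO G y)"
    using bij ob bij_betwE by blast
  show "x \<in> Ob (Src F) \<Longrightarrow> y \<in> Ob (Tgt F) \<Longrightarrow> k \<in> Hom (Src F) x (FO G y) \<Longrightarrow>
       \<exists>f. f \<in> Hom (Tgt F) (FO F x) y \<and> \<phi> x f = k"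
    using bij[of x y] unfolding bij_betw_def by (auto simp: image_iff dest!: equalityD2 subsetD)
  show "x \<in> Ob (Src F) \<Longrightarrow> f \<in> Hom (Tgt F) (FO F x) y \<Longrightarrow> f' \<in> Hom (Tgt F) (FO F x) y \<Longrightarrow>
       \<phi> x f = \<phi> x f' \<Longrightarrow> f = f'"
    using bij[of x y] ob unfolding bij_betw_def inj_on_def by blast
qed (use assms in \<open>unfold hom_adj_def, blast+\<close>)

lemma hom_adjI:
  assumes "is_functor F" "is_functor G" "Src G = Tgt F" "Tgt G = Src F"
    "\<And>x y f. x \<in> Ob (Src F) \<Longrightarrow> y \<in> Ob (Tgt F) \<Longrightarrow> f \<in> Hom (Tgt F) (FO F x) y \<Longrightarrow>
       \<phi> x f \<in> Hom (Src F) x (FO G y) \<and> \<psi> y (\<phi> x f) = f"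
    "\<And>x y k. x \<in> Ob (Src F) \<Longrightarrow> y \<in> Ob (Tgt F) \<Longrightarrow> k \<in> Hom (Src F) x (FO G y) \<Longrightarrow>
       \<psi> y k \<in> Hom (Tgt F) (FO F x) y \<and> \<phi> x (\<psi> y k) = k"
    "\<And>x x' y f a. a \<in> Hom (Src F) x' x \<Longrightarrow> f \<in> Hom (Tgt F) (FO F x) y \<Longrightarrow>
        \<phi> x' (Cmp (Tgt F) f (FA F a)) = Cmp (Src F) (\<phi> x f) a"
    "\<And>x y y' f b. x \<in> Ob (Src F) \<Longrightarrow> f \<in> Hom (Tgt F) (FO F x) y \<Longrightarrow> b \<in> Hom (Tgt F) y y' \<Longrightarrow>
        \<phi> x (Cmp (Tgt F) b f) = Cmp (Src F) (FA G b) (\<phi> x f)"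
  shows "hom_adj F G \<phi>"
  unfolding hom_adj_def using assms
  by (auto intro!: bij_betw_byWitness[where f' = "\<psi> _"])

lemma adjunctionD:
  assumes "adjunction F G \<eta> \<epsilon>"
  shows "is_functor F" "is_functor G" "Src G = Tgt F" "Tgt G = Src F"
    "x \<in> Ob (Src F) \<Longrightarrow> NC \<eta> x \<in> Hom (Src F) x (FO G (FO F x))"
    "y \<in> Ob (Tgt F) \<Longrightarrow> NC \<epsilon> y \<in> Hom (Tgt F) (FO F (FO G y)) y"
    "f \<in> Hom (Src F) x x' \<Longrightarrow> Cmp (Src F) (NC \<eta> x') f = Cmp (Src F) (FA G (FA F f)) (NC \<eta> x)"
    "g \<in> Hom (Tgt F) y y' \<Longrightarrow> Cmp (Tgt F) (NC \<epsilon> y') (FA F (FA G g)) = Cmp (Tgt F) g (NC \<epsilon> y)"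
    "x \<in> Ob (Src F) \<Longrightarrow> Cmp (Tgt F) (NC \<epsilon> (FO F x)) (FA F (NC \<eta> x)) = Id (Tgt F) (FO F x)"
    "y \<in> Ob (Tgt F) \<Longrightarrow> Cmp (Src F) (FA G (NC \<epsilon> y)) (NC \<eta> (FO G y)) = Id (Src F) (FO G y)"
proof -
  note A = assms[unfolded adjunction_def]
  have e: "is_nt \<eta>" "NSrc \<eta> = id_fun (Src F)" "NTgt \<eta> = comp_fun G F"
    and c: "is_nt \<epsilon>" "NSrc \<epsilon> = comp_fun F G" "NTgt \<epsilon> = id_fun (Tgt F)"
    and G: "Src G = Tgt F" "Tgt G = Src F" using A by auto
  show "is_functor F" "is_functor G" "Src G = Tgt F" "Tgt G = Src F" using A by auto
  show "NC \<eta> x \<in> Hom (Src F) x (FO G (FO F x))" if "x \<in> Ob (Src F)"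
    using ntD(5)[OF e(1)] e(2,3) that by simp
  show "NC \<epsilon> y \<in> Hom (Tgt F) (FO F (FO G y)) y" if "y \<in> Ob (Tgt F)"
    using ntD(5)[OF c(1)] c(2,3) G that by simp
  show "Cmp (Src F) (NC \<eta> x') f = Cmp (Src F) (FA G (FA F f)) (NC \<eta> x)" if "f \<in> Hom (Src F) x x'"
    using ntD(6)[OF e(1), of f x x'] e(2,3) that HomD[OF that] by simp
  show "Cmp (Tgt F) (NC \<epsilon> y') (FA F (FA G g)) = Cmp (Tgt F) g (NC \<epsilon> y)" if "g \<in> Hom (Tgt F) y y'"
    using ntD(6)[OF c(1), of g y y'] c(2,3) that HomD[OF that] G by simp
qed (use assms[unfolded adjunction_def] in auto)

text \<open>The inverse bijection sends k to the counit after F k; the two triangle identities are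
  the two round trips.\<close>

lemma adjunction_hom_adj:
  assumes A: "adjunction F G \<eta> \<epsilon>"
  shows "hom_adj F G (\<lambda>x f. Cmp (Src F) (FA G f) (NC \<eta> x))"
proof -
  note D = adjunctionD[OF A]
  note C = functorD(1)[OF D(1)] functorD(2)[OF D(1)]
  have G: "FA G f \<in> Hom (Src F) (FO G y) (FO G y')" if "f \<in> Hom (Tgt F) y y'" for f y y'
    using functorD(4)[OF D(2)] D(3,4) that by simp
  have Gc: "FA G (Cmp (Tgt F) g f) = Cmp (Src F) (FA G g) (FA G f)"
    if "g \<in> Hom (Tgt F) y z" "f \<in> Hom (Tgt F) x y" for g f x y z
    using functorD(6)[OF D(2)] D(3,4) that by metis
  show ?thesis
  proof (rule hom_adjI[where \<psi> = "\<lambda>y k. Cmp (Tgt F) (NC \<epsilon> y) (FA F k)"])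
  fix x y f assume x: "x \<in> Ob (Src F)" and y: "y \<in> Ob (Tgt F)" and f: "f \<in> Hom (Tgt F) (FO F x) y"
  have "Cmp (Tgt F) (NC \<epsilon> y) (FA F (Cmp (Src F) (FA G f) (NC \<eta> x))) =
      Cmp (Tgt F) (Cmp (Tgt F) (NC \<epsilon> y) (FA F (FA G f))) (FA F (NC \<eta> x))"
    using functorD(6)[OF D(1) G[OF f] D(5)[OF x]]
      Cmp_assoc[OF C(2) D(6)[OF y] functorD(4)[OF D(1) G[OF f]] functorD(4)[OF D(1) D(5)[OF x]]] by simp
  also have "\<dots> = Cmp (Tgt F) f (Cmp (Tgt F) (NC \<epsilon> (FO F x)) (FA F (NC \<eta> x)))"
    using D(8)[OF f] Cmp_assoc[OF C(2) f D(6)[OF functorD(3)[OF D(1) x]] functorD(4)[OF D(1) D(5)[OF x]]] by simp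
  also have "\<dots> = f" using D(9)[OF x] Cmp_Id_right[OF C(2) f] by simp
  finally show "Cmp (Src F) (FA G f) (NC \<eta> x) \<in> Hom (Src F) x (FO G y) \<and>
      Cmp (Tgt F) (NC \<epsilon> y) (FA F (Cmp (Src F) (FA G f) (NC \<eta> x))) = f"
    using Cmp_Hom[OF C(1) G[OF f] D(5)[OF x]] by simp
next
  fix x y k assume x: "x \<in> Ob (Src F)" and y: "y \<in> Ob (Tgt F)" and k: "k \<in> Hom (Src F) x (FO G y)"
  have Gy: "FO G y \<in> Ob (Src F)" using functorD(3)[OF D(2)] D(3,4) y by simp
  have "Cmp (Src F) (FA G (Cmp (Tgt F) (NC \<epsilon> y) (FA F k))) (NC \<eta> x) =
      Cmp (Src F) (FA G (NC \<epsilon> y)) (Cmp (Src F) (FA G (FA F k)) (NC \<eta> x))"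
    using Gc[OF D(6)[OF y] functorD(4)[OF D(1) k]]
      Cmp_assoc[OF C(1) G[OF D(6)[OF y]] G[OF functorD(4)[OF D(1) k]] D(5)[OF x]] by simp
  also have "\<dots> = Cmp (Src F) (Cmp (Src F) (FA G (NC \<epsilon> y)) (NC \<eta> (FO G y))) k"
    using D(7)[OF k] Cmp_assoc[OF C(1) G[OF D(6)[OF y]] D(5)[OF Gy] k] by simp
  also have "\<dots> = k" using D(10)[OF y] Cmp_Id_left[OF C(1) k] by simp
  finally show "Cmp (Tgt F) (NC \<epsilon> y) (FA F k) \<in> Hom (Tgt F) (FO F x) y \<and>
      Cmp (Src F) (FA G (Cmp (Tgt F) (NC \<epsilon> y) (FA F k))) (NC \<eta> x) = k"
    using Cmp_Hom[OF C(2) D(6)[OF y] functorD(4)[OF D(1) k]] by simp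
next
  { fix x x' y f a assume a: "a \<in> Hom (Src F) x' x" and f: "f \<in> Hom (Tgt F) (FO F x) y"
    have x: "x \<in> Ob (Src F)" "x' \<in> Ob (Src F)" using Hom_Ob[OF C(1) a] by auto
    note Fa = functorD(4)[OF D(1) a]
    show "Cmp (Src F) (FA G (Cmp (Tgt F) f (FA F a))) (NC \<eta> x') = Cmp (Src F) (Cmp (Src F) (FA G f) (NC \<eta> x)) a"
      using Gc[OF f Fa] Cmp_assoc[OF C(1) G[OF f] G[OF Fa] D(5)[OF x(2)]] D(7)[OF a]
        Cmp_assoc[OF C(1) G[OF f] D(5)[OF x(1)] a] by simp }
  { fix x y y' f b assume x: "x \<in> Ob (Src F)" and f: "f \<in> Hom (Tgt F) (FO F x) y" and b: "b \<in> Hom (Tgt F) y y'"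
    show "Cmp (Src F) (FA G (Cmp (Tgt F) b f)) (NC \<eta> x) = Cmp (Src F) (FA G b) (Cmp (Src F) (FA G f) (NC \<eta> x))"
      using Gc[OF b f] Cmp_assoc[OF C(1) G[OF b] G[OF f] D(5)[OF x]] by simp }
  qed (use adjunctionD[OF A] in auto)
qed

lemma hom_adj_comp:
  assumes A: "hom_adj F G \<phi>" and B: "hom_adj F' G' \<phi>'" and FF: "Tgt F = Src F'"
  shows "hom_adj (comp_fun F' F) (comp_fun G G') (\<lambda>x f. \<phi> x (\<phi>' (FO F x) f))"
proof -
  note A' = hom_adjD[OF A] and B' = hom_adjD[OF B]
  have ob: "FO F x \<in> Ob (Src F')" if "x \<in> Ob (Src F)" for x using functorD(3)[OF A'(1) that] FF by simp
  have ob': "FO G' y \<in> Ob (Tgt F)" if "y \<in> Ob (Tgt F')" for y using functorD(3)[OF B'(2)] B'(3,4) FF that by simp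
  have bij: "bij_betw (\<lambda>f. \<phi> x (\<phi>' (FO F x) f)) (Hom (Tgt F') (FO F' (FO F x)) y) (Hom (Src F) x (FO G (FO G' y)))"
    if "x \<in> Ob (Src F)" "y \<in> Ob (Tgt F')" for x y
  proof -
    have "bij_betw (\<phi>' (FO F x)) (Hom (Tgt F') (FO F' (FO F x)) y) (Hom (Tgt F) (FO F x) (FO G' y))"
      using B[unfolded hom_adj_def] ob[OF that(1)] that(2) FF by auto
    moreover have "bij_betw (\<phi> x) (Hom (Tgt F) (FO F x) (FO G' y)) (Hom (Src F) x (FO G (FO G' y)))"
      using A[unfolded hom_adj_def] ob'[OF that(2)] that(1) by auto
    ultimately show ?thesis using bij_betw_trans by (force simp: comp_def)
  qed
  have "\<phi> x' (\<phi>' (FO F x') (Cmp (Tgt F') f (FA F' (FA F a)))) = Cmp (Src F) (\<phi> x (\<phi>' (FO F x) f)) a"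
    if a: "a \<in> Hom (Src F) x' x" and f: "f \<in> Hom (Tgt F') (FO F' (FO F x)) y" for x x' y f a
  proof -
    have x: "x \<in> Ob (Src F)" using Hom_Ob[OF functorD(1)[OF A'(1)] a] by simp
    have Fa: "FA F a \<in> Hom (Src F') (FO F x') (FO F x)" using functorD(4)[OF A'(1) a] FF by simp
    have f': "\<phi>' (FO F x) f \<in> Hom (Tgt F) (FO F x) (FO G' y)" using B'(5)[OF ob[OF x] f] FF by simp
    show ?thesis using B'(8)[OF Fa f] A'(8)[OF a f'] FF by simp
  qed
  moreover have "\<phi> x (\<phi>' (FO F x) (Cmp (Tgt F') b f)) = Cmp (Src F) (FA G (FA G' b)) (\<phi> x (\<phi>' (FO F x) f))"
    if x: "x \<in> Ob (Src F)" and f: "f \<in> Hom (Tgt F') (FO F' (FO F x)) y" and b: "b \<in> Hom (Tgt F') y y'"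
    for x y y' f b
  proof -
    have f': "\<phi>' (FO F x) f \<in> Hom (Tgt F) (FO F x) (FO G' y)" using B'(5)[OF ob[OF x] f] FF by simp
    have b': "FA G' b \<in> Hom (Tgt F) (FO G' y) (FO G' y')" using functorD(4)[OF B'(2)] b B'(3,4) FF by simp
    show ?thesis using B'(9)[OF ob[OF x] f b] A'(9)[OF x f' b'] FF by simp
  qed
  moreover have "is_functor (comp_fun F' F)" "is_functor (comp_fun G G')"
    using A'(1-4) B'(1-4) FF by (auto intro!: functor_comp_fun)
  ultimately show ?thesis
    unfolding hom_adj_def using bij A'(3,4) B'(3,4) FF
    by (auto simp: HomD(1) Hom_Ob[OF functorD(1)[OF A'(1)]] Hom_Ob[OF functorD(2)[OF B'(1)]])
qed

section \<open>Natural isomorphism and uniqueness of adjoints\<close>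

definition naturally_isomorphic :: "('o, 'm, 'p, 'q) func \<Rightarrow> ('o, 'm, 'p, 'q) func \<Rightarrow> bool" where
  "naturally_isomorphic F G \<longleftrightarrow>
     is_functor F \<and> is_functor G \<and> Src F = Src G \<and> Tgt F = Tgt G \<and>
     (\<exists>c. (\<forall>x\<in>Ob (Src F). c x \<in> Hom (Tgt F) (FO F x) (FO G x) \<and> invertible (Tgt F) (c x)) \<and>
       (\<forall>x y. \<forall>f\<in>Hom (Src F) x y. Cmp (Tgt F) (c y) (FA F f) = Cmp (Tgt F) (FA G f) (c x)))"

lemma naturally_isomorphicE:
  assumes "naturally_isomorphic F G"
  obtains c where "is_functor F" "is_functor G" "Src G = Src F" "Tgt G = Tgt F"
    "\<forall>x\<in>Ob (Src F). c x \<in> Hom (Tgt F) (FO F x) (FO G x) \<and> invertible (Tgt F) (c x)"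
    "\<forall>x y f. f \<in> Hom (Src F) x y \<longrightarrow> Cmp (Tgt F) (c y) (FA F f) = Cmp (Tgt F) (FA G f) (c x)"
  using assms unfolding naturally_isomorphic_def by metis

lemma naturally_isomorphic_refl: "is_functor F \<Longrightarrow> naturally_isomorphic F F"
  unfolding naturally_isomorphic_def
  by (auto intro!: exI[of _ "\<lambda>x. Id (Tgt F) (FO F x)"] Id_Hom invertible_Id functorD
      simp: Cmp_Id_left[OF functorD(2) functorD(4)] Cmp_Id_right[OF functorD(2) functorD(4)])

lemma naturally_isomorphic_comp:
  assumes F: "naturally_isomorphic F F'" and G: "naturally_isomorphic G G'" and FG: "Tgt F = Src G"
  shows "naturally_isomorphic (comp_fun G F) (comp_fun G' F')"
proof -
  obtain c where f: "is_functor F" "is_functor F'" "Src F' = Src F" "Tgt F' = Tgt F"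
    and c0: "\<forall>x\<in>Ob (Src F). c x \<in> Hom (Tgt F) (FO F x) (FO F' x) \<and> invertible (Tgt F) (c x)"
    "\<forall>x y f. f \<in> Hom (Src F) x y \<longrightarrow> Cmp (Tgt F) (c y) (FA F f) = Cmp (Tgt F) (FA F' f) (c x)"
    using naturally_isomorphicE[OF F] .
  obtain d where g: "is_functor G" "is_functor G'" "Src G' = Src G" "Tgt G' = Tgt G"
    and d0: "\<forall>x\<in>Ob (Src G). d x \<in> Hom (Tgt G) (FO G x) (FO G' x) \<and> invertible (Tgt G) (d x)"
    "\<forall>x y f. f \<in> Hom (Src G) x y \<longrightarrow> Cmp (Tgt G) (d y) (FA G f) = Cmp (Tgt G) (FA G' f) (d x)"
    using naturally_isomorphicE[OF G] .
  note fn = f(1,2) g(1,2) f(3,4) g(3,4)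
  have c: "\<And>x. x\<in>Ob (Src F) \<Longrightarrow> c x \<in> Hom (Src G) (FO F x) (FO F' x)"
    "\<And>x. x\<in>Ob (Src F) \<Longrightarrow> invertible (Src G) (c x)"
    "\<And>x y f. f\<in>Hom (Src F) x y \<Longrightarrow> Cmp (Src G) (c y) (FA F f) = Cmp (Src G) (FA F' f) (c x)"
    using c0 FG by auto
  have d: "\<And>x. x\<in>Ob (Src G) \<Longrightarrow> d x \<in> Hom (Tgt G) (FO G x) (FO G' x)"
    "\<And>x. x\<in>Ob (Src G) \<Longrightarrow> invertible (Tgt G) (d x)"
    "\<And>x y f. f\<in>Hom (Src G) x y \<Longrightarrow> Cmp (Tgt G) (d y) (FA G f) = Cmp (Tgt G) (FA G' f) (d x)"
    using d0 by auto
  note C = functorD(2)[OF fn(3)]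
  have ob: "FO F x \<in> Ob (Src G)" "FO F' x \<in> Ob (Src G)" if "x \<in> Ob (Src F)" for x
    using functorD(3)[OF fn(1)] functorD(3)[OF fn(2)] fn FG that by auto
  have Gc: "FA G (c x) \<in> Hom (Tgt G) (FO G (FO F x)) (FO G (FO F' x))" if "x \<in> Ob (Src F)" for x
    using functorD(4)[OF fn(3) c(1)[OF that]] .
  let ?e = "\<lambda>x. Cmp (Tgt G) (d (FO F' x)) (FA G (c x))"
  show ?thesis unfolding naturally_isomorphic_def comp_fun_simps
  proof (intro conjI exI[of _ ?e] ballI allI)
    fix x assume x: "x \<in> Ob (Src F)"
    show "?e x \<in> Hom (Tgt G) (FO (comp_fun G F) x) (FO (comp_fun G' F') x)"
      using Cmp_Hom[OF C d(1)[OF ob(2)[OF x]] Gc[OF x]] x fn by simp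
    show "invertible (Tgt G) (?e x)"
      using invertible_Cmp[OF C d(1)[OF ob(2)[OF x]] Gc[OF x] d(2)[OF ob(2)[OF x]]]
        functor_invertible[OF fn(3) c(1,2)[OF x]] by simp
  next
    fix x y h assume h: "h \<in> Hom (Src F) x y"
    have x: "x \<in> Ob (Src F)" and y: "y \<in> Ob (Src F)" using Hom_Ob[OF functorD(1)[OF fn(1)] h] by auto
    have Fh: "FA F h \<in> Hom (Src G) (FO F x) (FO F y)" "FA F' h \<in> Hom (Src G) (FO F' x) (FO F' y)"
      using functorD(4)[OF fn(1) h] functorD(4)[OF fn(2), of h x y] h fn FG by auto
    have G'h: "FA G' (FA F' h) \<in> Hom (Tgt G) (FO G' (FO F' x)) (FO G' (FO F' y))"
      using functorD(4)[OF fn(4), of "FA F' h"] Fh fn by simp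
    have "Cmp (Tgt G) (?e y) (FA G (FA F h)) = Cmp (Tgt G) (d (FO F' y)) (FA G (Cmp (Src G) (c y) (FA F h)))"
      using Cmp_assoc[OF C d(1)[OF ob(2)[OF y]] Gc[OF y] functorD(4)[OF fn(3) Fh(1)]]
        functorD(6)[OF fn(3) c(1)[OF y] Fh(1)] by simp
    also have "\<dots> = Cmp (Tgt G) (d (FO F' y)) (Cmp (Tgt G) (FA G (FA F' h)) (FA G (c x)))"
      using c(3)[OF h] functorD(6)[OF fn(3) Fh(2) c(1)[OF x]] by simp
    also have "\<dots> = Cmp (Tgt G) (Cmp (Tgt G) (FA G' (FA F' h)) (d (FO F' x))) (FA G (c x))"
      using Cmp_assoc[OF C d(1)[OF ob(2)[OF y]] functorD(4)[OF fn(3) Fh(2)] Gc[OF x]] d(3)[OF Fh(2)] by simp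
    also have "\<dots> = Cmp (Tgt G) (FA G' (FA F' h)) (?e x)"
      using Cmp_assoc[OF C G'h d(1)[OF ob(2)[OF x]] Gc[OF x]] .
    finally show "Cmp (Tgt G) (?e y) (FA (comp_fun G F) h) = Cmp (Tgt G) (FA (comp_fun G' F') h) (?e x)"
      using HomD(1)[OF h] fn by simp
  qed (use fn FG in \<open>auto intro!: functor_comp_fun\<close>)
qed

text \<open>Yoneda: \<open>c x\<close> is the arrow F x -> F' x that the first bijection sends to
  the unit of the second adjunction, and exchanging the roles gives its inverse. Kan extensions are
  arbitrary choices, and this is how two left ones are compared.\<close>

lemma left_adjoint_unique:
  assumes A: "hom_adj F G \<phi>" and B: "hom_adj F' G \<phi>'"
  shows "naturally_isomorphic F F'"
proof -
  note A' = hom_adjD[OF A] and B' = hom_adjD[OF B]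
  have S: "Src F' = Src F" "Tgt F' = Tgt F" using A'(3,4) B'(3,4) by auto
  note C = functorD(1,2)[OF A'(1)]
  have G: "is_functor G" "Src G = Tgt F" "Tgt G = Src F" using A' by auto
  have I: "Id (Tgt F) (FO F x) \<in> Hom (Tgt F) (FO F x) (FO F x)" "FO F x \<in> Ob (Tgt F)" if "x \<in> Ob (Src F)" for x
    using Id_Hom[OF C(2)] functorD(3)[OF A'(1) that] by auto
  have I': "Id (Tgt F) (FO F' x) \<in> Hom (Tgt F) (FO F' x) (FO F' x)" "FO F' x \<in> Ob (Tgt F)" if "x \<in> Ob (Src F)" for x
    using Id_Hom[OF C(2)] functorD(3)[OF B'(1)] S that by auto
  let ?u = "\<lambda>x. \<phi> x (Id (Tgt F) (FO F x))" and ?u' = "\<lambda>x. \<phi>' x (Id (Tgt F) (FO F' x))"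
  have u: "?u x \<in> Hom (Src F) x (FO G (FO F x))" if "x \<in> Ob (Src F)" for x
    using A'(5)[OF that I(1)[OF that]] .
  have u': "?u' x \<in> Hom (Src F) x (FO G (FO F' x))" if "x \<in> Ob (Src F)" for x
    using B'(5)[of x] that I'(1)[OF that] S by simp
  define c where "c x = (SOME f. f \<in> Hom (Tgt F) (FO F x) (FO F' x) \<and> \<phi> x f = ?u' x)" for x
  have c: "c x \<in> Hom (Tgt F) (FO F x) (FO F' x)" "\<phi> x (c x) = ?u' x" if "x \<in> Ob (Src F)" for x
    using someI_ex[OF A'(6)[OF that I'(2)[OF that] u'[OF that]]] unfolding c_def by auto
  have inv: "invertible (Tgt F) (c x)" if x: "x \<in> Ob (Src F)" for x
  proof -
    obtain d where d: "d \<in> Hom (Tgt F) (FO F' x) (FO F x)" "\<phi>' x d = ?u x"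
      using B'(6)[of x "FO F x" "?u x"] x I(2)[OF x] u[OF x] S by auto
    have "\<phi> x (Cmp (Tgt F) d (c x)) = Cmp (Src F) (FA G d) (?u' x)"
      using A'(9)[OF x c(1)[OF x] d(1)] c(2)[OF x] by simp
    also have "\<dots> = \<phi>' x (Cmp (Tgt F) d (Id (Tgt F) (FO F' x)))"
      using B'(9)[of x "Id (Tgt F) (FO F' x)" "FO F' x" d "FO F x"] x I'(1)[OF x] d(1) S by simp
    also have "\<dots> = ?u x" using Cmp_Id_right[OF C(2) d(1)] d(2) by simp
    finally have 1: "Cmp (Tgt F) d (c x) = Id (Tgt F) (FO F x)"
      using A'(7)[OF x Cmp_Hom[OF C(2) d(1) c(1)[OF x]] I(1)[OF x]] by simp
    have "\<phi>' x (Cmp (Tgt F) (c x) d) = Cmp (Src F) (FA G (c x)) (?u x)"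
      using B'(9)[of x d "FO F x" "c x"] x c(1)[OF x] d S by simp
    also have "\<dots> = \<phi> x (Cmp (Tgt F) (c x) (Id (Tgt F) (FO F x)))"
      using A'(9)[OF x I(1)[OF x] c(1)[OF x]] by simp
    also have "\<dots> = ?u' x" using Cmp_Id_right[OF C(2) c(1)[OF x]] c(2)[OF x] by simp
    finally have 2: "Cmp (Tgt F) (c x) d = Id (Tgt F) (FO F' x)"
      using B'(7)[of x "Cmp (Tgt F) (c x) d"] x Cmp_Hom[OF C(2) c(1)[OF x] d(1)] I'(1)[OF x] S by simp
    show ?thesis using invertibleI[OF c(1)[OF x] d(1) 1 2] .
  qed
  have nat: "Cmp (Tgt F) (c y) (FA F a) = Cmp (Tgt F) (FA F' a) (c x)" if a: "a \<in> Hom (Src F) x y" for a x y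
  proof -
    have x: "x \<in> Ob (Src F)" and y: "y \<in> Ob (Src F)" using Hom_Ob[OF C(1) a] by auto
    have Fa: "FA F a \<in> Hom (Tgt F) (FO F x) (FO F y)" "FA F' a \<in> Hom (Tgt F) (FO F' x) (FO F' y)"
      using functorD(4)[OF A'(1)] functorD(4)[OF B'(1)] a S by auto
    have "\<phi> x (Cmp (Tgt F) (c y) (FA F a)) = Cmp (Src F) (?u' y) a"
      using A'(8)[OF a c(1)[OF y]] c(2)[OF y] by simp
    also have "\<dots> = \<phi>' x (FA F' a)"
      using B'(8)[of a x y "Id (Tgt F) (FO F' y)" "FO F' y"] a I'(1)[OF y] Cmp_Id_left[OF C(2) Fa(2)] S by simp
    also have "\<dots> = Cmp (Src F) (FA G (FA F' a)) (?u' x)"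
      using B'(9)[of x "Id (Tgt F) (FO F' x)" "FO F' x" "FA F' a"] x I'(1)[OF x] Fa(2) Cmp_Id_right[OF C(2) Fa(2)] S by simp
    also have "\<dots> = \<phi> x (Cmp (Tgt F) (FA F' a) (c x))"
      using A'(9)[OF x c(1)[OF x] Fa(2)] c(2)[OF x] by simp
    finally show ?thesis
      using A'(7)[OF x Cmp_Hom[OF C(2) c(1)[OF y] Fa(1)] Cmp_Hom[OF C(2) Fa(2) c(1)[OF x]]] by simp
  qed
  show ?thesis unfolding naturally_isomorphic_def
    using A'(1) B'(1) S c(1) inv nat by (intro conjI exI[of _ c]) simp_all
qed

text \<open>The counits \<open>e\<close> and \<open>e'\<close> are obtained as preimages of
  identities, since \<open>hom_adj\<close> does not store them. The comparison is the image of
  \<open>e y\<close> under the second bijection; \<open>key\<close> says that it turns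
  \<open>e' y\<close> into \<open>e y\<close>, and the same identity with the roles exchanged
  provides the inverse.\<close>

lemma right_adjoint_unique:
  assumes A: "hom_adj F G \<phi>" and B: "hom_adj F G' \<phi>'"
  shows "naturally_isomorphic G G'"
proof -
  note A' = hom_adjD[OF A] and B' = hom_adjD[OF B]
  note C = functorD(1,2)[OF A'(1)]
  have G: "FO G y \<in> Ob (Src F)" "FO G' y \<in> Ob (Src F)" if "y \<in> Ob (Tgt F)" for y
    using functorD(3)[OF A'(2)] functorD(3)[OF B'(2)] A'(3,4) B'(3,4) that by auto
  have I: "Id (Src F) (FO G y) \<in> Hom (Src F) (FO G y) (FO G y)"
    "Id (Src F) (FO G' y) \<in> Hom (Src F) (FO G' y) (FO G' y)" if "y \<in> Ob (Tgt F)" for y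
    using Id_Hom[OF C(1)] G that by auto
  define e where "e y = (SOME f. f \<in> Hom (Tgt F) (FO F (FO G y)) y \<and> \<phi> (FO G y) f = Id (Src F) (FO G y))" for y
  have e: "e y \<in> Hom (Tgt F) (FO F (FO G y)) y" "\<phi> (FO G y) (e y) = Id (Src F) (FO G y)"
    if "y \<in> Ob (Tgt F)" for y
    using someI_ex[OF A'(6)[OF G(1)[OF that] that I(1)[OF that]]] unfolding e_def by auto
  define e' where "e' y = (SOME f. f \<in> Hom (Tgt F) (FO F (FO G' y)) y \<and> \<phi>' (FO G' y) f = Id (Src F) (FO G' y))" for y
  have e': "e' y \<in> Hom (Tgt F) (FO F (FO G' y)) y" "\<phi>' (FO G' y) (e' y) = Id (Src F) (FO G' y)"
    if "y \<in> Ob (Tgt F)" for y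
    using someI_ex[OF B'(6)[OF G(2)[OF that] that I(2)[OF that]]] unfolding e'_def by auto
  let ?c = "\<lambda>y. \<phi>' (FO G y) (e y)"
  have c: "?c y \<in> Hom (Src F) (FO G y) (FO G' y)" if "y \<in> Ob (Tgt F)" for y
    using B'(5)[OF G(1)[OF that] e(1)[OF that]] .
  have key: "Cmp (Tgt F) (e' y) (FA F (?c y)) = e y" if y: "y \<in> Ob (Tgt F)" for y
  proof (rule B'(7)[OF G(1)[OF y] _ e(1)[OF y]])
    show "Cmp (Tgt F) (e' y) (FA F (?c y)) \<in> Hom (Tgt F) (FO F (FO G y)) y"
      using Cmp_Hom[OF C(2) e'(1)[OF y] functorD(4)[OF B'(1) c[OF y]]] .
    show "\<phi>' (FO G y) (Cmp (Tgt F) (e' y) (FA F (?c y))) = ?c y"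
      using B'(8)[OF c[OF y] e'(1)[OF y]] e'(2)[OF y] Cmp_Id_left[OF C(1) c[OF y]] by simp
  qed
  have inv: "invertible (Src F) (?c y)" if y: "y \<in> Ob (Tgt F)" for y
  proof -
    let ?d = "\<phi> (FO G' y) (e' y)"
    have d: "?d \<in> Hom (Src F) (FO G' y) (FO G y)" using A'(5)[OF G(2)[OF y] e'(1)[OF y]] .
    have "Cmp (Src F) ?d (?c y) = \<phi> (FO G y) (Cmp (Tgt F) (e' y) (FA F (?c y)))"
      using A'(8)[OF c[OF y] e'(1)[OF y]] by simp
    hence 1: "Cmp (Src F) ?d (?c y) = Id (Src F) (FO G y)" using key[OF y] e(2)[OF y] by simp
    have "Cmp (Tgt F) (e y) (FA F ?d) = e' y"
    proof (rule A'(7)[OF G(2)[OF y] _ e'(1)[OF y]])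
      show "Cmp (Tgt F) (e y) (FA F ?d) \<in> Hom (Tgt F) (FO F (FO G' y)) y"
        using Cmp_Hom[OF C(2) e(1)[OF y] functorD(4)[OF B'(1) d]] .
      show "\<phi> (FO G' y) (Cmp (Tgt F) (e y) (FA F ?d)) = ?d"
        using A'(8)[OF d e(1)[OF y]] e(2)[OF y] Cmp_Id_left[OF C(1) d] by simp
    qed
    hence 2: "Cmp (Src F) (?c y) ?d = Id (Src F) (FO G' y)"
      using B'(8)[OF d e(1)[OF y]] e'(2)[OF y] by simp
    show ?thesis using invertibleI[OF c[OF y] d 1 2] .
  qed
  have nat: "Cmp (Src F) (?c y') (FA G b) = Cmp (Src F) (FA G' b) (?c y)" if b: "b \<in> Hom (Tgt F) y y'" for b y y'
  proof -
    have y: "y \<in> Ob (Tgt F)" and y': "y' \<in> Ob (Tgt F)" using Hom_Ob[OF C(2) b] by auto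
    have Gb: "FA G b \<in> Hom (Src F) (FO G y) (FO G y')" using functorD(4)[OF A'(2)] A'(3,4) b by simp
    have "Cmp (Tgt F) (e y') (FA F (FA G b)) = Cmp (Tgt F) b (e y)"
    proof (rule A'(7)[OF G(1)[OF y] Cmp_Hom[OF C(2) e(1)[OF y'] functorD(4)[OF B'(1) Gb]] Cmp_Hom[OF C(2) b e(1)[OF y]]])
      show "\<phi> (FO G y) (Cmp (Tgt F) (e y') (FA F (FA G b))) = \<phi> (FO G y) (Cmp (Tgt F) b (e y))"
        using A'(8)[OF Gb e(1)[OF y']] e(2)[OF y'] A'(9)[OF G(1)[OF y] e(1)[OF y] b] e(2)[OF y]
          Cmp_Id_left[OF C(1) Gb] Cmp_Id_right[OF C(1) Gb] by simp
    qed
    thus ?thesis using B'(8)[OF Gb e(1)[OF y']] B'(9)[OF G(1)[OF y] e(1)[OF y] b] by simp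
  qed
  show ?thesis unfolding naturally_isomorphic_def using A'(2-4) B'(2-4) c inv nat by (intro conjI exI[of _ ?c]) simp_all
qed

lemma naturally_isomorphic_invertible:
  assumes N: "naturally_isomorphic F G" and h: "h \<in> Hom (Src F) x y"
  shows "invertible (Tgt F) (FA F h) \<longleftrightarrow> invertible (Tgt F) (FA G h)"
proof -
  obtain c where F: "is_functor F" "is_functor G" "Src G = Src F" "Tgt G = Tgt F"
    and c0: "\<forall>x\<in>Ob (Src F). c x \<in> Hom (Tgt F) (FO F x) (FO G x) \<and> invertible (Tgt F) (c x)"
    "\<forall>x y f. f \<in> Hom (Src F) x y \<longrightarrow> Cmp (Tgt F) (c y) (FA F f) = Cmp (Tgt F) (FA G f) (c x)"
    using naturally_isomorphicE[OF N] .
  have "x \<in> Ob (Src F)" "y \<in> Ob (Src F)" using Hom_Ob[OF functorD(1)[OF F(1)] h] by auto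
  thus ?thesis
    using invertible_square[OF functorD(2)[OF F(1)], of "FA G h" "FO G x" "FO G y" "FA F h" "FO F x" "FO F y" "c x" "c y"]
      c0(1) c0(2)[rule_format, OF h] functorD(4)[OF F(1) h] functorD(4)[OF F(2), of h x y] h F(3,4) by simp
qed

text \<open>Orthogonality of u to h: composition with h is a bijection Hom(y, u) -> Hom(x, u). By
  Yoneda, invertibility of h is locality at enough objects u, and since the condition refers to Hom
  sets only, adjunctions transport it.\<close>

definition local_at :: "('o, 'm) cat \<Rightarrow> 'm \<Rightarrow> 'o \<Rightarrow> bool" where
  "local_at C h u \<longleftrightarrow> (\<forall>f\<in>Hom C (Dom C h) u. \<exists>!g. g \<in> Hom C (Cod C h) u \<and> Cmp C g h = f)"

lemma local_atI:
  assumes "h \<in> Hom C x y"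
    and "\<And>f. f \<in> Hom C x u \<Longrightarrow> \<exists>g. g \<in> Hom C y u \<and> Cmp C g h = f"
    and "\<And>g g'. g \<in> Hom C y u \<Longrightarrow> g' \<in> Hom C y u \<Longrightarrow> Cmp C g h = Cmp C g' h \<Longrightarrow> g = g'"
  shows "local_at C h u"
  using assms unfolding local_at_def by (auto simp: HomD)

lemma local_atD:
  assumes "category C" "local_at C h u" "h \<in> Hom C x y"
  shows "f \<in> Hom C x u \<Longrightarrow> \<exists>g. g \<in> Hom C y u \<and> Cmp C g h = f"
    "g \<in> Hom C y u \<Longrightarrow> g' \<in> Hom C y u \<Longrightarrow> Cmp C g h = Cmp C g' h \<Longrightarrow> g = g'"
proof -
  have l: "\<forall>f\<in>Hom C x u. \<exists>!g. g \<in> Hom C y u \<and> Cmp C g h = f"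
    using assms(2,3) unfolding local_at_def by (simp add: HomD)
  show "f \<in> Hom C x u \<Longrightarrow> \<exists>g. g \<in> Hom C y u \<and> Cmp C g h = f" using l by blast
  show "g = g'" if g: "g \<in> Hom C y u" "g' \<in> Hom C y u" "Cmp C g h = Cmp C g' h"
    using l Cmp_Hom[OF assms(1) g(1) assms(3)] g by metis
qed

lemma local_at_invertible:
  assumes C: "category C" and h: "h \<in> Hom C x y" and i: "invertible C h"
  shows "local_at C h u"
proof (rule local_atI[OF h])
  obtain k where k: "k \<in> Hom C y x" "Cmp C k h = Id C x" "Cmp C h k = Id C y" using invertibleE[OF i h] .
  show "\<exists>g. g \<in> Hom C y u \<and> Cmp C g h = f" if f: "f \<in> Hom C x u" for f
    using Cmp_Hom[OF C f k(1)] Cmp_assoc[OF C f k(1) h] Cmp_Id_right[OF C f] k(2)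
    by (intro exI[of _ "Cmp C f k"]) simp
  show "g = g'" if g: "g \<in> Hom C y u" "g' \<in> Hom C y u" and e: "Cmp C g h = Cmp C g' h" for g g'
    using Cmp_assoc[OF C g(1) h k(1)] Cmp_assoc[OF C g(2) h k(1)] Cmp_Id_right[OF C g(1)]
      Cmp_Id_right[OF C g(2)] e k(3) by metis
qed

text \<open>Locality at the source produces a left inverse k of h. Locality at the target shows that
  h k is the identity, because the two agree after composition with h.\<close>

lemma invertible_local_at:
  assumes C: "category C" and h: "h \<in> Hom C x y" and l: "local_at C h x" "local_at C h y"
  shows "invertible C h"
proof -
  have xy: "x \<in> Ob C" "y \<in> Ob C" using Hom_Ob[OF C h] by auto
  obtain k where k: "k \<in> Hom C y x" "Cmp C k h = Id C x"
    using local_atD(1)[OF C l(1) h Id_Hom[OF C xy(1)]] by auto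
  have "Cmp C (Cmp C h k) h = Cmp C (Id C y) h"
    using Cmp_assoc[OF C h k(1) h] k(2) Cmp_Id_right[OF C h] Cmp_Id_left[OF C h] by simp
  hence "Cmp C h k = Id C y"
    using local_atD(2)[OF C l(2) h Cmp_Hom[OF C h k(1)] Id_Hom[OF C xy(2)]] by simp
  thus ?thesis using invertibleI[OF h k] by simp
qed

lemma local_at_zero_object:
  assumes C: "category C" and h: "h \<in> Hom C x y" and u: "zero_object C u"
  shows "local_at C h u"
proof (rule local_atI[OF h])
  have xy: "x \<in> Ob C" "y \<in> Ob C" using Hom_Ob[OF C h] by auto
  show "\<exists>g. g \<in> Hom C y u \<and> Cmp C g h = f" if f: "f \<in> Hom C x u" for f
    using zero_objectD(3)[OF u xy(2)] zero_objectD(5)[OF u xy(1)] Cmp_Hom[OF C _ h] f by metis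
  show "g = g'" if "g \<in> Hom C y u" "g' \<in> Hom C y u" for g g'
    using zero_objectD(5)[OF u xy(2) that] .
qed

text \<open>The bijections for x and for y intertwine composition with F h and composition with h,
  so one of these is bijective exactly if the other is. Chains of adjunctions are handled by
  repeated use of this step.\<close>

lemma local_at_hom_adj:
  assumes A: "hom_adj F G \<phi>" and h: "h \<in> Hom (Src F) x y" and u: "u \<in> Ob (Tgt F)"
  shows "local_at (Tgt F) (FA F h) u \<longleftrightarrow> local_at (Src F) h (FO G u)"
proof -
  note A' = hom_adjD[OF A]
  note C = functorD(1,2)[OF A'(1)]
  have x: "x \<in> Ob (Src F)" and y: "y \<in> Ob (Src F)" using Hom_Ob[OF C(1) h] by auto
  have Fh: "FA F h \<in> Hom (Tgt F) (FO F x) (FO F y)" using functorD(4)[OF A'(1) h] .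
  show ?thesis
  proof
    assume l: "local_at (Tgt F) (FA F h) u"
    show "local_at (Src F) h (FO G u)"
    proof (rule local_atI[OF h])
      fix f assume f: "f \<in> Hom (Src F) x (FO G u)"
      obtain f0 where f0: "f0 \<in> Hom (Tgt F) (FO F x) u" "\<phi> x f0 = f" using A'(6)[OF x u f] by auto
      obtain g where g: "g \<in> Hom (Tgt F) (FO F y) u" "Cmp (Tgt F) g (FA F h) = f0"
        using local_atD(1)[OF C(2) l Fh f0(1)] by auto
      show "\<exists>g. g \<in> Hom (Src F) y (FO G u) \<and> Cmp (Src F) g h = f"
        using A'(8)[OF h g(1)] g(2) f0(2) A'(5)[OF y g(1)] by (intro exI[of _ "\<phi> y g"]) simp
    next
      fix g g' assume g: "g \<in> Hom (Src F) y (FO G u)" "g' \<in> Hom (Src F) y (FO G u)"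
        and e: "Cmp (Src F) g h = Cmp (Src F) g' h"
      obtain k where k: "k \<in> Hom (Tgt F) (FO F y) u" "\<phi> y k = g" using A'(6)[OF y u g(1)] by auto
      obtain k' where k': "k' \<in> Hom (Tgt F) (FO F y) u" "\<phi> y k' = g'" using A'(6)[OF y u g(2)] by auto
      have "\<phi> x (Cmp (Tgt F) k (FA F h)) = \<phi> x (Cmp (Tgt F) k' (FA F h))"
        using A'(8)[OF h k(1)] A'(8)[OF h k'(1)] k(2) k'(2) e by simp
      hence "Cmp (Tgt F) k (FA F h) = Cmp (Tgt F) k' (FA F h)"
        using A'(7)[OF x Cmp_Hom[OF C(2) k(1) Fh] Cmp_Hom[OF C(2) k'(1) Fh]] by simp
      thus "g = g'" using local_atD(2)[OF C(2) l Fh k(1) k'(1)] k k' by simp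
    qed
  next
    assume l: "local_at (Src F) h (FO G u)"
    show "local_at (Tgt F) (FA F h) u"
    proof (rule local_atI[OF Fh])
      fix f assume f: "f \<in> Hom (Tgt F) (FO F x) u"
      obtain g where g: "g \<in> Hom (Src F) y (FO G u)" "Cmp (Src F) g h = \<phi> x f"
        using local_atD(1)[OF C(1) l h A'(5)[OF x f]] by auto
      obtain k where k: "k \<in> Hom (Tgt F) (FO F y) u" "\<phi> y k = g" using A'(6)[OF y u g(1)] by auto
      have "Cmp (Tgt F) k (FA F h) = f"
        using A'(7)[OF x Cmp_Hom[OF C(2) k(1) Fh] f] A'(8)[OF h k(1)] k(2) g(2) by simp
      thus "\<exists>g. g \<in> Hom (Tgt F) (FO F y) u \<and> Cmp (Tgt F) g (FA F h) = f" using k(1) by auto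
    next
      fix g g' assume g: "g \<in> Hom (Tgt F) (FO F y) u" "g' \<in> Hom (Tgt F) (FO F y) u"
        and e: "Cmp (Tgt F) g (FA F h) = Cmp (Tgt F) g' (FA F h)"
      have "\<phi> y g = \<phi> y g'"
        using local_atD(2)[OF C(1) l h A'(5)[OF y g(1)] A'(5)[OF y g(2)]] A'(8)[OF h g(1)] A'(8)[OF h g(2)] e by simp
      thus "g = g'" using A'(7)[OF y g] by simp
    qed
  qed
qed

lemma local_at_target_imp:
  assumes C: "category C" and h: "h \<in> Hom C x y" and k: "k \<in> Hom C u v" and i: "invertible C k"
    and l: "local_at C h u"
  shows "local_at C h v"
proof (rule local_atI[OF h])
  obtain k' where k': "k' \<in> Hom C v u" "invertible C k'" "Cmp C k' k = Id C u" "Cmp C k k' = Id C v"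
    using invertible_inverse[OF C k i] .
  { fix f assume f: "f \<in> Hom C x v"
    obtain g where g: "g \<in> Hom C y u" "Cmp C g h = Cmp C k' f" using local_atD(1)[OF C l h Cmp_Hom[OF C k'(1) f]] by auto
    have "Cmp C (Cmp C k g) h = f"
      using Cmp_assoc[OF C k g(1) h] g(2) Cmp_assoc[OF C k k'(1) f] k'(4) Cmp_Id_left[OF C f] by simp
    thus "\<exists>g. g \<in> Hom C y v \<and> Cmp C g h = f" using Cmp_Hom[OF C k g(1)] by blast }
  { fix g g' assume g: "g \<in> Hom C y v" "g' \<in> Hom C y v" and e: "Cmp C g h = Cmp C g' h"
    have "Cmp C (Cmp C k' g) h = Cmp C (Cmp C k' g') h"
      using Cmp_assoc[OF C k'(1) g(1) h] Cmp_assoc[OF C k'(1) g(2) h] e by metis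
    hence "Cmp C k' g = Cmp C k' g'"
      using local_atD(2)[OF C l h Cmp_Hom[OF C k'(1) g(1)] Cmp_Hom[OF C k'(1) g(2)]] by simp
    hence "Cmp C k (Cmp C k' g) = Cmp C k (Cmp C k' g')" by simp
    thus "g = g'"
      using Cmp_assoc[OF C k k'(1) g(1)] Cmp_assoc[OF C k k'(1) g(2)] k'(4) Cmp_Id_left[OF C g(1)] Cmp_Id_left[OF C g(2)] by metis }
qed

text \<open>Serves where an object is identified with a Kan extension through an invertible
  unit.\<close>

lemma local_at_target:
  assumes C: "category C" and h: "h \<in> Hom C x y" and k: "k \<in> Hom C u v" and i: "invertible C k"
  shows "local_at C h u \<longleftrightarrow> local_at C h v"
  using local_at_target_imp[OF C h] k i invertible_inverse[OF C k i] by metis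

lemma local_at_square:
  assumes C: "category C" and h: "h \<in> Hom C x y" and h': "h' \<in> Hom C x' y'"
    and k: "k \<in> Hom C x' x" and k': "k' \<in> Hom C y' y" and ik: "invertible C k" and ik': "invertible C k'"
    and sq: "Cmp C k' h' = Cmp C h k" and l: "local_at C h u"
  shows "local_at C h' u"
proof (rule local_atI[OF h'])
  note lk = local_at_invertible[OF C k ik, of u] and lk' = local_at_invertible[OF C k' ik', of u]
  { fix f assume f: "f \<in> Hom C x' u"
    obtain f1 where f1: "f1 \<in> Hom C x u" "Cmp C f1 k = f" using local_atD(1)[OF C lk k f] by auto
    obtain g where g: "g \<in> Hom C y u" "Cmp C g h = f1" using local_atD(1)[OF C l h f1(1)] by auto
    show "\<exists>g. g \<in> Hom C y' u \<and> Cmp C g h' = f"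
      using Cmp_Hom[OF C g(1) k'] Cmp_assoc[OF C g(1) k' h'] sq Cmp_assoc[OF C g(1) h k] g(2) f1(2)
      by (intro exI[of _ "Cmp C g k'"]) simp }
  { fix g g' assume g: "g \<in> Hom C y' u" "g' \<in> Hom C y' u" and e: "Cmp C g h' = Cmp C g' h'"
    obtain g1 where g1: "g1 \<in> Hom C y u" "Cmp C g1 k' = g" using local_atD(1)[OF C lk' k' g(1)] by auto
    obtain g2 where g2: "g2 \<in> Hom C y u" "Cmp C g2 k' = g'" using local_atD(1)[OF C lk' k' g(2)] by auto
    have "Cmp C (Cmp C g1 h) k = Cmp C (Cmp C g2 h) k"
      using Cmp_assoc[OF C g1(1) h k] Cmp_assoc[OF C g2(1) h k] sq Cmp_assoc[OF C g1(1) k' h'] Cmp_assoc[OF C g2(1) k' h'] g1(2) g2(2) e by metis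
    hence "Cmp C g1 h = Cmp C g2 h"
      using local_atD(2)[OF C lk k Cmp_Hom[OF C g1(1) h] Cmp_Hom[OF C g2(1) h]] by simp
    hence "g1 = g2" using local_atD(2)[OF C l h g1(1) g2(1)] by simp
    thus "g = g'" using g1 g2 by simp }
qed

text \<open>There is exactly one arrow z -> u, so composition with h is bijective exactly if Hom(x,
  u) has one element. This converts a statement about an object X into one about the arrow 0 -> X,
  to which \<open>local_at_hom_adj\<close> applies.\<close>

lemma local_at_from_zero:
  assumes C: "category C" and z: "zero_object C z" and h: "h \<in> Hom C z x" and u: "u \<in> Ob C"
  shows "local_at C h u \<longleftrightarrow> (\<exists>!f. f \<in> Hom C x u)"
proof
  obtain f0 where f0: "f0 \<in> Hom C z u" using zero_objectD(2)[OF z u] by auto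
  have eq: "Cmp C g h = f0" if "g \<in> Hom C x u" for g
    using zero_objectD(4)[OF z u Cmp_Hom[OF C that h] f0] .
  show "local_at C h u \<Longrightarrow> \<exists>!f. f \<in> Hom C x u"
    using local_atD[OF C _ h] f0 eq by metis
  show "\<exists>!f. f \<in> Hom C x u \<Longrightarrow> local_at C h u"
    using local_atI[OF h, of u] zero_objectD(4)[OF z u f0] eq by metis
qed

text \<open>A left adjoint preserves initial objects. Since the target has a zero object z', the
  initial object F z is isomorphic to it.\<close>

lemma hom_adj_zero_left:
  assumes A: "hom_adj F G \<phi>" and z: "zero_object (Src F) z" and z': "zero_object (Tgt F) z'"
  shows "zero_object (Tgt F) (FO F z)"
proof -
  note A' = hom_adjD[OF A]
  note C = functorD(1,2)[OF A'(1)]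
  have zo: "z \<in> Ob (Src F)" "z' \<in> Ob (Tgt F)" using zero_objectD(1)[OF z] zero_objectD(1)[OF z'] by auto
  have Fz: "FO F z \<in> Ob (Tgt F)" using functorD(3)[OF A'(1) zo(1)] .
  have u: "f = g" if "f \<in> Hom (Tgt F) (FO F z) y" "g \<in> Hom (Tgt F) (FO F z) y" for f g y
  proof -
    have "y \<in> Ob (Tgt F)" using Hom_Ob[OF C(2) that(1)] by simp
    hence "FO G y \<in> Ob (Src F)" using functorD(3)[OF A'(2)] A'(3,4) by simp
    thus ?thesis using A'(7)[OF zo(1) that] zero_objectD(4)[OF z] A'(5)[OF zo(1)] that by blast
  qed
  obtain f where f: "f \<in> Hom (Tgt F) (FO F z) z'" using zero_objectD(3)[OF z' Fz] by auto
  obtain g where g: "g \<in> Hom (Tgt F) z' (FO F z)" using zero_objectD(2)[OF z' Fz] by auto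
  have "invertible (Tgt F) g"
    by (rule invertibleI[OF g f])
      (rule zero_objectD(4)[OF z' zo(2)] u; auto intro: Cmp_Hom[OF C(2)] f g Id_Hom[OF C(2)] zo Fz)+
  thus ?thesis using zero_object_invertible[OF C(2) z' g] by simp
qed

lemma hom_adj_zero_right:
  assumes A: "hom_adj F G \<phi>" and z: "zero_object (Tgt F) z" and z': "zero_object (Src F) z'"
  shows "zero_object (Src F) (FO G z)"
proof -
  note A' = hom_adjD[OF A]
  note C = functorD(1,2)[OF A'(1)]
  have zo: "z \<in> Ob (Tgt F)" "z' \<in> Ob (Src F)" using zero_objectD(1)[OF z] zero_objectD(1)[OF z'] by auto
  have Gz: "FO G z \<in> Ob (Src F)" using functorD(3)[OF A'(2)] zo(1) A'(3,4) by simp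
  have u: "f = g" if "f \<in> Hom (Src F) x (FO G z)" "g \<in> Hom (Src F) x (FO G z)" for f g x
  proof -
    have x: "x \<in> Ob (Src F)" using Hom_Ob[OF C(1) that(1)] by simp
    have "FO F x \<in> Ob (Tgt F)" using functorD(3)[OF A'(1) x] .
    thus ?thesis using A'(6)[OF x zo(1)] that zero_objectD(5)[OF z] by metis
  qed
  obtain f where f: "f \<in> Hom (Src F) (FO G z) z'" using zero_objectD(3)[OF z' Gz] by auto
  obtain g where g: "g \<in> Hom (Src F) z' (FO G z)" using zero_objectD(2)[OF z' Gz] by auto
  have "invertible (Src F) g"
    by (rule invertibleI[OF g f])
      (rule zero_objectD(4)[OF z' zo(2)] u; auto intro: Cmp_Hom[OF C(1)] f g Id_Hom[OF C(1)] zo Gz)+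
  thus ?thesis using zero_object_invertible[OF C(1) z' g] by simp
qed

section \<open>Small categories\<close>

lemma universeD:
  assumes "universe U"
  shows "U S \<Longrightarrow> T \<subseteq> S \<Longrightarrow> U T" "U S \<Longrightarrow> U (f ` S)"
    "U I \<Longrightarrow> (\<And>i. i \<in> I \<Longrightarrow> U (A i)) \<Longrightarrow> U (\<Union>i\<in>I. A i)"
  using assms unfolding universe_def by auto

text \<open>The axioms provide one infinite small set; a finite set is the image of a subset of it
  with the same cardinality.\<close>

lemma universe_finite:
  assumes "universe U" "finite T"
  shows "U T"
proof -
  obtain S where S: "infinite S" "U S" using assms unfolding universe_def by auto
  obtain R where R: "R \<subseteq> S" "card R = card T" "finite R"
    using infinite_arbitrarily_large[OF S(1)] by metis
  obtain f where "bij_betw f R T" using finite_same_card_bij[OF R(3) assms(2) R(2)] by auto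
  hence "T = f ` R" by (simp add: bij_betw_def)
  thus ?thesis using universeD(2)[OF assms(1) universeD(1)[OF assms(1) S(2) R(1)]] by simp
qed

lemma universe_Pr:
  assumes "universe U" "U S" "U T"
  shows "U {Pr a b | a b. a \<in> S \<and> b \<in> T}"
proof -
  have "{Pr a b | a b. a \<in> S \<and> b \<in> T} = (\<Union>a\<in>S. Pr a ` T)" by auto
  thus ?thesis using universeD(2,3)[OF assms(1)] assms(2,3) by simp
qed

lemma mk_cat_simps [simp]:
  "Ob (mk_cat X M d c i m) = X" "Ar (mk_cat X M d c i m) = M"
  "f \<in> M \<Longrightarrow> Dom (mk_cat X M d c i m) f = d f" "f \<in> M \<Longrightarrow> Cod (mk_cat X M d c i m) f = c f"
  "x \<in> X \<Longrightarrow> Id (mk_cat X M d c i m) x = i x"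
  "f \<in> M \<Longrightarrow> g \<in> M \<Longrightarrow> c f = d g \<Longrightarrow> Cmp (mk_cat X M d c i m) g f = m g f"
  by (simp_all add: mk_cat_def)

lemma Hom_mk_cat: "f \<in> Hom (mk_cat X M d c i m) x y \<longleftrightarrow> f \<in> M \<and> d f = x \<and> c f = y"
  by (auto simp: Hom_def)

lemma category_mk_cat:
  assumes "\<And>f. f \<in> M \<Longrightarrow> d f \<in> X \<and> c f \<in> X"
    and "\<And>x. x \<in> X \<Longrightarrow> i x \<in> M \<and> d (i x) = x \<and> c (i x) = x"
    and "\<And>f g. f \<in> M \<Longrightarrow> g \<in> M \<Longrightarrow> c f = d g \<Longrightarrow> m g f \<in> M \<and> d (m g f) = d f \<and> c (m g f) = c g"
    and "\<And>f. f \<in> M \<Longrightarrow> m f (i (d f)) = f \<and> m (i (c f)) f = f"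
    and "\<And>f g h. f \<in> M \<Longrightarrow> g \<in> M \<Longrightarrow> h \<in> M \<Longrightarrow> c f = d g \<Longrightarrow> c g = d h \<Longrightarrow> m h (m g f) = m (m h g) f"
  shows "category (mk_cat X M d c i m)"
  unfolding category_def Hom_mk_cat using assms by (auto simp: mk_cat_def)

section \<open>Full subposets of cubes\<close>

lemma ble_refl: "list_all2 (\<le>) p (p :: bool list)"
  by (simp add: list_all2_refl)

lemma ble_trans: "list_all2 (\<le>) p q \<Longrightarrow> list_all2 (\<le>) q r \<Longrightarrow> list_all2 (\<le>) p (r :: bool list)"
  by (rule list_all2_trans) auto

lemma ble_antisym: "list_all2 (\<le>) p q \<Longrightarrow> list_all2 (\<le>) q p \<Longrightarrow> p = (q :: bool list)"
  by (auto simp: list_all2_conv_all_nth intro: nth_equalityI)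

lemma Ob_poset [simp]: "Ob (poset_cat P) = Vx ` P"
  by (simp add: poset_cat_def)

lemma Hom_poset:
  "f \<in> Hom (poset_cat P) x y \<longleftrightarrow>
     (\<exists>p q. x = Vx p \<and> y = Vx q \<and> f = Pr (Vx p) (Vx q) \<and> p \<in> P \<and> q \<in> P \<and> list_all2 (\<le>) p q)"
  by (auto simp: poset_cat_def Hom_mk_cat)

lemma Ar_poset: "f \<in> Ar (poset_cat P) \<longleftrightarrow>
     (\<exists>p q. f = Pr (Vx p) (Vx q) \<and> p \<in> P \<and> q \<in> P \<and> list_all2 (\<le>) p q)"
  by (auto simp: poset_cat_def)

lemma category_poset: "category (poset_cat P)"
  unfolding poset_cat_def
  by (rule category_mk_cat) (auto intro: ble_refl ble_trans)

lemma poset_simps [simp]: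
  "p \<in> P \<Longrightarrow> Id (poset_cat P) (Vx p) = Pr (Vx p) (Vx p)"
  "p \<in> P \<Longrightarrow> q \<in> P \<Longrightarrow> list_all2 (\<le>) p q \<Longrightarrow> Dom (poset_cat P) (Pr (Vx p) (Vx q)) = Vx p"
  "p \<in> P \<Longrightarrow> q \<in> P \<Longrightarrow> list_all2 (\<le>) p q \<Longrightarrow> Cod (poset_cat P) (Pr (Vx p) (Vx q)) = Vx q"
  "p \<in> P \<Longrightarrow> q \<in> P \<Longrightarrow> r \<in> P \<Longrightarrow> list_all2 (\<le>) p q \<Longrightarrow> list_all2 (\<le>) q r \<Longrightarrow>
     Cmp (poset_cat P) (Pr (Vx q) (Vx r)) (Pr (Vx p) (Vx q)) = Pr (Vx p) (Vx r)"
  by (simp_all add: poset_cat_def)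

lemma small_poset:
  fixes U :: "'a code set \<Rightarrow> bool"
  assumes "universe U" "finite P"
  shows "small_cat U (poset_cat P)"
proof -
  have "Ar (poset_cat P :: 'a scat) \<subseteq> (\<lambda>(p, q). Pr (Vx p) (Vx q)) ` (P \<times> P)" by (auto simp: Ar_poset)
  hence "finite (Ar (poset_cat P :: 'a scat))" by (rule finite_subset) (simp add: assms(2))
  thus ?thesis
    using assms(2) by (simp add: small_cat_def category_poset universe_finite[OF assms(1)])
qed

lemma finite_cube_pts: "finite (cube_pts n)"
proof -
  have "finite {p::bool list. set p \<subseteq> UNIV \<and> length p = n}" by (rule finite_lists_length_eq) simp
  thus ?thesis by (simp add: cube_pts_def)
qed

lemma cube_0 [simp]: "cube_pts 0 = {[]}"
  by (auto simp: cube_pts_def)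

lemma functor_poset:
  assumes "\<And>p. p \<in> P \<Longrightarrow> h p \<in> Q"
    and "\<And>p q. p \<in> P \<Longrightarrow> q \<in> P \<Longrightarrow> list_all2 (\<le>) p q \<Longrightarrow> list_all2 (\<le>) (h p) (h q)"
  shows "is_functor (poset_fun P Q h)"
  unfolding poset_fun_def
proof (rule functorI)
  show "vmap h x \<in> Ob (poset_cat Q)" if "x \<in> Ob (poset_cat P)" for x
    using that assms by (auto simp: vmap_def)
  show "emap h f \<in> Hom (poset_cat Q) (vmap h (Dom (poset_cat P) f)) (vmap h (Cod (poset_cat P) f))"
    if "f \<in> Ar (poset_cat P)" for f
    using that assms by (auto simp: Ar_poset emap_def vmap_def Hom_poset)
  show "emap h (Id (poset_cat P) x) = Id (poset_cat Q) (vmap h x)" if "x \<in> Ob (poset_cat P)" for x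
    using that assms by (auto simp: emap_def vmap_def)
  show "emap h (Cmp (poset_cat P) g f) = Cmp (poset_cat Q) (emap h g) (emap h f)"
    if "f \<in> Ar (poset_cat P)" "g \<in> Ar (poset_cat P)" "Cod (poset_cat P) f = Dom (poset_cat P) g" for f g
    using that assms by (auto simp: Ar_poset emap_def vmap_def)
qed (rule category_poset)+

lemma poset_fun_simps [simp]:
  "Src (poset_fun P Q h) = poset_cat P" "Tgt (poset_fun P Q h) = poset_cat Q"
  "p \<in> P \<Longrightarrow> FO (poset_fun P Q h) (Vx p) = Vx (h p)"
  "p \<in> P \<Longrightarrow> q \<in> P \<Longrightarrow> list_all2 (\<le>) p q \<Longrightarrow>
     FA (poset_fun P Q h) (Pr (Vx p) (Vx q)) = Pr (Vx (h p)) (Vx (h q))"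
  by (simp_all add: poset_fun_def vmap_def emap_def Ar_poset)

lemma poset_fun_cong:
  assumes "\<And>p. p \<in> P \<Longrightarrow> h p = h' p"
  shows "poset_fun P Q h = poset_fun P Q h'"
  unfolding poset_fun_def mk_fun_def
  by (auto intro!: restrict_ext simp: Ar_poset vmap_def emap_def assms)

lemma poset_fun_id: "poset_fun P P (\<lambda>p. p) = id_fun (poset_cat P)"
  unfolding poset_fun_def id_fun_def mk_fun_def
  by (auto intro!: restrict_ext simp: Ar_poset vmap_def emap_def)

lemma poset_fun_comp:
  assumes "\<And>p. p \<in> P \<Longrightarrow> h p \<in> Q"
    and "\<And>p q. p \<in> P \<Longrightarrow> q \<in> P \<Longrightarrow> list_all2 (\<le>) p q \<Longrightarrow> list_all2 (\<le>) (h p) (h q)"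
  shows "comp_fun (poset_fun Q R k) (poset_fun P Q h) = poset_fun P R (\<lambda>p. k (h p))"
  unfolding comp_fun_def poset_fun_simps unfolding poset_fun_def[of P R] mk_fun_def
  by (auto intro!: restrict_ext simp: Ar_poset vmap_def emap_def assms)

text \<open>The inequality h \<le> k between monotone maps, regarded as a transformation: arrows of
  a poset are pairs of end points.\<close>

definition poset_nt ::
  "bool list set \<Rightarrow> bool list set \<Rightarrow> (bool list \<Rightarrow> bool list) \<Rightarrow> (bool list \<Rightarrow> bool list) \<Rightarrow> 'a snt" where
  "poset_nt P Q h k = mk_nt (poset_fun P Q h) (poset_fun P Q k) (\<lambda>x. Pr (vmap h x) (vmap k x))"

lemma poset_nt_simps [simp]:
  "NSrc (poset_nt P Q h k) = poset_fun P Q h" "NTgt (poset_nt P Q h k) = poset_fun P Q k"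
  "p \<in> P \<Longrightarrow> NC (poset_nt P Q h k) (Vx p) = Pr (Vx (h p)) (Vx (k p))"
  by (simp_all add: poset_nt_def vmap_def)

lemma nt_poset_nt:
  assumes h: "is_functor (poset_fun P Q h :: 'a sfun)" and k: "is_functor (poset_fun P Q k :: 'a sfun)"
    and le: "\<And>p. p \<in> P \<Longrightarrow> list_all2 (\<le>) (h p) (k p)"
  shows "is_nt (poset_nt P Q h k :: 'a snt)"
  unfolding poset_nt_def
proof (rule ntI[OF h k])
  have hQ: "h p \<in> Q" if "p \<in> P" for p using functorD(3)[OF h, of "Vx p"] that by (auto simp: image_iff)
  have kQ: "k p \<in> Q" if "p \<in> P" for p using functorD(3)[OF k, of "Vx p"] that by (auto simp: image_iff)
  have hm: "list_all2 (\<le>) (h p) (h q)" if "p \<in> P" "q \<in> P" "list_all2 (\<le>) p q" for p q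
    using functorD(4)[OF h, of "Pr (Vx p) (Vx q)" "Vx p" "Vx q"] that by (auto simp: Hom_poset)
  have km: "list_all2 (\<le>) (k p) (k q)" if "p \<in> P" "q \<in> P" "list_all2 (\<le>) p q" for p q
    using functorD(4)[OF k, of "Pr (Vx p) (Vx q)" "Vx p" "Vx q"] that by (auto simp: Hom_poset)
  show "Pr (vmap h x) (vmap k x) \<in> Hom (Tgt (poset_fun P Q h)) (FO (poset_fun P Q h) x) (FO (poset_fun P Q k) x)"
    if "x \<in> Ob (Src (poset_fun P Q h :: 'a sfun))" for x :: "'a code"
    using that hQ kQ le by (auto simp: Hom_poset vmap_def)
  show "Cmp (Tgt (poset_fun P Q h)) (Pr (vmap h (Cod (Src (poset_fun P Q h)) f)) (vmap k (Cod (Src (poset_fun P Q h)) f)))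
          (FA (poset_fun P Q h) f) =
        Cmp (Tgt (poset_fun P Q h)) (FA (poset_fun P Q k) f)
          (Pr (vmap h (Dom (Src (poset_fun P Q h)) f)) (vmap k (Dom (Src (poset_fun P Q h)) f)))"
    if "f \<in> Ar (Src (poset_fun P Q h :: 'a sfun))" for f :: "'a code"
  proof -
    obtain p q where f: "f = Pr (Vx p) (Vx q)" "p \<in> P" "q \<in> P" "list_all2 (\<le>) p q"
      using \<open>f \<in> _\<close> by (auto simp: Ar_poset)
    show ?thesis using f hQ[OF f(2)] hQ[OF f(3)] kQ[OF f(2)] kQ[OF f(3)] hm[OF f(2-4)] km[OF f(2-4)] le
      by (simp add: vmap_def)
  qed
qed simp_all

section \<open>Products of small categories\<close>

lemma Ob_prod [simp]: "x \<in> Ob (prod_cat A B) \<longleftrightarrow> (\<exists>a b. x = Pr a b \<and> a \<in> Ob A \<and> b \<in> Ob B)"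
  by (auto simp: prod_cat_def)

lemma Ar_prod: "f \<in> Ar (prod_cat A B) \<longleftrightarrow> (\<exists>g h. f = Pr g h \<and> g \<in> Ar A \<and> h \<in> Ar B)"
  by (auto simp: prod_cat_def)

lemma Hom_prod [simp]:
  "Pr f g \<in> Hom (prod_cat A B) (Pr a b) (Pr a' b') \<longleftrightarrow> f \<in> Hom A a a' \<and> g \<in> Hom B b b'"
  by (auto simp: prod_cat_def Hom_mk_cat Hom_def)

lemma Hom_prodE:
  assumes "f \<in> Hom (prod_cat A B) x y"
  obtains a b a' b' g h where "f = Pr g h" "x = Pr a b" "y = Pr a' b'" "g \<in> Hom A a a'" "h \<in> Hom B b b'"
  using assms by (auto simp: prod_cat_def Hom_mk_cat Hom_def)

lemma prod_simps [simp]: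
  "f \<in> Ar A \<Longrightarrow> g \<in> Ar B \<Longrightarrow> Dom (prod_cat A B) (Pr f g) = Pr (Dom A f) (Dom B g)"
  "f \<in> Ar A \<Longrightarrow> g \<in> Ar B \<Longrightarrow> Cod (prod_cat A B) (Pr f g) = Pr (Cod A f) (Cod B g)"
  "a \<in> Ob A \<Longrightarrow> b \<in> Ob B \<Longrightarrow> Id (prod_cat A B) (Pr a b) = Pr (Id A a) (Id B b)"
  "f \<in> Ar A \<Longrightarrow> g \<in> Ar B \<Longrightarrow> f' \<in> Ar A \<Longrightarrow> g' \<in> Ar B \<Longrightarrow> Cod A f = Dom A f' \<Longrightarrow> Cod B g = Dom B g' \<Longrightarrow>
     Cmp (prod_cat A B) (Pr f' g') (Pr f g) = Pr (Cmp A f' f) (Cmp B g' g)"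
  by (simp_all add: prod_cat_def)

lemma category_prod:
  assumes A: "category A" and B: "category B"
  shows "category (prod_cat A B)"
  unfolding prod_cat_def
proof (rule category_mk_cat)
  fix f g assume f: "f \<in> {Pr f g |f g. f \<in> Ar A \<and> g \<in> Ar B}" and g: "g \<in> {Pr f g |f g. f \<in> Ar A \<and> g \<in> Ar B}"
    and fg: "Pr (Cod A (pfst f)) (Cod B (psnd f)) = Pr (Dom A (pfst g)) (Dom B (psnd g))"
  obtain f1 f2 g1 g2 where e: "f = Pr f1 f2" "g = Pr g1 g2" "f1 \<in> Ar A" "f2 \<in> Ar B" "g1 \<in> Ar A" "g2 \<in> Ar B"
    using f g by auto
  have 1: "Cmp A g1 f1 \<in> Hom A (Dom A f1) (Cod A g1)" "Cmp B g2 f2 \<in> Hom B (Dom B f2) (Cod B g2)"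
    using Cmp_Hom[OF A, of g1 "Cod A f1" "Cod A g1" f1 "Dom A f1"] Cmp_Hom[OF B, of g2 "Cod B f2" "Cod B g2" f2 "Dom B f2"]
      e fg by (auto simp: Hom_def)
  show "Pr (Cmp A (pfst g) (pfst f)) (Cmp B (psnd g) (psnd f)) \<in> {Pr f g |f g. f \<in> Ar A \<and> g \<in> Ar B} \<and>
     Pr (Dom A (pfst (Pr (Cmp A (pfst g) (pfst f)) (Cmp B (psnd g) (psnd f)))))
       (Dom B (psnd (Pr (Cmp A (pfst g) (pfst f)) (Cmp B (psnd g) (psnd f))))) = Pr (Dom A (pfst f)) (Dom B (psnd f)) \<and>
     Pr (Cod A (pfst (Pr (Cmp A (pfst g) (pfst f)) (Cmp B (psnd g) (psnd f)))))
       (Cod B (psnd (Pr (Cmp A (pfst g) (pfst f)) (Cmp B (psnd g) (psnd f))))) = Pr (Cod A (pfst g)) (Cod B (psnd g))"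
    using 1 e by (auto simp: HomD)
next
  fix f g h assume "f \<in> {Pr f g |f g. f \<in> Ar A \<and> g \<in> Ar B}" "g \<in> {Pr f g |f g. f \<in> Ar A \<and> g \<in> Ar B}"
    "h \<in> {Pr f g |f g. f \<in> Ar A \<and> g \<in> Ar B}"
    and fg: "Pr (Cod A (pfst f)) (Cod B (psnd f)) = Pr (Dom A (pfst g)) (Dom B (psnd g))"
     "Pr (Cod A (pfst g)) (Cod B (psnd g)) = Pr (Dom A (pfst h)) (Dom B (psnd h))"
  then obtain f1 f2 g1 g2 h1 h2 where e: "f = Pr f1 f2" "g = Pr g1 g2" "h = Pr h1 h2"
     "f1 \<in> Ar A" "f2 \<in> Ar B" "g1 \<in> Ar A" "g2 \<in> Ar B" "h1 \<in> Ar A" "h2 \<in> Ar B" by auto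
  have "Cmp A (Cmp A h1 g1) f1 = Cmp A h1 (Cmp A g1 f1)"
    by (rule Cmp_assoc[OF A, of _ "Dom A h1" "Cod A h1" _ "Cod A f1" _ "Dom A f1"]) (use e fg in \<open>auto simp: Hom_def\<close>)
  moreover have "Cmp B (Cmp B h2 g2) f2 = Cmp B h2 (Cmp B g2 f2)"
    by (rule Cmp_assoc[OF B, of _ "Dom B h2" "Cod B h2" _ "Cod B f2" _ "Dom B f2"]) (use e fg in \<open>auto simp: Hom_def\<close>)
  ultimately show "Pr (Cmp A (pfst h) (pfst (Pr (Cmp A (pfst g) (pfst f)) (Cmp B (psnd g) (psnd f)))))
       (Cmp B (psnd h) (psnd (Pr (Cmp A (pfst g) (pfst f)) (Cmp B (psnd g) (psnd f))))) =
     Pr (Cmp A (pfst (Pr (Cmp A (pfst h) (pfst g)) (Cmp B (psnd h) (psnd g)))) (pfst f))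
       (Cmp B (psnd (Pr (Cmp A (pfst h) (pfst g)) (Cmp B (psnd h) (psnd g)))) (psnd f))"
    using e by simp
qed (use A B in \<open>auto simp: Dom_Ob Cod_Ob HomD[OF Id_Hom] Cmp_Id_right[OF _ Ar_Hom] Cmp_Id_left[OF _ Ar_Hom]\<close>)

lemma small_prod: "universe U \<Longrightarrow> small_cat U A \<Longrightarrow> small_cat U B \<Longrightarrow> small_cat U (prod_cat A B)"
  unfolding small_cat_def using universe_Pr[of U "Ob A" "Ob B"] universe_Pr[of U "Ar A" "Ar B"]
  by (auto intro!: category_prod) (simp_all add: prod_cat_def)

lemma prod_fun_simps [simp]:
  "Src (prod_fun u v) = prod_cat (Src u) (Src v)" "Tgt (prod_fun u v) = prod_cat (Tgt u) (Tgt v)"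
  "a \<in> Ob (Src u) \<Longrightarrow> b \<in> Ob (Src v) \<Longrightarrow> FO (prod_fun u v) (Pr a b) = Pr (FO u a) (FO v b)"
  "f \<in> Ar (Src u) \<Longrightarrow> g \<in> Ar (Src v) \<Longrightarrow> FA (prod_fun u v) (Pr f g) = Pr (FA u f) (FA v g)"
  by (simp_all add: prod_fun_def Ar_prod)

lemma functor_prod:
  assumes u: "is_functor u" and v: "is_functor v"
  shows "is_functor (prod_fun u v)"
  unfolding prod_fun_def
proof (rule functorI)
  fix f g assume f: "f \<in> Ar (prod_cat (Src u) (Src v))" and g: "g \<in> Ar (prod_cat (Src u) (Src v))"
    and fg: "Cod (prod_cat (Src u) (Src v)) f = Dom (prod_cat (Src u) (Src v)) g"
  obtain f1 f2 g1 g2 where e: "f = Pr f1 f2" "g = Pr g1 g2" "f1 \<in> Ar (Src u)" "g1 \<in> Ar (Src u)" "f2 \<in> Ar (Src v)" "g2 \<in> Ar (Src v)"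
    using f g by (auto simp: Ar_prod)
  have fg': "Cod (Src u) f1 = Dom (Src u) g1" "Cod (Src v) f2 = Dom (Src v) g2" using fg e by auto
  have h: "f1 \<in> Hom (Src u) (Dom (Src u) f1) (Dom (Src u) g1)" "g1 \<in> Hom (Src u) (Dom (Src u) g1) (Cod (Src u) g1)"
    "f2 \<in> Hom (Src v) (Dom (Src v) f2) (Dom (Src v) g2)" "g2 \<in> Hom (Src v) (Dom (Src v) g2) (Cod (Src v) g2)"
    using e fg' by (auto simp: Hom_def)
  note uf = functorD(4)[OF u h(1)] functorD(4)[OF u h(2)] functorD(4)[OF v h(3)] functorD(4)[OF v h(4)]
  show "Pr (FA u (pfst (Cmp (prod_cat (Src u) (Src v)) g f))) (FA v (psnd (Cmp (prod_cat (Src u) (Src v)) g f))) =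
     Cmp (prod_cat (Tgt u) (Tgt v)) (Pr (FA u (pfst g)) (FA v (psnd g))) (Pr (FA u (pfst f)) (FA v (psnd f)))"
    using e fg' functorD(6)[OF u h(2,1)] functorD(6)[OF v h(4,3)] uf by (simp add: HomD)
next
  fix f assume "f \<in> Ar (prod_cat (Src u) (Src v))"
  then obtain f1 f2 where e: "f = Pr f1 f2" "f1 \<in> Ar (Src u)" "f2 \<in> Ar (Src v)" by (auto simp: Ar_prod)
  show "Pr (FA u (pfst f)) (FA v (psnd f))
         \<in> Hom (prod_cat (Tgt u) (Tgt v))
             (Pr (FO u (pfst (Dom (prod_cat (Src u) (Src v)) f))) (FO v (psnd (Dom (prod_cat (Src u) (Src v)) f))))
             (Pr (FO u (pfst (Cod (prod_cat (Src u) (Src v)) f))) (FO v (psnd (Cod (prod_cat (Src u) (Src v)) f))))"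
    using e functorD(4)[OF u Ar_Hom[OF e(2)]] functorD(4)[OF v Ar_Hom[OF e(3)]] by simp
qed (use u v in \<open>auto intro!: category_prod functorD simp: functorD(3,5)\<close>)

lemma comp_prod_fun:
  assumes "is_functor u" "is_functor v" "is_functor u'" "is_functor v'" "Tgt u = Src u'" "Tgt v = Src v'"
  shows "comp_fun (prod_fun u' v') (prod_fun u v) = prod_fun (comp_fun u' u) (comp_fun v' v)"
proof (rule functor_eqI)
  show "is_functor (comp_fun (prod_fun u' v') (prod_fun u v))" "is_functor (prod_fun (comp_fun u' u) (comp_fun v' v))"
    using assms by (auto intro!: functor_comp_fun functor_prod)
qed (use assms functorD(3)[OF assms(1)] functorD(3)[OF assms(2)] functor_Ar[OF assms(1)] functor_Ar[OF assms(2)]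
    in \<open>auto simp: Ar_prod\<close>)

lemma prod_fun_id: "category A \<Longrightarrow> category B \<Longrightarrow> prod_fun (id_fun A) (id_fun B) = id_fun (prod_cat A B)"
  by (rule functor_eqI) (auto intro!: functor_prod functor_id_fun category_prod simp: Ar_prod)

lemma prod_nt_simps [simp]:
  "NSrc (prod_nt \<alpha> \<beta>) = prod_fun (NSrc \<alpha>) (NSrc \<beta>)" "NTgt (prod_nt \<alpha> \<beta>) = prod_fun (NTgt \<alpha>) (NTgt \<beta>)"
  "a \<in> Ob (Src (NSrc \<alpha>)) \<Longrightarrow> b \<in> Ob (Src (NSrc \<beta>)) \<Longrightarrow> NC (prod_nt \<alpha> \<beta>) (Pr a b) = Pr (NC \<alpha> a) (NC \<beta> b)"
  by (simp_all add: prod_nt_def)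

lemma nt_prod:
  assumes a: "is_nt \<alpha>" and b: "is_nt \<beta>"
  shows "is_nt (prod_nt \<alpha> \<beta>)"
  unfolding prod_nt_def
proof (rule ntI)
  note A = ntD[OF a] and B = ntD[OF b]
  show "is_functor (prod_fun (NSrc \<alpha>) (NSrc \<beta>))" "is_functor (prod_fun (NTgt \<alpha>) (NTgt \<beta>))"
    using A(1,2) B(1,2) by (auto intro: functor_prod)
  show "Pr (NC \<alpha> (pfst x)) (NC \<beta> (psnd x)) \<in> Hom (Tgt (prod_fun (NSrc \<alpha>) (NSrc \<beta>)))
          (FO (prod_fun (NSrc \<alpha>) (NSrc \<beta>)) x) (FO (prod_fun (NTgt \<alpha>) (NTgt \<beta>)) x)"
    if "x \<in> Ob (Src (prod_fun (NSrc \<alpha>) (NSrc \<beta>)))" for x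
    using that A(3,5) B(3,5) by auto
  fix f assume "f \<in> Ar (Src (prod_fun (NSrc \<alpha>) (NSrc \<beta>)))"
  then obtain g h where e: "f = Pr g h" "g \<in> Ar (Src (NSrc \<alpha>))" "h \<in> Ar (Src (NSrc \<beta>))" by (auto simp: Ar_prod)
  note G = Ar_Hom[OF e(2)] and H = Ar_Hom[OF e(3)]
  have ob: "Dom (Src (NSrc \<alpha>)) g \<in> Ob (Src (NSrc \<alpha>))" "Cod (Src (NSrc \<alpha>)) g \<in> Ob (Src (NSrc \<alpha>))"
    "Dom (Src (NSrc \<beta>)) h \<in> Ob (Src (NSrc \<beta>))" "Cod (Src (NSrc \<beta>)) h \<in> Ob (Src (NSrc \<beta>))"
    using Hom_Ob[OF functorD(1)[OF A(1)] G] Hom_Ob[OF functorD(1)[OF B(1)] H] by auto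
  have tg: "FA (NTgt \<alpha>) g \<in> Hom (Tgt (NSrc \<alpha>)) (FO (NTgt \<alpha>) (Dom (Src (NSrc \<alpha>)) g)) (FO (NTgt \<alpha>) (Cod (Src (NSrc \<alpha>)) g))"
    using functorD(4)[OF A(2), of g] G A(3,4) by simp
  have th: "FA (NTgt \<beta>) h \<in> Hom (Tgt (NSrc \<beta>)) (FO (NTgt \<beta>) (Dom (Src (NSrc \<beta>)) h)) (FO (NTgt \<beta>) (Cod (Src (NSrc \<beta>)) h))"
    using functorD(4)[OF B(2), of h] H B(3,4) by simp
  show "Cmp (Tgt (prod_fun (NSrc \<alpha>) (NSrc \<beta>)))
          (Pr (NC \<alpha> (pfst (Cod (Src (prod_fun (NSrc \<alpha>) (NSrc \<beta>))) f))) (NC \<beta> (psnd (Cod (Src (prod_fun (NSrc \<alpha>) (NSrc \<beta>))) f))))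
          (FA (prod_fun (NSrc \<alpha>) (NSrc \<beta>)) f) =
        Cmp (Tgt (prod_fun (NSrc \<alpha>) (NSrc \<beta>))) (FA (prod_fun (NTgt \<alpha>) (NTgt \<beta>)) f)
          (Pr (NC \<alpha> (pfst (Dom (Src (prod_fun (NSrc \<alpha>) (NSrc \<beta>))) f))) (NC \<beta> (psnd (Dom (Src (prod_fun (NSrc \<alpha>) (NSrc \<beta>))) f))))"
    using e A(6)[OF G] B(6)[OF H] HomD[OF functorD(4)[OF A(1) G]] HomD[OF functorD(4)[OF B(1) H]] HomD[OF tg] HomD[OF th]
      HomD[OF A(5)[OF ob(1)]] HomD[OF A(5)[OF ob(2)]] HomD[OF B(5)[OF ob(3)]] HomD[OF B(5)[OF ob(4)]] A(3,4) B(3,4)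
    by simp
qed (use ntD[OF a] ntD[OF b] in auto)

section \<open>Points and the terminal category\<close>

lemma functor_pt:
  assumes "category A" "a \<in> Ob A"
  shows "is_functor (pt_fun A a)"
  unfolding pt_fun_def
  by (rule functorI)
    (use assms in \<open>auto simp: category_poset Ar_poset Id_Hom Cmp_Id_left[OF _ Id_Hom]\<close>)

lemma functor_to_term:
  assumes "category A"
  shows "is_functor (to_term A)"
  unfolding to_term_def
  by (rule functorI) (use assms in \<open>auto simp: category_poset Hom_poset\<close>)

lemma pt_fun_simps [simp]:
  "Src (pt_fun A a) = term_cat" "Tgt (pt_fun A a) = A" "FO (pt_fun A a) (Vx []) = a"
  "FA (pt_fun A a) (Pr (Vx []) (Vx [])) = Id A a"
  by (simp_all add: pt_fun_def Ar_poset)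

lemma to_term_simps [simp]:
  "Src (to_term A) = A" "Tgt (to_term A) = term_cat" "x \<in> Ob A \<Longrightarrow> FO (to_term A) x = Vx []"
  "f \<in> Ar A \<Longrightarrow> FA (to_term A) f = Pr (Vx []) (Vx [])"
  by (simp_all add: to_term_def)

lemma comp_pt:
  assumes "is_functor u" "a \<in> Ob (Src u)"
  shows "comp_fun u (pt_fun (Src u) a) = pt_fun (Tgt u) (FO u a)"
  by (rule functor_eqI)
    (use assms in \<open>auto intro!: functor_comp_fun functor_pt functorD simp: Ar_poset functorD(5)\<close>)

lemma comp_to_term:
  assumes "is_functor u"
  shows "comp_fun (to_term (Tgt u)) u = to_term (Src u)"
  by (rule functor_eqI)
    (use assms functorD(3)[OF assms] functor_Ar[OF assms] in \<open>auto intro!: functor_comp_fun functor_to_term functorD\<close>)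

lemma to_term_pt:
  assumes "category A" "a \<in> Ob A"
  shows "comp_fun (to_term A) (pt_fun A a) = id_fun term_cat"
  by (rule functor_eqI)
    (use assms in \<open>auto intro!: functor_comp_fun functor_to_term functor_pt functor_id_fun category_poset
      simp: Ar_poset HomD[OF Id_Hom]\<close>)

section \<open>Comma categories\<close>

lemma category_comma:
  assumes A: "category A" and X: "\<And>x. x \<in> X \<Longrightarrow> pfst x \<in> Ob A"
    and R1: "\<And>x. x \<in> X \<Longrightarrow> R x x (Id A (pfst x))"
    and R2: "\<And>x y z g h. x \<in> X \<Longrightarrow> y \<in> X \<Longrightarrow> z \<in> X \<Longrightarrow> h \<in> Hom A (pfst x) (pfst y) \<Longrightarrow> g \<in> Hom A (pfst y) (pfst z) \<Longrightarrow>
      R x y h \<Longrightarrow> R y z g \<Longrightarrow> R x z (Cmp A g h)"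
  shows "category (comma_cat A X R)"
  unfolding comma_cat_def
  by (rule category_mk_cat)
    (auto intro: Cmp_Hom[OF A] R1 R2 Id_Hom[OF A X] simp: Cmp_assoc[OF A] Cmp_Id_right[OF A] Cmp_Id_left[OF A])

lemma comma_simps [simp]:
  "Ob (comma_cat A X R) = X"
  "x \<in> X \<Longrightarrow> Id (comma_cat A X R) x = Pr (Pr x x) (Id A (pfst x))"
  by (simp_all add: comma_cat_def)

lemma Hom_comma:
  "f \<in> Hom (comma_cat A X R) x y \<longleftrightarrow>
     (\<exists>h. f = Pr (Pr x y) h \<and> x \<in> X \<and> y \<in> X \<and> h \<in> Hom A (pfst x) (pfst y) \<and> R x y h)"
  by (auto simp: comma_cat_def Hom_mk_cat)

lemma Cmp_comma:
  "Pr (Pr x y) h \<in> Hom (comma_cat A X R) x y \<Longrightarrow> Pr (Pr y z) g \<in> Hom (comma_cat A X R) y z \<Longrightarrow>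
     Cmp (comma_cat A X R) (Pr (Pr y z) g) (Pr (Pr x y) h) = Pr (Pr x z) (Cmp A g h)"
  unfolding Hom_comma by (auto simp: comma_cat_def)

lemma small_comma:
  assumes U: "universe U" and A: "small_cat U A" and X: "U X" and C: "category (comma_cat A X R)"
  shows "small_cat U (comma_cat A X R)"
proof -
  have "U {Pr x y | x y. x \<in> {Pr x y | x y. x \<in> X \<and> y \<in> X} \<and> y \<in> Ar A}"
    using universe_Pr[OF U universe_Pr[OF U X X]] A by (auto simp: small_cat_def)
  moreover have "Ar (comma_cat A X R) \<subseteq> {Pr x y | x y. x \<in> {Pr x y | x y. x \<in> X \<and> y \<in> X} \<and> y \<in> Ar A}"
    by (auto simp: comma_cat_def Hom_def)
  ultimately have "U (Ar (comma_cat A X R))" using universeD(1)[OF U] by blast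
  thus ?thesis using C X by (simp add: small_cat_def)
qed

lemma Ob_over [simp]: "Ob (over_cat u b) = {Pr a f | a f. a \<in> Ob (Src u) \<and> f \<in> Hom (Tgt u) (FO u a) b}"
  by (simp add: over_cat_def)

lemma Ob_under [simp]: "Ob (under_cat b u) = {Pr a f | a f. a \<in> Ob (Src u) \<and> f \<in> Hom (Tgt u) b (FO u a)}"
  by (simp add: under_cat_def)

lemma category_over:
  assumes u: "is_functor u"
  shows "category (over_cat u b)"
  unfolding over_cat_def
proof (rule category_comma)
  note C = functorD(1,2)[OF u]
  fix x y z g h
  assume x: "x \<in> {Pr a f |a f. a \<in> Ob (Src u) \<and> f \<in> Hom (Tgt u) (FO u a) b}"
    and y: "y \<in> {Pr a f |a f. a \<in> Ob (Src u) \<and> f \<in> Hom (Tgt u) (FO u a) b}"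
    and z: "z \<in> {Pr a f |a f. a \<in> Ob (Src u) \<and> f \<in> Hom (Tgt u) (FO u a) b}"
    and h: "h \<in> Hom (Src u) (pfst x) (pfst y)" and g: "g \<in> Hom (Src u) (pfst y) (pfst z)"
    and e: "Cmp (Tgt u) (psnd y) (FA u h) = psnd x" "Cmp (Tgt u) (psnd z) (FA u g) = psnd y"
  have z': "psnd z \<in> Hom (Tgt u) (FO u (pfst z)) b" using z by auto
  show "Cmp (Tgt u) (psnd z) (FA u (Cmp (Src u) g h)) = psnd x"
    using functorD(6)[OF u g h] Cmp_assoc[OF C(2) z' functorD(4)[OF u g] functorD(4)[OF u h]] e by simp
qed (use functorD(1,2)[OF u] in \<open>auto simp: functorD(5)[OF u] Cmp_Id_right\<close>)

lemma category_under:
  assumes u: "is_functor u"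
  shows "category (under_cat b u)"
  unfolding under_cat_def
proof (rule category_comma)
  note C = functorD(1,2)[OF u]
  fix x y z g h
  assume x: "x \<in> {Pr a f |a f. a \<in> Ob (Src u) \<and> f \<in> Hom (Tgt u) b (FO u a)}"
    and y: "y \<in> {Pr a f |a f. a \<in> Ob (Src u) \<and> f \<in> Hom (Tgt u) b (FO u a)}"
    and z: "z \<in> {Pr a f |a f. a \<in> Ob (Src u) \<and> f \<in> Hom (Tgt u) b (FO u a)}"
    and h: "h \<in> Hom (Src u) (pfst x) (pfst y)" and g: "g \<in> Hom (Src u) (pfst y) (pfst z)"
    and e: "Cmp (Tgt u) (FA u h) (psnd x) = psnd y" "Cmp (Tgt u) (FA u g) (psnd y) = psnd z"
  have x': "psnd x \<in> Hom (Tgt u) b (FO u (pfst x))" using x by auto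
  show "Cmp (Tgt u) (FA u (Cmp (Src u) g h)) (psnd x) = psnd z"
    using functorD(6)[OF u g h] Cmp_assoc[OF C(2) functorD(4)[OF u g] functorD(4)[OF u h] x'] e by simp
qed (use functorD(1,2)[OF u] in \<open>auto simp: functorD(5)[OF u] Cmp_Id_left\<close>)

lemma small_over:
  assumes U: "universe U" and u: "small_fun U u"
  shows "small_cat U (over_cat u b)"
proof -
  have "U {Pr a f | a f. a \<in> Ob (Src u) \<and> f \<in> Ar (Tgt u)}"
    using universe_Pr[OF U] u by (auto simp: small_fun_def small_cat_def)
  hence X: "U {Pr a f | a f. a \<in> Ob (Src u) \<and> f \<in> Hom (Tgt u) (FO u a) b}"
    by (rule universeD(1)[OF U]) (auto simp: Hom_def)
  show ?thesis
    unfolding over_cat_def by (rule small_comma[OF U _ X]) (use u category_over[of u b] in \<open>auto simp: small_fun_def over_cat_def\<close>)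
qed

lemma small_under:
  assumes U: "universe U" and u: "small_fun U u"
  shows "small_cat U (under_cat b u)"
proof -
  have "U {Pr a f | a f. a \<in> Ob (Src u) \<and> f \<in> Ar (Tgt u)}"
    using universe_Pr[OF U] u by (auto simp: small_fun_def small_cat_def)
  hence X: "U {Pr a f | a f. a \<in> Ob (Src u) \<and> f \<in> Hom (Tgt u) b (FO u a)}"
    by (rule universeD(1)[OF U]) (auto simp: Hom_def)
  show ?thesis
    unfolding under_cat_def by (rule small_comma[OF U _ X]) (use u category_under[of u b] in \<open>auto simp: small_fun_def under_cat_def\<close>)
qed

lemma over_proj_simps [simp]:
  "Src (over_proj u b) = over_cat u b" "Tgt (over_proj u b) = Src u"
  "x \<in> Ob (over_cat u b) \<Longrightarrow> FO (over_proj u b) x = pfst x"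
  "f \<in> Ar (over_cat u b) \<Longrightarrow> FA (over_proj u b) f = psnd f"
  by (simp_all add: over_proj_def)

lemma under_proj_simps [simp]:
  "Src (under_proj b u) = under_cat b u" "Tgt (under_proj b u) = Src u"
  "x \<in> Ob (under_cat b u) \<Longrightarrow> FO (under_proj b u) x = pfst x"
  "f \<in> Ar (under_cat b u) \<Longrightarrow> FA (under_proj b u) f = psnd f"
  by (simp_all add: under_proj_def)

lemma Hom_over:
  "f \<in> Hom (over_cat u b) x y \<longleftrightarrow>
     (\<exists>h. f = Pr (Pr x y) h \<and> x \<in> Ob (over_cat u b) \<and> y \<in> Ob (over_cat u b) \<and>
        h \<in> Hom (Src u) (pfst x) (pfst y) \<and> Cmp (Tgt u) (psnd y) (FA u h) = psnd x)"
  unfolding Ob_over unfolding over_cat_def Hom_comma by blast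

lemma Hom_under:
  "f \<in> Hom (under_cat b u) x y \<longleftrightarrow>
     (\<exists>h. f = Pr (Pr x y) h \<and> x \<in> Ob (under_cat b u) \<and> y \<in> Ob (under_cat b u) \<and>
        h \<in> Hom (Src u) (pfst x) (pfst y) \<and> Cmp (Tgt u) (FA u h) (psnd x) = psnd y)"
  unfolding Ob_under unfolding under_cat_def Hom_comma by blast

lemma Cmp_over:
  "Pr (Pr x y) h \<in> Hom (over_cat u b) x y \<Longrightarrow> Pr (Pr y z) g \<in> Hom (over_cat u b) y z \<Longrightarrow>
     Cmp (over_cat u b) (Pr (Pr y z) g) (Pr (Pr x y) h) = Pr (Pr x z) (Cmp (Src u) g h)"
  unfolding over_cat_def by (rule Cmp_comma)

lemma Cmp_under:
  "Pr (Pr x y) h \<in> Hom (under_cat b u) x y \<Longrightarrow> Pr (Pr y z) g \<in> Hom (under_cat b u) y z \<Longrightarrow>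
     Cmp (under_cat b u) (Pr (Pr y z) g) (Pr (Pr x y) h) = Pr (Pr x z) (Cmp (Src u) g h)"
  unfolding under_cat_def by (rule Cmp_comma)

lemma Id_over: "x \<in> Ob (over_cat u b) \<Longrightarrow> Id (over_cat u b) x = Pr (Pr x x) (Id (Src u) (pfst x))"
  unfolding over_cat_def by simp

lemma Id_under: "x \<in> Ob (under_cat b u) \<Longrightarrow> Id (under_cat b u) x = Pr (Pr x x) (Id (Src u) (pfst x))"
  unfolding under_cat_def by simp

lemma functor_over_proj:
  assumes u: "is_functor u"
  shows "is_functor (over_proj u b)"
  unfolding over_proj_def
proof (rule functorI[OF category_over[OF u] functorD(1)[OF u]])
  show "psnd f \<in> Hom (Src u) (pfst (Dom (over_cat u b) f)) (pfst (Cod (over_cat u b) f))"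
    if "f \<in> Ar (over_cat u b)" for f
    using Ar_Hom[OF that] unfolding Hom_over by auto
  show "psnd (Cmp (over_cat u b) g f) = Cmp (Src u) (psnd g) (psnd f)"
    if "f \<in> Ar (over_cat u b)" "g \<in> Ar (over_cat u b)" "Cod (over_cat u b) f = Dom (over_cat u b) g" for f g
  proof -
    let ?x = "Dom (over_cat u b) f" and ?y = "Cod (over_cat u b) f" and ?z = "Cod (over_cat u b) g"
    have f: "f \<in> Hom (over_cat u b) ?x ?y" using Ar_Hom[OF that(1)] .
    have g: "g \<in> Hom (over_cat u b) ?y ?z" using Ar_Hom[OF that(2)] that(3) by simp
    obtain h where h: "f = Pr (Pr ?x ?y) h" using f unfolding Hom_over by blast
    obtain l where l: "g = Pr (Pr ?y ?z) l" using g unfolding Hom_over by blast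
    \<comment> \<open>The equation \<open>h\<close> expresses f through its own end points, so as a
      rewrite rule it would loop. The composite is computed on the coded arrows and folded back with
      \<open>[symmetric]\<close>.\<close>
    have "Cmp (over_cat u b) (Pr (Pr ?y ?z) l) (Pr (Pr ?x ?y) h) = Pr (Pr ?x ?z) (Cmp (Src u) l h)"
      by (rule Cmp_over) (use f g in \<open>simp_all only: h[symmetric] l[symmetric]\<close>)
    hence "Cmp (over_cat u b) g f = Pr (Pr ?x ?z) (Cmp (Src u) l h)" unfolding h[symmetric] l[symmetric] .
    moreover have "psnd f = h" "psnd g = l" by (subst h l, simp)+
    ultimately show ?thesis by simp
  qed
  show "psnd (Id (over_cat u b) x) = Id (Src u) (pfst x)" if "x \<in> Ob (over_cat u b)" for x
    using Id_over[OF that] by simp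
qed auto

lemma functor_under_proj:
  assumes u: "is_functor u"
  shows "is_functor (under_proj b u)"
  unfolding under_proj_def
proof (rule functorI[OF category_under[OF u] functorD(1)[OF u]])
  show "psnd f \<in> Hom (Src u) (pfst (Dom (under_cat b u) f)) (pfst (Cod (under_cat b u) f))"
    if "f \<in> Ar (under_cat b u)" for f
    using Ar_Hom[OF that] unfolding Hom_under by auto
  show "psnd (Cmp (under_cat b u) g f) = Cmp (Src u) (psnd g) (psnd f)"
    if "f \<in> Ar (under_cat b u)" "g \<in> Ar (under_cat b u)" "Cod (under_cat b u) f = Dom (under_cat b u) g" for f g
  proof -
    let ?x = "Dom (under_cat b u) f" and ?y = "Cod (under_cat b u) f" and ?z = "Cod (under_cat b u) g"
    have f: "f \<in> Hom (under_cat b u) ?x ?y" using Ar_Hom[OF that(1)] .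
    have g: "g \<in> Hom (under_cat b u) ?y ?z" using Ar_Hom[OF that(2)] that(3) by simp
    obtain h where h: "f = Pr (Pr ?x ?y) h" using f unfolding Hom_under by blast
    obtain l where l: "g = Pr (Pr ?y ?z) l" using g unfolding Hom_under by blast
    have "Cmp (under_cat b u) (Pr (Pr ?y ?z) l) (Pr (Pr ?x ?y) h) = Pr (Pr ?x ?z) (Cmp (Src u) l h)"
      by (rule Cmp_under) (use f g in \<open>simp_all only: h[symmetric] l[symmetric]\<close>)
    hence "Cmp (under_cat b u) g f = Pr (Pr ?x ?z) (Cmp (Src u) l h)" unfolding h[symmetric] l[symmetric] .
    moreover have "psnd f = h" "psnd g = l" by (subst h l, simp)+
    ultimately show ?thesis by simp
  qed
  show "psnd (Id (under_cat b u) x) = Id (Src u) (pfst x)" if "x \<in> Ob (under_cat b u)" for x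
    using Id_under[OF that] by simp
qed auto

lemma nt_over_cell:
  assumes u: "is_functor u" and b: "b \<in> Ob (Tgt u)"
  shows "is_nt (over_cell u b)"
  unfolding over_cell_def
proof (rule ntI)
  note C = functorD(1,2)[OF u]
  let ?F = "comp_fun u (over_proj u b)" and ?G = "comp_fun (pt_fun (Tgt u) b) (to_term (over_cat u b))"
  show "is_functor ?F" using u functor_over_proj[OF u] by (auto intro!: functor_comp_fun)
  show "is_functor ?G" using C b category_over[OF u] by (auto intro!: functor_comp_fun functor_pt functor_to_term)
  show "psnd x \<in> Hom (Tgt ?F) (FO ?F x) (FO ?G x)" if "x \<in> Ob (Src ?F)" for x
    using that by (auto simp del: Ob_over) auto
  fix f assume "f \<in> Ar (Src ?F)"
  hence f: "f \<in> Ar (over_cat u b)" by simp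
  let ?x = "Dom (over_cat u b) f" and ?y = "Cod (over_cat u b) f"
  have "psnd ?x \<in> Hom (Tgt u) (FO u (pfst ?x)) b" using Dom_Ob[OF category_over[OF u] f] by auto
  moreover have "Cmp (Tgt u) (psnd ?y) (FA u (psnd f)) = psnd ?x"
    using Ar_Hom[OF f] unfolding Hom_over by auto
  ultimately show "Cmp (Tgt ?F) (psnd (Cod (Src ?F) f)) (FA ?F f) = Cmp (Tgt ?F) (FA ?G f) (psnd (Dom (Src ?F) f))"
    using f Cmp_Id_left[OF C(2)] by simp
qed auto

lemma nt_under_cell:
  assumes u: "is_functor u" and b: "b \<in> Ob (Tgt u)"
  shows "is_nt (under_cell b u)"
  unfolding under_cell_def
proof (rule ntI)
  note C = functorD(1,2)[OF u]
  let ?F = "comp_fun u (under_proj b u)" and ?G = "comp_fun (pt_fun (Tgt u) b) (to_term (under_cat b u))"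
  show "is_functor ?F" using u functor_under_proj[OF u] by (auto intro!: functor_comp_fun)
  show "is_functor ?G" using C b category_under[OF u] by (auto intro!: functor_comp_fun functor_pt functor_to_term)
  show "psnd x \<in> Hom (Tgt ?G) (FO ?G x) (FO ?F x)" if "x \<in> Ob (Src ?G)" for x
    using that by (auto simp del: Ob_under) auto
  fix f assume "f \<in> Ar (Src ?G)"
  hence f: "f \<in> Ar (under_cat b u)" by simp
  let ?x = "Dom (under_cat b u) f" and ?y = "Cod (under_cat b u) f"
  have "psnd ?y \<in> Hom (Tgt u) b (FO u (pfst ?y))" using Cod_Ob[OF category_under[OF u] f] by auto
  moreover have "Cmp (Tgt u) (FA u (psnd f)) (psnd ?x) = psnd ?y"
    using Ar_Hom[OF f] unfolding Hom_under by auto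
  ultimately show "Cmp (Tgt ?G) (psnd (Cod (Src ?G) f)) (FA ?G f) = Cmp (Tgt ?G) (FA ?F f) (psnd (Dom (Src ?G) f))"
    using f Cmp_Id_right[OF C(2)] by simp
qed auto

section \<open>Restriction functors and Kan extensions\<close>

definition fully_faithful :: "('o, 'm, 'p, 'q) func \<Rightarrow> bool" where
  "fully_faithful u \<longleftrightarrow>
     (\<forall>a\<in>Ob (Src u). \<forall>a'\<in>Ob (Src u). \<forall>f\<in>Hom (Tgt u) (FO u a) (FO u a').
        \<exists>!g. g \<in> Hom (Src u) a a' \<and> FA u g = f)"

lemma fully_faithfulD:
  assumes u: "is_functor u" and ff: "fully_faithful u"
  shows "a \<in> Ob (Src u) \<Longrightarrow> a' \<in> Ob (Src u) \<Longrightarrow> f \<in> Hom (Tgt u) (FO u a) (FO u a') \<Longrightarrow>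
      \<exists>g. g \<in> Hom (Src u) a a' \<and> FA u g = f"
    and "g \<in> Hom (Src u) a a' \<Longrightarrow> g' \<in> Hom (Src u) a a' \<Longrightarrow> FA u g = FA u g' \<Longrightarrow> g = g'"
proof -
  have F: "\<exists>!g. g \<in> Hom (Src u) a a' \<and> FA u g = f"
    if "a \<in> Ob (Src u)" "a' \<in> Ob (Src u)" "f \<in> Hom (Tgt u) (FO u a) (FO u a')" for a a' f
    using ff that by (simp add: fully_faithful_def)
  show "a \<in> Ob (Src u) \<Longrightarrow> a' \<in> Ob (Src u) \<Longrightarrow> f \<in> Hom (Tgt u) (FO u a) (FO u a') \<Longrightarrow>
      \<exists>g. g \<in> Hom (Src u) a a' \<and> FA u g = f" using F by blast
  show "g \<in> Hom (Src u) a a' \<Longrightarrow> g' \<in> Hom (Src u) a a' \<Longrightarrow> FA u g = FA u g' \<Longrightarrow> g = g'"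
    using F[OF Hom_Ob[OF functorD(1)[OF u]] functorD(4)[OF u]] by metis
qed

locale pointed_derivator =
  fixes U :: "'a code set \<Rightarrow> bool" and D :: "('a, 'o, 'm) pder"
  assumes universe: "universe U" and derivator: "derivator U D" and pointed: "pointed D"
begin

section \<open>The prederivator as a strict 2-functor\<close>

lemma category_V0: "small_cat U A \<Longrightarrow> category (V0 D A)"
  using derivator unfolding derivator_def prederivator_def by blast

lemma small_funD: "small_fun U u \<Longrightarrow> is_functor u" "small_fun U u \<Longrightarrow> small_cat U (Src u)"
    "small_fun U u \<Longrightarrow> small_cat U (Tgt u)"
  by (simp_all add: small_fun_def)

lemma small_catD: "small_cat U A \<Longrightarrow> category A"
  by (simp add: small_cat_def)

lemma small_term: "small_cat U term_cat"
  by (rule small_poset[OF universe]) simp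

lemma small_pt: "small_cat U A \<Longrightarrow> a \<in> Ob A \<Longrightarrow> small_fun U (pt_fun A a)"
  by (auto simp: small_fun_def small_term[simplified] functor_pt small_catD)

lemma small_to_term: "small_cat U A \<Longrightarrow> small_fun U (to_term A)"
  by (auto simp: small_fun_def small_term[simplified] functor_to_term small_catD)

lemma small_id: "small_cat U A \<Longrightarrow> small_fun U (id_fun A)"
  by (auto simp: small_fun_def functor_id_fun small_catD)

lemma small_comp: "small_fun U u \<Longrightarrow> small_fun U v \<Longrightarrow> Tgt u = Src v \<Longrightarrow> small_fun U (comp_fun v u)"
  by (auto simp: small_fun_def intro: functor_comp_fun)

lemma small_prod_fun: "small_fun U u \<Longrightarrow> small_fun U v \<Longrightarrow> small_fun U (prod_fun u v)"
  by (auto simp: small_fun_def intro: functor_prod small_prod[OF universe])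

lemma small_over_proj: "small_fun U u \<Longrightarrow> small_fun U (over_proj u b)"
  using small_over[OF universe, of u b] functor_over_proj[of u b] by (auto simp: small_fun_def)

lemma small_under_proj: "small_fun U u \<Longrightarrow> small_fun U (under_proj b u)"
  using small_under[OF universe, of u b] functor_under_proj[of u b] by (auto simp: small_fun_def)

lemma V1D:
  assumes "small_fun U u"
  shows "is_functor (V1 D u)" "Src (V1 D u) = V0 D (Tgt u)" "Tgt (V1 D u) = V0 D (Src u)"
  using derivator assms unfolding derivator_def prederivator_def by blast+

lemma V1_Ob: "small_fun U u \<Longrightarrow> X \<in> Ob (V0 D (Tgt u)) \<Longrightarrow> FO (V1 D u) X \<in> Ob (V0 D (Src u))"
  using functorD(3)[OF V1D(1)] V1D(2,3) by auto

lemma V1_Hom: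
  "small_fun U u \<Longrightarrow> f \<in> Hom (V0 D (Tgt u)) X Y \<Longrightarrow>
     FA (V1 D u) f \<in> Hom (V0 D (Src u)) (FO (V1 D u) X) (FO (V1 D u) Y)"
  using functorD(4)[OF V1D(1)] V1D(2,3) by auto

lemma V1_Id:
  "small_fun U u \<Longrightarrow> X \<in> Ob (V0 D (Tgt u)) \<Longrightarrow> FA (V1 D u) (Id (V0 D (Tgt u)) X) = Id (V0 D (Src u)) (FO (V1 D u) X)"
  using functorD(5)[OF V1D(1), of u X] V1D(2,3)[of u] by auto

lemma V1_Cmp:
  "small_fun U u \<Longrightarrow> g \<in> Hom (V0 D (Tgt u)) Y Z \<Longrightarrow> f \<in> Hom (V0 D (Tgt u)) X Y \<Longrightarrow>
     FA (V1 D u) (Cmp (V0 D (Tgt u)) g f) = Cmp (V0 D (Src u)) (FA (V1 D u) g) (FA (V1 D u) f)"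
  using functorD(6)[OF V1D(1), of u g Y Z f X] V1D(2,3)[of u] by auto

lemma V1_comp_fun:
  "small_fun U u \<Longrightarrow> small_fun U v \<Longrightarrow> Tgt u = Src v \<Longrightarrow> V1 D (comp_fun v u) = comp_fun (V1 D u) (V1 D v)"
  using derivator unfolding derivator_def prederivator_def by blast

lemma V1_comp_Ob:
  "small_fun U u \<Longrightarrow> small_fun U v \<Longrightarrow> Tgt u = Src v \<Longrightarrow> X \<in> Ob (V0 D (Tgt v)) \<Longrightarrow>
     FO (V1 D (comp_fun v u)) X = FO (V1 D u) (FO (V1 D v) X)"
  by (simp add: V1_comp_fun V1D)

lemma V1_comp_Ar:
  "small_fun U u \<Longrightarrow> small_fun U v \<Longrightarrow> Tgt u = Src v \<Longrightarrow> f \<in> Ar (V0 D (Tgt v)) \<Longrightarrow>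
     FA (V1 D (comp_fun v u)) f = FA (V1 D u) (FA (V1 D v) f)"
  by (simp add: V1_comp_fun V1D)

lemma V1_id_fun: "small_cat U A \<Longrightarrow> V1 D (id_fun A) = id_fun (V0 D A)"
  using derivator unfolding derivator_def prederivator_def by blast

lemma V2D:
  assumes "small_nt U \<alpha>"
  shows "is_nt (V2 D \<alpha>)" "NSrc (V2 D \<alpha>) = V1 D (NSrc \<alpha>)" "NTgt (V2 D \<alpha>) = V1 D (NTgt \<alpha>)"
  using derivator assms unfolding derivator_def prederivator_def by blast+

lemma small_ntD:
  assumes "small_nt U \<alpha>"
  shows "is_nt \<alpha>" "small_fun U (NSrc \<alpha>)" "small_fun U (NTgt \<alpha>)"
    "Src (NTgt \<alpha>) = Src (NSrc \<alpha>)" "Tgt (NTgt \<alpha>) = Tgt (NSrc \<alpha>)"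
  using assms ntD(3,4)[of \<alpha>] by (auto simp: small_nt_def)

lemma V2_Hom:
  assumes "small_nt U \<alpha>" "X \<in> Ob (V0 D (Tgt (NSrc \<alpha>)))"
  shows "NC (V2 D \<alpha>) X \<in> Hom (V0 D (Src (NSrc \<alpha>))) (FO (V1 D (NSrc \<alpha>)) X) (FO (V1 D (NTgt \<alpha>)) X)"
  using ntD(5)[OF V2D(1)[OF assms(1)], of X] V2D(2,3)[OF assms(1)] V1D(2,3)[OF small_ntD(2)[OF assms(1)]] assms(2) by simp

lemma V2_natural:
  assumes "small_nt U \<alpha>" "f \<in> Hom (V0 D (Tgt (NSrc \<alpha>))) X Y"
  shows "Cmp (V0 D (Src (NSrc \<alpha>))) (NC (V2 D \<alpha>) Y) (FA (V1 D (NSrc \<alpha>)) f) =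
     Cmp (V0 D (Src (NSrc \<alpha>))) (FA (V1 D (NTgt \<alpha>)) f) (NC (V2 D \<alpha>) X)"
  using ntD(6)[OF V2D(1)[OF assms(1)], of f X Y] V2D(2,3)[OF assms(1)] V1D(2,3)[OF small_ntD(2)[OF assms(1)]] assms(2) by simp

lemma V2_id_nt: "small_fun U u \<Longrightarrow> V2 D (id_nt u) = id_nt (V1 D u)"
  using derivator unfolding derivator_def prederivator_def by blast

lemma V2_hcomp:
  "small_nt U \<alpha> \<Longrightarrow> small_nt U \<beta> \<Longrightarrow> Tgt (NSrc \<alpha>) = Src (NSrc \<beta>) \<Longrightarrow>
     V2 D (hcomp \<beta> \<alpha>) = hcomp (V2 D \<alpha>) (V2 D \<beta>)"
  using derivator unfolding derivator_def prederivator_def by blast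

lemma small_id_nt: "small_fun U u \<Longrightarrow> small_nt U (id_nt u)"
  by (auto simp: small_nt_def small_funD intro: nt_id_nt)

text \<open>By \<open>eq\<close> and \<open>id\<close> the whiskering of \<open>\<beta>\<close> with
  u is an identity transformation, and D is strict on horizontal composition and on identities. The
  conclusion is the component at X of the resulting equation.\<close>

lemma V2_whisker_right:
  assumes b: "small_nt U \<beta>" and u: "small_fun U u" and bu: "Tgt u = Src (NSrc \<beta>)"
    and eq: "comp_fun (NTgt \<beta>) u = comp_fun (NSrc \<beta>) u"
    and id: "\<And>x. x \<in> Ob (Src u) \<Longrightarrow> NC \<beta> (FO u x) = Id (Tgt (NSrc \<beta>)) (FO (NSrc \<beta>) (FO u x))"
    and X: "X \<in> Ob (V0 D (Tgt (NSrc \<beta>)))"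
  shows "FA (V1 D u) (NC (V2 D \<beta>) X) = Id (V0 D (Src u)) (FO (V1 D u) (FO (V1 D (NSrc \<beta>)) X))"
proof -
  note B = small_ntD[OF b]
  note Bf = small_funD(1)[OF B(2)] and uf = small_funD(1)[OF u]
  let ?w = "comp_fun (NSrc \<beta>) u"
  have w: "small_fun U ?w" using small_comp[OF u B(2) bu] .
  have "hcomp \<beta> (id_nt u) = id_nt ?w"
  proof (rule nt_eqI)
    show "is_nt (hcomp \<beta> (id_nt u))" using nt_hcomp[OF nt_id_nt[OF uf] B(1)] bu by simp
    show "is_nt (id_nt ?w)" using nt_id_nt small_funD(1)[OF w] by blast
    fix x assume "x \<in> Ob (Src (NSrc (hcomp \<beta> (id_nt u))))"
    hence x: "x \<in> Ob (Src u)" by simp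
    have ux: "FO u x \<in> Ob (Src (NSrc \<beta>))" using functorD(3)[OF uf x] bu by simp
    have I: "Id (Tgt (NSrc \<beta>)) (FO (NSrc \<beta>) (FO u x)) \<in>
        Hom (Tgt (NSrc \<beta>)) (FO (NSrc \<beta>) (FO u x)) (FO (NSrc \<beta>) (FO u x))"
      using Id_Hom[OF functorD(2)[OF Bf]] functorD(3)[OF Bf ux] by simp
    show "NC (hcomp \<beta> (id_nt u)) x = NC (id_nt ?w) x"
      using x id[OF x] functorD(5)[OF Bf ux] Cmp_Id_left[OF functorD(2)[OF Bf] I] bu by simp
  qed (use eq in simp_all)
  hence e: "hcomp (id_nt (V1 D u)) (V2 D \<beta>) = id_nt (V1 D ?w)"
    using V2_hcomp[OF small_id_nt[OF u] b] bu V2_id_nt[OF u] V2_id_nt[OF w] by simp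
  have S: "Src (V1 D (NSrc \<beta>)) = V0 D (Tgt (NSrc \<beta>))" using V1D(2)[OF B(2)] .
  have h: "NC (V2 D \<beta>) X \<in> Hom (V0 D (Tgt u)) (FO (V1 D (NSrc \<beta>)) X) (FO (V1 D (NTgt \<beta>)) X)"
    using V2_Hom[OF b X] bu by simp
  have ob: "FO (V1 D (NTgt \<beta>)) X \<in> Ob (V0 D (Tgt u))"
    using Hom_Ob(2)[OF category_V0[OF small_funD(3)[OF u]] h] .
  have "NC (hcomp (id_nt (V1 D u)) (V2 D \<beta>)) X =
      Cmp (V0 D (Src u)) (Id (V0 D (Src u)) (FO (V1 D u) (FO (V1 D (NTgt \<beta>)) X))) (FA (V1 D u) (NC (V2 D \<beta>) X))"
    using X V2D(2,3)[OF b] S V1D[OF u] ob by simp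
  also have "\<dots> = FA (V1 D u) (NC (V2 D \<beta>) X)"
    using Cmp_Id_left[OF category_V0[OF small_funD(2)[OF u]] V1_Hom[OF u h]] .
  finally show ?thesis using e X V1D[OF w] V1_comp_Ob[OF u B(2) bu X] by simp
qed

text \<open>The mirror image of \<open>V2_whisker_right\<close>: since D reverses 1-cells,
  whiskering with v on the outside becomes evaluation at objects of the form v^* X.\<close>

lemma V2_whisker_left:
  assumes a: "small_nt U \<alpha>" and v: "small_fun U v" and av: "Tgt (NSrc \<alpha>) = Src v"
    and eq: "comp_fun v (NTgt \<alpha>) = comp_fun v (NSrc \<alpha>)"
    and id: "\<And>x. x \<in> Ob (Src (NSrc \<alpha>)) \<Longrightarrow> FA v (NC \<alpha> x) = Id (Tgt v) (FO v (FO (NSrc \<alpha>) x))"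
    and X: "X \<in> Ob (V0 D (Tgt v))"
  shows "NC (V2 D \<alpha>) (FO (V1 D v) X) = Id (V0 D (Src (NSrc \<alpha>))) (FO (V1 D (NSrc \<alpha>)) (FO (V1 D v) X))"
proof -
  note A = small_ntD[OF a]
  note Af = small_funD(1)[OF A(2)] and vf = small_funD(1)[OF v]
  let ?w = "comp_fun v (NSrc \<alpha>)"
  have w: "small_fun U ?w" using small_comp[OF A(2) v av] .
  have "hcomp (id_nt v) \<alpha> = id_nt ?w"
  proof (rule nt_eqI)
    show "is_nt (hcomp (id_nt v) \<alpha>)" using nt_hcomp[OF A(1) nt_id_nt[OF vf]] av by simp
    show "is_nt (id_nt ?w)" using nt_id_nt small_funD(1)[OF w] by blast
    fix x assume "x \<in> Ob (Src (NSrc (hcomp (id_nt v) \<alpha>)))"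
    hence x: "x \<in> Ob (Src (NSrc \<alpha>))" by simp
    have h: "NC \<alpha> x \<in> Hom (Src v) (FO (NSrc \<alpha>) x) (FO (NTgt \<alpha>) x)"
      using ntD(5)[OF A(1) x] av by simp
    have y: "FO (NTgt \<alpha>) x \<in> Ob (Src v)" using Hom_Ob(2)[OF functorD(1)[OF vf] h] .
    show "NC (hcomp (id_nt v) \<alpha>) x = NC (id_nt ?w) x"
      using x y id[OF x] Cmp_Id_left[OF functorD(2)[OF vf] functorD(4)[OF vf h]] av by simp
  qed (use eq in simp_all)
  hence e: "hcomp (V2 D \<alpha>) (id_nt (V1 D v)) = id_nt (V1 D ?w)"
    using V2_hcomp[OF a small_id_nt[OF v]] av V2_id_nt[OF v] V2_id_nt[OF w] by simp
  let ?Y = "FO (V1 D v) X"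
  have Y: "?Y \<in> Ob (V0 D (Tgt (NSrc \<alpha>)))" using V1_Ob[OF v X] av by simp
  have h: "NC (V2 D \<alpha>) ?Y \<in> Hom (V0 D (Src (NSrc \<alpha>))) (FO (V1 D (NSrc \<alpha>)) ?Y) (FO (V1 D (NTgt \<alpha>)) ?Y)"
    using V2_Hom[OF a Y] .
  have "NC (hcomp (V2 D \<alpha>) (id_nt (V1 D v))) X =
      Cmp (V0 D (Src (NSrc \<alpha>))) (NC (V2 D \<alpha>) ?Y) (Id (V0 D (Src (NSrc \<alpha>))) (FO (V1 D (NSrc \<alpha>)) ?Y))"
    using X V2D(2,3)[OF a] V1D[OF v] V1D[OF A(2)] V1_Id[OF A(2) Y] av by simp
  also have "\<dots> = NC (V2 D \<alpha>) ?Y"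
    using Cmp_Id_right[OF category_V0[OF small_funD(2)[OF A(2)]] h] .
  finally show ?thesis using e X V1D[OF w] V1_comp_Ob[OF A(2) v av X] by simp
qed

text \<open>The hypotheses make r a right adjoint of l with unit \<open>\<theta>\<close> and
  identity counit. D reverses 1-cells and keeps 2-cells, so r^* is left adjoint to l^*, again with
  identity counit; the two whiskering lemmas are the triangle identities.\<close>

lemma reflection_hom_adj:
  assumes l: "small_fun U l" and r: "small_fun U r" and lr: "Tgt l = Src r" "Tgt r = Src l"
    and id: "comp_fun l r = id_fun (Src r)"
    and t: "is_nt \<theta>" "NSrc \<theta> = id_fun (Src l)" "NTgt \<theta> = comp_fun r l"
    and tl: "\<And>x. x \<in> Ob (Src l) \<Longrightarrow> FA l (NC \<theta> x) = Id (Tgt l) (FO l x)"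
    and tr: "\<And>y. y \<in> Ob (Src r) \<Longrightarrow> NC \<theta> (FO r y) = Id (Src l) (FO r y)"
  shows "hom_adj (V1 D r) (V1 D l) (\<lambda>X f. Cmp (V0 D (Src l)) (FA (V1 D l) f) (NC (V2 D \<theta>) X))"
proof -
  note lf = small_funD[OF l] and rf = small_funD[OF r]
  note CK = category_V0[OF lf(2)] and CK' = category_V0[OF rf(2)]
  have rl: "small_fun U (comp_fun r l)" using small_comp[OF l r lr(1)] .
  have t': "small_nt U \<theta>" using t small_id[OF lf(2)] rl by (simp add: small_nt_def)
  have th: "NC (V2 D \<theta>) X \<in> Hom (V0 D (Src l)) X (FO (V1 D l) (FO (V1 D r) X))" if "X \<in> Ob (V0 D (Src l))" for X
    using V2_Hom[OF t', of X] t that V1_id_fun[OF lf(2)] V1_comp_Ob[OF l r lr(1)] lr(2) by simp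
  have tn: "Cmp (V0 D (Src l)) (NC (V2 D \<theta>) Y) f = Cmp (V0 D (Src l)) (FA (V1 D l) (FA (V1 D r) f)) (NC (V2 D \<theta>) X)"
    if f: "f \<in> Hom (V0 D (Src l)) X Y" for f X Y
    using V2_natural[OF t', of f X Y] t f HomD(1)[OF f] V1_id_fun[OF lf(2)] V1_comp_Ar[OF l r lr(1)] lr(2) by simp
  have rt: "FA (V1 D r) (NC (V2 D \<theta>) X) = Id (V0 D (Src r)) (FO (V1 D r) X)" if X: "X \<in> Ob (V0 D (Src l))" for X
  proof -
    have "comp_fun (comp_fun r l) r = comp_fun r (comp_fun l r)" using comp_fun_assoc[of r l r] rf(1) lf(1) lr by simp
    also have "\<dots> = r" using id comp_fun_id_right[OF rf(1)] by simp
    finally have "comp_fun (NTgt \<theta>) r = comp_fun (NSrc \<theta>) r" using t(2,3) comp_fun_id_left[OF rf(1)] lr by simp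
    moreover have "FO r x \<in> Ob (Src l)" if "x \<in> Ob (Src r)" for x using functorD(3)[OF rf(1) that] lr by simp
    ultimately show ?thesis
      using V2_whisker_right[OF t' r] t(2) lr(2) X tr V1_id_fun[OF lf(2)] by simp
  qed
  have lt: "NC (V2 D \<theta>) (FO (V1 D l) Y) = Id (V0 D (Src l)) (FO (V1 D l) Y)" if Y: "Y \<in> Ob (V0 D (Src r))" for Y
  proof -
    have "comp_fun l (comp_fun r l) = comp_fun (comp_fun l r) l" using comp_fun_assoc[of l r l] rf(1) lf(1) lr by simp
    also have "\<dots> = l" using id comp_fun_id_left[OF lf(1)] lr by simp
    finally have "comp_fun l (NTgt \<theta>) = comp_fun l (NSrc \<theta>)" using t(2,3) comp_fun_id_right[OF lf(1)] by simp
    thus ?thesis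
      using V2_whisker_left[OF t' l, of Y] t(2) lr tl V1_id_fun[OF lf(2)] Y V1_Ob[OF l, of Y] by simp
  qed
  have rlO: "FO (V1 D r) (FO (V1 D l) Y) = Y" if "Y \<in> Ob (V0 D (Src r))" for Y
    using V1_comp_Ob[OF r l lr(2), of Y] id that lr V1_id_fun[OF rf(2)] by simp
  have rlA: "FA (V1 D r) (FA (V1 D l) f) = f" if "f \<in> Ar (V0 D (Src r))" for f
    using V1_comp_Ar[OF r l lr(2), of f] id that lr V1_id_fun[OF rf(2)] by simp
  note L = V1D[OF l] and R = V1D[OF r]
  have lH: "FA (V1 D l) f \<in> Hom (V0 D (Src l)) (FO (V1 D l) X) (FO (V1 D l) Y)" if "f \<in> Hom (V0 D (Src r)) X Y" for f X Y
    using V1_Hom[OF l] that lr by simp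
  have rH: "FA (V1 D r) f \<in> Hom (V0 D (Src r)) (FO (V1 D r) X) (FO (V1 D r) Y)" if "f \<in> Hom (V0 D (Src l)) X Y" for f X Y
    using V1_Hom[OF r] that lr by simp
  have rC: "FA (V1 D r) (Cmp (V0 D (Src l)) g f) = Cmp (V0 D (Src r)) (FA (V1 D r) g) (FA (V1 D r) f)"
    if "g \<in> Hom (V0 D (Src l)) Y Z" "f \<in> Hom (V0 D (Src l)) X Y" for f g X Y Z using V1_Cmp[OF r] that lr by simp
  have lC: "FA (V1 D l) (Cmp (V0 D (Src r)) g f) = Cmp (V0 D (Src l)) (FA (V1 D l) g) (FA (V1 D l) f)"
    if "g \<in> Hom (V0 D (Src r)) Y Z" "f \<in> Hom (V0 D (Src r)) X Y" for f g X Y Z using V1_Cmp[OF l] that lr by simp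
  show ?thesis
  proof (rule hom_adjI[where \<psi> = "\<lambda>y k. FA (V1 D r) k"], unfold R(2,3) lr(2))
    show "is_functor (V1 D r)" "is_functor (V1 D l)" "Src (V1 D l) = V0 D (Src r)" "Tgt (V1 D l) = V0 D (Src l)"
      using L R lr by auto
  next
    fix X Y f assume X: "X \<in> Ob (V0 D (Src l))" and Y: "Y \<in> Ob (V0 D (Src r))" and f: "f \<in> Hom (V0 D (Src r)) (FO (V1 D r) X) Y"
    have "FA (V1 D r) (Cmp (V0 D (Src l)) (FA (V1 D l) f) (NC (V2 D \<theta>) X)) = f"
      using rC[OF lH[OF f] th[OF X]] rlA[OF HomD(1)[OF f]] rt[OF X] Cmp_Id_right[OF CK' f] by simp
    thus "Cmp (V0 D (Src l)) (FA (V1 D l) f) (NC (V2 D \<theta>) X) \<in> Hom (V0 D (Src l)) X (FO (V1 D l) Y) \<and>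
        FA (V1 D r) (Cmp (V0 D (Src l)) (FA (V1 D l) f) (NC (V2 D \<theta>) X)) = f"
      using Cmp_Hom[OF CK lH[OF f] th[OF X]] by simp
  next
    fix X Y k assume X: "X \<in> Ob (V0 D (Src l))" and Y: "Y \<in> Ob (V0 D (Src r))" and k: "k \<in> Hom (V0 D (Src l)) X (FO (V1 D l) Y)"
    have "Cmp (V0 D (Src l)) (FA (V1 D l) (FA (V1 D r) k)) (NC (V2 D \<theta>) X) = k"
      using tn[OF k] lt[OF Y] Cmp_Id_left[OF CK k] by simp
    thus "FA (V1 D r) k \<in> Hom (V0 D (Src r)) (FO (V1 D r) X) Y \<and>
        Cmp (V0 D (Src l)) (FA (V1 D l) (FA (V1 D r) k)) (NC (V2 D \<theta>) X) = k"
      using rH[OF k] rlO[OF Y] by simp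
  next
    fix X X' Y f a assume a: "a \<in> Hom (V0 D (Src l)) X' X" and f: "f \<in> Hom (V0 D (Src r)) (FO (V1 D r) X) Y"
    have X: "X \<in> Ob (V0 D (Src l))" "X' \<in> Ob (V0 D (Src l))" using Hom_Ob[OF CK a] by auto
    show "Cmp (V0 D (Src l)) (FA (V1 D l) (Cmp (V0 D (Src r)) f (FA (V1 D r) a))) (NC (V2 D \<theta>) X') =
       Cmp (V0 D (Src l)) (Cmp (V0 D (Src l)) (FA (V1 D l) f) (NC (V2 D \<theta>) X)) a"
      using lC[OF f rH[OF a]] Cmp_assoc[OF CK lH[OF f] lH[OF rH[OF a]] th[OF X(2)]] tn[OF a]
        Cmp_assoc[OF CK lH[OF f] th[OF X(1)] a] by simp
  next
    fix X Y Y' f b assume X: "X \<in> Ob (V0 D (Src l))" and f: "f \<in> Hom (V0 D (Src r)) (FO (V1 D r) X) Y"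
      and b: "b \<in> Hom (V0 D (Src r)) Y Y'"
    show "Cmp (V0 D (Src l)) (FA (V1 D l) (Cmp (V0 D (Src r)) b f)) (NC (V2 D \<theta>) X) =
      Cmp (V0 D (Src l)) (FA (V1 D l) b) (Cmp (V0 D (Src l)) (FA (V1 D l) f) (NC (V2 D \<theta>) X))"
      using lC[OF b f] Cmp_assoc[OF CK lH[OF b] lH[OF f] th[OF X]] by simp
  qed
qed

section \<open>The chosen Kan extensions and their adjunctions\<close>

lemma lkan_adjunction:
  assumes "small_fun U u"
  shows "adjunction (lkan D u) (V1 D u) (lkan_unit D u) (lkan_counit D u)"
proof -
  have "\<exists>d. case d of (F, \<eta>, \<epsilon>) \<Rightarrow> adjunction F (V1 D u) \<eta> \<epsilon>"
    using derivator assms unfolding derivator_def der3_def by auto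
  from someI_ex[OF this] show ?thesis
    unfolding lkan_def lkan_unit_def lkan_counit_def lkan_data_def by (simp add: case_prod_unfold)
qed

lemma rkan_adjunction:
  assumes "small_fun U u"
  shows "adjunction (V1 D u) (rkan D u) (rkan_unit D u) (rkan_counit D u)"
proof -
  have "\<exists>d. case d of (G, \<eta>, \<epsilon>) \<Rightarrow> adjunction (V1 D u) G \<eta> \<epsilon>"
    using derivator assms unfolding derivator_def der3_def by auto
  from someI_ex[OF this] show ?thesis
    unfolding rkan_def rkan_unit_def rkan_counit_def rkan_data_def by (simp add: case_prod_unfold)
qed

lemma lkanD:
  assumes "small_fun U u"
  shows "is_functor (lkan D u)" "Src (lkan D u) = V0 D (Src u)" "Tgt (lkan D u) = V0 D (Tgt u)"
  using adjunctionD(1,3,4)[OF lkan_adjunction[OF assms]] V1D[OF assms] by auto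

lemma rkanD:
  assumes "small_fun U u"
  shows "is_functor (rkan D u)" "Src (rkan D u) = V0 D (Src u)" "Tgt (rkan D u) = V0 D (Tgt u)"
  using adjunctionD(2,3,4)[OF rkan_adjunction[OF assms]] V1D[OF assms] by auto

lemma lkan_Ob: "small_fun U u \<Longrightarrow> X \<in> Ob (V0 D (Src u)) \<Longrightarrow> FO (lkan D u) X \<in> Ob (V0 D (Tgt u))"
  using functorD(3)[OF lkanD(1)] lkanD(2,3) by auto

lemma lkan_Hom: "small_fun U u \<Longrightarrow> f \<in> Hom (V0 D (Src u)) X Y \<Longrightarrow>
     FA (lkan D u) f \<in> Hom (V0 D (Tgt u)) (FO (lkan D u) X) (FO (lkan D u) Y)"
  using functorD(4)[OF lkanD(1)] lkanD(2,3) by auto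

lemma lkan_Cmp:
  "small_fun U u \<Longrightarrow> g \<in> Hom (V0 D (Src u)) Y Z \<Longrightarrow> f \<in> Hom (V0 D (Src u)) X Y \<Longrightarrow>
     FA (lkan D u) (Cmp (V0 D (Src u)) g f) = Cmp (V0 D (Tgt u)) (FA (lkan D u) g) (FA (lkan D u) f)"
  using functorD(6)[OF lkanD(1), of u g Y Z f X] lkanD(2,3)[of u] by auto

lemma rkan_Ob: "small_fun U u \<Longrightarrow> X \<in> Ob (V0 D (Src u)) \<Longrightarrow> FO (rkan D u) X \<in> Ob (V0 D (Tgt u))"
  using functorD(3)[OF rkanD(1)] rkanD(2,3) by auto

lemma rkan_Hom: "small_fun U u \<Longrightarrow> f \<in> Hom (V0 D (Src u)) X Y \<Longrightarrow>
     FA (rkan D u) f \<in> Hom (V0 D (Tgt u)) (FO (rkan D u) X) (FO (rkan D u) Y)"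
  using functorD(4)[OF rkanD(1)] rkanD(2,3) by auto

lemma rkan_Cmp:
  "small_fun U u \<Longrightarrow> g \<in> Hom (V0 D (Src u)) Y Z \<Longrightarrow> f \<in> Hom (V0 D (Src u)) X Y \<Longrightarrow>
     FA (rkan D u) (Cmp (V0 D (Src u)) g f) = Cmp (V0 D (Tgt u)) (FA (rkan D u) g) (FA (rkan D u) f)"
  using functorD(6)[OF rkanD(1), of u g Y Z f X] rkanD(2,3)[of u] by auto

lemma lkan_unit:
  assumes "small_fun U u"
  shows "X \<in> Ob (V0 D (Src u)) \<Longrightarrow> NC (lkan_unit D u) X \<in> Hom (V0 D (Src u)) X (FO (V1 D u) (FO (lkan D u) X))"
    "f \<in> Hom (V0 D (Src u)) X Y \<Longrightarrow> Cmp (V0 D (Src u)) (NC (lkan_unit D u) Y) f =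
        Cmp (V0 D (Src u)) (FA (V1 D u) (FA (lkan D u) f)) (NC (lkan_unit D u) X)"
    "Y \<in> Ob (V0 D (Tgt u)) \<Longrightarrow> NC (lkan_counit D u) Y \<in> Hom (V0 D (Tgt u)) (FO (lkan D u) (FO (V1 D u) Y)) Y"
    "g \<in> Hom (V0 D (Tgt u)) Y Y' \<Longrightarrow> Cmp (V0 D (Tgt u)) (NC (lkan_counit D u) Y') (FA (lkan D u) (FA (V1 D u) g)) =
       Cmp (V0 D (Tgt u)) g (NC (lkan_counit D u) Y)"
    "Y \<in> Ob (V0 D (Tgt u)) \<Longrightarrow>
      Cmp (V0 D (Src u)) (FA (V1 D u) (NC (lkan_counit D u) Y)) (NC (lkan_unit D u) (FO (V1 D u) Y)) =
        Id (V0 D (Src u)) (FO (V1 D u) Y)"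
  using adjunctionD(5-10)[OF lkan_adjunction[OF assms]] lkanD(2,3)[OF assms] by simp_all

lemma rkan_unit:
  assumes "small_fun U u"
  shows "Y \<in> Ob (V0 D (Tgt u)) \<Longrightarrow> NC (rkan_unit D u) Y \<in> Hom (V0 D (Tgt u)) Y (FO (rkan D u) (FO (V1 D u) Y))"
    "f \<in> Hom (V0 D (Tgt u)) Y Y' \<Longrightarrow> Cmp (V0 D (Tgt u)) (NC (rkan_unit D u) Y') f =
        Cmp (V0 D (Tgt u)) (FA (rkan D u) (FA (V1 D u) f)) (NC (rkan_unit D u) Y)"
    "X \<in> Ob (V0 D (Src u)) \<Longrightarrow> NC (rkan_counit D u) X \<in> Hom (V0 D (Src u)) (FO (V1 D u) (FO (rkan D u) X)) X"
    "g \<in> Hom (V0 D (Src u)) X X' \<Longrightarrow> Cmp (V0 D (Src u)) (NC (rkan_counit D u) X') (FA (V1 D u) (FA (rkan D u) g)) =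
       Cmp (V0 D (Src u)) g (NC (rkan_counit D u) X)"
    "Y \<in> Ob (V0 D (Tgt u)) \<Longrightarrow>
      Cmp (V0 D (Src u)) (NC (rkan_counit D u) (FO (V1 D u) Y)) (FA (V1 D u) (NC (rkan_unit D u) Y)) =
        Id (V0 D (Src u)) (FO (V1 D u) Y)"
  using adjunctionD(5-10)[OF rkan_adjunction[OF assms]] V1D(2,3)[OF assms] by simp_all

lemma lkan_hom_adj:
  "small_fun U u \<Longrightarrow> hom_adj (lkan D u) (V1 D u) (\<lambda>X f. Cmp (V0 D (Src u)) (FA (V1 D u) f) (NC (lkan_unit D u) X))"
  using adjunction_hom_adj[OF lkan_adjunction] lkanD(2) by simp

lemma rkan_hom_adj:
  "small_fun U u \<Longrightarrow> hom_adj (V1 D u) (rkan D u) (\<lambda>Y f. Cmp (V0 D (Tgt u)) (FA (rkan D u) f) (NC (rkan_unit D u) Y))"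
  using adjunction_hom_adj[OF rkan_adjunction] V1D(2) by simp

lemma local_at_lkan:
  "small_fun U u \<Longrightarrow> h \<in> Hom (V0 D (Src u)) X Y \<Longrightarrow> Z \<in> Ob (V0 D (Tgt u)) \<Longrightarrow>
     local_at (V0 D (Tgt u)) (FA (lkan D u) h) Z \<longleftrightarrow> local_at (V0 D (Src u)) h (FO (V1 D u) Z)"
  using local_at_hom_adj[OF lkan_hom_adj, of u h X Y Z] lkanD(2,3)[of u] by simp

lemma local_at_rkan:
  "small_fun U u \<Longrightarrow> h \<in> Hom (V0 D (Tgt u)) X Y \<Longrightarrow> Z \<in> Ob (V0 D (Src u)) \<Longrightarrow>
     local_at (V0 D (Src u)) (FA (V1 D u) h) Z \<longleftrightarrow> local_at (V0 D (Tgt u)) h (FO (rkan D u) Z)"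
  using local_at_hom_adj[OF rkan_hom_adj, of u h X Y Z] V1D(2,3)[of u] by simp

lemma local_at_reflection:
  assumes l: "small_fun U l" and r: "small_fun U r" and lr: "Tgt l = Src r" "Tgt r = Src l"
    and "comp_fun l r = id_fun (Src r)"
    and "is_nt \<theta>" "NSrc \<theta> = id_fun (Src l)" "NTgt \<theta> = comp_fun r l"
    and "\<And>x. x \<in> Ob (Src l) \<Longrightarrow> FA l (NC \<theta> x) = Id (Tgt l) (FO l x)"
    and "\<And>y. y \<in> Ob (Src r) \<Longrightarrow> NC \<theta> (FO r y) = Id (Src l) (FO r y)"
    and h: "h \<in> Hom (V0 D (Src l)) X Y" and Z: "Z \<in> Ob (V0 D (Src r))"
  shows "local_at (V0 D (Src r)) (FA (V1 D r) h) Z \<longleftrightarrow> local_at (V0 D (Src l)) h (FO (V1 D l) Z)"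
  using local_at_hom_adj[OF reflection_hom_adj[OF assms(1-10)], of h X Y Z] V1D(2,3)[OF r] lr h Z by simp

section \<open>Isomorphisms and zero objects, tested at single objects of the index category\<close>

definition iso_at :: "'a scat \<Rightarrow> 'm \<Rightarrow> 'a code \<Rightarrow> bool" where
  "iso_at A f a \<longleftrightarrow> invertible (V0 D term_cat) (FA (V1 D (pt_fun A a)) f)"

definition zero_at :: "'a scat \<Rightarrow> 'o \<Rightarrow> 'a code \<Rightarrow> bool" where
  "zero_at A X a \<longleftrightarrow> zero_object (V0 D term_cat) (FO (V1 D (pt_fun A a)) X)"

lemma invertible_iff:
  assumes A: "small_cat U A" and f: "f \<in> Hom (V0 D A) X Y"
  shows "invertible (V0 D A) f \<longleftrightarrow> (\<forall>a\<in>Ob A. iso_at A f a)"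
proof -
  have "der2 U D" using derivator by (simp add: derivator_def)
  thus ?thesis using A HomD(1)[OF f] unfolding der2_def iso_at_def by simp
qed

lemma iso_at_V1:
  assumes u: "small_fun U u" and f: "f \<in> Hom (V0 D (Tgt u)) X Y" and a: "a \<in> Ob (Src u)"
  shows "iso_at (Src u) (FA (V1 D u) f) a \<longleftrightarrow> iso_at (Tgt u) f (FO u a)"
  using V1_comp_Ar[OF small_pt[OF small_funD(2)[OF u] a] u _ HomD(1)[OF f]] comp_pt[OF small_funD(1)[OF u] a]
  unfolding iso_at_def by simp

lemma zero_at_V1:
  assumes u: "small_fun U u" and X: "X \<in> Ob (V0 D (Tgt u))" and a: "a \<in> Ob (Src u)"
  shows "zero_at (Src u) (FO (V1 D u) X) a \<longleftrightarrow> zero_at (Tgt u) X (FO u a)"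
  using V1_comp_Ob[OF small_pt[OF small_funD(2)[OF u] a] u _ X] comp_pt[OF small_funD(1)[OF u] a]
  unfolding zero_at_def by simp

text \<open>By Der3, u^* has adjoints on both sides; the unique arrows from and to u^* z are
  transposes along u_* and u_! of those of z. \<open>hom_adj_zero_left\<close> does not apply here,
  since it presupposes a zero object in the target, and \<open>ex_zero\<close> derives that from
  this lemma.\<close>

lemma V1_zero:
  assumes u: "small_fun U u" and z: "zero_object (V0 D (Tgt u)) z"
  shows "zero_object (V0 D (Src u)) (FO (V1 D u) z)"
proof -
  note L = hom_adjD[OF lkan_hom_adj[OF u], unfolded lkanD(2,3)[OF u]]
  note R = hom_adjD[OF rkan_hom_adj[OF u], unfolded V1D(2,3)[OF u]]
  note zo = zero_objectD(1)[OF z]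
  have "\<exists>!f. f \<in> Hom (V0 D (Src u)) (FO (V1 D u) z) x" if x: "x \<in> Ob (V0 D (Src u))" for x
  proof -
    have rx: "FO (rkan D u) x \<in> Ob (V0 D (Tgt u))" using rkan_Ob[OF u x] .
    obtain f0 where "f0 \<in> Hom (V0 D (Tgt u)) z (FO (rkan D u) x)" using zero_objectD(2)[OF z rx] by auto
    then obtain f where "f \<in> Hom (V0 D (Src u)) (FO (V1 D u) z) x" using R(6)[OF zo x] by blast
    moreover have "f = g" if "f \<in> Hom (V0 D (Src u)) (FO (V1 D u) z) x" "g \<in> Hom (V0 D (Src u)) (FO (V1 D u) z) x" for f g
      using R(7)[OF zo that] zero_objectD(4)[OF z rx R(5)[OF zo that(1)] R(5)[OF zo that(2)]] by simp
    ultimately show ?thesis by auto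
  qed
  moreover have "\<exists>!f. f \<in> Hom (V0 D (Src u)) x (FO (V1 D u) z)" if x: "x \<in> Ob (V0 D (Src u))" for x
  proof -
    have lx: "FO (lkan D u) x \<in> Ob (V0 D (Tgt u))" using lkan_Ob[OF u x] .
    obtain f0 where f0: "f0 \<in> Hom (V0 D (Tgt u)) (FO (lkan D u) x) z" using zero_objectD(3)[OF z lx] by auto
    have "\<exists>f. f \<in> Hom (V0 D (Src u)) x (FO (V1 D u) z)" using L(5)[OF x f0] by blast
    moreover have "f = g" if fg: "f \<in> Hom (V0 D (Src u)) x (FO (V1 D u) z)" "g \<in> Hom (V0 D (Src u)) x (FO (V1 D u) z)" for f g
      using L(6)[OF x zo fg(1)] L(6)[OF x zo fg(2)] zero_objectD(5)[OF z lx] by blast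
    ultimately show ?thesis by auto
  qed
  ultimately show ?thesis unfolding zero_object_def using V1_Ob[OF u zo] by blast
qed

lemma ex_zero: "small_cat U A \<Longrightarrow> \<exists>z. zero_object (V0 D A) z"
  using pointed V1_zero[OF small_to_term] unfolding pointed_def by fastforce

lemma lkan_zero: "small_fun U u \<Longrightarrow> zero_object (V0 D (Src u)) z \<Longrightarrow> zero_object (V0 D (Tgt u)) (FO (lkan D u) z)"
  using hom_adj_zero_left[OF lkan_hom_adj] ex_zero[OF small_funD(3)] lkanD(2,3) by fastforce

lemma rkan_zero: "small_fun U u \<Longrightarrow> zero_object (V0 D (Src u)) z \<Longrightarrow> zero_object (V0 D (Tgt u)) (FO (rkan D u) z)"
  using hom_adj_zero_right[OF rkan_hom_adj] ex_zero[OF small_funD(3)] V1D(2,3) by fastforce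

lemma zero_object_zero_at: "small_cat U A \<Longrightarrow> zero_object (V0 D A) z \<Longrightarrow> a \<in> Ob A \<Longrightarrow> zero_at A z a"
  unfolding zero_at_def using V1_zero[OF small_pt] by simp

lemma iso_at_zero:
  assumes A: "small_cat U A" and a: "a \<in> Ob A" and f: "f \<in> Hom (V0 D A) X Y" and "zero_at A X a" "zero_at A Y a"
  shows "iso_at A f a"
  using zero_object_arrow_invertible[OF category_V0[OF small_term]] V1_Hom[OF small_pt[OF A a], of f X Y] assms
  unfolding iso_at_def zero_at_def by simp

lemma zero_at_iso:
  assumes A: "small_cat U A" and a: "a \<in> Ob A" and f: "f \<in> Hom (V0 D A) X Y" and "iso_at A f a"
  shows "zero_at A X a \<longleftrightarrow> zero_at A Y a"
  using zero_object_isomorphic[OF category_V0[OF small_term]] V1_Hom[OF small_pt[OF A a], of f X Y] assms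
  unfolding iso_at_def zero_at_def by simp

lemma iso_at_square:
  assumes A: "small_cat U A" and a: "a \<in> Ob A" and h: "h \<in> Hom (V0 D A) X Y" and h': "h' \<in> Hom (V0 D A) X' Y'"
    and k: "k \<in> Hom (V0 D A) X' X" and k': "k' \<in> Hom (V0 D A) Y' Y" and ik: "iso_at A k a" and ik': "iso_at A k' a"
    and sq: "Cmp (V0 D A) k' h' = Cmp (V0 D A) h k"
  shows "iso_at A h a \<longleftrightarrow> iso_at A h' a"
proof -
  note p = small_pt[OF A a]
  have e: "Cmp (V0 D term_cat) (FA (V1 D (pt_fun A a)) k') (FA (V1 D (pt_fun A a)) h') =
    Cmp (V0 D term_cat) (FA (V1 D (pt_fun A a)) h) (FA (V1 D (pt_fun A a)) k)"
    using V1_Cmp[OF p, of k' Y' Y h' X'] V1_Cmp[OF p, of h X Y k X'] h h' k k' sq by simp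
  show ?thesis unfolding iso_at_def
    by (rule invertible_square[OF category_V0[OF small_term] _ _ _ _ _ _ e])
      (use V1_Hom[OF p, of h X Y] V1_Hom[OF p, of h' X' Y'] V1_Hom[OF p, of k X' X] V1_Hom[OF p, of k' Y' Y] assms
        in \<open>auto simp: iso_at_def\<close>)
qed

text \<open>X is compared with a zero object of the same category. An arrow between objects that
  both vanish at a is invertible at a, and Der2 assembles these local statements.\<close>

lemma zero_object_iff:
  assumes A: "small_cat U A" and X: "X \<in> Ob (V0 D A)"
  shows "zero_object (V0 D A) X \<longleftrightarrow> (\<forall>a\<in>Ob A. zero_at A X a)"
proof
  assume z: "\<forall>a\<in>Ob A. zero_at A X a"
  obtain z where z0: "zero_object (V0 D A) z" using ex_zero[OF A] by auto
  obtain f where f: "f \<in> Hom (V0 D A) z X" using zero_objectD(2)[OF z0 X] by auto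
  have "invertible (V0 D A) f"
    using invertible_iff[OF A f] iso_at_zero[OF A _ f] zero_object_zero_at[OF A z0] z by blast
  thus "zero_object (V0 D A) X" using zero_object_invertible[OF category_V0[OF A] z0 f] by simp
qed (use zero_object_zero_at[OF A] in auto)

end

section \<open>Pointwise Kan extensions\<close>

context pointed_derivator
begin

section \<open>The pointwise formula for left Kan extensions\<close>

lemma lkan_transpose:
  assumes q: "small_fun U q" and w: "w \<in> Hom (V0 D (Src q)) P (FO (V1 D q) Z)" and Z: "Z \<in> Ob (V0 D (Tgt q))"
  defines "T \<equiv> Cmp (V0 D (Tgt q)) (NC (lkan_counit D q) Z) (FA (lkan D q) w)"
  shows "T \<in> Hom (V0 D (Tgt q)) (FO (lkan D q) P) Z"
    and "Cmp (V0 D (Src q)) (FA (V1 D q) T) (NC (lkan_unit D q) P) = w"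
proof -
  note S = category_V0[OF small_funD(2)[OF q]] and C = category_V0[OF small_funD(3)[OF q]]
  note e = lkan_unit[OF q]
  have P: "P \<in> Ob (V0 D (Src q))" using Hom_Ob(1)[OF S w] .
  have qZ: "FO (V1 D q) Z \<in> Ob (V0 D (Src q))" using V1_Ob[OF q Z] .
  show "T \<in> Hom (V0 D (Tgt q)) (FO (lkan D q) P) Z"
    unfolding T_def using Cmp_Hom[OF C e(3)[OF Z] lkan_Hom[OF q w]] .
  show "Cmp (V0 D (Src q)) (FA (V1 D q) T) (NC (lkan_unit D q) P) = w"
    unfolding T_def V1_Cmp[OF q e(3)[OF Z] lkan_Hom[OF q w]]
    using Cmp_assoc[OF S V1_Hom[OF q e(3)[OF Z]] V1_Hom[OF q lkan_Hom[OF q w]] e(1)[OF P]] e(2)[OF w]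
      Cmp_assoc[OF S V1_Hom[OF q e(3)[OF Z]] e(1)[OF qZ] w] e(5)[OF Z] Cmp_Id_left[OF S w] by simp
qed

lemma small_over_cell: "small_fun U u \<Longrightarrow> b \<in> Ob (Tgt u) \<Longrightarrow> small_nt U (over_cell u b)"
  unfolding small_nt_def
  using nt_over_cell[OF small_funD(1)] small_comp[OF small_over_proj, of u u b] small_over[OF universe]
    small_comp[OF small_to_term small_pt, of "over_cat u b" "Tgt u" b] small_funD
  by (simp add: over_cell_def)

lemma small_under_cell: "small_fun U u \<Longrightarrow> b \<in> Ob (Tgt u) \<Longrightarrow> small_nt U (under_cell b u)"
  unfolding small_nt_def
  using nt_under_cell[OF small_funD(1)] small_comp[OF small_under_proj, of u u b] small_under[OF universe]
    small_comp[OF small_to_term small_pt, of "under_cat b u" "Tgt u" b] small_funD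
  by (simp add: under_cell_def)

text \<open>The transpose of the component of the mate that \<open>Der4\<close> requires to be invertible.\<close>

definition over_arrow :: "'a sfun \<Rightarrow> 'a code \<Rightarrow> 'o \<Rightarrow> 'm" where
  "over_arrow u b X =
     Cmp (V0 D (over_cat u b)) (NC (V2 D (over_cell u b)) (FO (lkan D u) X))
       (FA (V1 D (over_proj u b)) (NC (lkan_unit D u) X))"

lemma over_arrow_Hom:
  assumes u: "small_fun U u" and b: "b \<in> Ob (Tgt u)" and X: "X \<in> Ob (V0 D (Src u))"
  shows "FA (V1 D (over_proj u b)) (NC (lkan_unit D u) X) \<in> Hom (V0 D (over_cat u b)) (FO (V1 D (over_proj u b)) X)
      (FO (V1 D (over_proj u b)) (FO (V1 D u) (FO (lkan D u) X)))"
    and "NC (V2 D (over_cell u b)) (FO (lkan D u) X) \<in> Hom (V0 D (over_cat u b))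
      (FO (V1 D (over_proj u b)) (FO (V1 D u) (FO (lkan D u) X)))
      (FO (V1 D (to_term (over_cat u b))) (FO (V1 D (pt_fun (Tgt u) b)) (FO (lkan D u) X)))"
    and "over_arrow u b X \<in> Hom (V0 D (over_cat u b)) (FO (V1 D (over_proj u b)) X)
      (FO (V1 D (to_term (over_cat u b))) (FO (V1 D (pt_fun (Tgt u) b)) (FO (lkan D u) X)))"
proof -
  note p = small_over_proj[OF u, of b] and K = small_over[OF universe u, of b]
  note q = small_to_term[OF K] and v = small_pt[OF small_funD(3)[OF u] b]
  note LX = lkan_Ob[OF u X]
  show 1: "FA (V1 D (over_proj u b)) (NC (lkan_unit D u) X) \<in> Hom (V0 D (over_cat u b)) (FO (V1 D (over_proj u b)) X)
      (FO (V1 D (over_proj u b)) (FO (V1 D u) (FO (lkan D u) X)))"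
    using V1_Hom[OF p] lkan_unit(1)[OF u X] by simp
  show 2: "NC (V2 D (over_cell u b)) (FO (lkan D u) X) \<in> Hom (V0 D (over_cat u b))
      (FO (V1 D (over_proj u b)) (FO (V1 D u) (FO (lkan D u) X)))
      (FO (V1 D (to_term (over_cat u b))) (FO (V1 D (pt_fun (Tgt u) b)) (FO (lkan D u) X)))"
    using V2_Hom[OF small_over_cell[OF u b], of "FO (lkan D u) X"] LX
      V1_comp_Ob[OF p u _ LX] V1_comp_Ob[OF q v _ ] by (simp add: over_cell_def)
  show "over_arrow u b X \<in> Hom (V0 D (over_cat u b)) (FO (V1 D (over_proj u b)) X)
      (FO (V1 D (to_term (over_cat u b))) (FO (V1 D (pt_fun (Tgt u) b)) (FO (lkan D u) X)))"
    unfolding over_arrow_def using Cmp_Hom[OF category_V0[OF K] 2 1] .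
qed

lemma over_arrow_natural:
  assumes u: "small_fun U u" and b: "b \<in> Ob (Tgt u)" and g: "g \<in> Hom (V0 D (Src u)) X Y"
  shows "Cmp (V0 D (over_cat u b)) (over_arrow u b Y) (FA (V1 D (over_proj u b)) g) =
    Cmp (V0 D (over_cat u b)) (FA (V1 D (to_term (over_cat u b))) (FA (V1 D (pt_fun (Tgt u) b)) (FA (lkan D u) g)))
      (over_arrow u b X)"
proof -
  note p = small_over_proj[OF u, of b] and K = small_over[OF universe u, of b]
  note q = small_to_term[OF K] and v = small_pt[OF small_funD(3)[OF u] b]
  note C = category_V0[OF K] and CA = category_V0[OF small_funD(2)[OF u]]
  have X: "X \<in> Ob (V0 D (Src u))" and Y: "Y \<in> Ob (V0 D (Src u))" using Hom_Ob[OF CA g] by auto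
  let ?p = "V1 D (over_proj u b)" and ?q = "V1 D (to_term (over_cat u b))" and ?v = "V1 D (pt_fun (Tgt u) b)"
    and ?a = "\<lambda>X. NC (V2 D (over_cell u b)) (FO (lkan D u) X)" and ?e = "NC (lkan_unit D u)"
  note Lg = lkan_Hom[OF u g]
  have pg: "FA ?p g \<in> Hom (V0 D (over_cat u b)) (FO ?p X) (FO ?p Y)" using V1_Hom[OF p] g by simp
  have puLg: "FA ?p (FA (V1 D u) (FA (lkan D u) g)) \<in> Hom (V0 D (over_cat u b))
      (FO ?p (FO (V1 D u) (FO (lkan D u) X))) (FO ?p (FO (V1 D u) (FO (lkan D u) Y)))"
    using V1_Hom[OF p] V1_Hom[OF u Lg] by simp
  have qvLg: "FA ?q (FA ?v (FA (lkan D u) g)) \<in> Hom (V0 D (over_cat u b))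
      (FO ?q (FO ?v (FO (lkan D u) X))) (FO ?q (FO ?v (FO (lkan D u) Y)))"
    using V1_Hom[OF q] V1_Hom[OF v] Lg by simp
  have nat: "Cmp (V0 D (over_cat u b)) (?a Y) (FA ?p (FA (V1 D u) (FA (lkan D u) g))) =
      Cmp (V0 D (over_cat u b)) (FA ?q (FA ?v (FA (lkan D u) g))) (?a X)"
    using V2_natural[OF small_over_cell[OF u b], of "FA (lkan D u) g" "FO (lkan D u) X" "FO (lkan D u) Y"]
      Lg V1_comp_Ar[OF p u _ HomD(1)[OF Lg]] V1_comp_Ar[OF q v] HomD(1)[OF Lg] by (simp add: over_cell_def)
  have "Cmp (V0 D (over_cat u b)) (FA ?p (?e Y)) (FA ?p g) = FA ?p (Cmp (V0 D (Src u)) (?e Y) g)"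
    using V1_Cmp[OF p, of "?e Y" Y _ g X] lkan_unit(1)[OF u Y] g by simp
  also have "\<dots> = Cmp (V0 D (over_cat u b)) (FA ?p (FA (V1 D u) (FA (lkan D u) g))) (FA ?p (?e X))"
    unfolding lkan_unit(2)[OF u g]
    using V1_Cmp[OF p, of "FA (V1 D u) (FA (lkan D u) g)" _ _ "?e X" X] lkan_unit(1)[OF u X] V1_Hom[OF u Lg] by simp
  finally have e: "Cmp (V0 D (over_cat u b)) (FA ?p (?e Y)) (FA ?p g) =
      Cmp (V0 D (over_cat u b)) (FA ?p (FA (V1 D u) (FA (lkan D u) g))) (FA ?p (?e X))" .
  note HX = over_arrow_Hom[OF u b X] and HY = over_arrow_Hom[OF u b Y]
  show ?thesis
    unfolding over_arrow_def
    unfolding Cmp_assoc[OF C HY(2) HY(1) pg] e Cmp_assoc[OF C HY(2) puLg HX(1), symmetric] nat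
    using Cmp_assoc[OF C qvLg HX(2) HX(1)] .
qed

text \<open>The component at X of the mate that Der4 makes invertible, arranged so that its
  transpose \<open>over_arrow\<close> is visible.\<close>

definition over_mate :: "'a sfun \<Rightarrow> 'a code \<Rightarrow> 'o \<Rightarrow> 'm" where
  "over_mate u b X =
     Cmp (V0 D term_cat) (NC (lkan_counit D (to_term (over_cat u b))) (FO (V1 D (pt_fun (Tgt u) b)) (FO (lkan D u) X)))
       (FA (lkan D (to_term (over_cat u b))) (over_arrow u b X))"

lemma over_mate:
  assumes u: "small_fun U u" and b: "b \<in> Ob (Tgt u)" and X: "X \<in> Ob (V0 D (Src u))"
  shows "over_mate u b X \<in> Hom (V0 D term_cat) (FO (lkan D (to_term (over_cat u b))) (FO (V1 D (over_proj u b)) X))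
      (FO (V1 D (pt_fun (Tgt u) b)) (FO (lkan D u) X))"
    "Cmp (V0 D (over_cat u b)) (FA (V1 D (to_term (over_cat u b))) (over_mate u b X))
       (NC (lkan_unit D (to_term (over_cat u b))) (FO (V1 D (over_proj u b)) X)) = over_arrow u b X"
    "invertible (V0 D term_cat) (over_mate u b X)"
proof -
  note p = small_over_proj[OF u, of b] and K = small_over[OF universe u, of b]
  note q = small_to_term[OF K] and v = small_pt[OF small_funD(3)[OF u] b]
  have Z: "FO (V1 D (pt_fun (Tgt u) b)) (FO (lkan D u) X) \<in> Ob (V0 D term_cat)"
    using V1_Ob[OF v] lkan_Ob[OF u X] by simp
  show "over_mate u b X \<in> Hom (V0 D term_cat) (FO (lkan D (to_term (over_cat u b))) (FO (V1 D (over_proj u b)) X))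
      (FO (V1 D (pt_fun (Tgt u) b)) (FO (lkan D u) X))"
    "Cmp (V0 D (over_cat u b)) (FA (V1 D (to_term (over_cat u b))) (over_mate u b X))
       (NC (lkan_unit D (to_term (over_cat u b))) (FO (V1 D (over_proj u b)) X)) = over_arrow u b X"
    using lkan_transpose[OF q, of "over_arrow u b X"] over_arrow_Hom(3)[OF u b X] Z
    unfolding over_mate_def by simp_all
  have "der4 U D" using derivator by (simp add: derivator_def)
  hence "invertible (V0 D term_cat)
          (NC (lkan_mate D u (over_proj u b) (pt_fun (Tgt u) b) (to_term (over_cat u b)) (over_cell u b)) X)"
    using u b X unfolding der4_def by blast
  thus "invertible (V0 D term_cat) (over_mate u b X)"
    using X V1D(2)[OF p] by (simp add: lkan_mate_def over_mate_def over_arrow_def)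
qed

text \<open>\<open>over_mate\<close> is natural in X and invertible by Der4, so the value of u_! g
  at b is conjugate to the colimit of the restriction of g to the comma category.\<close>

lemma lkan_iso_at_iff:
  assumes u: "small_fun U u" and b: "b \<in> Ob (Tgt u)" and g: "g \<in> Hom (V0 D (Src u)) X Y"
  shows "iso_at (Tgt u) (FA (lkan D u) g) b \<longleftrightarrow>
    invertible (V0 D term_cat) (FA (lkan D (to_term (over_cat u b))) (FA (V1 D (over_proj u b)) g))"
proof -
  note p = small_over_proj[OF u, of b] and K = small_over[OF universe u, of b]
  note q = small_to_term[OF K] and v = small_pt[OF small_funD(3)[OF u] b]
  note CA = category_V0[OF small_funD(2)[OF u]] and C1 = category_V0[OF small_term]
  have X: "X \<in> Ob (V0 D (Src u))" and Y: "Y \<in> Ob (V0 D (Src u))" using Hom_Ob[OF CA g] by auto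
  let ?p = "V1 D (over_proj u b)" and ?q = "lkan D (to_term (over_cat u b))" and ?v = "V1 D (pt_fun (Tgt u) b)"
  let ?Z = "\<lambda>X. FO ?v (FO (lkan D u) X)" and ?c = "NC (lkan_counit D (to_term (over_cat u b)))"
  have Z: "?Z X \<in> Ob (V0 D term_cat)" "?Z Y \<in> Ob (V0 D term_cat)"
    using V1_Ob[OF v] lkan_Ob[OF u X] lkan_Ob[OF u Y] by auto
  have vg: "FA ?v (FA (lkan D u) g) \<in> Hom (V0 D term_cat) (?Z X) (?Z Y)" using V1_Hom[OF v] lkan_Hom[OF u g] by simp
  have pg: "FA ?p g \<in> Hom (V0 D (over_cat u b)) (FO ?p X) (FO ?p Y)" using V1_Hom[OF p] g by simp
  have qpg: "FA ?q (FA ?p g) \<in> Hom (V0 D term_cat) (FO ?q (FO ?p X)) (FO ?q (FO ?p Y))" using lkan_Hom[OF q] pg by simp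
  note wX = over_arrow_Hom(3)[OF u b X] and wY = over_arrow_Hom(3)[OF u b Y]
  have qw: "FA ?q (over_arrow u b X) \<in> Hom (V0 D term_cat) (FO ?q (FO ?p X)) (FO ?q (FO (V1 D (to_term (over_cat u b))) (?Z X)))"
    "FA ?q (over_arrow u b Y) \<in> Hom (V0 D term_cat) (FO ?q (FO ?p Y)) (FO ?q (FO (V1 D (to_term (over_cat u b))) (?Z Y)))"
    using lkan_Hom[OF q] wX wY by auto
  have qqvg: "FA (V1 D (to_term (over_cat u b))) (FA ?v (FA (lkan D u) g)) \<in> Hom (V0 D (over_cat u b))
     (FO (V1 D (to_term (over_cat u b))) (?Z X)) (FO (V1 D (to_term (over_cat u b))) (?Z Y))"
    using V1_Hom[OF q] vg by simp
  have qqqvg: "FA ?q (FA (V1 D (to_term (over_cat u b))) (FA ?v (FA (lkan D u) g))) \<in> Hom (V0 D term_cat)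
     (FO ?q (FO (V1 D (to_term (over_cat u b))) (?Z X))) (FO ?q (FO (V1 D (to_term (over_cat u b))) (?Z Y)))"
    using lkan_Hom[OF q] qqvg by simp
  have c: "?c (?Z X) \<in> Hom (V0 D term_cat) (FO ?q (FO (V1 D (to_term (over_cat u b))) (?Z X))) (?Z X)"
    "?c (?Z Y) \<in> Hom (V0 D term_cat) (FO ?q (FO (V1 D (to_term (over_cat u b))) (?Z Y))) (?Z Y)"
    using lkan_unit(3)[OF q] Z by auto
  have e1: "Cmp (V0 D term_cat) (FA ?q (over_arrow u b Y)) (FA ?q (FA ?p g)) = Cmp (V0 D term_cat)
      (FA ?q (FA (V1 D (to_term (over_cat u b))) (FA ?v (FA (lkan D u) g)))) (FA ?q (over_arrow u b X))"
    using lkan_Cmp[OF q, of "over_arrow u b Y" _ _ "FA ?p g"] wY pg over_arrow_natural[OF u b g]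
      lkan_Cmp[OF q, of _ _ _ "over_arrow u b X"] wX qqvg by simp
  have e2: "Cmp (V0 D term_cat) (?c (?Z Y)) (FA ?q (FA (V1 D (to_term (over_cat u b))) (FA ?v (FA (lkan D u) g)))) =
      Cmp (V0 D term_cat) (FA ?v (FA (lkan D u) g)) (?c (?Z X))"
    using lkan_unit(4)[OF q] vg by simp
  have "Cmp (V0 D term_cat) (over_mate u b Y) (FA ?q (FA ?p g)) =
      Cmp (V0 D term_cat) (FA ?v (FA (lkan D u) g)) (over_mate u b X)"
    unfolding over_mate_def
    unfolding Cmp_assoc[OF C1 c(2) qw(2) qpg] e1 Cmp_assoc[OF C1 c(2) qqqvg qw(1), symmetric] e2
    using Cmp_assoc[OF C1 vg c(1) qw(1)] .
  thus ?thesis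
    unfolding iso_at_def
    using invertible_square[OF C1 vg qpg over_mate(1)[OF u b X] over_mate(1)[OF u b Y] over_mate(3)[OF u b X] over_mate(3)[OF u b Y]]
    by simp
qed

text \<open>The whiskering of \<open>\<theta>\<close> with K -> 1 is an identity because the
  terminal category has a single arrow. Hence E and \<open>\<theta>\<close> act trivially on
  constant diagrams.\<close>

lemma V2_term:
  assumes t: "small_nt U \<theta>" "NSrc \<theta> = id_fun K" "NTgt \<theta> = E" and Z: "Z \<in> Ob (V0 D term_cat)"
  shows "NC (V2 D \<theta>) (FO (V1 D (to_term K)) Z) = Id (V0 D K) (FO (V1 D (to_term K)) Z)"
    and "FO (V1 D E) (FO (V1 D (to_term K)) Z) = FO (V1 D (to_term K)) Z"
proof -
  note T = small_ntD[OF t(1)]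
  have K: "small_cat U K" using small_funD(2)[OF T(2)] t by simp
  have E: "small_fun U E" "Src E = K" "Tgt E = K" using T t by auto
  have e: "comp_fun (to_term K) E = to_term K" using comp_to_term[OF small_funD(1)[OF E(1)]] E by simp
  show "NC (V2 D \<theta>) (FO (V1 D (to_term K)) Z) = Id (V0 D K) (FO (V1 D (to_term K)) Z)"
  proof -
    have "comp_fun (to_term K) (NTgt \<theta>) = comp_fun (to_term K) (NSrc \<theta>)"
      using e t comp_fun_id_right[OF functor_to_term[OF small_catD[OF K]]] by simp
    moreover have "FA (to_term K) (NC \<theta> x) = Id (Tgt (to_term K)) (FO (to_term K) (FO (NSrc \<theta>) x))"
      if "x \<in> Ob (Src (NSrc \<theta>))" for x
      using ntD(5)[OF T(1) that] that t by (simp add: HomD)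
    ultimately show ?thesis
      using V2_whisker_left[OF t(1) small_to_term[OF K], of Z] t Z V1_Ob[OF small_to_term[OF K], of Z]
      by (simp add: V1_id_fun[OF K])
  qed
  show "FO (V1 D E) (FO (V1 D (to_term K)) Z) = FO (V1 D (to_term K)) Z"
    using V1_comp_Ob[OF E(1) small_to_term[OF K], of Z] E Z e by simp
qed

text \<open>
  \<open>E\<close> is final: arrows from \<open>X\<close> to a constant diagram correspond to arrows from \<open>E\<^sup>* X\<close>.
\<close>

lemma colim_invertible:
  assumes t: "small_nt U \<theta>" "NSrc \<theta> = id_fun K" "NTgt \<theta> = E" and h: "h \<in> Hom (V0 D K) X Y"
    and i: "\<And>k. k \<in> Ob K \<Longrightarrow> iso_at K h (FO E k)"
  shows "invertible (V0 D term_cat) (FA (lkan D (to_term K)) h)"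
proof -
  note T = small_ntD[OF t(1)]
  have K: "small_cat U K" using small_funD(2)[OF T(2)] t by simp
  have E: "small_fun U E" "Src E = K" "Tgt E = K" using T t by auto
  note q = small_to_term[OF K] and C = category_V0[OF K]
  have X: "X \<in> Ob (V0 D K)" and Y: "Y \<in> Ob (V0 D K)" using Hom_Ob[OF C h] by auto
  have Eh: "FA (V1 D E) h \<in> Hom (V0 D K) (FO (V1 D E) X) (FO (V1 D E) Y)" using V1_Hom[OF E(1)] E h by simp
  have iE: "invertible (V0 D K) (FA (V1 D E) h)"
    using invertible_iff[OF K Eh] iso_at_V1[OF E(1), of h X Y] E h i by simp
  \<comment> \<open>A left inverse of E^* h suffices to extend f along h: f is restricted to E^* f,
    composed with s and pulled back along \<open>\<theta>\<close>.\<close>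
  obtain s where s: "s \<in> Hom (V0 D K) (FO (V1 D E) Y) (FO (V1 D E) X)"
      "Cmp (V0 D K) s (FA (V1 D E) h) = Id (V0 D K) (FO (V1 D E) X)"
    using invertibleE[OF iE Eh] by metis
  have th: "NC (V2 D \<theta>) X' \<in> Hom (V0 D K) X' (FO (V1 D E) X')" if "X' \<in> Ob (V0 D K)" for X'
    using V2_Hom[OF t(1), of X'] t that V1_id_fun[OF K] by simp
  have tn: "Cmp (V0 D K) (NC (V2 D \<theta>) Y') f = Cmp (V0 D K) (FA (V1 D E) f) (NC (V2 D \<theta>) X')"
    if f: "f \<in> Hom (V0 D K) X' Y'" for f X' Y'
    using V2_natural[OF t(1), of f X' Y'] t f HomD(1)[OF f] V1_id_fun[OF K] by simp
  have loc: "local_at (V0 D K) h (FO (V1 D (to_term K)) Z)" if Z: "Z \<in> Ob (V0 D term_cat)" for Z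
  proof -
    let ?V = "FO (V1 D (to_term K)) Z"
    note VV = V2_term[OF t Z]
    have EV: "FA (V1 D E) f \<in> Hom (V0 D K) (FO (V1 D E) X') ?V" if "f \<in> Hom (V0 D K) X' ?V" for f X'
      using V1_Hom[OF E(1), of f X' ?V] E VV(2) that by simp
    \<comment> \<open>E^* V is V and \<open>\<theta>\<close> is an identity at the constant diagram
      V, so an arrow into V is recovered from its restriction along E.\<close>
    have ret: "Cmp (V0 D K) (FA (V1 D E) f) (NC (V2 D \<theta>) X') = f" if f: "f \<in> Hom (V0 D K) X' ?V" for f X'
      using tn[OF f] VV(1) Cmp_Id_left[OF C f] by simp
    show ?thesis
    proof (rule local_atI[OF h])
      fix f assume f: "f \<in> Hom (V0 D K) X ?V"
      let ?fs = "Cmp (V0 D K) (FA (V1 D E) f) s"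
      have fs: "?fs \<in> Hom (V0 D K) (FO (V1 D E) Y) ?V" using Cmp_Hom[OF C EV[OF f] s(1)] .
      have "Cmp (V0 D K) (Cmp (V0 D K) ?fs (NC (V2 D \<theta>) Y)) h = Cmp (V0 D K) ?fs (Cmp (V0 D K) (FA (V1 D E) h) (NC (V2 D \<theta>) X))"
        using Cmp_assoc[OF C fs th[OF Y] h] tn[OF h] by simp
      also have "\<dots> = Cmp (V0 D K) (Cmp (V0 D K) ?fs (FA (V1 D E) h)) (NC (V2 D \<theta>) X)"
        using Cmp_assoc[OF C fs Eh th[OF X]] by simp
      also have "Cmp (V0 D K) ?fs (FA (V1 D E) h) = FA (V1 D E) f"
        using Cmp_assoc[OF C EV[OF f] s(1) Eh] s(2) Cmp_Id_right[OF C EV[OF f]] by simp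
      finally show "\<exists>g. g \<in> Hom (V0 D K) Y ?V \<and> Cmp (V0 D K) g h = f"
        using ret[OF f] Cmp_Hom[OF C fs th[OF Y]] by (intro exI[of _ "Cmp (V0 D K) ?fs (NC (V2 D \<theta>) Y)"]) simp
    next
      fix g g' assume g: "g \<in> Hom (V0 D K) Y ?V" "g' \<in> Hom (V0 D K) Y ?V" and e: "Cmp (V0 D K) g h = Cmp (V0 D K) g' h"
      have c: "FA (V1 D E) (Cmp (V0 D K) g h) = Cmp (V0 D K) (FA (V1 D E) g) (FA (V1 D E) h)"
         "FA (V1 D E) (Cmp (V0 D K) g' h) = Cmp (V0 D K) (FA (V1 D E) g') (FA (V1 D E) h)"
        using V1_Cmp[OF E(1), of _ Y ?V h X] E g h by auto
      have "FA (V1 D E) g = FA (V1 D E) g'"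
        by (rule local_atD(2)[OF C local_at_invertible[OF C Eh iE] Eh EV[OF g(1)] EV[OF g(2)]]) (use c e in simp)
      thus "g = g'" using ret[OF g(1)] ret[OF g(2)] by metis
    qed
  qed
  have qh: "FA (lkan D (to_term K)) h \<in> Hom (V0 D term_cat) (FO (lkan D (to_term K)) X) (FO (lkan D (to_term K)) Y)"
    using lkan_Hom[OF q] h by simp
  have l: "local_at (V0 D term_cat) (FA (lkan D (to_term K)) h) Z" if "Z \<in> Ob (V0 D term_cat)" for Z
    using local_at_lkan[OF q, of h X Y Z] h loc that by simp
  show ?thesis
    using invertible_local_at[OF category_V0[OF small_term] qh] l Hom_Ob[OF category_V0[OF small_term] qh] by blast
qed

text \<open>By the pointwise formula the value of u_! g at b is a colimit over the comma category,
  and the transformation \<open>\<theta>\<close> from the identity to E makes this colimit depend on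
  the image of E alone.\<close>

lemma lkan_iso_at:
  assumes u: "small_fun U u" and b: "b \<in> Ob (Tgt u)" and g: "g \<in> Hom (V0 D (Src u)) X Y"
    and t: "is_nt \<theta>" "NSrc \<theta> = id_fun (over_cat u b)" "NTgt \<theta> = E"
    and i: "\<And>k. k \<in> Ob (over_cat u b) \<Longrightarrow> iso_at (Src u) g (pfst (FO E k))"
  shows "iso_at (Tgt u) (FA (lkan D u) g) b"
proof -
  note p = small_over_proj[OF u, of b] and K = small_over[OF universe u, of b]
  have E: "is_functor E" "Src E = over_cat u b" "Tgt E = over_cat u b" using ntD[OF t(1)] t by auto
  have sE: "small_fun U E" using E K by (simp add: small_fun_def)
  have t': "small_nt U \<theta>" using t sE small_id[OF K] by (simp add: small_nt_def)
  have pg: "FA (V1 D (over_proj u b)) g \<in> Hom (V0 D (over_cat u b)) (FO (V1 D (over_proj u b)) X) (FO (V1 D (over_proj u b)) Y)"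
    using V1_Hom[OF p] g by simp
  have "iso_at (over_cat u b) (FA (V1 D (over_proj u b)) g) (FO E k)" if k: "k \<in> Ob (over_cat u b)" for k
  proof -
    have Ek: "FO E k \<in> Ob (over_cat u b)" using functorD(3)[OF E(1)] E k by metis
    have "FO (over_proj u b) (FO E k) = pfst (FO E k)" by (rule over_proj_simps(3)[OF Ek])
    thus ?thesis using iso_at_V1[OF p, of g X Y "FO E k"] Ek g i[OF k] by simp
  qed
  from colim_invertible[OF t'  t(2,3) pg this] show ?thesis using lkan_iso_at_iff[OF u b g] by simp
qed

text \<open>As the mate is invertible, \<open>over_arrow\<close> inherits the universal property of
  the colimit unit: it is universal among arrows from the restricted X to constant diagrams. In this
  form it can be compared with another universal arrow.\<close>

lemma over_universal:
  assumes u: "small_fun U u" and b: "b \<in> Ob (Tgt u)" and X: "X \<in> Ob (V0 D (Src u))" and Z: "Z \<in> Ob (V0 D term_cat)"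
  defines "Y \<equiv> FO (V1 D (pt_fun (Tgt u) b)) (FO (lkan D u) X)"
  shows "f \<in> Hom (V0 D (over_cat u b)) (FO (V1 D (over_proj u b)) X) (FO (V1 D (to_term (over_cat u b))) Z) \<Longrightarrow>
      \<exists>y. y \<in> Hom (V0 D term_cat) Y Z \<and>
        Cmp (V0 D (over_cat u b)) (FA (V1 D (to_term (over_cat u b))) y) (over_arrow u b X) = f"
    and "y \<in> Hom (V0 D term_cat) Y Z \<Longrightarrow> y' \<in> Hom (V0 D term_cat) Y Z \<Longrightarrow>
      Cmp (V0 D (over_cat u b)) (FA (V1 D (to_term (over_cat u b))) y) (over_arrow u b X) =
      Cmp (V0 D (over_cat u b)) (FA (V1 D (to_term (over_cat u b))) y') (over_arrow u b X) \<Longrightarrow> y = y'"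
proof -
  note p = small_over_proj[OF u, of b] and K = small_over[OF universe u, of b]
  note q = small_to_term[OF K] and C = category_V0[OF K] and C1 = category_V0[OF small_term]
  let ?q = "V1 D (to_term (over_cat u b))" and ?P = "FO (V1 D (over_proj u b)) X" and ?l = "lkan D (to_term (over_cat u b))"
  have P: "?P \<in> Ob (V0 D (over_cat u b))" using V1_Ob[OF p] X by simp
  note M = over_mate[OF u b X, folded Y_def]
  note A = hom_adjD[OF lkan_hom_adj[OF q], unfolded lkanD(2,3)[OF q] to_term_simps]
  obtain M' where M': "M' \<in> Hom (V0 D term_cat) Y (FO ?l ?P)" "Cmp (V0 D term_cat) M' (over_mate u b X) = Id (V0 D term_cat) (FO ?l ?P)"
      "Cmp (V0 D term_cat) (over_mate u b X) M' = Id (V0 D term_cat) Y"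
    using invertibleE[OF M(3,1)] .
  have eta: "NC (lkan_unit D (to_term (over_cat u b))) ?P \<in> Hom (V0 D (over_cat u b)) ?P (FO ?q (FO ?l ?P))"
    using lkan_unit(1)[OF q] P by simp
  have qH: "FA ?q y \<in> Hom (V0 D (over_cat u b)) (FO ?q x1) (FO ?q x2)" if "y \<in> Hom (V0 D term_cat) x1 x2" for y x1 x2
    using V1_Hom[OF q] that by simp
  have key: "Cmp (V0 D (over_cat u b)) (FA ?q y) (over_arrow u b X) =
      Cmp (V0 D (over_cat u b)) (FA ?q (Cmp (V0 D term_cat) y (over_mate u b X))) (NC (lkan_unit D (to_term (over_cat u b))) ?P)"
    if y: "y \<in> Hom (V0 D term_cat) Y Z" for y
    using V1_Cmp[OF q, of y Y Z "over_mate u b X"] y M(1,2) Cmp_assoc[OF C qH[OF y] qH[OF M(1)] eta] by simp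
  { assume f: "f \<in> Hom (V0 D (over_cat u b)) ?P (FO ?q Z)"
    obtain f0 where f0: "f0 \<in> Hom (V0 D term_cat) (FO ?l ?P) Z"
       "Cmp (V0 D (over_cat u b)) (FA ?q f0) (NC (lkan_unit D (to_term (over_cat u b))) ?P) = f"
      using A(6)[OF P Z f] by auto
    have y: "Cmp (V0 D term_cat) f0 M' \<in> Hom (V0 D term_cat) Y Z" using Cmp_Hom[OF C1 f0(1) M'(1)] .
    have "Cmp (V0 D term_cat) (Cmp (V0 D term_cat) f0 M') (over_mate u b X) = f0"
      using Cmp_assoc[OF C1 f0(1) M'(1) M(1)] M'(2) Cmp_Id_right[OF C1 f0(1)] by simp
    thus "\<exists>y. y \<in> Hom (V0 D term_cat) Y Z \<and> Cmp (V0 D (over_cat u b)) (FA ?q y) (over_arrow u b X) = f"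
      using key[OF y] f0(2) y by (intro exI[of _ "Cmp (V0 D term_cat) f0 M'"]) simp }
  { assume y: "y \<in> Hom (V0 D term_cat) Y Z" "y' \<in> Hom (V0 D term_cat) Y Z"
      and e: "Cmp (V0 D (over_cat u b)) (FA ?q y) (over_arrow u b X) = Cmp (V0 D (over_cat u b)) (FA ?q y') (over_arrow u b X)"
    have "Cmp (V0 D term_cat) y (over_mate u b X) = Cmp (V0 D term_cat) y' (over_mate u b X)"
      by (rule A(7)[OF P Cmp_Hom[OF C1 y(1) M(1)] Cmp_Hom[OF C1 y(2) M(1)]]) (use key[OF y(1)] key[OF y(2)] e in simp)
    thus "y = y'" using local_atD(2)[OF C1 local_at_invertible[OF C1 M(1,3)] M(1) y] by simp }
qed

text \<open>For b = u a, full faithfulness makes (a, id) terminal in the comma category over b.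
  Evaluation at a terminal object also computes the colimit, so evaluating \<open>over_arrow\<close>
  there gives an invertible arrow, and this arrow is the unit at a.\<close>

lemma lkan_unit_invertible:
  assumes u: "small_fun U u" and ff: "fully_faithful u" and X: "X \<in> Ob (V0 D (Src u))"
  shows "invertible (V0 D (Src u)) (NC (lkan_unit D u) X)"
proof -
  have "iso_at (Src u) (NC (lkan_unit D u) X) a" if a: "a \<in> Ob (Src u)" for a
  proof -
    note uf = small_funD[OF u]
    define b where "b = FO u a"
    have b: "b \<in> Ob (Tgt u)" unfolding b_def using functorD(3)[OF uf(1) a] .
    let ?K = "over_cat u b"
    note p = small_over_proj[OF u, of b] and K = small_over[OF universe u, of b]
    note CK = category_over[OF uf(1), of b]
    note q = small_to_term[OF K] and C = category_V0[OF K] and C1 = category_V0[OF small_term]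
    note v = small_pt[OF uf(3) b]
    \<comment> \<open>The terminal object (a, id) of the comma category; \<open>ex\<close> below
      uses fullness and \<open>un\<close> faithfulness.\<close>
    let ?t = "Pr a (Id (Tgt u) b)"
    have t: "?t \<in> Ob ?K" using a Id_Hom[OF functorD(2)[OF uf(1)] b] b_def by simp
    note r = small_pt[OF K t]
    have ex: "\<exists>f. f \<in> Hom ?K x ?t" if x: "x \<in> Ob ?K" for x
    proof -
      obtain a' f where e: "x = Pr a' f" "a' \<in> Ob (Src u)" "f \<in> Hom (Tgt u) (FO u a') (FO u a)" using x b_def by auto
      then obtain g where g: "g \<in> Hom (Src u) a' a" "FA u g = f" using fully_faithfulD(1)[OF uf(1) ff _ a] by blast
      have "Cmp (Tgt u) (Id (Tgt u) b) (FA u g) = f" using Cmp_Id_left[OF functorD(2)[OF uf(1)] e(3)] g b_def by simp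
      thus ?thesis unfolding Hom_over using x t g e by auto
    qed
    have un: "f = g" if f: "f \<in> Hom ?K x ?t" "g \<in> Hom ?K x ?t" for f g x
    proof -
      obtain h where h: "f = Pr (Pr x ?t) h" "x \<in> Ob ?K" "h \<in> Hom (Src u) (pfst x) a" "Cmp (Tgt u) (Id (Tgt u) b) (FA u h) = psnd x"
        using f(1) unfolding Hom_over by auto
      obtain l where l: "g = Pr (Pr x ?t) l" "l \<in> Hom (Src u) (pfst x) a" "Cmp (Tgt u) (Id (Tgt u) b) (FA u l) = psnd x"
        using f(2) unfolding Hom_over by auto
      have "FA u h = psnd x" "FA u l = psnd x"
        using h(4) l(3) Cmp_Id_left[OF functorD(2)[OF uf(1)] functorD(4)[OF uf(1) h(3)]]
          Cmp_Id_left[OF functorD(2)[OF uf(1)] functorD(4)[OF uf(1) l(2)]] b_def by auto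
      hence "FA u h = FA u l" by simp
      hence "h = l" by (rule fully_faithfulD(2)[OF uf(1) ff h(3) l(2)])
      thus ?thesis using h l by simp
    qed
    define \<theta> where "\<theta> = mk_nt (id_fun ?K) (comp_fun (pt_fun ?K ?t) (to_term ?K)) (\<lambda>x. SOME f. f \<in> Hom ?K x ?t)"
    have th: "(SOME f. f \<in> Hom ?K x ?t) \<in> Hom ?K x ?t" if "x \<in> Ob ?K" for x using someI_ex[OF ex[OF that]] .
    have Gf: "is_functor (comp_fun (pt_fun ?K ?t) (to_term ?K))"
      using small_funD(1)[OF small_comp[OF q r]] by simp
    have nt: "is_nt \<theta>" unfolding \<theta>_def
    proof (rule ntI[OF functor_id_fun[OF CK] Gf])
      show "(SOME f. f \<in> Hom ?K x ?t) \<in> Hom (Tgt (id_fun ?K)) (FO (id_fun ?K) x) (FO (comp_fun (pt_fun ?K ?t) (to_term ?K)) x)"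
        if "x \<in> Ob (Src (id_fun ?K))" for x using th[of x] that by (simp del: Ob_over)
      fix f assume "f \<in> Ar (Src (id_fun ?K))"
      hence f: "f \<in> Ar ?K" by simp
      have xy: "Dom ?K f \<in> Ob ?K" "Cod ?K f \<in> Ob ?K" using Dom_Ob[OF CK f] Cod_Ob[OF CK f] by auto
      have "Cmp ?K (SOME g. g \<in> Hom ?K (Cod ?K f) ?t) f = Cmp ?K (Id ?K ?t) (SOME g. g \<in> Hom ?K (Dom ?K f) ?t)"
        by (rule un[OF Cmp_Hom[OF CK th[OF xy(2)] Ar_Hom[OF f]] Cmp_Hom[OF CK Id_Hom[OF CK t] th[OF xy(1)]]])
      thus "Cmp (Tgt (id_fun ?K)) (SOME g. g \<in> Hom ?K (Cod (Src (id_fun ?K)) f) ?t) (FA (id_fun ?K) f) =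
        Cmp (Tgt (id_fun ?K)) (FA (comp_fun (pt_fun ?K ?t) (to_term ?K)) f) (SOME g. g \<in> Hom ?K (Dom (Src (id_fun ?K)) f) ?t)"
        using f by simp
    qed simp_all
    have tS: "NSrc \<theta> = id_fun ?K" "NTgt \<theta> = comp_fun (pt_fun ?K ?t) (to_term ?K)" by (simp_all add: \<theta>_def)
    have tt: "NC \<theta> ?t = Id ?K ?t" using un[OF th[OF t] Id_Hom[OF CK t]] t by (simp add: \<theta>_def del: Ob_over)
    have tC: "NC \<theta> x \<in> Hom ?K x ?t" if "x \<in> Ob ?K" for x using th[OF that] that by (simp add: \<theta>_def del: Ob_over)
    have tT: "FA (to_term ?K) (NC \<theta> x) = Pr (Vx []) (Vx [])" if "x \<in> Ob ?K" for x
      using HomD(1)[OF tC[OF that]] by simp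
    \<comment> \<open>A terminal object is right adjoint to the functor into the terminal category,
      so evaluation at it is left adjoint to forming constant diagrams.\<close>
    have A: "hom_adj (V1 D (pt_fun ?K ?t)) (V1 D (to_term ?K))
       (\<lambda>X f. Cmp (V0 D ?K) (FA (V1 D (to_term ?K)) f) (NC (V2 D \<theta>) X))"
      using reflection_hom_adj[OF q r _ _ _ nt] tS to_term_pt[OF CK t] tt tT by (auto simp del: Ob_over)
    have st: "small_nt U \<theta>" using nt tS small_id[OF K] small_comp[OF q r] by (simp add: small_nt_def)
    let ?w = "over_arrow u b X" and ?q = "V1 D (to_term ?K)" and ?r = "V1 D (pt_fun ?K ?t)" and ?Y = "FO (V1 D (pt_fun (Tgt u) b)) (FO (lkan D u) X)"
    let ?P = "FO (V1 D (over_proj u b)) X"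
    note w = over_arrow_Hom[OF u b X]
    have P: "?P \<in> Ob (V0 D ?K)" using V1_Ob[OF p] X by simp
    have Y: "?Y \<in> Ob (V0 D term_cat)" using V1_Ob[OF v] lkan_Ob[OF u X] by simp
    note A' = hom_adjD[OF A, unfolded V1D(2,3)[OF r] pt_fun_simps]
    have rq: "FO ?r (FO ?q Z) = Z" if "Z \<in> Ob (V0 D term_cat)" for Z
      using V1_comp_Ob[OF r q, of Z] to_term_pt[OF CK t] that V1_id_fun[OF small_term] by simp
    have rw: "FA ?r ?w \<in> Hom (V0 D term_cat) (FO ?r ?P) ?Y" using V1_Hom[OF r] w(3) rq[OF Y] by fastforce
    \<comment> \<open>Both \<open>?w\<close> and the unit of this adjunction are universal among
      arrows from \<open>?P\<close> to constant diagrams. \<open>FA ?r ?w\<close> is the comparison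
      between the two, hence local at every Z.\<close>
    have loc: "local_at (V0 D term_cat) (FA ?r ?w) Z" if Z: "Z \<in> Ob (V0 D term_cat)" for Z
    proof (rule local_atI[OF rw])
      have qH: "FA ?q y \<in> Hom (V0 D ?K) (FO ?q ?Y) (FO ?q Z)" if "y \<in> Hom (V0 D term_cat) ?Y Z" for y
        using V1_Hom[OF q] that by simp
      have key: "Cmp (V0 D ?K) (FA ?q (Cmp (V0 D term_cat) y (FA ?r ?w))) (NC (V2 D \<theta>) ?P) = Cmp (V0 D ?K) (FA ?q y) ?w"
        if y: "y \<in> Hom (V0 D term_cat) ?Y Z" for y
        using A'(8)[OF w(3), of y Z] rq[OF Y] y V2_term(1)[OF st tS Y] Cmp_Id_right[OF C qH[OF y]] by simp
      { fix k assume k: "k \<in> Hom (V0 D term_cat) (FO ?r ?P) Z"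
        obtain y where y: "y \<in> Hom (V0 D term_cat) ?Y Z" "Cmp (V0 D ?K) (FA ?q y) ?w = Cmp (V0 D ?K) (FA ?q k) (NC (V2 D \<theta>) ?P)"
          using over_universal(1)[OF u b X Z A'(5)[OF P k]] by auto
        have "Cmp (V0 D term_cat) y (FA ?r ?w) = k"
          by (rule A'(7)[OF P Cmp_Hom[OF C1 y(1) rw] k]) (use key[OF y(1)] y(2) in simp)
        thus "\<exists>g. g \<in> Hom (V0 D term_cat) ?Y Z \<and> Cmp (V0 D term_cat) g (FA ?r ?w) = k" using y(1) by blast }
      { fix y y' assume y: "y \<in> Hom (V0 D term_cat) ?Y Z" "y' \<in> Hom (V0 D term_cat) ?Y Z"
          and e: "Cmp (V0 D term_cat) y (FA ?r ?w) = Cmp (V0 D term_cat) y' (FA ?r ?w)"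
        show "y = y'" by (rule over_universal(2)[OF u b X Z y]) (use key[OF y(1)] key[OF y(2)] e in simp) }
    qed
    have inv: "invertible (V0 D term_cat) (FA ?r ?w)"
      using invertible_local_at[OF C1 rw] loc Hom_Ob[OF C1 rw] by blast
    have pr: "comp_fun (over_proj u b) (pt_fun ?K ?t) = pt_fun (Src u) a"
      using comp_pt[OF functor_over_proj[OF uf(1)], of ?t b] over_proj_simps(3)[OF t] t by simp
    \<comment> \<open>At the terminal object the cell of the comma square is the identity of b, so
      of the two factors of \<open>over_arrow\<close> only the unit of u_! survives.\<close>
    have c1: "FA ?r (NC (V2 D (over_cell u b)) (FO (lkan D u) X)) = Id (V0 D term_cat)
        (FO ?r (FO (V1 D (comp_fun u (over_proj u b))) (FO (lkan D u) X)))"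
    proof -
      have "comp_fun (NTgt (over_cell u b)) (pt_fun ?K ?t) = comp_fun (pt_fun (Tgt u) b) (comp_fun (to_term ?K) (pt_fun ?K ?t))"
        using comp_fun_assoc[OF small_funD(1)[OF r] small_funD(1)[OF q] small_funD(1)[OF v]] by (simp add: over_cell_def)
      also have "\<dots> = pt_fun (Tgt u) b" using to_term_pt[OF CK t] comp_fun_id_right[OF small_funD(1)[OF v]] by simp
      also have "\<dots> = comp_fun u (comp_fun (over_proj u b) (pt_fun ?K ?t))" using pr comp_pt[OF uf(1) a] b_def by simp
      also have "\<dots> = comp_fun (NSrc (over_cell u b)) (pt_fun ?K ?t)"
        using comp_fun_assoc[OF small_funD(1)[OF r] functor_over_proj[OF uf(1)] uf(1)] by (simp add: over_cell_def)
      finally have e: "comp_fun (NTgt (over_cell u b)) (pt_fun ?K ?t) = comp_fun (NSrc (over_cell u b)) (pt_fun ?K ?t)" .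
      have "NC (over_cell u b) ?t = Id (Tgt u) b" using t by (simp add: over_cell_def del: Ob_over)
      moreover have "FO (comp_fun u (over_proj u b)) ?t = b" using t b_def over_proj_simps(3)[OF t] by (simp del: Ob_over)
      ultimately show ?thesis
        using V2_whisker_right[OF small_over_cell[OF u b] r _ e] lkan_Ob[OF u X] by (simp add: over_cell_def)
    qed
    have c2: "FA ?r (FA (V1 D (over_proj u b)) (NC (lkan_unit D u) X)) = FA (V1 D (pt_fun (Src u) a)) (NC (lkan_unit D u) X)"
      using V1_comp_Ar[OF r p, of "NC (lkan_unit D u) X"] HomD(1)[OF lkan_unit(1)[OF u X]] pr by simp
    have Z: "FO ?r (FO (V1 D (comp_fun u (over_proj u b))) (FO (lkan D u) X)) = FO (V1 D (pt_fun (Src u) a)) (FO (V1 D u) (FO (lkan D u) X))"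
      using V1_comp_Ob[OF p u _ lkan_Ob[OF u X]] V1_comp_Ob[OF r p, of "FO (V1 D u) (FO (lkan D u) X)"]
        V1_Ob[OF u lkan_Ob[OF u X]] pr by simp
    have ea: "FA (V1 D (pt_fun (Src u) a)) (NC (lkan_unit D u) X) \<in> Hom (V0 D term_cat)
        (FO (V1 D (pt_fun (Src u) a)) X) (FO (V1 D (pt_fun (Src u) a)) (FO (V1 D u) (FO (lkan D u) X)))"
      using V1_Hom[OF small_pt[OF uf(2) a]] lkan_unit(1)[OF u X] by simp
    have "FA ?r ?w = Cmp (V0 D term_cat) (FA ?r (NC (V2 D (over_cell u b)) (FO (lkan D u) X)))
        (FA ?r (FA (V1 D (over_proj u b)) (NC (lkan_unit D u) X)))"
      unfolding over_arrow_def using V1_Cmp[OF r] w(1,2) by simp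
    also have "\<dots> = FA (V1 D (pt_fun (Src u) a)) (NC (lkan_unit D u) X)"
      unfolding c1 c2 Z
      using Cmp_Id_left[OF C1 ea] .
    finally show ?thesis using inv unfolding iso_at_def by simp
  qed
  thus ?thesis using invertible_iff[OF small_funD(2)[OF u] lkan_unit(1)[OF u X]] by simp
qed

text \<open>For fully faithful u the unit identifies u^* u_! g with g.\<close>

lemma lkan_iso_at_image:
  assumes u: "small_fun U u" and ff: "fully_faithful u" and g: "g \<in> Hom (V0 D (Src u)) X Y" and a: "a \<in> Ob (Src u)"
  shows "iso_at (Tgt u) (FA (lkan D u) g) (FO u a) \<longleftrightarrow> iso_at (Src u) g a"
proof -
  note A = small_funD(2)[OF u]
  have X: "X \<in> Ob (V0 D (Src u))" and Y: "Y \<in> Ob (V0 D (Src u))" using Hom_Ob[OF category_V0[OF A] g] by auto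
  have i: "iso_at (Src u) (NC (lkan_unit D u) Z) a" if Z: "Z \<in> Ob (V0 D (Src u))" for Z
    using lkan_unit_invertible[OF u ff Z] invertible_iff[OF A lkan_unit(1)[OF u Z]] a by simp
  have "iso_at (Src u) (FA (V1 D u) (FA (lkan D u) g)) a \<longleftrightarrow> iso_at (Src u) g a"
    using iso_at_square[OF A a V1_Hom[OF u lkan_Hom[OF u g]] g lkan_unit(1)[OF u X] lkan_unit(1)[OF u Y] i[OF X] i[OF Y]]
      lkan_unit(2)[OF u g] by simp
  thus ?thesis using iso_at_V1[OF u lkan_Hom[OF u g] a] by simp
qed

lemma lkan_zero_at_image:
  assumes u: "small_fun U u" and ff: "fully_faithful u" and X: "X \<in> Ob (V0 D (Src u))" and a: "a \<in> Ob (Src u)"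
  shows "zero_at (Tgt u) (FO (lkan D u) X) (FO u a) \<longleftrightarrow> zero_at (Src u) X a"
  using zero_at_V1[OF u lkan_Ob[OF u X] a] zero_at_iso[OF small_funD(2)[OF u] a lkan_unit(1)[OF u X]]
    lkan_unit_invertible[OF u ff X] invertible_iff[OF small_funD(2)[OF u] lkan_unit(1)[OF u X]] a by simp

text \<open>By a triangle identity the restriction of the counit is inverse to the unit at u^* Y,
  which is invertible.\<close>

lemma lkan_counit_iso_at_image:
  assumes u: "small_fun U u" and ff: "fully_faithful u" and Y: "Y \<in> Ob (V0 D (Tgt u))" and a: "a \<in> Ob (Src u)"
  shows "iso_at (Tgt u) (NC (lkan_counit D u) Y) (FO u a)"
proof -
  note C = category_V0[OF small_funD(2)[OF u]] and uY = V1_Ob[OF u Y]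
  note uc = V1_Hom[OF u lkan_unit(3)[OF u Y]]
  have "invertible (V0 D (Src u)) (FA (V1 D u) (NC (lkan_counit D u) Y))"
    using invertible_cancel_right[OF C uc lkan_unit(1)[OF u uY] lkan_unit_invertible[OF u ff uY]]
      lkan_unit(5)[OF u Y] invertible_Id[OF C uY] by simp
  thus ?thesis
    using invertible_iff[OF small_funD(2)[OF u] uc] a iso_at_V1[OF u lkan_unit(3)[OF u Y] a] by simp
qed

text \<open>In the adjoint triple \<open>u\<^sub>! \<stileturn> u\<^sup>* \<stileturn> u\<^sub>*\<close>, the outer adjoints are fully faithful simultaneously.\<close>

lemma rkan_counit_invertible:
  assumes u: "small_fun U u" and ff: "fully_faithful u" and V: "V \<in> Ob (V0 D (Src u))"
  shows "invertible (V0 D (Src u)) (NC (rkan_counit D u) V)"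
proof -
  note C = category_V0[OF small_funD(2)[OF u]]
  note L = hom_adjD[OF lkan_hom_adj[OF u], unfolded lkanD(2,3)[OF u]]
  note R = hom_adjD[OF rkan_hom_adj[OF u], unfolded V1D(2,3)[OF u]]
  let ?e = "NC (rkan_counit D u) V" and ?R = "FO (rkan D u) V"
  have RV: "?R \<in> Ob (V0 D (Tgt u))" using rkan_Ob[OF u V] .
  have e: "?e \<in> Hom (V0 D (Src u)) (FO (V1 D u) ?R) V" using rkan_unit(3)[OF u V] .
  have uR: "FO (V1 D u) ?R \<in> Ob (V0 D (Src u))" using V1_Ob[OF u RV] .
  \<comment> \<open>Composition with the counit is surjective: g becomes an arrow from u^* u_! Z to
    V through the inverse \<open>n'\<close> of the unit, is transposed to an arrow from u_! Z to u_*
    V, restricted along u, and composed with the unit again.\<close>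
  have eu: "\<exists>f. f \<in> Hom (V0 D (Src u)) Z (FO (V1 D u) ?R) \<and> Cmp (V0 D (Src u)) ?e f = g"
    if g: "g \<in> Hom (V0 D (Src u)) Z V" for g Z
  proof -
    have Z: "Z \<in> Ob (V0 D (Src u))" using Hom_Ob(1)[OF C g] .
    let ?n = "NC (lkan_unit D u) Z"
    note n = lkan_unit(1)[OF u Z]
    obtain n' where n': "n' \<in> Hom (V0 D (Src u)) (FO (V1 D u) (FO (lkan D u) Z)) Z" "Cmp (V0 D (Src u)) n' ?n = Id (V0 D (Src u)) Z"
      using invertibleE[OF lkan_unit_invertible[OF u ff Z] n] by metis
    have gn: "Cmp (V0 D (Src u)) g n' \<in> Hom (V0 D (Src u)) (FO (V1 D u) (FO (lkan D u) Z)) V" using Cmp_Hom[OF C g n'(1)] .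
    note LZ = lkan_Ob[OF u Z]
    let ?k = "Cmp (V0 D (Tgt u)) (FA (rkan D u) (Cmp (V0 D (Src u)) g n')) (NC (rkan_unit D u) (FO (lkan D u) Z))"
    have k: "?k \<in> Hom (V0 D (Tgt u)) (FO (lkan D u) Z) ?R" using R(5)[OF LZ gn] .
    have "Cmp (V0 D (Src u)) ?e (FA (V1 D u) ?k) = Cmp (V0 D (Src u)) g n'"
    proof -
      have uk: "FA (V1 D u) ?k = Cmp (V0 D (Src u)) (FA (V1 D u) (FA (rkan D u) (Cmp (V0 D (Src u)) g n')))
          (FA (V1 D u) (NC (rkan_unit D u) (FO (lkan D u) Z)))"
        using V1_Cmp[OF u rkan_Hom[OF u gn] rkan_unit(1)[OF u LZ]] .
      have 1: "NC (rkan_counit D u) (FO (V1 D u) (FO (lkan D u) Z)) \<in> Hom (V0 D (Src u))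
          (FO (V1 D u) (FO (rkan D u) (FO (V1 D u) (FO (lkan D u) Z)))) (FO (V1 D u) (FO (lkan D u) Z))"
        using rkan_unit(3)[OF u V1_Ob[OF u LZ]] .
      show ?thesis
        unfolding uk using Cmp_assoc[OF C e V1_Hom[OF u rkan_Hom[OF u gn]] V1_Hom[OF u rkan_unit(1)[OF u LZ]]]
          rkan_unit(4)[OF u gn] Cmp_assoc[OF C gn 1 V1_Hom[OF u rkan_unit(1)[OF u LZ]]] rkan_unit(5)[OF u LZ]
          Cmp_Id_right[OF C gn] by simp
    qed
    hence "Cmp (V0 D (Src u)) ?e (Cmp (V0 D (Src u)) (FA (V1 D u) ?k) ?n) = g"
      using Cmp_assoc[OF C e V1_Hom[OF u k] n] Cmp_assoc[OF C g n'(1) n] n'(2) Cmp_Id_right[OF C g] by simp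
    thus ?thesis using Cmp_Hom[OF C V1_Hom[OF u k] n] by blast
  qed
  \<comment> \<open>Injectivity by the reverse passage: both arrows come from arrows
    \<open>k\<close> and \<open>k'\<close> out of u_! Z, and these are determined by the composites
    of their restrictions with the counit.\<close>
  have mono: "f = f'" if f: "f \<in> Hom (V0 D (Src u)) Z (FO (V1 D u) ?R)" "f' \<in> Hom (V0 D (Src u)) Z (FO (V1 D u) ?R)"
      and eq: "Cmp (V0 D (Src u)) ?e f = Cmp (V0 D (Src u)) ?e f'" for f f' Z
  proof -
    have Z: "Z \<in> Ob (V0 D (Src u))" using Hom_Ob(1)[OF C f(1)] .
    let ?n = "NC (lkan_unit D u) Z"
    note n = lkan_unit(1)[OF u Z] and LZ = lkan_Ob[OF u Z]
    obtain k where k: "k \<in> Hom (V0 D (Tgt u)) (FO (lkan D u) Z) ?R" "Cmp (V0 D (Src u)) (FA (V1 D u) k) ?n = f"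
      using L(6)[OF Z RV f(1)] by auto
    obtain k' where k': "k' \<in> Hom (V0 D (Tgt u)) (FO (lkan D u) Z) ?R" "Cmp (V0 D (Src u)) (FA (V1 D u) k') ?n = f'"
      using L(6)[OF Z RV f(2)] by auto
    have c: "Cmp (V0 D (Src u)) (Cmp (V0 D (Src u)) ?e (FA (V1 D u) k)) ?n =
        Cmp (V0 D (Src u)) (Cmp (V0 D (Src u)) ?e (FA (V1 D u) k')) ?n"
      using Cmp_assoc[OF C e V1_Hom[OF u k(1)] n] Cmp_assoc[OF C e V1_Hom[OF u k'(1)] n] k(2) k'(2) eq by simp
    have "Cmp (V0 D (Src u)) ?e (FA (V1 D u) k) = Cmp (V0 D (Src u)) ?e (FA (V1 D u) k')"
      by (rule local_atD(2)[OF C local_at_invertible[OF C n lkan_unit_invertible[OF u ff Z]] n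
            Cmp_Hom[OF C e V1_Hom[OF u k(1)]] Cmp_Hom[OF C e V1_Hom[OF u k'(1)]] c])
    moreover have "x = Cmp (V0 D (Tgt u)) (FA (rkan D u) (Cmp (V0 D (Src u)) ?e (FA (V1 D u) x))) (NC (rkan_unit D u) (FO (lkan D u) Z))"
      if x: "x \<in> Hom (V0 D (Tgt u)) (FO (lkan D u) Z) ?R" for x
    proof -
      obtain y where y: "y \<in> Hom (V0 D (Src u)) (FO (V1 D u) (FO (lkan D u) Z)) V"
        "Cmp (V0 D (Tgt u)) (FA (rkan D u) y) (NC (rkan_unit D u) (FO (lkan D u) Z)) = x" using R(6)[OF LZ V x] by auto
      have 1: "NC (rkan_counit D u) (FO (V1 D u) (FO (lkan D u) Z)) \<in> Hom (V0 D (Src u))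
          (FO (V1 D u) (FO (rkan D u) (FO (V1 D u) (FO (lkan D u) Z)))) (FO (V1 D u) (FO (lkan D u) Z))"
        using rkan_unit(3)[OF u V1_Ob[OF u LZ]] .
      have "Cmp (V0 D (Src u)) ?e (FA (V1 D u) x) = y"
        using y(2)[symmetric] V1_Cmp[OF u rkan_Hom[OF u y(1)] rkan_unit(1)[OF u LZ]]
          Cmp_assoc[OF C e V1_Hom[OF u rkan_Hom[OF u y(1)]] V1_Hom[OF u rkan_unit(1)[OF u LZ]]]
          rkan_unit(4)[OF u y(1)] Cmp_assoc[OF C y(1) 1 V1_Hom[OF u rkan_unit(1)[OF u LZ]]] rkan_unit(5)[OF u LZ]
          Cmp_Id_right[OF C y(1)] by simp
      thus ?thesis using y(2) by simp
    qed
    ultimately have "k = k'" using k(1) k'(1) by metis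
    thus ?thesis using k(2) k'(2) by simp
  qed
  \<comment> \<open>A section of the counit; as the counit can be cancelled by \<open>mono\<close>,
    it is a two-sided inverse.\<close>
  obtain s where s: "s \<in> Hom (V0 D (Src u)) V (FO (V1 D u) ?R)" "Cmp (V0 D (Src u)) ?e s = Id (V0 D (Src u)) V"
    using eu[OF Id_Hom[OF C V]] by auto
  have "Cmp (V0 D (Src u)) s ?e = Id (V0 D (Src u)) (FO (V1 D u) ?R)"
    by (rule mono[OF Cmp_Hom[OF C s(1) e] Id_Hom[OF C uR]])
      (use Cmp_assoc[OF C e s(1) e] s(2) Cmp_Id_left[OF C e] Cmp_Id_right[OF C e] in simp)
  thus ?thesis using invertibleI[OF e s(1)] s(2) by simp
qed

lemma rkan_iso_at_image:
  assumes u: "small_fun U u" and ff: "fully_faithful u" and g: "g \<in> Hom (V0 D (Src u)) X Y" and a: "a \<in> Ob (Src u)"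
  shows "iso_at (Tgt u) (FA (rkan D u) g) (FO u a) \<longleftrightarrow> iso_at (Src u) g a"
proof -
  note A = small_funD(2)[OF u]
  have X: "X \<in> Ob (V0 D (Src u))" and Y: "Y \<in> Ob (V0 D (Src u))" using Hom_Ob[OF category_V0[OF A] g] by auto
  have i: "iso_at (Src u) (NC (rkan_counit D u) Z) a" if Z: "Z \<in> Ob (V0 D (Src u))" for Z
    using rkan_counit_invertible[OF u ff Z] invertible_iff[OF A rkan_unit(3)[OF u Z]] a by simp
  have "iso_at (Src u) g a \<longleftrightarrow> iso_at (Src u) (FA (V1 D u) (FA (rkan D u) g)) a"
    using iso_at_square[OF A a g V1_Hom[OF u rkan_Hom[OF u g]] rkan_unit(3)[OF u X] rkan_unit(3)[OF u Y] i[OF X] i[OF Y]]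
      rkan_unit(4)[OF u g] by simp
  thus ?thesis using iso_at_V1[OF u rkan_Hom[OF u g] a] by simp
qed

text \<open>The counits at X and Y are isomorphisms and make g and u^* u_* g isomorphic as arrows;
  their inverses form the square for the other direction.\<close>

lemma local_at_rkan_counit:
  assumes u: "small_fun U u" and ff: "fully_faithful u" and g: "g \<in> Hom (V0 D (Src u)) X Y"
  shows "local_at (V0 D (Src u)) (FA (V1 D u) (FA (rkan D u) g)) Z \<longleftrightarrow> local_at (V0 D (Src u)) g Z"
proof -
  note C = category_V0[OF small_funD(2)[OF u]]
  have X: "X \<in> Ob (V0 D (Src u))" and Y: "Y \<in> Ob (V0 D (Src u))" using Hom_Ob[OF C g] by auto
  note eX = rkan_unit(3)[OF u X] and eY = rkan_unit(3)[OF u Y]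
  note iX = rkan_counit_invertible[OF u ff X] and iY = rkan_counit_invertible[OF u ff Y]
  note g' = V1_Hom[OF u rkan_Hom[OF u g]]
  obtain x where x: "x \<in> Hom (V0 D (Src u)) X (FO (V1 D u) (FO (rkan D u) X))" "invertible (V0 D (Src u)) x"
     "Cmp (V0 D (Src u)) (NC (rkan_counit D u) X) x = Id (V0 D (Src u)) X"
    using invertible_inverse[OF C eX iX] by metis
  obtain y where y: "y \<in> Hom (V0 D (Src u)) Y (FO (V1 D u) (FO (rkan D u) Y))" "invertible (V0 D (Src u)) y"
     "Cmp (V0 D (Src u)) y (NC (rkan_counit D u) Y) = Id (V0 D (Src u)) (FO (V1 D u) (FO (rkan D u) Y))"
    using invertible_inverse[OF C eY iY] by metis
  let ?g = "FA (V1 D u) (FA (rkan D u) g)"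
  have "Cmp (V0 D (Src u)) y g = Cmp (V0 D (Src u)) y (Cmp (V0 D (Src u)) (Cmp (V0 D (Src u)) g (NC (rkan_counit D u) X)) x)"
    using Cmp_assoc[OF C g eX x(1)] x(3) Cmp_Id_right[OF C g] by simp
  also have "\<dots> = Cmp (V0 D (Src u)) (Cmp (V0 D (Src u)) y (NC (rkan_counit D u) Y)) (Cmp (V0 D (Src u)) ?g x)"
    using rkan_unit(4)[OF u g] Cmp_assoc[OF C eY g' x(1)] Cmp_assoc[OF C y(1) eY Cmp_Hom[OF C g' x(1)]] by simp
  also have "\<dots> = Cmp (V0 D (Src u)) ?g x"
    using y(3) Cmp_Id_left[OF C Cmp_Hom[OF C g' x(1)]] by simp
  finally have sq: "Cmp (V0 D (Src u)) y g = Cmp (V0 D (Src u)) ?g x" .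
  show ?thesis
    using local_at_square[OF C g g' eX eY iX iY rkan_unit(4)[OF u g]] local_at_square[OF C g' g x(1) y(1) x(2) y(2) sq] by blast
qed

text \<open>No arrow leads from b into the image, so the comma category in Der4 is empty. Over the
  empty category every arrow is invertible by Der2. Hence an arrow g from X to a zero object induces
  an isomorphism at b between u_* X and u_* of that zero object, which is zero.\<close>

lemma rkan_zero_at:
  assumes u: "small_fun U u" and b: "b \<in> Ob (Tgt u)" and X: "X \<in> Ob (V0 D (Src u))"
    and no: "\<And>a. a \<in> Ob (Src u) \<Longrightarrow> Hom (Tgt u) b (FO u a) = {}"
  shows "zero_at (Tgt u) (FO (rkan D u) X) b"
proof -
  note p = small_under_proj[OF u, of b] and K = small_under[OF universe u, of b]
  note q = small_to_term[OF K] and v = small_pt[OF small_funD(3)[OF u] b]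
  note A = small_funD(2)[OF u]
  note C = category_V0[OF K] and C1 = category_V0[OF small_term]
  obtain z where z: "zero_object (V0 D (Src u)) z" using ex_zero[OF A] by auto
  obtain g where g: "g \<in> Hom (V0 D (Src u)) X z" using zero_objectD(3)[OF z X] by auto
  have zo: "z \<in> Ob (V0 D (Src u))" using zero_objectD(1)[OF z] .
  let ?p = "V1 D (under_proj b u)" and ?q = "rkan D (to_term (under_cat b u))" and ?v = "V1 D (pt_fun (Tgt u) b)"
    and ?qs = "V1 D (to_term (under_cat b u))" and ?C = "V0 D (under_cat b u)" and ?C1 = "V0 D term_cat"
  let ?Z = "\<lambda>X. FO ?v (FO (rkan D u) X)" and ?n = "NC (rkan_unit D (to_term (under_cat b u)))"
  let ?a = "\<lambda>X. NC (V2 D (under_cell b u)) (FO (rkan D u) X)" and ?e = "NC (rkan_counit D u)"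
  let ?w = "\<lambda>X. Cmp ?C (FA ?p (?e X)) (?a X)"
  let ?M = "\<lambda>X. Cmp ?C1 (FA ?q (?w X)) (?n (?Z X))"
  have a: "?a X \<in> Hom ?C (FO ?qs (?Z X)) (FO ?p (FO (V1 D u) (FO (rkan D u) X)))" if X: "X \<in> Ob (V0 D (Src u))" for X
    using V2_Hom[OF small_under_cell[OF u b], of "FO (rkan D u) X"] rkan_Ob[OF u X]
      V1_comp_Ob[OF p u _ rkan_Ob[OF u X]] V1_comp_Ob[OF q v, of "FO (rkan D u) X"] by (simp add: under_cell_def)
  have pe: "FA ?p (?e X) \<in> Hom ?C (FO ?p (FO (V1 D u) (FO (rkan D u) X))) (FO ?p X)" if X: "X \<in> Ob (V0 D (Src u))" for X
    using V1_Hom[OF p] rkan_unit(3)[OF u X] by simp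
  have w: "?w X \<in> Hom ?C (FO ?qs (?Z X)) (FO ?p X)" if X: "X \<in> Ob (V0 D (Src u))" for X
    using Cmp_Hom[OF C pe[OF X] a[OF X]] .
  have Z: "?Z X \<in> Ob ?C1" if X: "X \<in> Ob (V0 D (Src u))" for X using V1_Ob[OF v] rkan_Ob[OF u X] by simp
  have n: "?n (?Z X) \<in> Hom ?C1 (?Z X) (FO ?q (FO ?qs (?Z X)))" if X: "X \<in> Ob (V0 D (Src u))" for X
    using rkan_unit(1)[OF q] Z[OF X] by simp
  have qw: "FA ?q (?w X) \<in> Hom ?C1 (FO ?q (FO ?qs (?Z X))) (FO ?q (FO ?p X))" if X: "X \<in> Ob (V0 D (Src u))" for X
    using rkan_Hom[OF q] w[OF X] by simp
  have M: "?M X \<in> Hom ?C1 (?Z X) (FO ?q (FO ?p X))" if X: "X \<in> Ob (V0 D (Src u))" for X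
    using Cmp_Hom[OF C1 qw[OF X] n[OF X]] .
  have Mi: "invertible ?C1 (?M X)" if X: "X \<in> Ob (V0 D (Src u))" for X
  proof -
    have "der4 U D" using derivator by (simp add: derivator_def)
    hence "invertible ?C1 (NC (rkan_mate D u (under_proj b u) (pt_fun (Tgt u) b) (to_term (under_cat b u)) (under_cell b u)) X)"
      using u b X unfolding der4_def by blast
    thus ?thesis using X rkanD(2)[OF u] by (simp add: rkan_mate_def)
  qed
  note Rg = rkan_Hom[OF u g]
  have vg: "FA ?v (FA (rkan D u) g) \<in> Hom ?C1 (?Z X) (?Z z)" using V1_Hom[OF v] Rg by simp
  have qvg: "FA ?qs (FA ?v (FA (rkan D u) g)) \<in> Hom ?C (FO ?qs (?Z X)) (FO ?qs (?Z z))" using V1_Hom[OF q] vg by simp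
  have qqvg: "FA ?q (FA ?qs (FA ?v (FA (rkan D u) g))) \<in> Hom ?C1 (FO ?q (FO ?qs (?Z X))) (FO ?q (FO ?qs (?Z z)))"
    using rkan_Hom[OF q] qvg by simp
  have pg: "FA ?p g \<in> Hom ?C (FO ?p X) (FO ?p z)" using V1_Hom[OF p] g by simp
  have qpg: "FA ?q (FA ?p g) \<in> Hom ?C1 (FO ?q (FO ?p X)) (FO ?q (FO ?p z))" using rkan_Hom[OF q] pg by simp
  have puRg: "FA ?p (FA (V1 D u) (FA (rkan D u) g)) \<in> Hom ?C (FO ?p (FO (V1 D u) (FO (rkan D u) X))) (FO ?p (FO (V1 D u) (FO (rkan D u) z)))"
    using V1_Hom[OF p] V1_Hom[OF u Rg] by simp
  have nat: "Cmp ?C (?a z) (FA ?qs (FA ?v (FA (rkan D u) g))) = Cmp ?C (FA ?p (FA (V1 D u) (FA (rkan D u) g))) (?a X)"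
    using V2_natural[OF small_under_cell[OF u b], of "FA (rkan D u) g" "FO (rkan D u) X" "FO (rkan D u) z"]
      Rg V1_comp_Ar[OF p u _ HomD(1)[OF Rg]] V1_comp_Ar[OF q v] HomD(1)[OF Rg] by (simp add: under_cell_def)
  have e: "Cmp ?C (FA ?p (?e z)) (FA ?p (FA (V1 D u) (FA (rkan D u) g))) = Cmp ?C (FA ?p g) (FA ?p (?e X))"
    using V1_Cmp[OF p, of "?e z" _ z "FA (V1 D u) (FA (rkan D u) g)"] rkan_unit(3)[OF u zo] V1_Hom[OF u Rg]
      rkan_unit(4)[OF u g] V1_Cmp[OF p, of g X z "?e X"] rkan_unit(3)[OF u X] g by simp
  have wn: "Cmp ?C (?w z) (FA ?qs (FA ?v (FA (rkan D u) g))) = Cmp ?C (FA ?p g) (?w X)"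
    using Cmp_assoc[OF C pe[OF zo] a[OF zo] qvg] nat Cmp_assoc[OF C pe[OF zo] puRg a[OF X]] e
      Cmp_assoc[OF C pg pe[OF X] a[OF X]] by simp
  have qC: "FA ?q (Cmp ?C y x) = Cmp ?C1 (FA ?q y) (FA ?q x)" if "y \<in> Hom ?C Y1 Y2" "x \<in> Hom ?C Y0 Y1" for y x Y0 Y1 Y2
    using rkan_Cmp[OF q] that by simp
  have qwn: "Cmp ?C1 (FA ?q (?w z)) (FA ?q (FA ?qs (FA ?v (FA (rkan D u) g)))) = Cmp ?C1 (FA ?q (FA ?p g)) (FA ?q (?w X))"
    using qC[OF w[OF zo] qvg] qC[OF pg w[OF X]] wn by metis
  have nn: "Cmp ?C1 (?n (?Z z)) (FA ?v (FA (rkan D u) g)) = Cmp ?C1 (FA ?q (FA ?qs (FA ?v (FA (rkan D u) g)))) (?n (?Z X))"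
    using rkan_unit(2)[OF q] vg by simp
  \<comment> \<open>Naturality of the isomorphism of Der4 with respect to g.\<close>
  have sq: "Cmp ?C1 (?M z) (FA ?v (FA (rkan D u) g)) = Cmp ?C1 (FA ?q (FA ?p g)) (?M X)"
    using Cmp_assoc[OF C1 qw[OF zo] n[OF zo] vg] nn Cmp_assoc[OF C1 qw[OF zo] qqvg n[OF X]] qwn
      Cmp_assoc[OF C1 qpg qw[OF X] n[OF X]] by simp
  have empty: "Ob (under_cat b u) = {}" using no by auto
  have "invertible ?C (FA ?p g)" using invertible_iff[OF K pg] empty by blast
  hence "invertible ?C1 (FA ?q (FA ?p g))" using functor_invertible[OF rkanD(1)[OF q], of "FA ?p g"] pg rkanD(2,3)[OF q] by simp
  hence "invertible ?C1 (FA ?v (FA (rkan D u) g))"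
    using invertible_square[OF C1 qpg vg M[OF X] M[OF zo] Mi[OF X] Mi[OF zo] sq] by simp
  hence "iso_at (Tgt u) (FA (rkan D u) g) b" by (simp add: iso_at_def)
  thus ?thesis
    using zero_at_iso[OF small_funD(3)[OF u] b Rg] zero_object_zero_at[OF small_funD(3)[OF u] rkan_zero[OF u z] b] by simp
qed

text \<open>By \<open>no\<close> the image of u is a sieve, for which u_* is extension by zero; an
  object that vanishes off the image is therefore right Kan extended from it. On the image the
  restricted unit is inverse to the counit, and off it both sides vanish.\<close>

lemma rkan_unit_invertible:
  assumes u: "small_fun U u" and ff: "fully_faithful u" and V: "V \<in> Ob (V0 D (Tgt u))"
    and no: "\<And>a b. b \<in> Ob (Tgt u) \<Longrightarrow> b \<notin> FO u ` Ob (Src u) \<Longrightarrow> a \<in> Ob (Src u) \<Longrightarrow> Hom (Tgt u) b (FO u a) = {}"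
    and z: "\<And>b. b \<in> Ob (Tgt u) \<Longrightarrow> b \<notin> FO u ` Ob (Src u) \<Longrightarrow> zero_at (Tgt u) V b"
  shows "invertible (V0 D (Tgt u)) (NC (rkan_unit D u) V)"
proof -
  note B = small_funD(3)[OF u] and C = category_V0[OF small_funD(2)[OF u]] and uV = V1_Ob[OF u V]
  note n = rkan_unit(1)[OF u V]
  have "iso_at (Tgt u) (NC (rkan_unit D u) V) b" if b: "b \<in> Ob (Tgt u)" for b
  proof (cases "b \<in> FO u ` Ob (Src u)")
    case True
    then obtain a where a: "a \<in> Ob (Src u)" "b = FO u a" by auto
    have "invertible (V0 D (Src u)) (FA (V1 D u) (NC (rkan_unit D u) V))"
      using invertible_cancel_left[OF C rkan_unit(3)[OF u uV] V1_Hom[OF u n] rkan_counit_invertible[OF u ff uV]]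
        rkan_unit(5)[OF u V] invertible_Id[OF C uV] by simp
    thus ?thesis using invertible_iff[OF small_funD(2)[OF u] V1_Hom[OF u n]] iso_at_V1[OF u n a(1)] a by simp
  next
    case False
    show ?thesis
      using iso_at_zero[OF B b n z[OF b False] rkan_zero_at[OF u b uV]] no[OF b False] by blast
  qed
  thus ?thesis using invertible_iff[OF B n] by simp
qed

end

section \<open>Kan extensions with a parameter category\<close>

lemma cube_pts_1: "cube_pts 1 = {[False], [True]}"
  by (auto simp: cube_pts_def length_Suc_conv)

lemma cube_pts_2: "cube_pts 2 = {[False, False], [True, False], [False, True], [True, True]}"
  by (auto simp: cube_pts_def length_Suc_conv numeral_2_eq_2)

lemma corner_pts: "corner_pts = {[False, False], [True, False], [False, True]}"
  by (auto simp: corner_pts_def cube_pts_2)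

context pointed_derivator
begin

abbreviation par :: "'a scat \<Rightarrow> 'a sfun \<Rightarrow> 'a sfun" where
  "par A u \<equiv> prod_fun u (id_fun A)"

lemma small_poset_fun: "is_functor (poset_fun P Q h :: 'a sfun) \<Longrightarrow> finite P \<Longrightarrow> finite Q \<Longrightarrow> small_fun U (poset_fun P Q h)"
  by (simp add: small_fun_def small_poset[OF universe])

lemma small_par: "small_cat U A \<Longrightarrow> small_fun U u \<Longrightarrow> small_fun U (par A u)"
  by (simp add: small_prod_fun small_id)

lemma comp_par:
  "small_cat U A \<Longrightarrow> small_fun U u \<Longrightarrow> small_fun U v \<Longrightarrow> Tgt u = Src v \<Longrightarrow>
     comp_fun (par A v) (par A u) = par A (comp_fun v u)"
  using comp_prod_fun[of u "id_fun A" v "id_fun A"] comp_fun_id_right[OF functor_id_fun, of A]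
  by (simp add: small_funD small_catD functor_id_fun)

lemma fully_faithful_par_poset:
  assumes u: "is_functor (poset_fun P Q h :: 'a sfun)" and A: "category (A :: 'a scat)"
    and emb: "\<And>p q. p \<in> P \<Longrightarrow> q \<in> P \<Longrightarrow> list_all2 (\<le>) (h p) (h q) \<Longrightarrow> list_all2 (\<le>) p q"
  shows "fully_faithful (par A (poset_fun P Q h))"
  unfolding fully_faithful_def
proof (intro ballI)
  fix x y f assume "x \<in> Ob (Src (par A (poset_fun P Q h)))" "y \<in> Ob (Src (par A (poset_fun P Q h)))"
    and f: "f \<in> Hom (Tgt (par A (poset_fun P Q h))) (FO (par A (poset_fun P Q h)) x) (FO (par A (poset_fun P Q h)) y)"
  then obtain p a q b where xy: "x = Pr (Vx p) a" "y = Pr (Vx q) b" "p \<in> P" "q \<in> P" "a \<in> Ob A" "b \<in> Ob A" by auto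
  obtain g where g: "f = Pr (Pr (Vx (h p)) (Vx (h q))) g" "g \<in> Hom A a b" "list_all2 (\<le>) (h p) (h q)"
    using f xy by (auto simp: Hom_poset elim!: Hom_prodE)
  have pq: "list_all2 (\<le>) p q" using emb xy g by auto
  have e: "Pr (Vx p) (Vx q) \<in> Hom (poset_cat P :: 'a scat) (Vx p) (Vx q)" using pq xy by (simp add: Hom_poset)
  show "\<exists>!k. k \<in> Hom (Src (par A (poset_fun P Q h))) x y \<and> FA (par A (poset_fun P Q h)) k = f"
  proof (rule ex1I[of _ "Pr (Pr (Vx p) (Vx q)) g"])
    show "Pr (Pr (Vx p) (Vx q)) g \<in> Hom (Src (par A (poset_fun P Q h))) x y \<and>
        FA (par A (poset_fun P Q h)) (Pr (Pr (Vx p) (Vx q)) g) = f"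
      using xy e g pq HomD(1)[OF e] HomD(1)[OF g(2)] by simp
    fix k assume k: "k \<in> Hom (Src (par A (poset_fun P Q h))) x y \<and> FA (par A (poset_fun P Q h)) k = f"
    then obtain l where l: "k = Pr (Pr (Vx p) (Vx q)) l" "l \<in> Hom A a b"
      using xy by (auto simp: Hom_poset elim!: Hom_prodE)
    show "k = Pr (Pr (Vx p) (Vx q)) g" using k l g HomD(1)[OF e] HomD(1)[OF l(2)] by simp
  qed
qed

text \<open>\<open>sieve\<close> says that h has a down-closed image, and an arrow of the product
  would have an inequality in Q as its first component.\<close>

lemma no_arrow_par_poset:
  assumes b: "b \<in> Ob (Tgt (par A (poset_fun P Q h)))" "b \<notin> FO (par A (poset_fun P Q h)) ` Ob (Src (par A (poset_fun P Q h)))"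
    and a: "a \<in> Ob (Src (par A (poset_fun P Q h)))"
    and sieve: "\<And>p q. p \<in> P \<Longrightarrow> q \<in> Q \<Longrightarrow> q \<notin> h ` P \<Longrightarrow> \<not> list_all2 (\<le>) q (h p)"
  shows "Hom (Tgt (par A (poset_fun P Q h))) b (FO (par A (poset_fun P Q h)) a) = {}"
proof -
  obtain q c where q: "b = Pr (Vx q) c" "q \<in> Q" "c \<in> Ob A" using b(1) by auto
  obtain p d where p: "a = Pr (Vx p) d" "p \<in> P" "d \<in> Ob A" using a by auto
  have "q \<notin> h ` P"
  proof
    assume "q \<in> h ` P"
    then obtain r where "r \<in> P" "q = h r" by auto
    hence "b = FO (par A (poset_fun P Q h)) (Pr (Vx r) c)" "Pr (Vx r) c \<in> Ob (Src (par A (poset_fun P Q h)))"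
      using q by auto
    thus False using b(2) by blast
  qed
  hence "\<not> list_all2 (\<le>) q (h p)" using sieve p q by blast
  thus ?thesis using p q by (auto simp: Hom_poset elim!: Hom_prodE)
qed

text \<open>
  The objects \<open>((s, a), (f, id))\<close> are reflective in the comma category of \<open>u \<times> A\<close> over \<open>(t, a)\<close>, so
  that only the values of \<open>g\<close> at the parameter \<open>a\<close> matter.
\<close>

lemma lkan_par_iso_at:
  assumes u: "small_fun U u" and A: "small_cat U A" and t: "t \<in> Ob (Tgt u)" and a: "a \<in> Ob A"
    and g: "g \<in> Hom (V0 D (prod_cat (Src u) A)) X Y"
    and i: "\<And>s. s \<in> Ob (Src u) \<Longrightarrow> Hom (Tgt u) (FO u s) t \<noteq> {} \<Longrightarrow> iso_at (prod_cat (Src u) A) g (Pr s a)"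
  shows "iso_at (prod_cat (Tgt u) A) (FA (lkan D (par A u)) g) (Pr t a)"
proof -
  let ?u = "par A u" and ?b = "Pr t a"
  let ?K = "over_cat ?u ?b"
  note uf = small_funD(1)[OF u] and cA = small_catD[OF A]
  note CS = functorD(1)[OF uf] and CT = functorD(2)[OF uf]
  have su: "small_fun U ?u" using small_par[OF A u] .
  have CK: "category ?K" using category_over[OF small_funD(1)[OF su]] .
  \<comment> \<open>E replaces the parameter part (a', \<psi>) of an object by (a, id) and keeps the
    part over t. The arrow (id, \<psi>) from an object to its replacement is the component of
    \<open>\<theta>\<close> below.\<close>
  define eo :: "'a code \<Rightarrow> 'a code" where "eo x = Pr (Pr (pfst (pfst x)) a) (Pr (pfst (psnd x)) (Id A a))" for x
  define ea :: "'a code \<Rightarrow> 'a code" where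
    "ea f = Pr (Pr (eo (pfst (pfst f))) (eo (psnd (pfst f)))) (Pr (pfst (psnd f)) (Id A a))" for f
  have Ia: "Id A a \<in> Hom A a a" using Id_Hom[OF cA a] .
  have obE: "\<exists>s a' \<phi> \<psi>. x = Pr (Pr s a') (Pr \<phi> \<psi>) \<and> s \<in> Ob (Src u) \<and> a' \<in> Ob A \<and> \<phi> \<in> Hom (Tgt u) (FO u s) t \<and> \<psi> \<in> Hom A a' a"
    if "x \<in> Ob ?K" for x
    using that by (auto elim!: Hom_prodE)
  have obI: "Pr (Pr s a') (Pr \<phi> \<psi>) \<in> Ob ?K"
    if "s \<in> Ob (Src u)" "a' \<in> Ob A" "\<phi> \<in> Hom (Tgt u) (FO u s) t" "\<psi> \<in> Hom A a' a" for s a' \<phi> \<psi>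
    using that by auto
  have eoK: "eo x \<in> Ob ?K" if "x \<in> Ob ?K" for x
    using obE[OF that] obI a Ia by (auto simp: eo_def simp del: Ob_over)
  have homE: "\<exists>k l. f = Pr (Pr x y) (Pr k l) \<and> k \<in> Hom (Src u) (pfst (pfst x)) (pfst (pfst y)) \<and> l \<in> Hom A (psnd (pfst x)) (psnd (pfst y))
      \<and> Cmp (Tgt u) (pfst (psnd y)) (FA u k) = pfst (psnd x) \<and> Cmp A (psnd (psnd y)) l = psnd (psnd x)"
    if f: "f \<in> Hom ?K x y" for f x y
  proof -
    obtain h where h: "f = Pr (Pr x y) h" "x \<in> Ob ?K" "y \<in> Ob ?K" "h \<in> Hom (prod_cat (Src u) A) (pfst x) (pfst y)"
      "Cmp (prod_cat (Tgt u) A) (psnd y) (FA ?u h) = psnd x" using f unfolding Hom_over by auto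
    obtain s1 a1 p1 q1 where x: "x = Pr (Pr s1 a1) (Pr p1 q1)" "s1 \<in> Ob (Src u)" "a1 \<in> Ob A" "p1 \<in> Hom (Tgt u) (FO u s1) t" "q1 \<in> Hom A a1 a"
      using obE[OF h(2)] by auto
    obtain s2 a2 p2 q2 where y: "y = Pr (Pr s2 a2) (Pr p2 q2)" "s2 \<in> Ob (Src u)" "a2 \<in> Ob A" "p2 \<in> Hom (Tgt u) (FO u s2) t" "q2 \<in> Hom A a2 a"
      using obE[OF h(3)] by auto
    obtain k l where kl: "h = Pr k l" "k \<in> Hom (Src u) s1 s2" "l \<in> Hom A a1 a2"
      using h(4) x y by (auto elim!: Hom_prodE)
    have uk: "FA u k \<in> Hom (Tgt u) (FO u s1) (FO u s2)" using functorD(4)[OF uf kl(2)] .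
    have "Cmp (prod_cat (Tgt u) A) (Pr p2 q2) (Pr (FA u k) l) = Pr (Cmp (Tgt u) p2 (FA u k)) (Cmp A q2 l)"
      using HomD[OF uk] HomD[OF kl(3)] HomD[OF y(4)] HomD[OF y(5)] by simp
    thus ?thesis using h(1,5) x y kl HomD(1)[OF kl(2)] HomD(1)[OF kl(3)] by simp
  qed
  have homI: "Pr (Pr x y) (Pr k l) \<in> Hom ?K x y"
    if xy: "x \<in> Ob ?K" "y \<in> Ob ?K" and kl: "k \<in> Hom (Src u) (pfst (pfst x)) (pfst (pfst y))" "l \<in> Hom A (psnd (pfst x)) (psnd (pfst y))"
      and e: "Cmp (Tgt u) (pfst (psnd y)) (FA u k) = pfst (psnd x)" "Cmp A (psnd (psnd y)) l = psnd (psnd x)" for x y k l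
  proof -
    obtain s1 a1 p1 q1 where x: "x = Pr (Pr s1 a1) (Pr p1 q1)" "s1 \<in> Ob (Src u)" "a1 \<in> Ob A" "p1 \<in> Hom (Tgt u) (FO u s1) t" "q1 \<in> Hom A a1 a"
      using obE[OF xy(1)] by auto
    obtain s2 a2 p2 q2 where y: "y = Pr (Pr s2 a2) (Pr p2 q2)" "s2 \<in> Ob (Src u)" "a2 \<in> Ob A" "p2 \<in> Hom (Tgt u) (FO u s2) t" "q2 \<in> Hom A a2 a"
      using obE[OF xy(2)] by auto
    have kl': "k \<in> Hom (Src u) s1 s2" "l \<in> Hom A a1 a2" using kl x y by auto
    have uk: "FA u k \<in> Hom (Tgt u) (FO u s1) (FO u s2)" using functorD(4)[OF uf kl'(1)] .
    have "Cmp (prod_cat (Tgt u) A) (Pr p2 q2) (FA ?u (Pr k l)) = Pr (Cmp (Tgt u) p2 (FA u k)) (Cmp A q2 l)"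
      using HomD[OF uk] HomD[OF kl'(2)] HomD[OF y(4)] HomD[OF y(5)] HomD[OF kl'(1)] by simp
    thus ?thesis unfolding Hom_over using xy x y kl' e by (simp del: Ob_over)
  qed
  define E where "E = mk_fun ?K ?K eo ea"
  define \<theta> where "\<theta> = mk_nt (id_fun ?K) E (\<lambda>x. Pr (Pr x (eo x)) (Pr (Id (Src u) (pfst (pfst x))) (psnd (psnd x))))"
  have eaH: "ea f \<in> Hom ?K (eo x) (eo y)" if f: "f \<in> Hom ?K x y" for f x y
  proof -
    have xy: "x \<in> Ob ?K" "y \<in> Ob ?K" using Hom_Ob[OF CK f] by auto
    obtain k l where kl: "f = Pr (Pr x y) (Pr k l)" "k \<in> Hom (Src u) (pfst (pfst x)) (pfst (pfst y))"
      "Cmp (Tgt u) (pfst (psnd y)) (FA u k) = pfst (psnd x)" using homE[OF f] by blast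
    have "Pr (Pr (eo x) (eo y)) (Pr k (Id A a)) \<in> Hom ?K (eo x) (eo y)"
      by (rule homI[OF eoK[OF xy(1)] eoK[OF xy(2)]]) (use kl Ia Cmp_Id_left[OF cA Ia] in \<open>simp_all add: eo_def\<close>)
    thus ?thesis using kl by (simp add: ea_def)
  qed
  have E: "is_functor E"
    unfolding E_def
  proof (rule functorI[OF CK CK])
    show "ea f \<in> Hom ?K (eo (Dom ?K f)) (eo (Cod ?K f))" if "f \<in> Ar ?K" for f using eaH[OF Ar_Hom[OF that]] .
    show "ea (Id ?K x) = Id ?K (eo x)" if x: "x \<in> Ob ?K" for x
    proof -
      obtain s1 a1 p1 q1 where e: "x = Pr (Pr s1 a1) (Pr p1 q1)" "s1 \<in> Ob (Src u)" "a1 \<in> Ob A" using obE[OF x] by auto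
      show ?thesis using Id_over[OF x] Id_over[OF eoK[OF x]] e a by (simp add: ea_def eo_def del: Ob_over)
    qed
    show "ea (Cmp ?K g f) = Cmp ?K (ea g) (ea f)" if f: "f \<in> Ar ?K" and g: "g \<in> Ar ?K" and fg: "Cod ?K f = Dom ?K g" for f g
    proof -
      let ?x = "Dom ?K f" and ?y = "Cod ?K f" and ?z = "Cod ?K g"
      have f': "f \<in> Hom ?K ?x ?y" and g': "g \<in> Hom ?K ?y ?z" using Ar_Hom[OF f] Ar_Hom[OF g] fg by auto
      obtain k l where kl: "f = Pr (Pr ?x ?y) (Pr k l)" "k \<in> Hom (Src u) (pfst (pfst ?x)) (pfst (pfst ?y))" "l \<in> Hom A (psnd (pfst ?x)) (psnd (pfst ?y))"
        using homE[OF f'] by blast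
      obtain k' l' where kl': "g = Pr (Pr ?y ?z) (Pr k' l')" "k' \<in> Hom (Src u) (pfst (pfst ?y)) (pfst (pfst ?z))" "l' \<in> Hom A (psnd (pfst ?y)) (psnd (pfst ?z))"
        using homE[OF g'] by blast
      have ef: "ea f = Pr (Pr (eo ?x) (eo ?y)) (Pr k (Id A a))" by (subst kl(1)) (simp add: ea_def)
      have eg: "ea g = Pr (Pr (eo ?y) (eo ?z)) (Pr k' (Id A a))" by (subst kl'(1)) (simp add: ea_def)
      have 1: "Cmp ?K (Pr (Pr ?y ?z) (Pr k' l')) (Pr (Pr ?x ?y) (Pr k l)) = Pr (Pr ?x ?z) (Cmp (Src ?u) (Pr k' l') (Pr k l))"
        by (rule Cmp_over) (use f' g' in \<open>simp_all only: kl(1)[symmetric] kl'(1)[symmetric]\<close>)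
      have 2: "Cmp ?K (ea g) (ea f) = Pr (Pr (eo ?x) (eo ?z)) (Cmp (Src ?u) (Pr k' (Id A a)) (Pr k (Id A a)))"
        unfolding ef eg by (rule Cmp_over) (use eaH[OF f'] eaH[OF g'] ef eg in simp_all)
      have "Cmp ?K g f = Pr (Pr ?x ?z) (Pr (Cmp (Src u) k' k) (Cmp A l' l))"
        using 1 HomD[OF kl(2)] HomD[OF kl(3)] HomD[OF kl'(2)] HomD[OF kl'(3)] unfolding kl(1)[symmetric] kl'(1)[symmetric] by simp
      hence "ea (Cmp ?K g f) = Pr (Pr (eo ?x) (eo ?z)) (Pr (Cmp (Src u) k' k) (Id A a))" by (simp add: ea_def)
      moreover have "Cmp ?K (ea g) (ea f) = Pr (Pr (eo ?x) (eo ?z)) (Pr (Cmp (Src u) k' k) (Id A a))"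
        using 2 HomD[OF kl(2)] HomD[OF kl'(2)] HomD[OF Ia] Cmp_Id_left[OF cA Ia] by simp
      ultimately show ?thesis by simp
    qed
  qed (rule eoK)
  have thH: "Pr (Pr x (eo x)) (Pr (Id (Src u) (pfst (pfst x))) (psnd (psnd x))) \<in> Hom ?K x (eo x)" if x: "x \<in> Ob ?K" for x
  proof -
    obtain s1 a1 p1 q1 where e: "x = Pr (Pr s1 a1) (Pr p1 q1)" "s1 \<in> Ob (Src u)" "a1 \<in> Ob A" "p1 \<in> Hom (Tgt u) (FO u s1) t" "q1 \<in> Hom A a1 a"
      using obE[OF x] by auto
    show ?thesis
      by (rule homI[OF x eoK[OF x]])
        (use e Id_Hom[OF CS] functorD(5)[OF uf] Cmp_Id_right[OF CT e(4)] Cmp_Id_left[OF cA e(5)] in \<open>simp_all add: eo_def\<close>)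
  qed
  have nt: "is_nt \<theta>"
    unfolding \<theta>_def
  proof (rule ntI[OF functor_id_fun[OF CK] E])
    show "Pr (Pr x (eo x)) (Pr (Id (Src u) (pfst (pfst x))) (psnd (psnd x))) \<in> Hom (Tgt (id_fun ?K)) (FO (id_fun ?K) x) (FO E x)"
      if "x \<in> Ob (Src (id_fun ?K))" for x using thH[of x] that by (simp add: E_def del: Ob_over)
    fix f assume "f \<in> Ar (Src (id_fun ?K))"
    hence f: "f \<in> Ar ?K" by simp
    let ?x = "Dom ?K f" and ?y = "Cod ?K f"
    let ?t = "\<lambda>x. Pr (Pr x (eo x)) (Pr (Id (Src u) (pfst (pfst x))) (psnd (psnd x)))"
    have f': "f \<in> Hom ?K ?x ?y" using Ar_Hom[OF f] .
    have xy: "?x \<in> Ob ?K" "?y \<in> Ob ?K" using Hom_Ob[OF CK f'] by auto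
    obtain k l where kl: "f = Pr (Pr ?x ?y) (Pr k l)" "k \<in> Hom (Src u) (pfst (pfst ?x)) (pfst (pfst ?y))" "l \<in> Hom A (psnd (pfst ?x)) (psnd (pfst ?y))"
        "Cmp A (psnd (psnd ?y)) l = psnd (psnd ?x)"
      using homE[OF f'] by blast
    have q: "psnd (psnd ?x) \<in> Hom A (psnd (pfst ?x)) a" "psnd (psnd ?y) \<in> Hom A (psnd (pfst ?y)) a"
      using obE[OF xy(1)] obE[OF xy(2)] by auto
    have s: "pfst (pfst ?x) \<in> Ob (Src u)" "pfst (pfst ?y) \<in> Ob (Src u)" using obE[OF xy(1)] obE[OF xy(2)] by auto
    have ef: "ea f = Pr (Pr (eo ?x) (eo ?y)) (Pr k (Id A a))" by (subst kl(1)) (simp add: ea_def)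
    have 1: "Cmp ?K (?t ?y) (Pr (Pr ?x ?y) (Pr k l)) = Pr (Pr ?x (eo ?y)) (Cmp (Src ?u) (Pr (Id (Src u) (pfst (pfst ?y))) (psnd (psnd ?y))) (Pr k l))"
      by (rule Cmp_over) (use f' thH[OF xy(2)] in \<open>simp_all only: kl(1)[symmetric]\<close>)
    have 2: "Cmp ?K (ea f) (?t ?x) = Pr (Pr ?x (eo ?y)) (Cmp (Src ?u) (Pr k (Id A a)) (Pr (Id (Src u) (pfst (pfst ?x))) (psnd (psnd ?x))))"
      unfolding ef by (rule Cmp_over) (use eaH[OF f'] thH[OF xy(1)] ef in simp_all)
    have 3: "Cmp (Src ?u) (Pr (Id (Src u) (pfst (pfst ?y))) (psnd (psnd ?y))) (Pr k l) = Pr k (psnd (psnd ?x))"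
      using HomD[OF kl(2)] HomD[OF kl(3)] HomD[OF Id_Hom[OF CS s(2)]] HomD[OF q(2)] Cmp_Id_left[OF CS kl(2)] kl(4) by simp
    have 4: "Cmp (Src ?u) (Pr k (Id A a)) (Pr (Id (Src u) (pfst (pfst ?x))) (psnd (psnd ?x))) = Pr k (psnd (psnd ?x))"
      using HomD[OF kl(2)] HomD[OF Ia] HomD[OF Id_Hom[OF CS s(1)]] HomD[OF q(1)] Cmp_Id_right[OF CS kl(2)] Cmp_Id_left[OF cA q(1)] by simp
    have "Cmp ?K (?t ?y) f = Cmp ?K (ea f) (?t ?x)"
      using 1 2 unfolding 3 4 kl(1)[symmetric] by simp
    thus "Cmp (Tgt (id_fun ?K)) (?t (Cod (Src (id_fun ?K)) f)) (FA (id_fun ?K) f) = Cmp (Tgt (id_fun ?K)) (FA E f) (?t (Dom (Src (id_fun ?K)) f))"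
      using f by (simp add: E_def)
  qed (simp_all add: E_def)
  have "iso_at (Src ?u) g (pfst (FO E x))" if x: "x \<in> Ob ?K" for x
  proof -
    obtain s1 a1 p1 q1 where e: "x = Pr (Pr s1 a1) (Pr p1 q1)" "s1 \<in> Ob (Src u)" "p1 \<in> Hom (Tgt u) (FO u s1) t"
      using obE[OF x] by auto
    have "FO E x = eo x" using x by (simp add: E_def del: Ob_over)
    hence "pfst (FO E x) = Pr s1 a" using e by (simp add: eo_def)
    thus ?thesis using i[OF e(2)] e(3) by auto
  qed
  thus ?thesis
    using lkan_iso_at[OF su, of ?b g X Y \<theta> E] nt g t a by (simp add: \<theta>_def del: Ob_over)
qed

text \<open>In a poset the comma category over t is the set of p with h p \<le> t, so only these
  vertices are consulted.\<close>

lemma lkan_par_poset_iso_at: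
  assumes u: "small_fun U (poset_fun P Q h)" and A: "small_cat U A" and t: "t \<in> Q" and a: "a \<in> Ob A"
    and g: "g \<in> Hom (V0 D (prod_cat (poset_cat P) A)) X Y"
    and i: "\<And>p. p \<in> P \<Longrightarrow> list_all2 (\<le>) (h p) t \<Longrightarrow> iso_at (prod_cat (poset_cat P) A) g (Pr (Vx p) a)"
  shows "iso_at (prod_cat (poset_cat Q) A) (FA (lkan D (par A (poset_fun P Q h))) g) (Pr (Vx t) a)"
proof -
  have "iso_at (prod_cat (poset_cat P) A) g (Pr s a)"
    if "s \<in> Ob (poset_cat P)" "Hom (poset_cat Q) (FO (poset_fun P Q h) s) (Vx t) \<noteq> {}" for s
    using that i by (auto simp: Hom_poset)
  thus ?thesis using lkan_par_iso_at[OF u A _ a, of "Vx t" g X Y] t g by simp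
qed

lemma V1_par_comp_Ob:
  "small_cat U A \<Longrightarrow> small_fun U u \<Longrightarrow> small_fun U v \<Longrightarrow> Tgt u = Src v \<Longrightarrow> X \<in> Ob (V0 D (prod_cat (Tgt v) A)) \<Longrightarrow>
     FO (V1 D (par A u)) (FO (V1 D (par A v)) X) = FO (V1 D (par A (comp_fun v u))) X"
  using V1_comp_Ob[OF small_par small_par, of A u A v X] comp_par[of A u v] by simp

text \<open>l and r form a Galois connection with l r = id, and its product with A satisfies the
  hypotheses of the reflection lemma. It is applied with r an edge of the square and l a coordinate
  projection.\<close>

lemma local_at_par_poset_reflection:
  assumes A: "small_cat U A" and fin: "finite P" "finite Q"
    and l: "is_functor (poset_fun P Q l :: 'a sfun)" and r: "is_functor (poset_fun Q P r :: 'a sfun)"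
    and lr: "\<And>q. q \<in> Q \<Longrightarrow> l (r q) = q" and rl: "\<And>p. p \<in> P \<Longrightarrow> list_all2 (\<le>) p (r (l p))"
    and h: "h \<in> Hom (V0 D (prod_cat (poset_cat P) A)) X Y" and Z: "Z \<in> Ob (V0 D (prod_cat (poset_cat Q) A))"
  shows "local_at (V0 D (prod_cat (poset_cat Q) A)) (FA (V1 D (par A (poset_fun Q P r))) h) Z \<longleftrightarrow>
     local_at (V0 D (prod_cat (poset_cat P) A)) h (FO (V1 D (par A (poset_fun P Q l))) Z)"
proof -
  let ?l = "poset_fun P Q l :: 'a sfun" and ?r = "poset_fun Q P r :: 'a sfun"
  note sl = small_poset_fun[OF l fin] and sr = small_poset_fun[OF r fin(2,1)]
  note cA = small_catD[OF A]
  have lQ: "l p \<in> Q" if "p \<in> P" for p using functorD(3)[OF l, of "Vx p"] that by (auto simp: image_iff)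
  have rP: "r p \<in> P" if "p \<in> Q" for p using functorD(3)[OF r, of "Vx p"] that by (auto simp: image_iff)
  have lm: "list_all2 (\<le>) (l p) (l q)" if "p \<in> P" "q \<in> P" "list_all2 (\<le>) p q" for p q
    using functorD(4)[OF l, of "Pr (Vx p) (Vx q)" "Vx p" "Vx q"] that by (auto simp: Hom_poset)
  have rm: "list_all2 (\<le>) (r p) (r q)" if "p \<in> Q" "q \<in> Q" "list_all2 (\<le>) p q" for p q
    using functorD(4)[OF r, of "Pr (Vx p) (Vx q)" "Vx p" "Vx q"] that by (auto simp: Hom_poset)
  have rlc: "comp_fun ?r ?l = poset_fun P P (\<lambda>p. r (l p))" by (rule poset_fun_comp) (use lQ lm in auto)
  have "comp_fun ?l ?r = poset_fun Q Q (\<lambda>q. l (r q))" by (rule poset_fun_comp) (use rP rm in auto)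
  also have "\<dots> = poset_fun Q Q (\<lambda>q. q)" by (rule poset_fun_cong) (use lr in simp)
  finally have lrc: "comp_fun ?l ?r = id_fun (poset_cat Q)" by (simp add: poset_fun_id)
  let ?n = "poset_nt P P (\<lambda>p. p) (\<lambda>p. r (l p)) :: 'a snt"
  let ?\<theta> = "prod_nt ?n (id_nt (id_fun A))"
  have rlf: "is_functor (poset_fun P P (\<lambda>p. r (l p)) :: 'a sfun)" using functor_comp_fun[OF l r] rlc by simp
  have n: "is_nt ?n" by (rule nt_poset_nt) (use rlf rl in \<open>auto simp: poset_fun_id functor_id_fun category_poset\<close>)
  have tn: "is_nt ?\<theta>" by (rule nt_prod[OF n nt_id_nt[OF functor_id_fun[OF cA]]])
  have S: "NSrc ?\<theta> = id_fun (Src (par A ?l))" by (simp add: poset_fun_id prod_fun_id category_poset cA)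
  have T: "NTgt ?\<theta> = comp_fun (par A ?r) (par A ?l)" using comp_par[OF A sl sr] rlc by simp
  have I: "comp_fun (par A ?l) (par A ?r) = id_fun (Src (par A ?r))"
    using comp_par[OF A sr sl] lrc by (simp add: prod_fun_id category_poset cA)
  have 1: "FA (par A ?l) (NC ?\<theta> x) = Id (Tgt (par A ?l)) (FO (par A ?l) x)" if x: "x \<in> Ob (Src (par A ?l))" for x
  proof -
    obtain p a where e: "x = Pr (Vx p) a" "p \<in> P" "a \<in> Ob A" using x by auto
    have "Pr (Vx p) (Vx (r (l p))) \<in> Ar (poset_cat P :: 'a scat)" using e lQ rP rl by (auto simp: Ar_poset)
    thus ?thesis using e lQ rP rl lr HomD(1)[OF Id_Hom[OF cA e(3)]] by simp
  qed
  have 2: "NC ?\<theta> (FO (par A ?r) y) = Id (Src (par A ?l)) (FO (par A ?r) y)" if y: "y \<in> Ob (Src (par A ?r))" for y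
    using y rP lr by auto
  show ?thesis
    using local_at_reflection[OF small_par[OF A sl] small_par[OF A sr] _ _ I tn S T 1 2, of h X Y Z] h Z by simp
qed

text \<open>Restricted to the point x, the transformation becomes an identity, hence so does its
  image under D.\<close>

lemma V2_iso_at:
  assumes t: "small_nt U \<theta>" and x: "x \<in> Ob (Src (NSrc \<theta>))" and e: "FO (NTgt \<theta>) x = FO (NSrc \<theta>) x"
    and i: "NC \<theta> x = Id (Tgt (NSrc \<theta>)) (FO (NSrc \<theta>) x)" and X: "X \<in> Ob (V0 D (Tgt (NSrc \<theta>)))"
  shows "iso_at (Src (NSrc \<theta>)) (NC (V2 D \<theta>) X) x"
proof -
  note T = small_ntD[OF t]
  note p = small_pt[OF small_funD(2)[OF T(2)] x]
  have xt: "x \<in> Ob (Src (NTgt \<theta>))" using x T by simp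
  have e': "comp_fun (NTgt \<theta>) (pt_fun (Src (NSrc \<theta>)) x) = comp_fun (NSrc \<theta>) (pt_fun (Src (NSrc \<theta>)) x)"
    using comp_pt[OF small_funD(1)[OF T(2)] x] comp_pt[OF small_funD(1)[OF T(3)] xt] T e by simp
  have "FA (V1 D (pt_fun (Src (NSrc \<theta>)) x)) (NC (V2 D \<theta>) X) =
      Id (V0 D term_cat) (FO (V1 D (pt_fun (Src (NSrc \<theta>)) x)) (FO (V1 D (NSrc \<theta>)) X))"
    using V2_whisker_right[OF t p _ e' _ X] i by simp
  moreover have "FO (V1 D (pt_fun (Src (NSrc \<theta>)) x)) (FO (V1 D (NSrc \<theta>)) X) \<in> Ob (V0 D term_cat)"
    using V1_Ob[OF p] V1_Ob[OF T(2) X] by simp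
  ultimately show ?thesis unfolding iso_at_def using invertible_Id[OF category_V0[OF small_term]] by simp
qed

end

section \<open>Cofibers\<close>

text \<open>The edge (0,1) -> (1,1), which carries 0 -> C in a cofiber square. It is right adjoint
  to \<open>fst_coord\<close>, as \<open>cof_edge\<close> is to \<open>snd_coord\<close>;
  restriction along either edge is therefore a left adjoint.\<close>

definition far_edge :: "'a sfun" where
  "far_edge = poset_fun (cube_pts 1) (cube_pts 2) (\<lambda>p. [p ! 0, True])"

text \<open>Constant, so that both edges ending in (1,1) admit a transformation into it.\<close>

definition top_vertex :: "'a sfun" where
  "top_vertex = poset_fun (cube_pts 1) (cube_pts 2) (\<lambda>p. [True, True])"

definition fst_coord :: "'a sfun" where
  "fst_coord = poset_fun (cube_pts 2) (cube_pts 1) (\<lambda>p. [p ! 0])"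

definition snd_coord :: "'a sfun" where
  "snd_coord = poset_fun (cube_pts 2) (cube_pts 1) (\<lambda>p. [p ! Suc 0])"

text \<open>The edge (0,0) -> (0,1) of the corner, which carries x -> 0. It serves to compute the
  cofiber of y -> C.\<close>

definition left_edge :: "'a sfun" where
  "left_edge = poset_fun {[False, False], [False, True]} corner_pts (\<lambda>p. p)"

lemmas pts = cube_pts_1 cube_pts_2 corner_pts

text \<open>Keeps \<open>cube 1\<close> and \<open>cube_pts 1\<close> from being rewritten with
  \<open>Suc 0\<close>, so that the equations about edges continue to match.\<close>

declare One_nat_def [simp del]

section \<open>Edges and projections of the square\<close>

lemma functor_edges:
  "is_functor (poset_fun (cube_pts 1) corner_pts (\<lambda>p. [p ! 0, False]))"
  "is_functor (poset_fun corner_pts (cube_pts 2) (\<lambda>p. p))"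
  "is_functor (poset_fun (cube_pts 1) (cube_pts 2) (\<lambda>p. [True, p ! 0]))"
  "is_functor (poset_fun (cube_pts 1) (cube_pts 2) (\<lambda>p. [p ! 0, True]))"
  "is_functor (poset_fun (cube_pts 1) (cube_pts 2) (\<lambda>p. [True, True]))"
  "is_functor (poset_fun (cube_pts 2) (cube_pts 1) (\<lambda>p. [p ! 0]))"
  "is_functor (poset_fun (cube_pts 2) (cube_pts 1) (\<lambda>p. [p ! Suc 0]))"
  "is_functor (poset_fun {[False, False], [False, True]} corner_pts (\<lambda>p. p))"
  by (rule functor_poset; auto simp: pts)+

context pointed_derivator
begin

lemma finite_pts: "finite (cube_pts n)" "finite corner_pts"
  by (simp_all add: finite_cube_pts corner_pts)

lemma small_edges:
  "small_fun U cof_i" "small_fun U cof_corner" "small_fun U cof_edge" "small_fun U far_edge"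
  "small_fun U top_vertex" "small_fun U fst_coord" "small_fun U snd_coord" "small_fun U left_edge"
  unfolding cof_i_def cof_corner_def cof_edge_def far_edge_def top_vertex_def fst_coord_def snd_coord_def left_edge_def
  by (rule small_poset_fun; simp add: functor_edges finite_pts)+

lemma edges_simps [simp]:
  "Src cof_i = cube 1" "Tgt cof_i = poset_cat corner_pts"
  "Src cof_corner = poset_cat corner_pts" "Tgt cof_corner = cube 2"
  "Src cof_edge = cube 1" "Tgt cof_edge = cube 2" "Src far_edge = cube 1" "Tgt far_edge = cube 2"
  "Src top_vertex = cube 1" "Tgt top_vertex = cube 2"
  "Src fst_coord = cube 2" "Tgt fst_coord = cube 1" "Src snd_coord = cube 2" "Tgt snd_coord = cube 1"
  "Src left_edge = poset_cat {[False, False], [False, True]}" "Tgt left_edge = poset_cat corner_pts"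
  by (simp_all add: cof_i_def cof_corner_def cof_edge_def far_edge_def top_vertex_def fst_coord_def snd_coord_def left_edge_def)

lemma edges_FO:
  "FO cof_i (Vx [x]) = Vx [x, False]" "FO cof_edge (Vx [x]) = Vx [True, x]" "FO far_edge (Vx [x]) = Vx [x, True]"
  "FO top_vertex (Vx [x]) = Vx [True, True]" "FO fst_coord (Vx [x, y]) = Vx [x]" "FO snd_coord (Vx [x, y]) = Vx [y]"
  "\<not> (x \<and> y) \<Longrightarrow> FO cof_corner (Vx [x, y]) = Vx [x, y]" "FO left_edge (Vx [False, y]) = Vx [False, y]"
  unfolding cof_i_def cof_corner_def cof_edge_def far_edge_def top_vertex_def fst_coord_def snd_coord_def left_edge_def
  by (subst poset_fun_simps; auto simp: pts)+

lemma fully_faithful_edges: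
  assumes "small_cat U A"
  shows "fully_faithful (par A cof_i)" "fully_faithful (par A cof_corner)" "fully_faithful (par A left_edge)"
  unfolding cof_i_def cof_corner_def left_edge_def
  by (rule fully_faithful_par_poset[OF functor_edges(1) small_catD[OF assms]]
      fully_faithful_par_poset[OF functor_edges(2) small_catD[OF assms]]
      fully_faithful_par_poset[OF functor_edges(8) small_catD[OF assms]]; auto simp: pts)+

lemma no_arrow_cof_i:
  "b \<in> Ob (Tgt (par A cof_i)) \<Longrightarrow> b \<notin> FO (par A cof_i) ` Ob (Src (par A cof_i)) \<Longrightarrow> a \<in> Ob (Src (par A cof_i)) \<Longrightarrow>
     Hom (Tgt (par A cof_i)) b (FO (par A cof_i) a) = {}"
  unfolding cof_i_def by (rule no_arrow_par_poset) (auto simp: pts)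

lemma no_arrow_left_edge:
  "b \<in> Ob (Tgt (par A left_edge)) \<Longrightarrow> b \<notin> FO (par A left_edge) ` Ob (Src (par A left_edge)) \<Longrightarrow> a \<in> Ob (Src (par A left_edge)) \<Longrightarrow>
     Hom (Tgt (par A left_edge)) b (FO (par A left_edge) a) = {}"
  unfolding left_edge_def by (rule no_arrow_par_poset) (auto simp: pts)

lemma not_image_cof_i: "a \<in> Ob A \<Longrightarrow> Pr (Vx [False, True]) a \<notin> FO (par A cof_i) ` Ob (Src (par A cof_i))"
  by (auto simp: pts edges_FO)

lemma image_cof_i:
  assumes "b \<in> Ob (prod_cat (poset_cat corner_pts) A)" "b \<notin> FO (par A cof_i) ` Ob (Src (par A cof_i))"
  shows "\<exists>a\<in>Ob A. b = Pr (Vx [False, True]) a"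
proof -
  obtain q a where b: "b = Pr (Vx q) a" "q \<in> corner_pts" "a \<in> Ob A" using assms(1) by auto
  have "FO (par A cof_i) (Pr (Vx [x]) a) \<in> FO (par A cof_i) ` Ob (Src (par A cof_i))" for x
    using b(3) by (intro imageI) (cases x; simp add: pts)
  moreover have "FO (par A cof_i) (Pr (Vx [x]) a) = Pr (Vx [x, False]) a" for x
    using b(3) by (cases x) (simp_all add: pts edges_FO)
  ultimately have "q \<noteq> [x, False]" for x using assms(2) b(1) by metis
  thus ?thesis using b by (auto simp: pts)
qed

lemma image_left_edge:
  assumes "b \<in> Ob (prod_cat (poset_cat corner_pts) A)" "b \<notin> FO (par A left_edge) ` Ob (Src (par A left_edge))"
  shows "\<exists>a\<in>Ob A. b = Pr (Vx [True, False]) a"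
proof -
  obtain q a where b: "b = Pr (Vx q) a" "q \<in> corner_pts" "a \<in> Ob A" using assms(1) by auto
  have "FO (par A left_edge) (Pr (Vx [False, x]) a) \<in> FO (par A left_edge) ` Ob (Src (par A left_edge))" for x
    using b(3) by (intro imageI) (cases x; simp)
  moreover have "FO (par A left_edge) (Pr (Vx [False, x]) a) = Pr (Vx [False, x]) a" for x
    using b(3) by (cases x) (simp_all add: edges_FO)
  ultimately have "q \<noteq> [False, x]" for x using assms(2) b(1) by metis
  thus ?thesis using b by (auto simp: pts)
qed

text \<open>The whole square with x, y, 0 and C at (0,0), (1,0), (0,1) and (1,1); \<open>cof\<close>
  and \<open>cone_arrow\<close> are two restrictions of it.\<close>

definition cofiber_square :: "'a scat \<Rightarrow> ('o, 'm, 'o, 'm) func" where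
  "cofiber_square A = comp_fun (lkan D (par A cof_corner)) (rkan D (par A cof_i))"

text \<open>
  \<open>x \<rightarrow> y\<close> is sent to \<open>0 \<rightarrow> C\<close>; this is the reflection onto the arrows with source \<open>0\<close>.
\<close>

definition cone_arrow :: "'a scat \<Rightarrow> ('o, 'm, 'o, 'm) func" where
  "cone_arrow A = comp_fun (V1 D (par A far_edge)) (cofiber_square A)"

lemma MF_cof: "MF (cof D) A = comp_fun (V1 D (par A cof_edge)) (cofiber_square A)"
  by (simp add: cof_def mcomp_def mres_def mlan_def mran_def cofiber_square_def)

context
  fixes A assumes A: "small_cat U A"
begin

lemmas small_par_edges = small_edges[THEN small_par[OF A]]

lemma cofiber_squareD:
  "is_functor (cofiber_square A)" "Src (cofiber_square A) = V0 D (prod_cat (cube 1) A)"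
  "Tgt (cofiber_square A) = V0 D (prod_cat (cube 2) A)"
  using functor_comp_fun[OF rkanD(1)[OF small_par_edges(1)] lkanD(1)[OF small_par_edges(2)]]
    rkanD(2,3)[OF small_par_edges(1)] lkanD(2,3)[OF small_par_edges(2)]
  by (simp_all add: cofiber_square_def)

lemma cofiber_square_Ob:
  "X \<in> Ob (V0 D (prod_cat (cube 1) A)) \<Longrightarrow> FO (cofiber_square A) X = FO (lkan D (par A cof_corner)) (FO (rkan D (par A cof_i)) X)"
  "X \<in> Ob (V0 D (prod_cat (cube 1) A)) \<Longrightarrow> FO (rkan D (par A cof_i)) X \<in> Ob (V0 D (prod_cat (poset_cat corner_pts) A))"
  "X \<in> Ob (V0 D (prod_cat (cube 1) A)) \<Longrightarrow> FO (cofiber_square A) X \<in> Ob (V0 D (prod_cat (cube 2) A))"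
  using functorD(3)[OF cofiber_squareD(1)] cofiber_squareD rkanD(2)[OF small_par_edges(1)] rkan_Ob[OF small_par_edges(1)]
  by (simp_all add: cofiber_square_def)

lemma cofiber_square_Hom:
  assumes f: "f \<in> Hom (V0 D (prod_cat (cube 1) A)) X Y"
  shows "FA (cofiber_square A) f = FA (lkan D (par A cof_corner)) (FA (rkan D (par A cof_i)) f)"
    "FA (rkan D (par A cof_i)) f \<in> Hom (V0 D (prod_cat (poset_cat corner_pts) A)) (FO (rkan D (par A cof_i)) X) (FO (rkan D (par A cof_i)) Y)"
    "FA (cofiber_square A) f \<in> Hom (V0 D (prod_cat (cube 2) A)) (FO (cofiber_square A) X) (FO (cofiber_square A) Y)"
  using functorD(4)[OF cofiber_squareD(1), of f X Y] cofiber_squareD rkanD(2)[OF small_par_edges(1)]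
    rkan_Hom[OF small_par_edges(1), of f X Y] f HomD(1)[OF f]
  by (simp_all add: cofiber_square_def)

lemma cone_arrowD:
  "is_functor (cone_arrow A)" "Src (cone_arrow A) = V0 D (prod_cat (cube 1) A)"
  "Tgt (cone_arrow A) = V0 D (prod_cat (cube 1) A)"
  using functor_comp_fun[OF cofiber_squareD(1) V1D(1)[OF small_par_edges(4)]]
    cofiber_squareD V1D(2,3)[OF small_par_edges(4)] by (simp_all add: cone_arrow_def)

lemma cof_functorD:
  "is_functor (MF (cof D) A)" "Src (MF (cof D) A) = V0 D (prod_cat (cube 1) A)"
  "Tgt (MF (cof D) A) = V0 D (prod_cat (cube 1) A)"
  using functor_comp_fun[OF cofiber_squareD(1) V1D(1)[OF small_par_edges(3)]]
    cofiber_squareD V1D(2,3)[OF small_par_edges(3)] by (simp_all add: MF_cof)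

text \<open>The vertex (0,1) lies below no vertex of the edge (0,0) -> (1,0), so
  \<open>rkan_zero_at\<close> applies.\<close>

lemma extension_by_zero:
  assumes X: "X \<in> Ob (V0 D (prod_cat (cube 1) A))" and a: "a \<in> Ob A"
  shows "zero_at (prod_cat (poset_cat corner_pts) A) (FO (rkan D (par A cof_i)) X) (Pr (Vx [False, True]) a)"
proof -
  have "zero_at (Tgt (par A cof_i)) (FO (rkan D (par A cof_i)) X) (Pr (Vx [False, True]) a)"
    by (rule rkan_zero_at[OF small_par_edges(1) _ _ no_arrow_cof_i[OF _ not_image_cof_i[OF a]]])
      (use X a in \<open>auto simp: pts\<close>)
  thus ?thesis by simp
qed

lemma cofiber_square_zero_at:
  assumes X: "X \<in> Ob (V0 D (prod_cat (cube 1) A))" and a: "a \<in> Ob A"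
  shows "zero_at (prod_cat (cube 2) A) (FO (cofiber_square A) X) (Pr (Vx [False, True]) a)"
  using lkan_zero_at_image[OF small_par_edges(2) fully_faithful_edges(2)[OF A], of "FO (rkan D (par A cof_i)) X" "Pr (Vx [False, True]) a"]
    extension_by_zero[OF X a] cofiber_square_Ob[OF X] a by (simp add: pts edges_FO)

lemma extension_iso_at:
  assumes f: "f \<in> Hom (V0 D (prod_cat (cube 1) A)) X Y" and a: "a \<in> Ob A"
  shows "iso_at (prod_cat (poset_cat corner_pts) A) (FA (rkan D (par A cof_i)) f) (Pr (Vx [x, False]) a) \<longleftrightarrow>
    iso_at (prod_cat (cube 1) A) f (Pr (Vx [x]) a)"
  using rkan_iso_at_image[OF small_par_edges(1) fully_faithful_edges(1)[OF A], of f X Y "Pr (Vx [x]) a"] f a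
  by (cases x) (simp_all add: pts edges_FO)

lemma extension_iso_at_zero:
  assumes f: "f \<in> Hom (V0 D (prod_cat (cube 1) A)) X Y" and a: "a \<in> Ob A"
  shows "iso_at (prod_cat (poset_cat corner_pts) A) (FA (rkan D (par A cof_i)) f) (Pr (Vx [False, True]) a)"
proof -
  have s: "small_cat U (prod_cat (cube 1) A)" "small_cat U (prod_cat (poset_cat corner_pts) A)"
    by (auto intro!: small_prod[OF universe _ A] small_poset[OF universe] simp: finite_pts)
  have "X \<in> Ob (V0 D (prod_cat (cube 1) A))" "Y \<in> Ob (V0 D (prod_cat (cube 1) A))"
    using Hom_Ob[OF category_V0[OF s(1)] f] by auto
  thus ?thesis
    using iso_at_zero[OF s(2) _ cofiber_square_Hom(2)[OF f]] extension_by_zero a by (simp add: pts)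
qed

lemma cofiber_square_iso_at_10:
  assumes f: "f \<in> Hom (V0 D (prod_cat (cube 1) A)) X Y" and a: "a \<in> Ob A"
  shows "iso_at (prod_cat (cube 2) A) (FA (cofiber_square A) f) (Pr (Vx [True, False]) a) \<longleftrightarrow>
    iso_at (prod_cat (cube 1) A) f (Pr (Vx [True]) a)"
  using lkan_iso_at_image[OF small_par_edges(2) fully_faithful_edges(2)[OF A], of "FA (rkan D (par A cof_i)) f" _ _ "Pr (Vx [True, False]) a"]
    cofiber_square_Hom[OF f] extension_iso_at[OF f a] a by (simp add: pts edges_FO)

text \<open>The cone at the parameter a depends on the corner at the same parameter. There
  \<open>i\<close> covers the vertices (0,0) and (1,0), and (0,1) carries zeros.\<close>

lemma cofiber_square_iso_at_11:
  assumes f: "f \<in> Hom (V0 D (prod_cat (cube 1) A)) X Y" and a: "a \<in> Ob A"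
    and i: "iso_at (prod_cat (cube 1) A) f (Pr (Vx [False]) a)" "iso_at (prod_cat (cube 1) A) f (Pr (Vx [True]) a)"
  shows "iso_at (prod_cat (cube 2) A) (FA (cofiber_square A) f) (Pr (Vx [True, True]) a)"
proof -
  have "iso_at (prod_cat (poset_cat corner_pts) A) (FA (rkan D (par A cof_i)) f) (Pr (Vx p) a)" if "p \<in> corner_pts" for p
    using that extension_iso_at[OF f a] extension_iso_at_zero[OF f a] i by (auto simp: corner_pts)
  thus ?thesis
    using lkan_par_poset_iso_at[OF small_edges(2)[unfolded cof_corner_def] A _ a cofiber_square_Hom(2)[OF f], of "[True, True]"]
      cofiber_square_Hom(1)[OF f] by (simp add: cof_corner_def pts)
qed

lemma cone_arrow_zero_at:
  assumes X: "X \<in> Ob (V0 D (prod_cat (cube 1) A))" and a: "a \<in> Ob A"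
  shows "zero_at (prod_cat (cube 1) A) (FO (cone_arrow A) X) (Pr (Vx [False]) a)"
  using zero_at_V1[OF small_par_edges(4), of "FO (cofiber_square A) X" "Pr (Vx [False]) a"] cofiber_square_zero_at[OF X a]
    cofiber_square_Ob[OF X] cofiber_squareD X a by (simp add: cone_arrow_def pts edges_FO)

lemma cone_arrow_iso_at:
  assumes f: "f \<in> Hom (V0 D (prod_cat (cube 1) A)) X Y" and a: "a \<in> Ob A"
  shows "iso_at (prod_cat (cube 1) A) (FA (cone_arrow A) f) (Pr (Vx [True]) a) \<longleftrightarrow>
    iso_at (prod_cat (cube 2) A) (FA (cofiber_square A) f) (Pr (Vx [True, True]) a)"
  using iso_at_V1[OF small_par_edges(4), of "FA (cofiber_square A) f" _ _ "Pr (Vx [True]) a"]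
    cofiber_square_Hom[OF f] cofiber_squareD HomD(1)[OF f] a by (simp add: cone_arrow_def pts edges_FO)

lemma cof_iso_at:
  assumes f: "f \<in> Hom (V0 D (prod_cat (cube 1) A)) X Y" and a: "a \<in> Ob A"
  shows "iso_at (prod_cat (cube 1) A) (FA (MF (cof D) A) f) (Pr (Vx [x]) a) \<longleftrightarrow>
    iso_at (prod_cat (cube 2) A) (FA (cofiber_square A) f) (Pr (Vx [True, x]) a)"
  using iso_at_V1[OF small_par_edges(3), of "FA (cofiber_square A) f" _ _ "Pr (Vx [x]) a"]
    cofiber_square_Hom[OF f] cofiber_squareD HomD(1)[OF f] a by (cases x) (simp_all add: MF_cof pts edges_FO)

text \<open>The assumptions concern a single parameter a, so X need not be a zero object. The arrow
  from a zero object to X is invertible at both vertices over a, and its image under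
  \<open>cone_arrow\<close> is then invertible at the vertex 1.\<close>

lemma cone_arrow_zero_at_1:
  assumes X: "X \<in> Ob (V0 D (prod_cat (cube 1) A))" and a: "a \<in> Ob A"
    and z: "zero_at (prod_cat (cube 1) A) X (Pr (Vx [False]) a)" "zero_at (prod_cat (cube 1) A) X (Pr (Vx [True]) a)"
  shows "zero_at (prod_cat (cube 1) A) (FO (cone_arrow A) X) (Pr (Vx [True]) a)"
proof -
  have s: "small_cat U (prod_cat (cube 1) A)"
    by (auto intro!: small_prod[OF universe _ A] small_poset[OF universe] simp: finite_pts)
  note C = category_V0[OF s]
  have ob: "Pr (Vx [False]) a \<in> Ob (prod_cat (cube 1) A)" "Pr (Vx [True]) a \<in> Ob (prod_cat (cube 1) A)"
    using a by (auto simp: pts)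
  obtain o' where o: "zero_object (V0 D (prod_cat (cube 1) A)) o'" using ex_zero[OF s] by auto
  obtain f where f: "f \<in> Hom (V0 D (prod_cat (cube 1) A)) o' X" using zero_objectD(2)[OF o X] by auto
  have "iso_at (prod_cat (cube 1) A) f (Pr (Vx [False]) a)" "iso_at (prod_cat (cube 1) A) f (Pr (Vx [True]) a)"
    using iso_at_zero[OF s ob(1) f zero_object_zero_at[OF s o ob(1)] z(1)]
      iso_at_zero[OF s ob(2) f zero_object_zero_at[OF s o ob(2)] z(2)] by auto
  hence i: "iso_at (prod_cat (cube 1) A) (FA (cone_arrow A) f) (Pr (Vx [True]) a)"
    using cone_arrow_iso_at[OF f a] cofiber_square_iso_at_11[OF f a] by simp
  have oo: "o' \<in> Ob (V0 D (prod_cat (cube 1) A))" using zero_objectD(1)[OF o] .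
  have "zero_object (V0 D (prod_cat (cube 2) A)) (FO (cofiber_square A) o')"
    using lkan_zero[OF small_par_edges(2)] rkan_zero[OF small_par_edges(1)] o cofiber_square_Ob(1)[OF oo] by simp
  hence zo: "zero_object (V0 D (prod_cat (cube 1) A)) (FO (cone_arrow A) o')"
    using V1_zero[OF small_par_edges(4)] oo cofiber_squareD by (simp add: cone_arrow_def)
  have cf: "FA (cone_arrow A) f \<in> Hom (V0 D (prod_cat (cube 1) A)) (FO (cone_arrow A) o') (FO (cone_arrow A) X)"
    using functorD(4)[OF cone_arrowD(1), of f] f cone_arrowD by simp
  show ?thesis using zero_at_iso[OF s ob(2) cf i] zero_object_zero_at[OF s zo ob(2)] by simp
qed

lemma local_at_cofiber_square:
  assumes h: "h \<in> Hom (V0 D (prod_cat (cube 1) A)) X Y" and Z: "Z \<in> Ob (V0 D (prod_cat (cube 2) A))"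
  shows "local_at (V0 D (prod_cat (cube 2) A)) (FA (cofiber_square A) h) Z \<longleftrightarrow>
    local_at (V0 D (prod_cat (poset_cat corner_pts) A)) (FA (rkan D (par A cof_i)) h) (FO (V1 D (par A cof_corner)) Z)"
  using local_at_lkan[OF small_par_edges(2), of "FA (rkan D (par A cof_i)) h"] cofiber_square_Hom[OF h] Z by simp

text \<open>A chain of adjunctions. For V with source zero, arrows from 0 -> C to V are arrows from
  the cofiber square to the square that repeats V in the second coordinate, hence arrows from the
  corner to the restriction of that square. This restriction vanishes at (0,1), so it is the
  extension by zero of V, and what remains are the arrows from x -> y to V.\<close>

lemma local_at_cone_arrow:
  assumes h: "h \<in> Hom (V0 D (prod_cat (cube 1) A)) X Y" and V: "V \<in> Ob (V0 D (prod_cat (cube 1) A))"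
    and z: "\<And>a. a \<in> Ob A \<Longrightarrow> zero_at (prod_cat (cube 1) A) V (Pr (Vx [False]) a)"
  shows "local_at (V0 D (prod_cat (cube 1) A)) (FA (cone_arrow A) h) V \<longleftrightarrow> local_at (V0 D (prod_cat (cube 1) A)) h V"
proof -
  let ?C1 = "V0 D (prod_cat (cube 1) A)" and ?C2 = "V0 D (prod_cat (cube 2) A)" and ?Cc = "V0 D (prod_cat (poset_cat corner_pts) A)"
  have sc: "small_cat U (prod_cat (poset_cat corner_pts) A)"
    by (auto intro!: small_prod[OF universe _ A] small_poset[OF universe] simp: finite_pts)
  let ?Q = "FO (V1 D (par A fst_coord)) V"
  let ?V = "FO (V1 D (par A cof_corner)) ?Q"
  have Q: "?Q \<in> Ob ?C2" using V1_Ob[OF small_par_edges(6)] V by simp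
  have V': "?V \<in> Ob ?Cc" using V1_Ob[OF small_par_edges(2)] Q by simp
  \<comment> \<open>The projection to the first coordinate, restricted to the corner and then to the
    edge (0,0) -> (1,0), is the identity, so V comes back on the nose.\<close>
  have iV: "FO (V1 D (par A cof_i)) ?V = V"
  proof -
    have c: "comp_fun (comp_fun fst_coord cof_corner) cof_i = (id_fun (cube 1) :: 'a sfun)"
    proof -
      have e: "comp_fun fst_coord cof_corner = (poset_fun corner_pts (cube_pts 1) (\<lambda>p. [p ! 0]) :: 'a sfun)"
        unfolding fst_coord_def cof_corner_def by (rule poset_fun_comp) (auto simp: pts)
      have "comp_fun (comp_fun fst_coord cof_corner) cof_i =
          (poset_fun (cube_pts 1) (cube_pts 1) (\<lambda>p. [[p ! 0, False] ! 0]) :: 'a sfun)"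
        unfolding e cof_i_def by (rule poset_fun_comp) (auto simp: pts)
      also have "\<dots> = poset_fun (cube_pts 1) (cube_pts 1) (\<lambda>p. p)" by (rule poset_fun_cong) (auto simp: pts)
      finally show ?thesis by (simp add: poset_fun_id)
    qed
    have "?V = FO (V1 D (par A (comp_fun fst_coord cof_corner))) V"
      using V1_par_comp_Ob[OF A small_edges(2,6), of V] V by simp
    also have "FO (V1 D (par A cof_i)) \<dots> = FO (V1 D (par A (comp_fun (comp_fun fst_coord cof_corner) cof_i))) V"
      using V1_par_comp_Ob[OF A small_edges(1) small_comp[OF small_edges(2,6)], of V] V by simp
    also have "\<dots> = V"
      using V V1_id_fun[of "prod_cat (cube 1) A"] small_prod[OF universe small_poset[OF universe finite_cube_pts] A]
      by (simp add: c prod_fun_id category_poset small_catD[OF A])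
    finally show ?thesis .
  qed
  have "local_at ?C1 (FA (cone_arrow A) h) V \<longleftrightarrow> local_at ?C1 (FA (V1 D (par A far_edge)) (FA (cofiber_square A) h)) V"
    using HomD(1)[OF h] cofiber_squareD by (simp add: cone_arrow_def)
  also have "\<dots> \<longleftrightarrow> local_at ?C2 (FA (cofiber_square A) h) ?Q"
    unfolding far_edge_def fst_coord_def
    by (rule local_at_par_poset_reflection[OF A finite_pts(1) finite_pts(1) functor_edges(6) functor_edges(4) _ _
          cofiber_square_Hom(3)[OF h] V]) (auto simp: pts)
  also have "\<dots> \<longleftrightarrow> local_at ?Cc (FA (rkan D (par A cof_i)) h) ?V"
    using local_at_cofiber_square[OF h Q] .
  \<comment> \<open>Here the vanishing of V at its source enters: \<open>?V\<close> is zero at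
    (0,1), so the unit of extension by zero is invertible at it.\<close>
  also have "\<dots> \<longleftrightarrow> local_at ?Cc (FA (rkan D (par A cof_i)) h) (FO (rkan D (par A cof_i)) (FO (V1 D (par A cof_i)) ?V))"
  proof (rule local_at_target[OF category_V0[OF sc] cofiber_square_Hom(2)[OF h]])
    show "NC (rkan_unit D (par A cof_i)) ?V \<in> Hom ?Cc ?V (FO (rkan D (par A cof_i)) (FO (V1 D (par A cof_i)) ?V))"
      using rkan_unit(1)[OF small_par_edges(1)] V' by simp
    have zz: "zero_at (prod_cat (poset_cat corner_pts) A) ?V (Pr (Vx [False, True]) a)" if a: "a \<in> Ob A" for a
      using zero_at_V1[OF small_par_edges(2), of ?Q "Pr (Vx [False, True]) a"] Q a
        zero_at_V1[OF small_par_edges(6), of V "Pr (Vx [False, True]) a"] V z[OF a] by (simp add: pts edges_FO)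
    have "invertible (V0 D (Tgt (par A cof_i))) (NC (rkan_unit D (par A cof_i)) ?V)"
    proof (rule rkan_unit_invertible[OF small_par_edges(1) fully_faithful_edges(1)[OF A] _ no_arrow_cof_i])
      fix b assume "b \<in> Ob (Tgt (par A cof_i))" "b \<notin> FO (par A cof_i) ` Ob (Src (par A cof_i))"
      then show "zero_at (Tgt (par A cof_i)) ?V b" using image_cof_i[of b A] zz by auto
    qed (use V' in auto)
    thus "invertible ?Cc (NC (rkan_unit D (par A cof_i)) ?V)" by simp
  qed
  also have "\<dots> \<longleftrightarrow> local_at ?C1 (FA (V1 D (par A cof_i)) (FA (rkan D (par A cof_i)) h)) V"
    using local_at_rkan[OF small_par_edges(1), of "FA (rkan D (par A cof_i)) h" _ _ V] cofiber_square_Hom(2)[OF h] V iV by simp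
  also have "\<dots> \<longleftrightarrow> local_at ?C1 h V"
    using local_at_rkan_counit[OF small_par_edges(1) fully_faithful_edges(1)[OF A], of h X Y V] h by simp
  finally show ?thesis .
qed

text \<open>
  The cofiber of \<open>y \<rightarrow> C\<close> depends only on \<open>x\<close>: maps out of it are maps from \<open>(x \<rightarrow> y, x \<rightarrow> 0)\<close> into
  an object that vanishes except at \<open>(0, 1)\<close>, and such an object is right Kan extended from the
  edge \<open>(0, 0) \<rightarrow> (0, 1)\<close>.
\<close>

lemma cof_cof_iso_at:
  assumes h: "h \<in> Hom (V0 D (prod_cat (cube 1) A)) X Y"
    and i: "\<And>a. a \<in> Ob A \<Longrightarrow> iso_at (prod_cat (cube 1) A) h (Pr (Vx [False]) a)" and a: "a \<in> Ob A"
  shows "iso_at (prod_cat (cube 1) A) (FA (MF (cof D) A) (FA (MF (cof D) A) h)) (Pr (Vx [True]) a)"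
proof -
  let ?C1 = "V0 D (prod_cat (cube 1) A)" and ?C2 = "V0 D (prod_cat (cube 2) A)" and ?Cc = "V0 D (prod_cat (poset_cat corner_pts) A)"
  let ?P = "{[False, False], [False, True]}"
  let ?Ce = "V0 D (prod_cat (poset_cat ?P) A)"
  have sc: "small_cat U (prod_cat (poset_cat corner_pts) A)" "small_cat U (prod_cat (poset_cat ?P) A)" "small_cat U (prod_cat (cube 1) A)"
    by (auto intro!: small_prod[OF universe _ A] small_poset[OF universe] simp: finite_pts)
  let ?h = "FA (MF (cof D) A) h" and ?ih = "FA (rkan D (par A cof_i)) h" and ?b = "V1 D (par A left_edge)"
  note ih = cofiber_square_Hom(2)[OF h]
  have h': "?h \<in> Hom ?C1 (FO (MF (cof D) A) X) (FO (MF (cof D) A) Y)"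
    using functorD(4)[OF cof_functorD(1), of h X Y] cof_functorD h by simp
  have ch': "FA (cone_arrow A) ?h \<in> Hom ?C1 (FO (cone_arrow A) (FO (MF (cof D) A) X)) (FO (cone_arrow A) (FO (MF (cof D) A) Y))"
    using functorD(4)[OF cone_arrowD(1), of ?h] cone_arrowD h' by simp
  have bih: "FA ?b ?ih \<in> Hom ?Ce (FO ?b (FO (rkan D (par A cof_i)) X)) (FO ?b (FO (rkan D (par A cof_i)) Y))"
    using V1_Hom[OF small_par_edges(8)] ih by simp
  have "iso_at (prod_cat (poset_cat ?P) A) (FA ?b ?ih) x" if x: "x \<in> Ob (prod_cat (poset_cat ?P) A)" for x
  proof -
    obtain y a where e: "x = Pr (Vx [False, y]) a" "a \<in> Ob A" using x by auto
    have "iso_at (prod_cat (poset_cat corner_pts) A) ?ih (Pr (Vx [False, y]) a)"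
      using extension_iso_at[OF h e(2)] extension_iso_at_zero[OF h e(2)] i[OF e(2)] by (cases y) auto
    thus ?thesis using iso_at_V1[OF small_par_edges(8), of ?ih _ _ x] ih x e by (simp add: edges_FO)
  qed
  \<comment> \<open>The left edge carries x -> 0: invertibility at x is assumption \<open>i\<close>,
    and the other vertex is zero.\<close>
  hence inv: "invertible ?Ce (FA ?b ?ih)" using invertible_iff[OF sc(2) bih] by blast
  have loc: "local_at ?C1 (FA (cone_arrow A) ?h) V"
    if V: "V \<in> Ob ?C1" and z: "\<And>a. a \<in> Ob A \<Longrightarrow> zero_at (prod_cat (cube 1) A) V (Pr (Vx [False]) a)" for V
  proof -
    \<comment> \<open>\<open>?L\<close> is V in the second coordinate and constant in the first. Its
      restriction \<open>?J\<close> to the corner is zero at (0,0) and (1,0) and has the target of V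
      at (0,1).\<close>
    let ?L = "FO (V1 D (par A snd_coord)) V"
    let ?J = "FO (V1 D (par A cof_corner)) ?L"
    have L: "?L \<in> Ob ?C2" using V1_Ob[OF small_par_edges(7)] V by simp
    have J: "?J \<in> Ob ?Cc" using V1_Ob[OF small_par_edges(2)] L by simp
    have bJ: "FO ?b ?J \<in> Ob ?Ce" using V1_Ob[OF small_par_edges(8)] J by simp
    have zz: "zero_at (prod_cat (poset_cat corner_pts) A) ?J (Pr (Vx [True, False]) a)" if a: "a \<in> Ob A" for a
      using zero_at_V1[OF small_par_edges(2), of ?L "Pr (Vx [True, False]) a"] L a
        zero_at_V1[OF small_par_edges(7), of V "Pr (Vx [True, False]) a"] V z[OF a] by (simp add: pts edges_FO)
    have "local_at ?Ce (FA ?b ?ih) (FO ?b ?J)"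
      using local_at_invertible[OF category_V0[OF sc(2)] bih inv] .
    hence "local_at ?Cc ?ih (FO (rkan D (par A left_edge)) (FO ?b ?J))"
      using local_at_rkan[OF small_par_edges(8), of ?ih] ih bJ by simp
    moreover have "local_at ?Cc ?ih ?J \<longleftrightarrow> local_at ?Cc ?ih (FO (rkan D (par A left_edge)) (FO ?b ?J))"
    proof (rule local_at_target[OF category_V0[OF sc(1)] ih])
      show "NC (rkan_unit D (par A left_edge)) ?J \<in> Hom ?Cc ?J (FO (rkan D (par A left_edge)) (FO ?b ?J))"
        using rkan_unit(1)[OF small_par_edges(8)] J by simp
      have "invertible (V0 D (Tgt (par A left_edge))) (NC (rkan_unit D (par A left_edge)) ?J)"
      proof (rule rkan_unit_invertible[OF small_par_edges(8) fully_faithful_edges(3)[OF A] _ no_arrow_left_edge])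
        fix b assume "b \<in> Ob (Tgt (par A left_edge))" "b \<notin> FO (par A left_edge) ` Ob (Src (par A left_edge))"
        then show "zero_at (Tgt (par A left_edge)) ?J b" using image_left_edge[of b A] zz by auto
      qed (use J in auto)
      thus "invertible ?Cc (NC (rkan_unit D (par A left_edge)) ?J)" by simp
    qed
    ultimately have "local_at ?C2 (FA (cofiber_square A) h) ?L"
      using local_at_cofiber_square[OF h L] by simp
    moreover have "local_at ?C1 (FA (V1 D (par A cof_edge)) (FA (cofiber_square A) h)) V \<longleftrightarrow> local_at ?C2 (FA (cofiber_square A) h) ?L"
      unfolding cof_edge_def snd_coord_def
      by (rule local_at_par_poset_reflection[OF A finite_pts(1) finite_pts(1) functor_edges(7) functor_edges(3) _ _
          cofiber_square_Hom(3)[OF h] V]) (auto simp: pts)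
    ultimately have "local_at ?C1 ?h V"
      using HomD(1)[OF h] cofiber_squareD by (simp add: MF_cof)
    thus ?thesis using local_at_cone_arrow[OF h' V z] by simp
  qed
  have ob: "FO (MF (cof D) A) X \<in> Ob ?C1" "FO (MF (cof D) A) Y \<in> Ob ?C1"
    using Hom_Ob[OF category_V0[OF sc(3)] h'] by auto
  \<comment> \<open>Source and target of the arrow are themselves values of
    \<open>cone_arrow\<close>, so they vanish at 0 and are admissible as V.\<close>
  have "invertible ?C1 (FA (cone_arrow A) ?h)"
    by (rule invertible_local_at[OF category_V0[OF sc(3)] ch' loc loc])
      (use Hom_Ob[OF category_V0[OF sc(3)] ch'] cone_arrow_zero_at ob in auto)
  hence "iso_at (prod_cat (cube 1) A) (FA (cone_arrow A) ?h) (Pr (Vx [True]) a)"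
    using invertible_iff[OF sc(3) ch'] a by (simp add: pts)
  thus ?thesis using cone_arrow_iso_at[OF h' a] cof_iso_at[OF h' a] by simp
qed

text \<open>Every vertex of the square lies below (1,1), which gives a transformation from u to
  \<open>top_vertex\<close>; by \<open>k\<close> it is an identity at the end point of u.\<close>

lemma top_comparison:
  fixes u :: "'a sfun"
  assumes u: "u = poset_fun (cube_pts 1) (cube_pts 2) k" and ku: "is_functor u" and k: "k [True] = [True, True]"
    and W: "W \<in> Ob (V0 D (prod_cat (cube 2) A))"
  shows "\<exists>f. f \<in> Hom (V0 D (prod_cat (cube 1) A)) (FO (V1 D (par A u)) W) (FO (V1 D (par A top_vertex)) W) \<and>
    (\<forall>a\<in>Ob A. iso_at (prod_cat (cube 1) A) f (Pr (Vx [True]) a))"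
proof -
  let ?n = "poset_nt (cube_pts 1) (cube_pts 2) k (\<lambda>p. [True, True]) :: 'a snt"
  let ?\<theta> = "prod_nt ?n (id_nt (id_fun A))"
  note cA = small_catD[OF A]
  have kc: "k p \<in> cube_pts 2" if "p \<in> cube_pts 1" for p
    using functorD(3)[OF ku, of "Vx p"] u that by (auto simp: image_iff)
  have kl: "list_all2 (\<le>) q [True, True]" if "q \<in> cube_pts 2" for q
    using that by (auto simp: cube_pts_2)
  have "is_nt ?n"
    by (rule nt_poset_nt) (use ku u kl[OF kc] functor_edges(5) in auto)
  hence n: "is_nt ?\<theta>" by (rule nt_prod[OF _ nt_id_nt[OF functor_id_fun[OF cA]]])
  have su: "small_fun U u" using small_poset_fun ku u finite_pts by simp
  have S: "NSrc ?\<theta> = par A u" "NTgt ?\<theta> = par A top_vertex" using u by (auto simp: top_vertex_def)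
  have sn: "small_nt U ?\<theta>" unfolding small_nt_def S using n small_par[OF A su] small_par_edges(5) by simp
  have uS: "Src u = cube 1" "Tgt u = cube 2" using u by auto
  have W': "W \<in> Ob (V0 D (Tgt (par A u)))" using W uS by simp
  have "iso_at (prod_cat (cube 1) A) (NC (V2 D ?\<theta>) W) (Pr (Vx [True]) a)" if a: "a \<in> Ob A" for a
  proof -
    have x: "Pr (Vx [True]) a \<in> Ob (Src (par A u))" using a uS by (simp add: pts)
    have uT: "FO u (Vx [True]) = Vx [True, True]" using u k by (simp add: pts)
    have T1: "[True] \<in> cube_pts 1" "[True, True] \<in> cube_pts 2" by (simp_all add: pts)
    have nT: "NC ?n (Vx [True]) = Pr (Vx [True, True]) (Vx [True, True])" using T1 k by simp
    have "iso_at (Src (par A u)) (NC (V2 D ?\<theta>) W) (Pr (Vx [True]) a)"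
    proof (rule V2_iso_at[OF sn, unfolded S])
      show "FO (par A top_vertex) (Pr (Vx [True]) a) = FO (par A u) (Pr (Vx [True]) a)"
        using a uS T1 uT by (simp add: edges_FO)
      show "NC ?\<theta> (Pr (Vx [True]) a) = Id (Tgt (par A u)) (FO (par A u) (Pr (Vx [True]) a))"
        using a uS T1 uT nT by simp
    qed (use x W' in simp_all)
    thus ?thesis using uS by simp
  qed
  moreover have "NC (V2 D ?\<theta>) W \<in> Hom (V0 D (prod_cat (cube 1) A)) (FO (V1 D (par A u)) W) (FO (V1 D (par A top_vertex)) W)"
    using V2_Hom[OF sn, of W, unfolded S] W' uS by simp
  ultimately show ?thesis by blast
qed

text \<open>The edges carrying y -> C and 0 -> C have incomparable sources, so neither edge maps to
  the other. Both map to the constant edge at (1,1), by arrows that are invertible at the common end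
  point.\<close>

lemma cof_cone_arrow_comparison:
  assumes X: "X \<in> Ob (V0 D (prod_cat (cube 1) A))"
  shows "\<exists>V f g. f \<in> Hom (V0 D (prod_cat (cube 1) A)) (FO (MF (cof D) A) X) V \<and>
    g \<in> Hom (V0 D (prod_cat (cube 1) A)) (FO (cone_arrow A) X) V \<and>
    (\<forall>a\<in>Ob A. iso_at (prod_cat (cube 1) A) f (Pr (Vx [True]) a) \<and> iso_at (prod_cat (cube 1) A) g (Pr (Vx [True]) a))"
proof -
  note W = cofiber_square_Ob(3)[OF X]
  obtain f where f: "f \<in> Hom (V0 D (prod_cat (cube 1) A)) (FO (V1 D (par A cof_edge)) (FO (cofiber_square A) X))
      (FO (V1 D (par A top_vertex)) (FO (cofiber_square A) X))"
    "\<forall>a\<in>Ob A. iso_at (prod_cat (cube 1) A) f (Pr (Vx [True]) a)"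
    using top_comparison[OF cof_edge_def functor_edges(3)[folded cof_edge_def] _ W] by auto
  obtain g where g: "g \<in> Hom (V0 D (prod_cat (cube 1) A)) (FO (V1 D (par A far_edge)) (FO (cofiber_square A) X))
      (FO (V1 D (par A top_vertex)) (FO (cofiber_square A) X))"
    "\<forall>a\<in>Ob A. iso_at (prod_cat (cube 1) A) g (Pr (Vx [True]) a)"
    using top_comparison[OF far_edge_def functor_edges(4)[folded far_edge_def] _ W] by auto
  show ?thesis
    by (rule exI[of _ "FO (V1 D (par A top_vertex)) (FO (cofiber_square A) X)"], rule exI[of _ f], rule exI[of _ g])
      (use f g X cofiber_squareD in \<open>simp add: MF_cof cone_arrow_def\<close>)
qed

end

end

section \<open>Stability and permutation of factors\<close>

lemma naturally_isomorphic_nat_iso: "is_nat_iso \<alpha> \<Longrightarrow> naturally_isomorphic (NSrc \<alpha>) (NTgt \<alpha>)"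
  unfolding is_nat_iso_def naturally_isomorphic_def
  using ntD(1-4)[of \<alpha>] ntD(5,6)[of \<alpha>] by (intro conjI exI[of _ "NC \<alpha>"]) auto

lemma shift_simps [simp]:
  "V0 (shift A D) B = V0 D (prod_cat A B)" "V1 (shift A D) u = V1 D (prod_fun (id_fun A) u)"
  by (simp_all add: shift_def)

text \<open>\<open>lkan_data\<close> depends on the derivator and on u only through the value of
  \<open>V1\<close>, so the arbitrary choices for the shifted derivator and for D literally
  coincide.\<close>

lemma lkan_shift: "lkan (shift A D) u = lkan D (prod_fun (id_fun A) u)"
  by (simp add: lkan_def lkan_data_def)

lemma rkan_shift: "rkan (shift A D) u = rkan D (prod_fun (id_fun A) u)"
  by (simp add: rkan_def rkan_data_def)

text \<open>One term serves for objects and for arrows, because both are coded by nested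
  pairs.\<close>

definition swap_fun :: "'a scat \<Rightarrow> 'a scat \<Rightarrow> 'a scat \<Rightarrow> 'a sfun" where
  "swap_fun A S B =
     mk_fun (prod_cat A (prod_cat S B)) (prod_cat S (prod_cat A B))
       (\<lambda>x. Pr (pfst (psnd x)) (Pr (pfst x) (psnd (psnd x)))) (\<lambda>x. Pr (pfst (psnd x)) (Pr (pfst x) (psnd (psnd x))))"

lemma swap_fun_simps [simp]:
  "Src (swap_fun A S B) = prod_cat A (prod_cat S B)" "Tgt (swap_fun A S B) = prod_cat S (prod_cat A B)"
  "a \<in> Ob A \<Longrightarrow> s \<in> Ob S \<Longrightarrow> b \<in> Ob B \<Longrightarrow> FO (swap_fun A S B) (Pr a (Pr s b)) = Pr s (Pr a b)"
  "f \<in> Ar A \<Longrightarrow> g \<in> Ar S \<Longrightarrow> h \<in> Ar B \<Longrightarrow> FA (swap_fun A S B) (Pr f (Pr g h)) = Pr g (Pr f h)"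
  by (simp_all add: swap_fun_def Ar_prod)

lemma functor_swap:
  assumes A: "category A" and S: "category S" and B: "category B"
  shows "is_functor (swap_fun A S B)"
  unfolding swap_fun_def
proof (rule functorI)
  fix f g assume f: "f \<in> Ar (prod_cat A (prod_cat S B))" and g: "g \<in> Ar (prod_cat A (prod_cat S B))"
    and fg: "Cod (prod_cat A (prod_cat S B)) f = Dom (prod_cat A (prod_cat S B)) g"
  obtain f1 f2 f3 where ef: "f = Pr f1 (Pr f2 f3)" "f1 \<in> Ar A" "f2 \<in> Ar S" "f3 \<in> Ar B" using f by (auto simp: Ar_prod)
  obtain g1 g2 g3 where eg: "g = Pr g1 (Pr g2 g3)" "g1 \<in> Ar A" "g2 \<in> Ar S" "g3 \<in> Ar B" using g by (auto simp: Ar_prod)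
  have c: "Cod A f1 = Dom A g1" "Cod S f2 = Dom S g2" "Cod B f3 = Dom B g3"
    using fg ef eg by (auto simp: Ar_prod)
  show "Pr (pfst (psnd (Cmp (prod_cat A (prod_cat S B)) g f)))
        (Pr (pfst (Cmp (prod_cat A (prod_cat S B)) g f)) (psnd (psnd (Cmp (prod_cat A (prod_cat S B)) g f)))) =
      Cmp (prod_cat S (prod_cat A B)) (Pr (pfst (psnd g)) (Pr (pfst g) (psnd (psnd g)))) (Pr (pfst (psnd f)) (Pr (pfst f) (psnd (psnd f))))"
    using ef eg c by (simp add: Ar_prod)
qed (use A S B in \<open>auto intro!: category_prod simp: Ar_prod Ar_Hom\<close>)

lemma swap_swap:
  assumes "category A" "category S" "category B"
  shows "comp_fun (swap_fun S A B) (swap_fun A S B) = id_fun (prod_cat A (prod_cat S B))"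
  by (rule functor_eqI)
    (use assms in \<open>auto intro!: functor_comp_fun functor_swap functor_id_fun category_prod simp: Ar_prod\<close>)

lemma swap_natural:
  assumes A: "category A" and B: "category B" and u: "is_functor u"
  shows "comp_fun (swap_fun A (Tgt u) B) (prod_fun (id_fun A) (prod_fun u (id_fun B))) =
     comp_fun (prod_fun u (id_fun (prod_cat A B))) (swap_fun A (Src u) B)"
proof -
  note C = functorD(1,2)[OF u]
  show ?thesis
    by (rule functor_eqI)
      (use assms C functorD(3)[OF u] functor_Ar[OF u] in \<open>auto intro!: functor_comp_fun functor_swap functor_prod functor_id_fun category_prod
        simp: Ar_prod\<close>)
qed

section \<open>Deleting and inserting a coordinate of a cube\<close>

lemma length_del_coord: "i < n \<Longrightarrow> length p = n \<Longrightarrow> length (del_coord i p) = n - 1"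
  by (auto simp: del_coord_def)

lemma del_coord_mono: "list_all2 (\<le>) p q \<Longrightarrow> list_all2 (\<le>) (del_coord i p) (del_coord i q)"
  by (auto simp: del_coord_def intro!: list_all2_appendI list_all2_takeI list_all2_dropI)

lemma length_ins_coord: "i < n \<Longrightarrow> length p = n - 1 \<Longrightarrow> length b = 1 \<Longrightarrow> length (ins_coord i b p) = n"
  by (auto simp: ins_coord_def)

lemma ins_coord_mono:
  "list_all2 (\<le>) p q \<Longrightarrow> list_all2 (\<le>) b c \<Longrightarrow> list_all2 (\<le>) (ins_coord i b p) (ins_coord i c q)"
  by (auto simp: ins_coord_def intro!: list_all2_appendI list_all2_takeI list_all2_dropI)

lemma ins_del_coord: "i < length p \<Longrightarrow> ins_coord i [x] (del_coord i p) = p[i := x]"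
  by (simp add: ins_coord_def del_coord_def upd_conv_take_nth_drop)

lemma del_ins_coord: "i \<le> length p \<Longrightarrow> del_coord i (ins_coord i [x] p) = p" "i \<le> length p \<Longrightarrow> ins_coord i [x] p ! i = x"
  by (simp_all add: ins_coord_def del_coord_def nth_append)

lemma split_cube_simps:
  "Src (split_cube n i B) = prod_cat (cube n) B" "Tgt (split_cube n i B) = prod_cat (cube (n - 1)) (prod_cat (cube 1) B)"
  "p \<in> cube_pts n \<Longrightarrow> b \<in> Ob B \<Longrightarrow> FO (split_cube n i B) (Pr (Vx p) b) = Pr (Vx (del_coord i p)) (Pr (Vx [p ! i]) b)"
  "p \<in> cube_pts n \<Longrightarrow> q \<in> cube_pts n \<Longrightarrow> list_all2 (\<le>) p q \<Longrightarrow> g \<in> Ar B \<Longrightarrow> FA (split_cube n i B) (Pr (Pr (Vx p) (Vx q)) g) =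
     Pr (Pr (Vx (del_coord i p)) (Vx (del_coord i q))) (Pr (Pr (Vx [p ! i]) (Vx [q ! i])) g)"
  by (simp_all add: split_cube_def Ar_prod Ar_poset vmap_def emap_def)

lemma merge_cube_simps:
  "Src (merge_cube n i B) = prod_cat (cube (n - 1)) (prod_cat (cube 1) B)" "Tgt (merge_cube n i B) = prod_cat (cube n) B"
  "p \<in> cube_pts (n - 1) \<Longrightarrow> x \<in> cube_pts 1 \<Longrightarrow> b \<in> Ob B \<Longrightarrow>
     FO (merge_cube n i B) (Pr (Vx p) (Pr (Vx x) b)) = Pr (Vx (ins_coord i x p)) b"
  "p \<in> cube_pts (n - 1) \<Longrightarrow> q \<in> cube_pts (n - 1) \<Longrightarrow> list_all2 (\<le>) p q \<Longrightarrow> x \<in> cube_pts 1 \<Longrightarrow> y \<in> cube_pts 1 \<Longrightarrow>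
     list_all2 (\<le>) x y \<Longrightarrow> g \<in> Ar B \<Longrightarrow> FA (merge_cube n i B) (Pr (Pr (Vx p) (Vx q)) (Pr (Pr (Vx x) (Vx y)) g)) =
     Pr (Pr (Vx (ins_coord i x p)) (Vx (ins_coord i y q))) g"
  by (simp_all add: merge_cube_def merge_vx_def Ar_prod Ar_poset)

lemma functor_split_cube:
  assumes B: "category B" and i: "i < n"
  shows "is_functor (split_cube n i B)"
proof -
  let ?s = "split_cube n i B" and ?S = "prod_cat (cube n) B" and ?T = "prod_cat (cube (n - 1)) (prod_cat (cube 1) B)"
  \<comment> \<open>\<open>functorI\<close> is applied to the evaluated maps of \<open>?s\<close>,
    so that \<open>split_cube_simps\<close> can compute them. Restricting them to their domain once
    more changes nothing, which gives back \<open>?s\<close>.\<close>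
  have "is_functor (mk_fun ?S ?T (FO ?s) (FA ?s))"
  proof (rule functorI)
    have d: "del_coord i p \<in> cube_pts (n - 1)" "[p ! i] \<in> cube_pts 1" if "p \<in> cube_pts n" for p
      using that length_del_coord[OF i] by (auto simp: cube_pts_def)
    have l: "p ! i \<le> q ! i" if "p \<in> cube_pts n" "list_all2 (\<le>) p q" for p q
      using list_all2_nthD[OF that(2), of i] that(1) i by (simp add: cube_pts_def)
    show "FO ?s x \<in> Ob ?T" if "x \<in> Ob ?S" for x
      using that d by (auto simp: split_cube_simps)
    show "FA ?s f \<in> Hom ?T (FO ?s (Dom ?S f)) (FO ?s (Cod ?S f))" if "f \<in> Ar ?S" for f
    proof -
      obtain p q g where e: "f = Pr (Pr (Vx p) (Vx q)) g" "p \<in> cube_pts n" "q \<in> cube_pts n" "list_all2 (\<le>) p q" "g \<in> Ar B"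
        using \<open>f \<in> Ar ?S\<close> by (auto simp: Ar_prod Ar_poset)
      have pq: "Pr (Vx p) (Vx q) \<in> Ar (cube n :: 'a scat)" using e by (auto simp: Ar_poset)
      show ?thesis using e pq d[OF e(2)] d[OF e(3)] l[OF e(2,4)] Dom_Ob[OF B e(5)] Cod_Ob[OF B e(5)] del_coord_mono[OF e(4), of i]
        by (simp add: split_cube_simps Hom_poset Ar_Hom)
    qed
    show "FA ?s (Id ?S x) = Id ?T (FO ?s x)" if "x \<in> Ob ?S" for x
      using that d HomD(1)[OF Id_Hom[OF B]] by (auto simp: split_cube_simps ble_refl)
    show "FA ?s (Cmp ?S g f) = Cmp ?T (FA ?s g) (FA ?s f)" if fg: "f \<in> Ar ?S" "g \<in> Ar ?S" "Cod ?S f = Dom ?S g" for f g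
    proof -
      obtain p q f' where e: "f = Pr (Pr (Vx p) (Vx q)) f'" "p \<in> cube_pts n" "q \<in> cube_pts n" "list_all2 (\<le>) p q" "f' \<in> Ar B"
        using fg(1) by (auto simp: Ar_prod Ar_poset)
      obtain r s g' where e': "g = Pr (Pr (Vx r) (Vx s)) g'" "r \<in> cube_pts n" "s \<in> cube_pts n" "list_all2 (\<le>) r s" "g' \<in> Ar B"
        using fg(2) by (auto simp: Ar_prod Ar_poset)
      have pq: "Pr (Vx p) (Vx q) \<in> Ar (cube n :: 'a scat)" "Pr (Vx r) (Vx s) \<in> Ar (cube n :: 'a scat)" using e e' by (auto simp: Ar_poset)
      have c: "r = q" "Cod B f' = Dom B g'" using fg(3) e e' pq by auto
      have gf: "Cmp B g' f' \<in> Ar B"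
        using HomD(1)[OF Cmp_Hom[OF B, of g' "Cod B f'" _ f']] Ar_Hom[OF e(5)] Ar_Hom[OF e'(5)] c by simp
      have a: "Pr (Vx (del_coord i p)) (Vx (del_coord i q)) \<in> Ar (cube (n - 1) :: 'a scat)"
         "Pr (Vx (del_coord i q)) (Vx (del_coord i s)) \<in> Ar (cube (n - 1) :: 'a scat)"
         "Pr (Vx [p ! i]) (Vx [q ! i]) \<in> Ar (cube 1 :: 'a scat)" "Pr (Vx [q ! i]) (Vx [s ! i]) \<in> Ar (cube 1 :: 'a scat)"
        using d[OF e(2)] d[OF e(3)] d[OF e'(3)] l[OF e(2,4)] l[OF e'(2,4)] del_coord_mono e e' c by (auto simp: Ar_poset)
      have t: "list_all2 (\<le>) p s" using ble_trans e(4) e'(4) c by blast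
      show ?thesis
        using e e' c pq gf a t d[OF e(2)] d[OF e(3)] d[OF e'(3)] l[OF e(2,4)] l[OF e'(2,4)] del_coord_mono
        by (simp add: split_cube_simps Ar_prod)
    qed
  qed (auto intro!: category_prod category_poset B)
  moreover have "mk_fun ?S ?T (FO ?s) (FA ?s) = ?s"
    by (simp add: split_cube_def mk_fun_def)
  ultimately show ?thesis by simp
qed

lemma functor_merge_cube:
  assumes B: "category B" and i: "i < n"
  shows "is_functor (merge_cube n i B)"
proof -
  let ?s = "merge_cube n i B" and ?T = "prod_cat (cube n) B" and ?S = "prod_cat (cube (n - 1)) (prod_cat (cube 1) B)"
  have "is_functor (mk_fun ?S ?T (FO ?s) (FA ?s))"
  proof (rule functorI)
    have d: "ins_coord i x p \<in> cube_pts n" if "p \<in> cube_pts (n - 1)" "x \<in> cube_pts 1" for p x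
      using that length_ins_coord[OF i] by (auto simp: cube_pts_def)
    show "FO ?s x \<in> Ob ?T" if "x \<in> Ob ?S" for x
      using that d by (auto simp: merge_cube_simps)
    show "FA ?s f \<in> Hom ?T (FO ?s (Dom ?S f)) (FO ?s (Cod ?S f))" if "f \<in> Ar ?S" for f
    proof -
      obtain p q x y g where e: "f = Pr (Pr (Vx p) (Vx q)) (Pr (Pr (Vx x) (Vx y)) g)" "p \<in> cube_pts (n - 1)" "q \<in> cube_pts (n - 1)"
         "list_all2 (\<le>) p q" "x \<in> cube_pts 1" "y \<in> cube_pts 1" "list_all2 (\<le>) x y" "g \<in> Ar B"
        using \<open>f \<in> Ar ?S\<close> by (auto simp: Ar_prod Ar_poset)
      have a: "Pr (Vx p) (Vx q) \<in> Ar (cube (n - 1) :: 'a scat)" "Pr (Vx x) (Vx y) \<in> Ar (cube 1 :: 'a scat)"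
        using e by (auto simp: Ar_poset)
      show ?thesis using e a d[OF e(2,5)] d[OF e(3,6)] Dom_Ob[OF B e(8)] Cod_Ob[OF B e(8)] ins_coord_mono[OF e(4,7), of i]
        by (simp add: merge_cube_simps Hom_poset Ar_Hom Ar_prod)
    qed
    show "FA ?s (Id ?S x) = Id ?T (FO ?s x)" if "x \<in> Ob ?S" for x
      using that d HomD(1)[OF Id_Hom[OF B]] by (auto simp: merge_cube_simps ble_refl)
    show "FA ?s (Cmp ?S g f) = Cmp ?T (FA ?s g) (FA ?s f)" if fg: "f \<in> Ar ?S" "g \<in> Ar ?S" "Cod ?S f = Dom ?S g" for f g
    proof -
      obtain p q x y f' where e: "f = Pr (Pr (Vx p) (Vx q)) (Pr (Pr (Vx x) (Vx y)) f')" "p \<in> cube_pts (n - 1)" "q \<in> cube_pts (n - 1)"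
         "list_all2 (\<le>) p q" "x \<in> cube_pts 1" "y \<in> cube_pts 1" "list_all2 (\<le>) x y" "f' \<in> Ar B"
        using fg(1) by (auto simp: Ar_prod Ar_poset)
      obtain r s z w g' where e': "g = Pr (Pr (Vx r) (Vx s)) (Pr (Pr (Vx z) (Vx w)) g')" "r \<in> cube_pts (n - 1)" "s \<in> cube_pts (n - 1)"
         "list_all2 (\<le>) r s" "z \<in> cube_pts 1" "w \<in> cube_pts 1" "list_all2 (\<le>) z w" "g' \<in> Ar B"
        using fg(2) by (auto simp: Ar_prod Ar_poset)
      have a: "Pr (Vx p) (Vx q) \<in> Ar (cube (n - 1) :: 'a scat)" "Pr (Vx x) (Vx y) \<in> Ar (cube 1 :: 'a scat)"
        "Pr (Vx r) (Vx s) \<in> Ar (cube (n - 1) :: 'a scat)" "Pr (Vx z) (Vx w) \<in> Ar (cube 1 :: 'a scat)"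
        using e e' by (auto simp: Ar_poset)
      have c: "r = q" "z = y" "Cod B f' = Dom B g'" using fg(3) e e' a by (auto simp: Ar_prod)
      have gf: "Cmp B g' f' \<in> Ar B"
        using HomD(1)[OF Cmp_Hom[OF B, of g' "Cod B f'" _ f']] Ar_Hom[OF e(8)] Ar_Hom[OF e'(8)] c by simp
      have a': "Pr (Vx (ins_coord i x p)) (Vx (ins_coord i y q)) \<in> Ar (cube n :: 'a scat)"
         "Pr (Vx (ins_coord i y q)) (Vx (ins_coord i w s)) \<in> Ar (cube n :: 'a scat)"
        using d[OF e(2,5)] d[OF e(3,6)] d[OF e'(3,6)] ins_coord_mono[OF e(4,7), of i] ins_coord_mono[OF e'(4,7), of i] c
        by (auto simp: Ar_poset)
      have t: "list_all2 (\<le>) p s" "list_all2 (\<le>) x w" using ble_trans e(4,7) e'(4,7) c by blast+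
      show ?thesis
        using e e' c a gf a' t d[OF e(2,5)] d[OF e(3,6)] d[OF e'(3,6)] ins_coord_mono[OF e(4,7), of i] ins_coord_mono[OF e'(4,7), of i]
        by (simp add: merge_cube_simps Ar_prod)
    qed
  qed (auto intro!: category_prod category_poset B)
  moreover have "mk_fun ?S ?T (FO ?s) (FA ?s) = ?s"
    by (simp add: merge_cube_def mk_fun_def)
  ultimately show ?thesis by simp
qed

lemma merge_split_cube:
  assumes B: "category B" and i: "i < n"
  shows "comp_fun (merge_cube n i B) (split_cube n i B) = id_fun (prod_cat (cube n) B)"
    and "comp_fun (split_cube n i B) (merge_cube n i B) = id_fun (prod_cat (cube (n - 1)) (prod_cat (cube 1) B))"
proof -
  have d: "del_coord i p \<in> cube_pts (n - 1)" "[p ! i] \<in> cube_pts 1" "ins_coord i [p ! i] (del_coord i p) = p" if "p \<in> cube_pts n" for p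
    using that length_del_coord[OF i] ins_del_coord[of i p] i by (auto simp: cube_pts_def)
  have l: "p ! i \<le> q ! i" if "p \<in> cube_pts n" "list_all2 (\<le>) p q" for p q
    using list_all2_nthD[OF that(2), of i] that(1) i by (simp add: cube_pts_def)
  show "comp_fun (merge_cube n i B) (split_cube n i B) = id_fun (prod_cat (cube n) B)"
  proof (rule functor_eqI)
    show "FA (comp_fun (merge_cube n i B) (split_cube n i B)) f = FA (id_fun (prod_cat (cube n) B)) f"
      if f0: "f \<in> Ar (Src (comp_fun (merge_cube n i B) (split_cube n i B)))" for f
    proof -
      obtain p q g where e: "f = Pr (Pr (Vx p) (Vx q)) g" "p \<in> cube_pts n" "q \<in> cube_pts n" "list_all2 (\<le>) p q" "g \<in> Ar B"
        using f0 by (auto simp: split_cube_simps Ar_prod Ar_poset)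
      have f: "f \<in> Ar (prod_cat (cube n) B)" using that by (simp add: split_cube_simps)
      show ?thesis using e f d[OF e(2)] d[OF e(3)] l[OF e(2,4)] del_coord_mono[OF e(4), of i]
        by (simp add: split_cube_simps merge_cube_simps)
    qed
  qed (use d functor_split_cube[OF B i] functor_merge_cube[OF B i] in
      \<open>auto intro!: functor_comp_fun functor_id_fun category_prod category_poset B simp: split_cube_simps merge_cube_simps\<close>)
  have d': "ins_coord i x p \<in> cube_pts n" "del_coord i (ins_coord i x p) = p" "[ins_coord i x p ! i] = x"
    if px: "p \<in> cube_pts (n - 1)" "x \<in> cube_pts 1" for p x
  proof -
    obtain y where y: "x = [y]" using px(2) by (auto simp: cube_pts_1)
    have "i \<le> length p" using px(1) i by (auto simp: cube_pts_def)
    thus "del_coord i (ins_coord i x p) = p" "[ins_coord i x p ! i] = x" using del_ins_coord y by auto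
    show "ins_coord i x p \<in> cube_pts n" using px length_ins_coord[OF i] by (auto simp: cube_pts_def)
  qed
  show "comp_fun (split_cube n i B) (merge_cube n i B) = id_fun (prod_cat (cube (n - 1)) (prod_cat (cube 1) B))"
  proof (rule functor_eqI)
    show "FA (comp_fun (split_cube n i B) (merge_cube n i B)) f = FA (id_fun (prod_cat (cube (n - 1)) (prod_cat (cube 1) B))) f"
      if f0: "f \<in> Ar (Src (comp_fun (split_cube n i B) (merge_cube n i B)))" for f
    proof -
      obtain p q x y g where e: "f = Pr (Pr (Vx p) (Vx q)) (Pr (Pr (Vx x) (Vx y)) g)" "p \<in> cube_pts (n - 1)" "q \<in> cube_pts (n - 1)"
         "list_all2 (\<le>) p q" "x \<in> cube_pts 1" "y \<in> cube_pts 1" "list_all2 (\<le>) x y" "g \<in> Ar B"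
        using f0 by (auto simp: merge_cube_simps Ar_prod Ar_poset)
      have f: "f \<in> Ar (prod_cat (cube (n - 1)) (prod_cat (cube 1) B))" using that by (simp add: merge_cube_simps)
      show ?thesis using e f d'[OF e(2,5)] d'[OF e(3,6)] ins_coord_mono[OF e(4,7), of i]
        by (simp add: split_cube_simps merge_cube_simps)
    qed
  qed (use d' functor_split_cube[OF B i] functor_merge_cube[OF B i] in
      \<open>auto intro!: functor_comp_fun functor_id_fun category_prod category_poset B simp: split_cube_simps merge_cube_simps\<close>)
qed

context pointed_derivator
begin

section \<open>Conjugate Kan extensions; conservativity of the cofiber\<close>

lemma naturally_isomorphic_iso_at:
  assumes N: "naturally_isomorphic F G" and T: "Tgt F = V0 D A" and A: "small_cat U A" and a: "a \<in> Ob A"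
    and h: "h \<in> Hom (Src F) X Y"
  shows "iso_at A (FA F h) a \<longleftrightarrow> iso_at A (FA G h) a"
proof -
  obtain c where F: "is_functor F" "is_functor G" "Src G = Src F" "Tgt G = Tgt F"
    and c: "\<forall>x\<in>Ob (Src F). c x \<in> Hom (Tgt F) (FO F x) (FO G x) \<and> invertible (Tgt F) (c x)"
    "\<forall>x y f. f \<in> Hom (Src F) x y \<longrightarrow> Cmp (Tgt F) (c y) (FA F f) = Cmp (Tgt F) (FA G f) (c x)"
    using naturally_isomorphicE[OF N] .
  have XY: "X \<in> Ob (Src F)" "Y \<in> Ob (Src F)" using Hom_Ob[OF functorD(1)[OF F(1)] h] by auto
  have cc: "c X \<in> Hom (V0 D A) (FO F X) (FO G X)" "c Y \<in> Hom (V0 D A) (FO F Y) (FO G Y)"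
    "iso_at A (c X) a" "iso_at A (c Y) a"
    using c(1) XY T invertible_iff[OF A] a by auto
  have "iso_at A (FA G h) a \<longleftrightarrow> iso_at A (FA F h) a"
    using iso_at_square[OF A a _ _ cc, of "FA G h" "FA F h"] functorD(4)[OF F(1) h] functorD(4)[OF F(2), of h X Y] h F T c(2)
    by simp
  thus ?thesis ..
qed

text \<open>An isomorphism of categories is a reflection with identity unit.\<close>

lemma V1_inverse:
  assumes u: "small_fun U u" and v: "small_fun U v" and uv: "Tgt u = Src v" "Tgt v = Src u"
    and i: "comp_fun v u = id_fun (Src u)" "comp_fun u v = id_fun (Src v)"
  shows "hom_adj (V1 D u) (V1 D v) (\<lambda>X f. Cmp (V0 D (Src v)) (FA (V1 D v) f) (NC (V2 D (id_nt (id_fun (Src v)))) X))"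
    and "X \<in> Ob (V0 D (Src u)) \<Longrightarrow> FO (V1 D u) (FO (V1 D v) X) = X"
    and "f \<in> Ar (V0 D (Src u)) \<Longrightarrow> FA (V1 D u) (FA (V1 D v) f) = f"
proof -
  note cv = small_catD[OF small_funD(2)[OF v]] and cu = small_catD[OF small_funD(2)[OF u]]
  show "hom_adj (V1 D u) (V1 D v) (\<lambda>X f. Cmp (V0 D (Src v)) (FA (V1 D v) f) (NC (V2 D (id_nt (id_fun (Src v)))) X))"
    by (rule reflection_hom_adj[OF v u])
      (use uv i functorD(3)[OF small_funD(1)[OF u]] functorD(3,5)[OF small_funD(1)[OF v]] cv in
        \<open>auto simp: nt_id_nt functor_id_fun\<close>)
  show "X \<in> Ob (V0 D (Src u)) \<Longrightarrow> FO (V1 D u) (FO (V1 D v) X) = X"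
    using V1_comp_Ob[OF u v uv(1), of X] uv i V1_id_fun[OF small_funD(2)[OF u]] by simp
  show "f \<in> Ar (V0 D (Src u)) \<Longrightarrow> FA (V1 D u) (FA (V1 D v) f) = f"
    using V1_comp_Ar[OF u v uv(1), of f] uv i V1_id_fun[OF small_funD(2)[OF u]] by simp
qed

text \<open>Restriction along w is strictly conjugate to restriction along w', by restrictions along
  isomorphisms. Passing to adjoints gives natural isomorphisms instead of equalities, since the Kan
  extensions along w and w' are chosen separately.\<close>

lemma kan_conjugate:
  assumes w: "small_fun U w" and w': "small_fun U w'"
    and s: "small_fun U s" "small_fun U s'" "Src s = Src w" "Tgt s = Src w'" "Src s' = Src w'" "Tgt s' = Src w"
    and t: "small_fun U t" "small_fun U t'" "Src t = Tgt w" "Tgt t = Tgt w'" "Src t' = Tgt w'" "Tgt t' = Tgt w"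
    and ss: "comp_fun s' s = id_fun (Src w)" "comp_fun s s' = id_fun (Src w')"
    and tt: "comp_fun t' t = id_fun (Tgt w)" "comp_fun t t' = id_fun (Tgt w')"
    and sq: "comp_fun t w = comp_fun w' s"
  shows "naturally_isomorphic (lkan D w) (comp_fun (V1 D t) (comp_fun (lkan D w') (V1 D s')))"
    and "naturally_isomorphic (rkan D w) (comp_fun (comp_fun (V1 D t) (rkan D w')) (V1 D s'))"
proof -
  note f = small_funD(1)
  have w's: "small_fun U (comp_fun w' s)" using small_comp[OF s(1) w'] s by simp
  have "comp_fun t' (comp_fun w' s) = comp_fun (comp_fun t' t) w"
    using sq comp_fun_assoc[OF f[OF w] f[OF t(1)] f[OF t(2)]] t by simp
  also have "\<dots> = w" using tt comp_fun_id_left[OF f[OF w]] by simp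
  finally have e: "V1 D w = V1 D (comp_fun t' (comp_fun w' s))" by simp
  also have "\<dots> = comp_fun (comp_fun (V1 D s) (V1 D w')) (V1 D t')"
    using V1_comp_fun[OF w's t(2)] V1_comp_fun[OF s(1) w'] s t by simp
  finally have e: "V1 D w = comp_fun (comp_fun (V1 D s) (V1 D w')) (V1 D t')" .
  have e': "V1 D w = comp_fun (V1 D s) (comp_fun (V1 D w') (V1 D t'))"
    unfolding e by (rule comp_fun_assoc) (use V1D[OF s(1)] V1D[OF w'] V1D[OF t(2)] s t in simp_all)
  have A1: "hom_adj (V1 D s') (V1 D s) (\<lambda>X f. Cmp (V0 D (Src s)) (FA (V1 D s) f) (NC (V2 D (id_nt (id_fun (Src s)))) X))"
    by (rule V1_inverse(1)) (use s ss in simp_all)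
  have A2: "hom_adj (V1 D t) (V1 D t') (\<lambda>X f. Cmp (V0 D (Src t')) (FA (V1 D t') f) (NC (V2 D (id_nt (id_fun (Src t')))) X))"
    by (rule V1_inverse(1)) (use t tt in simp_all)
  have A3: "hom_adj (V1 D s) (V1 D s') (\<lambda>X f. Cmp (V0 D (Src s')) (FA (V1 D s') f) (NC (V2 D (id_nt (id_fun (Src s')))) X))"
    by (rule V1_inverse(1)) (use s ss in simp_all)
  have A4: "hom_adj (V1 D t') (V1 D t) (\<lambda>X f. Cmp (V0 D (Src t)) (FA (V1 D t) f) (NC (V2 D (id_nt (id_fun (Src t)))) X))"
    by (rule V1_inverse(1)) (use t tt in simp_all)
  note V = V1D(2,3)[OF s(1)] V1D(2,3)[OF s(2)] V1D(2,3)[OF t(1)] V1D(2,3)[OF t(2)] V1D(2,3)[OF w'] lkanD(2,3)[OF w'] rkanD(2,3)[OF w'] s t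
  have L1: "Tgt (V1 D s') = Src (lkan D w')" and L2: "Tgt (comp_fun (lkan D w') (V1 D s')) = Src (V1 D t)"
    and R1: "Tgt (V1 D t') = Src (V1 D w')" and R2: "Tgt (comp_fun (V1 D w') (V1 D t')) = Src (V1 D s)" using V by simp_all
  show "naturally_isomorphic (lkan D w) (comp_fun (V1 D t) (comp_fun (lkan D w') (V1 D s')))"
    by (rule left_adjoint_unique[OF lkan_hom_adj[OF w] hom_adj_comp[OF hom_adj_comp[OF A1 lkan_hom_adj[OF w'] L1] A2 L2, folded e]])
  show "naturally_isomorphic (rkan D w) (comp_fun (comp_fun (V1 D t) (rkan D w')) (V1 D s'))"
    by (rule right_adjoint_unique[OF rkan_hom_adj[OF w] hom_adj_comp[OF hom_adj_comp[OF A4 rkan_hom_adj[OF w'] R1] A3 R2, folded e']])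
qed

text \<open>Over a single parameter object \<open>cof\<close> is conservative by stability, so g may
  be tested after two applications of it. The vertex 0 then carries the cone of g, where
  invertibility is \<open>i1\<close>, and the vertex 1 carries the cone of \<open>cof\<close> g,
  where \<open>i0\<close> suffices.\<close>

lemma stable_iso_at:
  assumes st: "stable_derivator U D" and A: "small_cat U A"
    and g: "g \<in> Hom (V0 D (prod_cat (cube 1) A)) X Y" and a: "a \<in> Ob A"
    and i0: "iso_at (prod_cat (cube 1) A) g (Pr (Vx [False]) a)"
    and i1: "iso_at (prod_cat (cube 1) A) (FA (MF (cof D) A) g) (Pr (Vx [True]) a)"
  shows "iso_at (prod_cat (cube 1) A) g (Pr (Vx [True]) a)"
proof -
  let ?E = "shift (cube 1) D"
  have eq: "derivator_equivalence U ?E ?E (cof D)" using st by (simp add: stable_derivator_def)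
  obtain G \<eta> where G: "dmorphism U ?E ?E G" and eta: "inv_modification U ?E ?E (mid ?E) (mcomp G (cof D)) \<eta>"
    and F: "dmorphism U ?E ?E (cof D)"
    using eq unfolding derivator_equivalence_def by auto
  have sc: "small_cat U (prod_cat (cube 1) A)" "small_cat U (prod_cat (cube 1) term_cat)"
    using small_prod[OF universe small_poset[OF universe finite_cube_pts]] A small_term by auto
  let ?T = "prod_cat (cube 1) term_cat"
  \<comment> \<open>\<open>i0\<close> and \<open>i1\<close> speak about one object a of the
    parameter category, whereas conservativity concerns all of it. Restriction along a reduces to
    the terminal category as parameter.\<close>
  let ?v = "prod_fun (id_fun (cube 1)) (pt_fun A a)"
  have v: "small_fun U ?v" using small_prod_fun[OF small_id small_pt[OF A a]] small_poset[OF universe finite_cube_pts] by simp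
  \<comment> \<open>Restriction to a commutes with \<open>cof\<close> up to the coherence
    isomorphism that is part of \<open>dmorphism\<close>.\<close>
  have N: "naturally_isomorphic (comp_fun (V1 D ?v) (MF (cof D) A)) (comp_fun (MF (cof D) term_cat) (V1 D ?v))"
  proof -
    have "small_fun U (pt_fun A a)" using small_pt[OF A a] .
    hence "is_nat_iso (MI (cof D) (pt_fun A a)) \<and> NSrc (MI (cof D) (pt_fun A a)) = comp_fun (V1 ?E (pt_fun A a)) (MF (cof D) A) \<and>
        NTgt (MI (cof D) (pt_fun A a)) = comp_fun (MF (cof D) term_cat) (V1 ?E (pt_fun A a))"
      using F unfolding dmorphism_def by (metis pt_fun_simps(1,2))
    thus ?thesis using naturally_isomorphic_nat_iso by fastforce
  qed
  \<comment> \<open>The component of \<open>\<eta>\<close> makes G after \<open>cof\<close>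
    isomorphic to the identity, so \<open>cof\<close> reflects isomorphisms.\<close>
  have cons: "invertible (V0 D ?T) h" if h: "h \<in> Hom (V0 D ?T) P Q" and i: "invertible (V0 D ?T) (FA (MF (cof D) term_cat) h)" for h P Q
  proof -
    have "is_nat_iso (\<eta> term_cat) \<and> NSrc (\<eta> term_cat) = MF (mid ?E) term_cat \<and> NTgt (\<eta> term_cat) = MF (mcomp G (cof D)) term_cat"
      using eta small_term unfolding inv_modification_def modification_def by blast
    hence "naturally_isomorphic (id_fun (V0 D ?T)) (comp_fun (MF G term_cat) (MF (cof D) term_cat))"
      using naturally_isomorphic_nat_iso[of "\<eta> term_cat"] by (simp add: mid_def mcomp_def)
    from naturally_isomorphic_invertible[OF this, of h P Q]
    have "invertible (V0 D ?T) h \<longleftrightarrow> invertible (V0 D ?T) (FA (MF G term_cat) (FA (MF (cof D) term_cat) h))"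
      using h HomD(1)[OF h] cof_functorD(2)[OF small_term] by simp
    moreover have "is_functor (MF G term_cat) \<and> Src (MF G term_cat) = V0 D ?T \<and> Tgt (MF G term_cat) = V0 D ?T"
      using G small_term unfolding dmorphism_def by simp
    moreover have "FA (MF (cof D) term_cat) h \<in> Hom (V0 D ?T) (FO (MF (cof D) term_cat) P) (FO (MF (cof D) term_cat) Q)"
      using functorD(4)[OF cof_functorD(1)[OF small_term], of h P Q] cof_functorD(2,3)[OF small_term] h by simp
    ultimately show ?thesis using functor_invertible[of "MF G term_cat"] i by fastforce
  qed
  let ?h = "FA (V1 D ?v) g"
  have h: "?h \<in> Hom (V0 D ?T) (FO (V1 D ?v) X) (FO (V1 D ?v) Y)" using V1_Hom[OF v] g by simp
  have pt: "Pr (Vx [x]) (Vx []) \<in> Ob ?T" "FO ?v (Pr (Vx [x]) (Vx [])) = Pr (Vx [x]) a" for x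
    by (auto simp: pts)
  have t0: "Vx [] \<in> Ob term_cat" by simp
  have ht: "iso_at ?T ?h (Pr (Vx [x]) (Vx [])) \<longleftrightarrow> iso_at (prod_cat (cube 1) A) g (Pr (Vx [x]) a)" for x
    using iso_at_V1[OF v, of g X Y "Pr (Vx [x]) (Vx [])"] g pt[of x] by simp
  have cg: "FA (MF (cof D) A) g \<in> Hom (V0 D (prod_cat (cube 1) A)) (FO (MF (cof D) A) X) (FO (MF (cof D) A) Y)"
    using functorD(4)[OF cof_functorD(1)[OF A], of g X Y] cof_functorD(2,3)[OF A] g by simp
  let ?ch = "FA (MF (cof D) term_cat) ?h"
  have ch: "?ch \<in> Hom (V0 D ?T) (FO (MF (cof D) term_cat) (FO (V1 D ?v) X)) (FO (MF (cof D) term_cat) (FO (V1 D ?v) Y))"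
    using functorD(4)[OF cof_functorD(1)[OF small_term], of ?h] cof_functorD(2,3)[OF small_term] h by simp
  have cch: "FA (MF (cof D) term_cat) ?ch \<in> Hom (V0 D ?T) (FO (MF (cof D) term_cat) (FO (MF (cof D) term_cat) (FO (V1 D ?v) X)))
      (FO (MF (cof D) term_cat) (FO (MF (cof D) term_cat) (FO (V1 D ?v) Y)))"
    using functorD(4)[OF cof_functorD(1)[OF small_term], of ?ch] cof_functorD(2,3)[OF small_term] ch by simp
  have "iso_at ?T (FA (V1 D ?v) (FA (MF (cof D) A) g)) (Pr (Vx [True]) (Vx []))"
    using iso_at_V1[OF v, of "FA (MF (cof D) A) g" _ _ "Pr (Vx [True]) (Vx [])"] cg pt[of True] i1 by simp
  hence ch1: "iso_at ?T ?ch (Pr (Vx [True]) (Vx []))"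
    using naturally_isomorphic_iso_at[OF N _ sc(2) pt(1), of g X Y] V1D(2,3)[OF v] cof_functorD[OF A] g HomD(1)[OF g] by simp
  have c0: "iso_at ?T (FA (MF (cof D) term_cat) ?ch) (Pr (Vx [False]) (Vx []))"
    using cof_iso_at[OF small_term ch t0] cofiber_square_iso_at_10[OF small_term ch t0] ch1 by simp
  have c1: "iso_at ?T (FA (MF (cof D) term_cat) ?ch) (Pr (Vx [True]) (Vx []))"
    by (rule cof_cof_iso_at[OF small_term h _ t0]) (use ht i0 in auto)
  have "invertible (V0 D ?T) (FA (MF (cof D) term_cat) ?ch)"
    using invertible_iff[OF sc(2) cch] c0 c1 by (auto simp: pts)
  hence "invertible (V0 D ?T) ?h" using cons[OF h cons[OF ch]] by simp
  thus ?thesis using invertible_iff[OF sc(2) h] pt(1) ht by blast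
qed

end

section \<open>Cofibers in one coordinate of a cube\<close>

lemma ble_length: "list_all2 (\<le>) p q \<Longrightarrow> length p = length (q :: bool list)"
  by (rule list_all2_lengthD)

lemma ble_iff: "list_all2 (\<le>) p q \<longleftrightarrow> length p = length q \<and> (\<forall>l<length p. p ! l \<longrightarrow> q ! l)"
  by (auto simp: list_all2_conv_all_nth)

lemma ble_update_False: "list_all2 (\<le>) (p[i := False]) p"
  by (cases "i < length p") (auto simp: ble_iff nth_list_update split: if_splits)

lemma ble_Cons: "list_all2 (\<le>) (x # p) (y # q) \<longleftrightarrow> (x \<longrightarrow> y) \<and> list_all2 (\<le>) p q"
  by simp

lemma weight_simps [simp]: "weight [] = 0" "weight (True # p) = Suc (weight p)" "weight (False # p) = weight p"
  by (simp_all add: weight_def)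

lemma weight_le_length: "weight p \<le> length p"
  by (simp add: weight_def count_le_length)

lemma weight_mono: "list_all2 (\<le>) p q \<Longrightarrow> weight p \<le> weight q"
proof (induction rule: list_all2_induct)
  case (Cons x xs y ys)
  thus ?case by (cases x; cases y) auto
qed simp

lemma weight_strict_mono: "list_all2 (\<le>) p q \<Longrightarrow> p \<noteq> q \<Longrightarrow> weight p < weight q"
proof (induction rule: list_all2_induct)
  case (Cons x xs y ys)
  thus ?case using weight_mono[OF Cons(2)] by (cases x; cases y) auto
qed simp

text \<open>Entries of p are switched off from the front as long as the rest still has weight at
  least j.\<close>

lemma ex_ble_weight: "j \<le> weight p \<Longrightarrow> \<exists>m. list_all2 (\<le>) m p \<and> weight m = j"
proof (induction p arbitrary: j)
  case Nil
  thus ?case by auto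
next
  case (Cons x p)
  show ?case
  proof (cases "j \<le> weight p")
    case True
    then obtain m where "list_all2 (\<le>) m p" "weight m = j" using Cons.IH by blast
    thus ?thesis by (intro exI[of _ "False # m"]) (simp only: ble_Cons weight_simps simp_thms)
  next
    case False
    hence x: "x" "j = Suc (weight p)" using Cons.prems by (cases x; simp)+
    thus ?thesis by (intro exI[of _ "True # p"]) (simp only: ble_Cons weight_simps simp_thms ble_refl)
  qed
qed

lemma length_insert_ones: "length (insert_ones m q) = length m"
  by (induction m q rule: insert_ones.induct) auto

lemma insert_ones_ge: "list_all2 (\<le>) m (insert_ones m q)"
  by (induction m q rule: insert_ones.induct) simp_all

text \<open>The length condition keeps \<open>hd\<close> and \<open>tl\<close> away from the empty
  list.\<close>

lemma insert_ones_mono: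
  "list_all2 (\<le>) q q' \<Longrightarrow> length q = length m - weight m \<Longrightarrow> list_all2 (\<le>) (insert_ones m q) (insert_ones m q')"
proof (induction m q arbitrary: q' rule: insert_ones.induct)
  case (3 m q)
  have "length q > 0" using 3(3) weight_le_length[of m] by simp
  then obtain x xs where q: "q = x # xs" by (cases q) simp_all
  have len: "length xs = length m - weight m" using 3(3) q weight_le_length[of m] by (simp add: Suc_diff_le)
  obtain y ys where q': "q' = y # ys" "x \<longrightarrow> y" "list_all2 (\<le>) xs ys"
    using 3(2) unfolding q list_all2_Cons1 by auto
  have "list_all2 (\<le>) (insert_ones m xs) (insert_ones m ys)"
    using 3(1)[of ys] q'(3) len unfolding q list.sel by blast
  thus ?case using q q'(1,2) by (simp only: insert_ones.simps list.sel ble_Cons simp_thms)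
qed auto

text \<open>Together with \<open>insert_ones_ge\<close> this identifies the face
  \<open>ones_fun m\<close> with the set of vertices above m, on which the total cone is read
  off.\<close>

lemma insert_ones_surj:
  "list_all2 (\<le>) m p \<Longrightarrow> \<exists>q. length q = length m - weight m \<and> insert_ones m q = p"
proof (induction rule: list_all2_induct)
  case (Cons x m y p)
  then obtain q where q: "length q = length m - weight m" "insert_ones m q = p" by auto
  show ?case
  proof (cases x)
    case True
    thus ?thesis using Cons q by (intro exI[of _ q]) simp
  next
    case False
    thus ?thesis using q weight_le_length[of m] by (intro exI[of _ "y # q"]) simp
  qed
qed simp

text \<open>The identity of x must equal the composite x -> 0 -> x.\<close>

lemma zero_object_unique_endo:
  assumes C: "category C" and z: "zero_object C z" and x: "x \<in> Ob C" and u: "\<exists>!f. f \<in> Hom C x x"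
  shows "zero_object C x"
proof -
  obtain f where f: "f \<in> Hom C z x" using zero_objectD(2)[OF z x] by auto
  obtain g where g: "g \<in> Hom C x z" using zero_objectD(3)[OF z x] by auto
  have "Cmp C f g = Id C x" using u Cmp_Hom[OF C f g] Id_Hom[OF C x] by blast
  moreover have "Cmp C g f = Id C z"
    using zero_objectD(4)[OF z zero_objectD(1)[OF z] Cmp_Hom[OF C g f] Id_Hom[OF C zero_objectD(1)[OF z]]] .
  ultimately have "invertible C f" using invertibleI[OF f g] by simp
  thus ?thesis using zero_object_invertible[OF C z f] by simp
qed

context pointed_derivator
begin

text \<open>Moves coordinate i to the front. The other coordinates join B to form the parameter
  category \<open>rest\<close>, so that the results about \<open>cof\<close> with parameters apply
  to one coordinate of a cube.\<close>

definition to_front :: "nat \<Rightarrow> nat \<Rightarrow> 'a scat \<Rightarrow> 'a sfun" where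
  "to_front n i B = comp_fun (swap_fun (cube (n - 1)) (cube 1) B) (split_cube n i B)"

definition from_front :: "nat \<Rightarrow> nat \<Rightarrow> 'a scat \<Rightarrow> 'a sfun" where
  "from_front n i B = comp_fun (merge_cube n i B) (swap_fun (cube 1) (cube (n - 1)) B)"

lemma small_cube: "small_cat U (cube n)"
  by (rule small_poset[OF universe finite_cube_pts])

context
  fixes n i :: nat and B :: "'a scat"
  assumes i: "i < n" and B: "small_cat U B"
begin

abbreviation "rest \<equiv> prod_cat (cube (n - 1)) B"

lemma small_A: "small_cat U rest" and small_nB: "small_cat U (prod_cat (cube n) B)" and small_1A: "small_cat U (prod_cat (cube 1) rest)"
  by (intro small_prod[OF universe] small_cube B)+

lemma small_coord_funs:
  "small_fun U (split_cube n i B)" "small_fun U (merge_cube n i B)"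
  "small_cat U S \<Longrightarrow> small_fun U (swap_fun (cube (n - 1)) S B)"
  "small_cat U S \<Longrightarrow> small_fun U (swap_fun S (cube (n - 1)) B)"
  using functor_split_cube[OF small_catD[OF B] i] functor_merge_cube[OF small_catD[OF B] i]
    functor_swap[OF category_poset small_catD small_catD[OF B]] functor_swap[OF small_catD category_poset small_catD[OF B]]
  by (auto simp: small_fun_def split_cube_simps merge_cube_simps intro!: small_prod[OF universe] small_cube B)

lemma front_Src_Tgt [simp]:
  "Src (to_front n i B) = prod_cat (cube n) B" "Tgt (to_front n i B) = prod_cat (cube 1) rest"
  "Src (from_front n i B) = prod_cat (cube 1) rest" "Tgt (from_front n i B) = prod_cat (cube n) B"
  by (simp_all add: to_front_def from_front_def split_cube_simps merge_cube_simps)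

lemma small_front: "small_fun U (to_front n i B)" "small_fun U (from_front n i B)"
  unfolding to_front_def from_front_def
  using small_comp[OF small_coord_funs(1) small_coord_funs(3)[OF small_cube]]
    small_comp[OF small_coord_funs(4)[OF small_cube] small_coord_funs(2)]
  by (simp_all add: split_cube_simps merge_cube_simps)

lemma front_inverse:
  "comp_fun (from_front n i B) (to_front n i B) = id_fun (prod_cat (cube n) B)"
  "comp_fun (to_front n i B) (from_front n i B) = id_fun (prod_cat (cube 1) rest)"
proof -
  let ?sp = "split_cube n i B" and ?me = "merge_cube n i B"
    and ?s = "swap_fun (cube (n - 1)) (cube 1) B" and ?t = "swap_fun (cube 1) (cube (n - 1)) B"
  note cB = small_catD[OF B]
  note ms = merge_split_cube[OF cB i]
  note f = small_coord_funs(1,2)[THEN small_funD(1)] small_coord_funs(3,4)[OF small_cube, THEN small_funD(1), of 1]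
  have st: "comp_fun ?t ?s = id_fun (prod_cat (cube (n - 1)) (prod_cat (cube 1) B))"
    "comp_fun ?s ?t = id_fun (prod_cat (cube 1) rest)"
    by (rule swap_swap; rule category_poset cB)+
  have "comp_fun (comp_fun ?me ?t) (comp_fun ?s ?sp) = comp_fun ?me (comp_fun (comp_fun ?t ?s) ?sp)"
    using f comp_fun_assoc[of "comp_fun ?s ?sp" ?t ?me] comp_fun_assoc[of ?sp ?s ?t] functor_comp_fun[of ?sp ?s]
    by (simp add: split_cube_simps merge_cube_simps)
  also have "\<dots> = id_fun (prod_cat (cube n) B)"
    unfolding st using comp_fun_id_left[OF f(1)] ms(1) by (simp add: split_cube_simps)
  finally show "comp_fun (from_front n i B) (to_front n i B) = id_fun (prod_cat (cube n) B)"
    by (simp add: from_front_def to_front_def)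
  have "comp_fun (comp_fun ?s ?sp) (comp_fun ?me ?t) = comp_fun ?s (comp_fun (comp_fun ?sp ?me) ?t)"
    using f comp_fun_assoc[of "comp_fun ?me ?t" ?sp ?s] comp_fun_assoc[of ?t ?me ?sp] functor_comp_fun[of ?t ?me]
    by (simp add: split_cube_simps merge_cube_simps)
  also have "\<dots> = id_fun (prod_cat (cube 1) rest)"
    unfolding ms(2) using comp_fun_id_left[OF f(4)] st(2) by simp
  finally show "comp_fun (to_front n i B) (from_front n i B) = id_fun (prod_cat (cube 1) rest)"
    by (simp add: from_front_def to_front_def)
qed

lemma front_FO:
  assumes p: "p \<in> cube_pts n" and b: "b \<in> Ob B"
  shows "FO (to_front n i B) (Pr (Vx p) b) = Pr (Vx [p ! i]) (Pr (Vx (del_coord i p)) b)"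
    "Pr (Vx (del_coord i p)) b \<in> Ob rest"
    "FO (from_front n i B) (Pr (Vx [x]) (Pr (Vx (del_coord i p)) b)) = Pr (Vx (p[i := x])) b"
proof -
  have d: "del_coord i p \<in> cube_pts (n - 1)" "[x] \<in> cube_pts 1" for x :: bool
    using p length_del_coord[OF i] by (auto simp: cube_pts_def)
  show "FO (to_front n i B) (Pr (Vx p) b) = Pr (Vx [p ! i]) (Pr (Vx (del_coord i p)) b)"
    "Pr (Vx (del_coord i p)) b \<in> Ob rest"
    using p b d by (simp_all add: to_front_def split_cube_simps)
  show "FO (from_front n i B) (Pr (Vx [x]) (Pr (Vx (del_coord i p)) b)) = Pr (Vx (p[i := x])) b"
    using p b d ins_del_coord[of i p x] i by (simp add: from_front_def merge_cube_simps cube_pts_def)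
qed

text \<open>The left side uses Kan extensions along C x (u x B), with C the cube of the other
  coordinates, and the right side those along u x (C x B). Conjugation with the exchange of factors
  identifies them up to isomorphism, and the two exchanges between the right and the left Kan
  extension cancel.\<close>

lemma cof_coord_naturally_isomorphic:
  "naturally_isomorphic (cof_coord D n i B)
     (comp_fun (V1 D (to_front n i B)) (comp_fun (MF (cof D) rest) (V1 D (from_front n i B))))"
proof -
  let ?C = "cube (n - 1) :: 'a scat"
  let ?w = "\<lambda>u. prod_fun (id_fun ?C) (prod_fun u (id_fun B))"
  let ?s = "\<lambda>S. swap_fun ?C S B" and ?s' = "\<lambda>S. swap_fun S ?C B"
  let ?c = "poset_cat corner_pts :: 'a scat"
  let ?sp = "split_cube n i B" and ?me = "merge_cube n i B"
  let ?L = "lkan D (par rest cof_corner)" and ?R = "rkan D (par rest cof_i)"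
  note cB = small_catD[OF B]
  have sc: "small_cat U ?c" by (rule small_poset[OF universe finite_pts(2)])
  have w: "small_fun U (?w u)" if "small_fun U u" for u
    using small_prod_fun[OF small_id[OF small_cube] small_par[OF B that]] .
  have conj: "naturally_isomorphic (lkan D (?w u)) (comp_fun (V1 D (?s (Tgt u))) (comp_fun (lkan D (par rest u)) (V1 D (?s' (Src u)))))"
     "naturally_isomorphic (rkan D (?w u)) (comp_fun (comp_fun (V1 D (?s (Tgt u))) (rkan D (par rest u))) (V1 D (?s' (Src u))))"
    if u: "small_fun U u" for u
  proof -
    note S = small_funD(2)[OF u] and T = small_funD(3)[OF u]
    note a = w[OF u] small_par[OF small_A u] small_coord_funs(3)[OF S] small_coord_funs(4)[OF S] _ _ _ _
      small_coord_funs(3)[OF T] small_coord_funs(4)[OF T] _ _ _ _ _ _ _ _ swap_natural[OF category_poset cB small_funD(1)[OF u]]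
    show "naturally_isomorphic (lkan D (?w u)) (comp_fun (V1 D (?s (Tgt u))) (comp_fun (lkan D (par rest u)) (V1 D (?s' (Src u)))))"
      by (rule kan_conjugate(1)[OF a]) (simp_all add: swap_swap category_poset cB small_catD[OF S] small_catD[OF T])
    show "naturally_isomorphic (rkan D (?w u)) (comp_fun (comp_fun (V1 D (?s (Tgt u))) (rkan D (par rest u))) (V1 D (?s' (Src u))))"
      by (rule kan_conjugate(2)[OF a]) (simp_all add: swap_swap category_poset cB small_catD[OF S] small_catD[OF T])
  qed
  let ?L' = "comp_fun (V1 D (?s (cube 2))) (comp_fun ?L (V1 D (?s' ?c)))"
  let ?R' = "comp_fun (comp_fun (V1 D (?s ?c)) ?R) (V1 D (?s' (cube 1)))"
  have NL: "naturally_isomorphic (lkan D (?w cof_corner)) ?L'" using conj(1)[OF small_edges(2)] by simp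
  have NR: "naturally_isomorphic (rkan D (?w cof_i)) ?R'" using conj(2)[OF small_edges(1)] by simp
  let ?e = "V1 D (?w cof_edge)"
  \<comment> \<open>After unfolding, only Kan extensions of D itself remain, because shifting does
    not alter the chosen data.\<close>
  have eq: "cof_coord D n i B = comp_fun (V1 D ?sp) (comp_fun (comp_fun ?e (comp_fun (lkan D (?w cof_corner)) (rkan D (?w cof_i)))) (V1 D ?me))"
    by (simp add: cof_coord_def cof_def mcomp_def mres_def mlan_def mran_def lkan_shift rkan_shift)
  note Vs = V1D[OF small_coord_funs(1)] V1D[OF small_coord_funs(2)] V1D[OF w[OF small_edges(3)]]
    lkanD[OF w[OF small_edges(2)]] rkanD[OF w[OF small_edges(1)]]
  let ?F = "comp_fun (V1 D ?sp) (comp_fun (comp_fun ?e (comp_fun ?L' ?R')) (V1 D ?me))"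
  have N: "naturally_isomorphic (cof_coord D n i B) ?F"
    unfolding eq
    by (rule naturally_isomorphic_comp[OF naturally_isomorphic_comp[OF naturally_isomorphic_refl
          naturally_isomorphic_comp[OF naturally_isomorphic_comp[OF NR NL] naturally_isomorphic_refl]] naturally_isomorphic_refl])
      (simp_all add: Vs split_cube_simps merge_cube_simps)
  let ?G = "comp_fun (V1 D (to_front n i B)) (comp_fun (MF (cof D) rest) (V1 D (from_front n i B)))"
  note sm = small_coord_funs(1,2) small_coord_funs(3)[OF small_cube, of 1] small_coord_funs(4)[OF small_cube, of 1]
    small_coord_funs(3)[OF small_cube, of 2] small_coord_funs(3)[OF sc] small_coord_funs(4)[OF sc]
  note pe = small_edges[THEN small_par[OF small_A]]
  have nat: "comp_fun (?s (cube 2)) (?w cof_edge) = comp_fun (par rest cof_edge) (?s (cube 1))"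
    using swap_natural[OF category_poset cB small_funD(1)[OF small_edges(3)], of "cube_pts (n - 1)"] by simp
  have ss: "comp_fun (?s ?c) (?s' ?c) = id_fun (prod_cat ?c rest)"
    by (rule swap_swap) (rule category_poset cB)+
  have scA: "small_cat U (prod_cat ?c rest)" by (rule small_prod[OF universe sc small_A])
  have ?thesis if FG: "?F = ?G"
    using N FG by simp
  \<comment> \<open>Apart from the two Kan extensions, which now agree on both sides, all factors
    are restrictions. These compose strictly, so what remains is an equality.\<close>
  moreover have "?F = ?G"
  proof (rule functor_eqI)
    show "is_functor ?F" using N by (simp add: naturally_isomorphic_def)
    show "is_functor ?G"
      using V1D[OF small_front(1)] V1D[OF small_front(2)] cof_functorD[OF small_A] by (auto intro!: functor_comp_fun)
    show "Src ?F = Src ?G" "Tgt ?F = Tgt ?G"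
      using V1D[OF small_front(1)] V1D[OF small_front(2)] Vs by (simp_all add: split_cube_simps merge_cube_simps)
  next
    fix X assume "X \<in> Ob (Src ?F)"
    hence X: "X \<in> Ob (V0 D (prod_cat (cube n) B))" using Vs by (simp add: merge_cube_simps)
    let ?X1 = "FO (V1 D ?me) X" let ?X2 = "FO (V1 D (?s' (cube 1))) ?X1" let ?X3 = "FO ?R ?X2"
    let ?X4 = "FO (V1 D (?s ?c)) ?X3" let ?X5 = "FO (V1 D (?s' ?c)) ?X4"
    have X1: "?X1 \<in> Ob (V0 D (prod_cat ?C (prod_cat (cube 1) B)))" using V1_Ob[OF sm(2)] X by (simp add: merge_cube_simps)
    have X2: "?X2 \<in> Ob (V0 D (prod_cat (cube 1) rest))" using V1_Ob[OF sm(4)] X1 by simp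
    have X2': "?X2 = FO (V1 D (from_front n i B)) X"
      using V1_comp_Ob[OF sm(4,2), of X] X by (simp add: from_front_def merge_cube_simps)
    have X3: "?X3 \<in> Ob (V0 D (prod_cat ?c rest))" using rkan_Ob[OF pe(1)] X2 by simp
    have X4: "?X4 \<in> Ob (V0 D (prod_cat ?C (prod_cat ?c B)))" using V1_Ob[OF sm(6)] X3 by simp
    have X5: "?X5 = ?X3" using V1_comp_Ob[OF sm(7,6), of ?X3] X3 ss V1_id_fun[OF scA] by simp
    let ?X6 = "FO ?L ?X3"
    have X6: "?X6 \<in> Ob (V0 D (prod_cat (cube 2) rest))" using lkan_Ob[OF pe(2)] X3 by simp
    have X7: "FO (V1 D (?s (cube 2))) ?X6 \<in> Ob (V0 D (prod_cat ?C (prod_cat (cube 2) B)))" using V1_Ob[OF sm(5)] X6 by simp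
    have X8: "FO ?e (FO (V1 D (?s (cube 2))) ?X6) = FO (V1 D (?s (cube 1))) (FO (V1 D (par rest cof_edge)) ?X6)"
      using V1_comp_Ob[OF w[OF small_edges(3)] sm(5), of ?X6] V1_comp_Ob[OF sm(3) pe(3), of ?X6] X6 nat by simp
    have X9: "FO (V1 D (par rest cof_edge)) ?X6 \<in> Ob (V0 D (prod_cat (cube 1) rest))" using V1_Ob[OF pe(3)] X6 by simp
    have X10: "FO (V1 D ?sp) (FO (V1 D (?s (cube 1))) (FO (V1 D (par rest cof_edge)) ?X6)) =
        FO (V1 D (to_front n i B)) (FO (V1 D (par rest cof_edge)) ?X6)"
      using V1_comp_Ob[OF sm(1,3), of "FO (V1 D (par rest cof_edge)) ?X6"] X9 by (simp add: to_front_def split_cube_simps)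
    have "FO ?F X = FO (V1 D ?sp) (FO ?e (FO (V1 D (?s (cube 2))) (FO ?L ?X5)))"
      using X X1 X2 X4 X3 V1D(2)[OF sm(2)] V1D(2)[OF sm(4)] V1D(2)[OF sm(7)] rkanD(2)[OF pe(1)] by (simp add: merge_cube_simps)
    also have "\<dots> = FO (V1 D (to_front n i B)) (FO (V1 D (par rest cof_edge)) (FO ?L (FO ?R ?X2)))"
      unfolding X5 X8 X10 ..
    also have "\<dots> = FO ?G X"
      unfolding X2' using X X2 X2' V1D(2)[OF small_front(2)] cofiber_squareD(2)[OF small_A] cofiber_square_Ob(1)[OF small_A, of ?X2]
      by (simp add: MF_cof)
    finally show "FO ?F X = FO ?G X" .
  next
    fix f assume "f \<in> Ar (Src ?F)"
    hence f: "f \<in> Ar (V0 D (prod_cat (cube n) B))" using Vs by (simp add: merge_cube_simps)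
    note X = Ar_Hom[OF f]
    let ?X1 = "FA (V1 D ?me) f" let ?X2 = "FA (V1 D (?s' (cube 1))) ?X1" let ?X3 = "FA ?R ?X2"
    let ?X4 = "FA (V1 D (?s ?c)) ?X3" let ?X5 = "FA (V1 D (?s' ?c)) ?X4"
    have X1: "?X1 \<in> Ar (V0 D (prod_cat ?C (prod_cat (cube 1) B)))" using functor_Ar[OF V1D(1)[OF sm(2)]] HomD(1)[OF X] V1D(2,3)[OF sm(2)] by (simp add: merge_cube_simps)
    have X2: "?X2 \<in> Ar (V0 D (prod_cat (cube 1) rest))" using functor_Ar[OF V1D(1)[OF sm(4)]] X1 V1D(2,3)[OF sm(4)] by simp
    have X2': "?X2 = FA (V1 D (from_front n i B)) f"
      using V1_comp_Ar[OF sm(4,2), of f] HomD(1)[OF X] by (simp add: from_front_def merge_cube_simps)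
    have X3: "?X3 \<in> Ar (V0 D (prod_cat ?c rest))" using functor_Ar[OF rkanD(1)[OF pe(1)]] X2 rkanD(2,3)[OF pe(1)] by simp
    have X4: "?X4 \<in> Ar (V0 D (prod_cat ?C (prod_cat ?c B)))" using functor_Ar[OF V1D(1)[OF sm(6)]] X3 V1D(2,3)[OF sm(6)] by simp
    have X5: "?X5 = ?X3" using V1_comp_Ar[OF sm(7,6), of ?X3] X3 ss V1_id_fun[OF scA] by simp
    let ?X6 = "FA ?L ?X3"
    have X6: "?X6 \<in> Ar (V0 D (prod_cat (cube 2) rest))" using functor_Ar[OF lkanD(1)[OF pe(2)]] X3 lkanD(2,3)[OF pe(2)] by simp
    have X8: "FA ?e (FA (V1 D (?s (cube 2))) ?X6) = FA (V1 D (?s (cube 1))) (FA (V1 D (par rest cof_edge)) ?X6)"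
      using V1_comp_Ar[OF w[OF small_edges(3)] sm(5), of ?X6] V1_comp_Ar[OF sm(3) pe(3), of ?X6] X6 nat by simp
    have X9: "FA (V1 D (par rest cof_edge)) ?X6 \<in> Ar (V0 D (prod_cat (cube 1) rest))"
      using functor_Ar[OF V1D(1)[OF pe(3)]] X6 V1D(2,3)[OF pe(3)] by simp
    have X10: "FA (V1 D ?sp) (FA (V1 D (?s (cube 1))) (FA (V1 D (par rest cof_edge)) ?X6)) =
        FA (V1 D (to_front n i B)) (FA (V1 D (par rest cof_edge)) ?X6)"
      using V1_comp_Ar[OF sm(1,3), of "FA (V1 D (par rest cof_edge)) ?X6"] X9 by (simp add: to_front_def split_cube_simps)
    have "FA ?F f = FA (V1 D ?sp) (FA ?e (FA (V1 D (?s (cube 2))) (FA ?L ?X5)))"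
      using HomD(1)[OF X] X1 X2 X4 X3 V1D(2)[OF sm(2)] V1D(2)[OF sm(4)] V1D(2)[OF sm(7)] rkanD(2)[OF pe(1)] by (simp add: merge_cube_simps)
    also have "\<dots> = FA (V1 D (to_front n i B)) (FA (V1 D (par rest cof_edge)) (FA ?L (FA ?R ?X2)))"
      unfolding X5 X8 X10 ..
    also have "\<dots> = FA ?G f"
      unfolding X2' using HomD(1)[OF X] X2 X2' V1D(2)[OF small_front(2)] cofiber_squareD(2)[OF small_A]
        cofiber_square_Hom(1)[OF small_A, of ?X2, OF Ar_Hom]
      by (simp add: MF_cof)
    finally show "FA ?F f = FA ?G f" .
  qed
  ultimately show ?thesis by simp
qed

lemma cof_coordD:
  "is_functor (cof_coord D n i B)" "Src (cof_coord D n i B) = V0 D (prod_cat (cube n) B)"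
  "Tgt (cof_coord D n i B) = V0 D (prod_cat (cube n) B)"
  using cof_coord_naturally_isomorphic V1D[OF small_front(1)] V1D[OF small_front(2)]
  by (simp_all add: naturally_isomorphic_def)

lemma from_front_iso_at:
  assumes f: "f \<in> Hom (V0 D (prod_cat (cube n) B)) X Y" and p: "p \<in> cube_pts n" and b: "b \<in> Ob B"
  shows "iso_at (prod_cat (cube 1) rest) (FA (V1 D (from_front n i B)) f) (Pr (Vx [x]) (Pr (Vx (del_coord i p)) b)) \<longleftrightarrow>
     iso_at (prod_cat (cube n) B) f (Pr (Vx (p[i := x])) b)"
  using iso_at_V1[OF small_front(2), of f X Y "Pr (Vx [x]) (Pr (Vx (del_coord i p)) b)"] f front_FO[OF p b]
  by (cases x) (auto simp: cube_pts_1)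

lemma from_front_zero_at:
  assumes X: "X \<in> Ob (V0 D (prod_cat (cube n) B))" and p: "p \<in> cube_pts n" and b: "b \<in> Ob B"
  shows "zero_at (prod_cat (cube 1) rest) (FO (V1 D (from_front n i B)) X) (Pr (Vx [x]) (Pr (Vx (del_coord i p)) b)) \<longleftrightarrow>
     zero_at (prod_cat (cube n) B) X (Pr (Vx (p[i := x])) b)"
  using zero_at_V1[OF small_front(2), of X "Pr (Vx [x]) (Pr (Vx (del_coord i p)) b)"] X front_FO[OF p b]
  by (cases x) (auto simp: cube_pts_1)

lemma from_front_Hom:
  "f \<in> Hom (V0 D (prod_cat (cube n) B)) X Y \<Longrightarrow> FA (V1 D (from_front n i B)) f \<in>
     Hom (V0 D (prod_cat (cube 1) rest)) (FO (V1 D (from_front n i B)) X) (FO (V1 D (from_front n i B)) Y)"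
  using V1_Hom[OF small_front(2)] by simp

lemma from_front_Ob:
  "X \<in> Ob (V0 D (prod_cat (cube n) B)) \<Longrightarrow> FO (V1 D (from_front n i B)) X \<in> Ob (V0 D (prod_cat (cube 1) rest))"
  using V1_Ob[OF small_front(2)] by simp

lemma to_front_iso_at:
  assumes f: "f \<in> Hom (V0 D (prod_cat (cube 1) rest)) X Y" and p: "p \<in> cube_pts n" and b: "b \<in> Ob B"
  shows "iso_at (prod_cat (cube n) B) (FA (V1 D (to_front n i B)) f) (Pr (Vx p) b) \<longleftrightarrow>
     iso_at (prod_cat (cube 1) rest) f (Pr (Vx [p ! i]) (Pr (Vx (del_coord i p)) b))"
  using iso_at_V1[OF small_front(1), of f X Y "Pr (Vx p) b"] f front_FO(1)[OF p b] p b by simp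

lemma to_front_zero_at:
  assumes X: "X \<in> Ob (V0 D (prod_cat (cube 1) rest))" and p: "p \<in> cube_pts n" and b: "b \<in> Ob B"
  shows "zero_at (prod_cat (cube n) B) (FO (V1 D (to_front n i B)) X) (Pr (Vx p) b) \<longleftrightarrow>
     zero_at (prod_cat (cube 1) rest) X (Pr (Vx [p ! i]) (Pr (Vx (del_coord i p)) b))"
  using zero_at_V1[OF small_front(1), of X "Pr (Vx p) b"] X front_FO(1)[OF p b] p b by simp

lemma cof_coord_iso_at_iff:
  assumes f: "f \<in> Hom (V0 D (prod_cat (cube n) B)) X Y" and p: "p \<in> cube_pts n" and b: "b \<in> Ob B"
  shows "iso_at (prod_cat (cube n) B) (FA (cof_coord D n i B) f) (Pr (Vx p) b) \<longleftrightarrow>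
     iso_at (prod_cat (cube 1) rest) (FA (MF (cof D) rest) (FA (V1 D (from_front n i B)) f)) (Pr (Vx [p ! i]) (Pr (Vx (del_coord i p)) b))"
proof -
  note f' = from_front_Hom[OF f]
  have cf: "FA (MF (cof D) rest) (FA (V1 D (from_front n i B)) f) \<in> Hom (V0 D (prod_cat (cube 1) rest))
      (FO (MF (cof D) rest) (FO (V1 D (from_front n i B)) X)) (FO (MF (cof D) rest) (FO (V1 D (from_front n i B)) Y))"
    using functorD(4)[OF cof_functorD(1)[OF small_A]] cof_functorD(2,3)[OF small_A] f' by simp
  have "iso_at (prod_cat (cube n) B) (FA (cof_coord D n i B) f) (Pr (Vx p) b) \<longleftrightarrow>
     iso_at (prod_cat (cube n) B) (FA (comp_fun (V1 D (to_front n i B)) (comp_fun (MF (cof D) rest) (V1 D (from_front n i B)))) f) (Pr (Vx p) b)"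
    by (rule naturally_isomorphic_iso_at[OF cof_coord_naturally_isomorphic cof_coordD(3) small_nB])
      (use p b f cof_coordD in auto)
  also have "\<dots> \<longleftrightarrow> iso_at (prod_cat (cube n) B) (FA (V1 D (to_front n i B)) (FA (MF (cof D) rest) (FA (V1 D (from_front n i B)) f))) (Pr (Vx p) b)"
    using HomD(1)[OF f] HomD(1)[OF f'] V1D(2)[OF small_front(2)] cof_functorD(2)[OF small_A] by simp
  finally show ?thesis using to_front_iso_at[OF cf p b] by simp
qed

text \<open>At a vertex with p_i = 1 the value is the cone of the edge in direction i that ends in
  p, so the two ends of this edge determine it.\<close>

lemma cof_coord_iso_at:
  assumes f: "f \<in> Hom (V0 D (prod_cat (cube n) B)) X Y" and p: "p \<in> cube_pts n" "p ! i" and b: "b \<in> Ob B"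
    and i1: "iso_at (prod_cat (cube n) B) f (Pr (Vx p) b)" and i0: "iso_at (prod_cat (cube n) B) f (Pr (Vx (p[i := False])) b)"
  shows "iso_at (prod_cat (cube n) B) (FA (cof_coord D n i B) f) (Pr (Vx p) b)"
proof -
  have pi: "p[i := True] = p" using p i list_update_id[of p i] by (simp add: cube_pts_def)
  note f' = from_front_Hom[OF f] and a = front_FO(2)[OF p(1) b]
  show ?thesis
    using cof_coord_iso_at_iff[OF f p(1) b] cof_iso_at[OF small_A f' a] cofiber_square_iso_at_11[OF small_A f' a]
      from_front_iso_at[OF f p(1) b] i1 i0 pi p(2) by simp
qed

text \<open>\<open>stable_iso_at\<close> for the edge in direction i that ends in p, with the
  remaining coordinates as parameters.\<close>

lemma stable_cof_coord_iso_at: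
  assumes st: "stable_derivator U D"
    and f: "f \<in> Hom (V0 D (prod_cat (cube n) B)) X Y" and p: "p \<in> cube_pts n" "p ! i" and b: "b \<in> Ob B"
    and i0: "iso_at (prod_cat (cube n) B) f (Pr (Vx (p[i := False])) b)"
    and i1: "iso_at (prod_cat (cube n) B) (FA (cof_coord D n i B) f) (Pr (Vx p) b)"
  shows "iso_at (prod_cat (cube n) B) f (Pr (Vx p) b)"
proof -
  have pi: "p[i := True] = p" using p i list_update_id[of p i] by (simp add: cube_pts_def)
  show ?thesis
    using stable_iso_at[OF st small_A from_front_Hom[OF f] front_FO(2)[OF p(1) b]]
      cof_coord_iso_at_iff[OF f p(1) b] from_front_iso_at[OF f p(1) b] i0 i1 pi p(2) by simp
qed

text \<open>\<open>cone_arrow\<close> in direction i: zero on the face p_i = 0 and the cones in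
  direction i on the face p_i = 1.\<close>

definition cone_coord :: "('o, 'm, 'o, 'm) func" where
  "cone_coord = comp_fun (V1 D (to_front n i B)) (comp_fun (cone_arrow rest) (V1 D (from_front n i B)))"

lemma cone_coordD:
  "is_functor cone_coord" "Src cone_coord = V0 D (prod_cat (cube n) B)" "Tgt cone_coord = V0 D (prod_cat (cube n) B)"
  unfolding cone_coord_def
  using V1D[OF small_front(1)] V1D[OF small_front(2)] cone_arrowD[OF small_A] by (auto intro!: functor_comp_fun)

lemma cone_coord_Ob:
  assumes X: "X \<in> Ob (V0 D (prod_cat (cube n) B))"
  shows "FO cone_coord X = FO (V1 D (to_front n i B)) (FO (cone_arrow rest) (FO (V1 D (from_front n i B)) X))"
    "FO (cone_arrow rest) (FO (V1 D (from_front n i B)) X) \<in> Ob (V0 D (prod_cat (cube 1) rest))"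
    "FO cone_coord X \<in> Ob (V0 D (prod_cat (cube n) B))"
  using X from_front_Ob[OF X] V1D(2)[OF small_front(2)] cone_arrowD[OF small_A] functorD(3)[OF cone_arrowD(1)[OF small_A]]
    functorD(3)[OF cone_coordD(1)] cone_coordD(2,3) by (simp_all add: cone_coord_def)

lemma cone_coord_zero_at:
  assumes X: "X \<in> Ob (V0 D (prod_cat (cube n) B))" and p: "p \<in> cube_pts n" and b: "b \<in> Ob B"
    and z: "\<not> p ! i \<or> zero_at (prod_cat (cube n) B) X (Pr (Vx p) b) \<and> zero_at (prod_cat (cube n) B) X (Pr (Vx (p[i := False])) b)"
  shows "zero_at (prod_cat (cube n) B) (FO cone_coord X) (Pr (Vx p) b)"
proof (cases "p ! i")
  case True
  have pi: "p[i := True] = p" using p i True list_update_id[of p i] by (simp add: cube_pts_def)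
  show ?thesis
    unfolding cone_coord_Ob(1)[OF X] to_front_zero_at[OF cone_coord_Ob(2)[OF X] p b]
    using cone_arrow_zero_at_1[OF small_A from_front_Ob[OF X] front_FO(2)[OF p b]] from_front_zero_at[OF X p b] z True pi by simp
next
  case False
  thus ?thesis
    unfolding cone_coord_Ob(1)[OF X] to_front_zero_at[OF cone_coord_Ob(2)[OF X] p b]
    using cone_arrow_zero_at[OF small_A from_front_Ob[OF X] front_FO(2)[OF p b]] by simp
qed

text \<open>The universal property of the cone in direction i, stated for targets that receive
  exactly one arrow from X. This is locality of 0 -> X, carried to the front coordinate, through
  \<open>local_at_cone_arrow\<close>, and back.\<close>

lemma cone_coord_unique_arrow:
  assumes X: "X \<in> Ob (V0 D (prod_cat (cube n) B))" and V: "V \<in> Ob (V0 D (prod_cat (cube n) B))"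
    and z: "\<And>p b. p \<in> cube_pts n \<Longrightarrow> \<not> p ! i \<Longrightarrow> b \<in> Ob B \<Longrightarrow> zero_at (prod_cat (cube n) B) V (Pr (Vx p) b)"
    and u: "\<exists>!f. f \<in> Hom (V0 D (prod_cat (cube n) B)) X V"
  shows "\<exists>!f. f \<in> Hom (V0 D (prod_cat (cube n) B)) (FO cone_coord X) V"
proof -
  let ?C = "V0 D (prod_cat (cube n) B)" and ?C1 = "V0 D (prod_cat (cube 1) rest)"
  let ?t = "V1 D (to_front n i B)" and ?f = "V1 D (from_front n i B)"
  note C = category_V0[OF small_nB] and C1 = category_V0[OF small_1A]
  obtain o' where o: "zero_object ?C o'" using ex_zero[OF small_nB] by auto
  have oo: "o' \<in> Ob ?C" using zero_objectD(1)[OF o] .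
  obtain h where h: "h \<in> Hom ?C o' X" using zero_objectD(2)[OF o X] by auto
  have l: "local_at ?C h V" using local_at_from_zero[OF C o h V] u by simp
  note inv1 = V1_inverse[OF small_front(2,1)] and inv2 = V1_inverse[OF small_front(1,2)]
  have tf: "FO ?t (FO ?f V) = V" using inv2(2)[of V] V front_inverse by simp
  have A1: "local_at (V0 D (Src (from_front n i B))) (FA ?f h) (FO ?f V) \<longleftrightarrow> local_at (V0 D (Tgt (from_front n i B))) h (FO ?t (FO ?f V))"
    using local_at_hom_adj[OF inv1(1), of h o' X "FO ?f V"] front_inverse h from_front_Ob[OF V] V1D(2,3)[OF small_front(2)] by simp
  have 1: "local_at ?C1 (FA ?f h) (FO ?f V)" using A1 tf l by simp
  \<comment> \<open>The vertex 0 of the front coordinate together with a parameter object is a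
    vertex of the cube whose coordinate i is 0, where V vanishes by \<open>z\<close>.\<close>
  have z1: "zero_at (prod_cat (cube 1) rest) (FO ?f V) (Pr (Vx [False]) a)" if "a \<in> Ob rest" for a
  proof -
    obtain q b where a: "a = Pr (Vx q) b" "q \<in> cube_pts (n - 1)" "b \<in> Ob B" using \<open>a \<in> Ob rest\<close> by auto
    define p where "p = ins_coord i [False] q"
    have len: "i \<le> length q" using a(2) i by (simp add: cube_pts_def)
    have p: "p \<in> cube_pts n" "del_coord i p = q" "\<not> p ! i"
      using length_ins_coord[OF i, of q "[False]"] a(2) del_ins_coord[OF len] by (auto simp: p_def cube_pts_def)
    have "p[i := False] = p" using p list_update_id[of p i] by simp
    thus ?thesis using from_front_zero_at[OF V p(1) a(3), of False] p z[OF p(1,3) a(3)] a by simp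
  qed
  note fh = from_front_Hom[OF h]
  have 2: "local_at ?C1 (FA (cone_arrow rest) (FA ?f h)) (FO ?f V)"
    using local_at_cone_arrow[OF small_A fh from_front_Ob[OF V] z1] 1 by simp
  have cfh: "FA (cone_arrow rest) (FA ?f h) \<in> Hom ?C1 (FO (cone_arrow rest) (FO ?f o')) (FO (cone_arrow rest) (FO ?f X))"
    using functorD(4)[OF cone_arrowD(1)[OF small_A]] cone_arrowD(2,3)[OF small_A] fh by simp
  have 3: "local_at ?C (FA ?t (FA (cone_arrow rest) (FA ?f h))) V"
    using local_at_hom_adj[OF inv2(1), of "FA (cone_arrow rest) (FA ?f h)"] front_inverse cfh V V1D(2,3)[OF small_front(1)] 2 by simp
  have "FA cone_coord h = FA ?t (FA (cone_arrow rest) (FA ?f h))"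
    using HomD(1)[OF h] HomD(1)[OF fh] V1D(2)[OF small_front(2)] cone_arrowD(2)[OF small_A] by (simp add: cone_coord_def)
  hence l': "local_at ?C (FA cone_coord h) V" using 3 by simp
  have ch: "FA cone_coord h \<in> Hom ?C (FO cone_coord o') (FO cone_coord X)"
    using functorD(4)[OF cone_coordD(1)] cone_coordD(2,3) h by simp
  have co: "zero_object ?C (FO cone_coord o')"
  proof -
    have "zero_at (prod_cat (cube n) B) (FO cone_coord o') x" if x0: "x \<in> Ob (prod_cat (cube n) B)" for x
    proof -
      obtain p b where x: "x = Pr (Vx p) b" "p \<in> cube_pts n" "b \<in> Ob B" using x0 by auto
      have "p[i := False] \<in> cube_pts n" using x by (simp add: cube_pts_def)
      thus ?thesis using cone_coord_zero_at[OF oo x(2,3)] zero_object_zero_at[OF small_nB o] x by auto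
    qed
    thus ?thesis using zero_object_iff[OF small_nB cone_coord_Ob(3)[OF oo]] by simp
  qed
  show ?thesis using local_at_from_zero[OF C co ch V] l' by simp
qed

text \<open>The cospan of \<open>cof_cone_arrow_comparison\<close>, moved to coordinate i. The
  isomorphism \<open>c\<close> in its left leg comes from the separate choices of Kan extensions in
  \<open>cof_coord\<close>.\<close>

lemma cof_cone_coord_comparison:
  assumes X: "X \<in> Ob (V0 D (prod_cat (cube n) B))"
  shows "\<exists>V f g. f \<in> Hom (V0 D (prod_cat (cube n) B)) (FO (cof_coord D n i B) X) V \<and>
    g \<in> Hom (V0 D (prod_cat (cube n) B)) (FO cone_coord X) V \<and>
    (\<forall>p\<in>cube_pts n. p ! i \<longrightarrow> (\<forall>b\<in>Ob B. iso_at (prod_cat (cube n) B) f (Pr (Vx p) b) \<and> iso_at (prod_cat (cube n) B) g (Pr (Vx p) b)))"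
proof -
  let ?C = "V0 D (prod_cat (cube n) B)" and ?C1 = "V0 D (prod_cat (cube 1) rest)"
  let ?t = "V1 D (to_front n i B)" and ?f = "V1 D (from_front n i B)"
  note C = category_V0[OF small_nB]
  note fX = from_front_Ob[OF X]
  obtain V f g where fg: "f \<in> Hom ?C1 (FO (MF (cof D) rest) (FO ?f X)) V" "g \<in> Hom ?C1 (FO (cone_arrow rest) (FO ?f X)) V"
    "\<forall>a\<in>Ob rest. iso_at (prod_cat (cube 1) rest) f (Pr (Vx [True]) a) \<and> iso_at (prod_cat (cube 1) rest) g (Pr (Vx [True]) a)"
    using cof_cone_arrow_comparison[OF small_A fX] by auto
  obtain c where c: "\<forall>x\<in>Ob (Src (cof_coord D n i B)). c x \<in> Hom (Tgt (cof_coord D n i B)) (FO (cof_coord D n i B) x)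
      (FO (comp_fun ?t (comp_fun (MF (cof D) rest) ?f)) x) \<and> invertible (Tgt (cof_coord D n i B)) (c x)"
    using naturally_isomorphicE[OF cof_coord_naturally_isomorphic] by metis
  have cX: "c X \<in> Hom ?C (FO (cof_coord D n i B) X) (FO ?t (FO (MF (cof D) rest) (FO ?f X)))" "invertible ?C (c X)"
    using c X cof_coordD fX V1D(2)[OF small_front(2)] cof_functorD(2)[OF small_A] by auto
  have tf: "FA ?t f \<in> Hom ?C (FO ?t (FO (MF (cof D) rest) (FO ?f X))) (FO ?t V)" using V1_Hom[OF small_front(1)] fg(1) by simp
  have tg: "FA ?t g \<in> Hom ?C (FO cone_coord X) (FO ?t V)" using V1_Hom[OF small_front(1)] fg(2) cone_coord_Ob(1)[OF X] by simp
  have i1: "iso_at (prod_cat (cube n) B) (FA ?t f) (Pr (Vx p) b)" "iso_at (prod_cat (cube n) B) (FA ?t g) (Pr (Vx p) b)"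
    if "p \<in> cube_pts n" "p ! i" "b \<in> Ob B" for p b
    using to_front_iso_at[OF fg(1) that(1,3)] to_front_iso_at[OF fg(2) that(1,3)] fg(3) front_FO(2)[OF that(1,3)] that(2) by auto
  have i2: "iso_at (prod_cat (cube n) B) (Cmp ?C (FA ?t f) (c X)) (Pr (Vx p) b)" if p: "p \<in> cube_pts n" "p ! i" "b \<in> Ob B" for p b
  proof -
    have a: "Pr (Vx p) b \<in> Ob (prod_cat (cube n) B)" using p by simp
    note pt = small_pt[OF small_nB a]
    have "FA (V1 D (pt_fun (prod_cat (cube n) B) (Pr (Vx p) b))) (Cmp ?C (FA ?t f) (c X)) =
       Cmp (V0 D term_cat) (FA (V1 D (pt_fun (prod_cat (cube n) B) (Pr (Vx p) b))) (FA ?t f)) (FA (V1 D (pt_fun (prod_cat (cube n) B) (Pr (Vx p) b))) (c X))"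
      using V1_Cmp[OF pt, of "FA ?t f" _ _ "c X"] tf cX(1) by simp
    moreover have "iso_at (prod_cat (cube n) B) (c X) (Pr (Vx p) b)"
      using invertible_iff[OF small_nB cX(1)] cX(2) a by blast
    ultimately show ?thesis
      using i1(1)[OF p] V1_Hom[OF pt, of "FA ?t f"] V1_Hom[OF pt, of "c X"] tf cX(1)
        invertible_Cmp[OF category_V0[OF small_term]] unfolding iso_at_def by fastforce
  qed
  show ?thesis using Cmp_Hom[OF C tf cX(1)] tg i1(2) i2 by blast
qed

end

end

section \<open>Total cones and cotruncated cubes\<close>

context pointed_derivator
begin

text \<open>Cofibers and cones are compared by cospans, so that repeating the comparison over
  several coordinates produces zigzags. P records the vertices at which all their arrows are
  invertible.\<close>

definition coord_step :: "nat \<Rightarrow> (bool list \<Rightarrow> bool) \<Rightarrow> 'a scat \<Rightarrow> 'o \<Rightarrow> 'o \<Rightarrow> bool" where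
  "coord_step n P B X Y \<longleftrightarrow>
     (\<exists>f. (f \<in> Hom (V0 D (prod_cat (cube n) B)) X Y \<or> f \<in> Hom (V0 D (prod_cat (cube n) B)) Y X) \<and>
        (\<forall>p\<in>cube_pts n. P p \<longrightarrow> (\<forall>b\<in>Ob B. iso_at (prod_cat (cube n) B) f (Pr (Vx p) b))))"

abbreviation "zigzag n P B \<equiv> (coord_step n P B)\<^sup>*\<^sup>*"

lemma zigzag_zero_at:
  assumes B: "small_cat U B" and z: "zigzag n P B X Y" and p: "p \<in> cube_pts n" "P p" and b: "b \<in> Ob B"
  shows "zero_at (prod_cat (cube n) B) X (Pr (Vx p) b) \<longleftrightarrow> zero_at (prod_cat (cube n) B) Y (Pr (Vx p) b)"
  using z
proof (induction rule: rtranclp_induct)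
  case (step Y Z)
  have s: "small_cat U (prod_cat (cube n) B)" using small_prod[OF universe small_cube B] .
  have "zero_at (prod_cat (cube n) B) Y (Pr (Vx p) b) \<longleftrightarrow> zero_at (prod_cat (cube n) B) Z (Pr (Vx p) b)"
    using step(2) zero_at_iso[OF s, of "Pr (Vx p) b"] p b unfolding coord_step_def by auto
  thus ?case using step(3) by simp
qed simp

text \<open>The cofiber at a vertex p with p_i = 1 involves the values at p and at its neighbour
  with coordinate 0, so both have to satisfy P.\<close>

lemma zigzag_cof_coord:
  assumes B: "small_cat U B" and i: "i < n" and z: "zigzag n P B X Y"
    and PQ: "\<And>p. p \<in> cube_pts n \<Longrightarrow> Q p \<Longrightarrow> p ! i \<and> P p \<and> P (p[i := False])"
  shows "zigzag n Q B (FO (cof_coord D n i B) X) (FO (cof_coord D n i B) Y)"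
  using z
proof (induction rule: rtranclp_induct)
  case (step Y Z)
  obtain f where f: "f \<in> Hom (V0 D (prod_cat (cube n) B)) Y Z \<or> f \<in> Hom (V0 D (prod_cat (cube n) B)) Z Y"
    and fi: "\<forall>p\<in>cube_pts n. P p \<longrightarrow> (\<forall>b\<in>Ob B. iso_at (prod_cat (cube n) B) f (Pr (Vx p) b))"
    using step(2) unfolding coord_step_def by auto
  let ?F = "cof_coord D n i B"
  have Ff: "FA ?F f \<in> Hom (V0 D (prod_cat (cube n) B)) (FO ?F Y) (FO ?F Z) \<or> FA ?F f \<in> Hom (V0 D (prod_cat (cube n) B)) (FO ?F Z) (FO ?F Y)"
    using functorD(4)[OF cof_coordD(1)[OF i B], of f] cof_coordD(2,3)[OF i B] f by auto
  have "iso_at (prod_cat (cube n) B) (FA ?F f) (Pr (Vx p) b)" if p: "p \<in> cube_pts n" "Q p" "b \<in> Ob B" for p b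
  proof -
    have "p[i := False] \<in> cube_pts n" using p by (simp add: cube_pts_def)
    thus ?thesis using cof_coord_iso_at[OF i B _ p(1) _ p(3)] f fi PQ[OF p(1,2)] p by blast
  qed
  hence "coord_step n Q B (FO ?F Y) (FO ?F Z)" unfolding coord_step_def using Ff by blast
  thus ?case using step(3) by simp
qed simp

lemma zigzag_cof_cone_coord:
  assumes B: "small_cat U B" and i: "i < n" and X: "X \<in> Ob (V0 D (prod_cat (cube n) B))"
    and Q: "\<And>p. p \<in> cube_pts n \<Longrightarrow> Q p \<Longrightarrow> p ! i"
  shows "zigzag n Q B (FO (cof_coord D n i B) X) (FO (cone_coord n i B) X)"
proof -
  obtain V f g where fg: "f \<in> Hom (V0 D (prod_cat (cube n) B)) (FO (cof_coord D n i B) X) V"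
    "g \<in> Hom (V0 D (prod_cat (cube n) B)) (FO (cone_coord n i B) X) V"
    "\<forall>p\<in>cube_pts n. p ! i \<longrightarrow> (\<forall>b\<in>Ob B. iso_at (prod_cat (cube n) B) f (Pr (Vx p) b) \<and> iso_at (prod_cat (cube n) B) g (Pr (Vx p) b))"
    using cof_cone_coord_comparison[OF i B X] by auto
  have "coord_step n Q B (FO (cof_coord D n i B) X) V" "coord_step n Q B V (FO (cone_coord n i B) X)"
    unfolding coord_step_def using fg Q by blast+
  thus ?thesis by (meson converse_rtranclp_into_rtranclp r_into_rtranclp)
qed

text \<open>Prefixes of the fold in \<open>cof_multi\<close>, for induction on the number of
  coordinates already treated.\<close>

definition cof_upto :: "bool list \<Rightarrow> nat \<Rightarrow> 'a scat \<Rightarrow> ('o, 'm, 'o, 'm) func" where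
  "cof_upto m j B =
     fold (\<lambda>i F. if m ! i then comp_fun (cof_coord D (length m) i B) F else F) [0..<j]
       (id_fun (V0 (shift (cube (length m)) D) B))"

lemma cof_multi_eq: "cof_multi D m B = cof_upto m (length m) B"
  by (simp add: cof_multi_def cof_upto_def)

lemma cof_upto_0: "cof_upto m 0 B = id_fun (V0 D (prod_cat (cube (length m)) B))"
  by (simp add: cof_upto_def)

lemma cof_upto_Suc:
  "cof_upto m (Suc j) B = (if m ! j then comp_fun (cof_coord D (length m) j B) (cof_upto m j B) else cof_upto m j B)"
  by (simp add: cof_upto_def)

lemma cof_uptoD:
  assumes B: "small_cat U B" and j: "j \<le> length m"
  shows "is_functor (cof_upto m j B) \<and> Src (cof_upto m j B) = V0 D (prod_cat (cube (length m)) B) \<and>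
    Tgt (cof_upto m j B) = V0 D (prod_cat (cube (length m)) B)"
  using j
proof (induction j)
  case 0
  show ?case using category_V0[OF small_prod[OF universe small_cube B]] by (simp add: cof_upto_0 functor_id_fun)
next
  case (Suc j)
  thus ?case using cof_coordD[of j "length m" B] B by (auto simp: cof_upto_Suc intro: functor_comp_fun)
qed

text \<open>m \<le> p tested on the first j coordinates: the region outside which the partial total
  cone, extended by zero, vanishes.\<close>

definition ge_upto :: "bool list \<Rightarrow> nat \<Rightarrow> bool list \<Rightarrow> bool" where
  "ge_upto m j p \<longleftrightarrow> (\<forall>l<j. m ! l \<longrightarrow> p ! l)"

lemma ge_upto_Suc: "ge_upto m (Suc j) p \<longleftrightarrow> ge_upto m j p \<and> (m ! j \<longrightarrow> p ! j)"
  by (auto simp: ge_upto_def less_Suc_eq)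

lemma ge_upto_update: "ge_upto m j (p[j := x]) \<longleftrightarrow> ge_upto m j p"
  by (auto simp: ge_upto_def)

lemma ge_upto_length: "length m = length p \<Longrightarrow> ge_upto m (length m) p \<longleftrightarrow> list_all2 (\<le>) m p"
  by (auto simp: ge_upto_def ble_iff)

text \<open>
  The total cone, extended by zero from the vertices above \<open>m\<close>: it is the reflection of \<open>X\<close> onto
  the objects supported on those vertices, and agrees there with \<open>cof_multi\<close>.
\<close>

lemma total_cone_reflection:
  assumes B: "small_cat U B" and X: "X \<in> Ob (V0 D (prod_cat (cube (length m)) B))" and j: "j \<le> length m"
  defines "C \<equiv> V0 D (prod_cat (cube (length m)) B)"
    and "supp \<equiv> \<lambda>j V. \<forall>p\<in>cube_pts (length m). \<not> ge_upto m j p \<longrightarrow> (\<forall>b\<in>Ob B. zero_at (prod_cat (cube (length m)) B) V (Pr (Vx p) b))"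
  shows "\<exists>R\<in>Ob C. supp j R \<and> (\<forall>V\<in>Ob C. supp j V \<and> (\<exists>!f. f \<in> Hom C X V) \<longrightarrow> (\<exists>!f. f \<in> Hom C R V)) \<and>
    zigzag (length m) (ge_upto m j) B (FO (cof_upto m j B) X) R"
  using j
proof (induction j)
  case 0
  show ?case using X by (intro bexI[of _ X]) (auto simp: supp_def cof_upto_0 ge_upto_def C_def)
next
  case (Suc j)
  let ?n = "length m"
  obtain R where R: "R \<in> Ob C" "supp j R" "\<And>V. V \<in> Ob C \<Longrightarrow> supp j V \<Longrightarrow> \<exists>!f. f \<in> Hom C X V \<Longrightarrow> \<exists>!f. f \<in> Hom C R V"
    "zigzag ?n (ge_upto m j) B (FO (cof_upto m j B) X) R"
    using Suc by auto
  have j: "j < ?n" using Suc.prems by simp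
  \<comment> \<open>A longer prefix imposes more conditions on p and hence more zeros on V, so a
    target admissible for j + 1 is admissible for j.\<close>
  have sj: "supp j V" if "supp (Suc j) V" for V using that by (auto simp: supp_def ge_upto_Suc)
  show ?case
  proof (cases "m ! j")
    case False
    hence "ge_upto m (Suc j) = ge_upto m j" by (auto simp: ge_upto_Suc)
    hence "supp (Suc j) = supp j" by (simp add: supp_def)
    thus ?thesis using R False \<open>ge_upto m (Suc j) = ge_upto m j\<close> by (intro bexI[of _ R]) (auto simp: cof_upto_Suc)
  next
    case True
    note R0 = R(1)[unfolded C_def]
    let ?R = "FO (cone_coord ?n j B) R"
    have 1: "?R \<in> Ob C" using cone_coord_Ob(3)[OF j B R0] by (simp add: C_def)
    have 2: "supp (Suc j) ?R"
      unfolding supp_def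
    proof (intro ballI impI)
      fix p b assume p: "p \<in> cube_pts ?n" "\<not> ge_upto m (Suc j) p" and b: "b \<in> Ob B"
      have p': "p[j := False] \<in> cube_pts ?n" using p by (simp add: cube_pts_def)
      have "\<not> p ! j \<or> zero_at (prod_cat (cube ?n) B) R (Pr (Vx p) b) \<and> zero_at (prod_cat (cube ?n) B) R (Pr (Vx (p[j := False])) b)"
        using p p' b R(2) True ge_upto_update[of m j p False] unfolding supp_def ge_upto_Suc by blast
      thus "zero_at (prod_cat (cube ?n) B) ?R (Pr (Vx p) b)"
        using cone_coord_zero_at[OF j B R0 p(1) b] by blast
    qed
    have 3: "\<exists>!f. f \<in> Hom C ?R V" if V: "V \<in> Ob C" "supp (Suc j) V" "\<exists>!f. f \<in> Hom C X V" for V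
    proof -
      have "\<exists>!f. f \<in> Hom C R V" using R(3)[OF V(1) sj[OF V(2)] V(3)] .
      thus ?thesis
        unfolding C_def by (intro cone_coord_unique_arrow[OF j B R0])
          (use V True in \<open>auto simp: C_def supp_def ge_upto_Suc\<close>)
    qed
    have F: "is_functor (cof_upto m j B)" "Src (cof_upto m j B) = C" "Tgt (cof_upto m j B) = C"
      using cof_uptoD[OF B, of j m] j by (auto simp: C_def)
    \<comment> \<open>Two comparisons are chained: \<open>cof\<close> in direction j applied to the
      zigzag for j, and then \<open>cof\<close> of R against the cone of R. Both are used on
      vertices with p_j = 1.\<close>
    have "zigzag ?n (ge_upto m (Suc j)) B (FO (cof_coord D ?n j B) (FO (cof_upto m j B) X)) (FO (cof_coord D ?n j B) R)"
      by (rule zigzag_cof_coord[OF B j R(4)]) (use True in \<open>simp add: ge_upto_Suc ge_upto_update\<close>)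
    moreover have "zigzag ?n (ge_upto m (Suc j)) B (FO (cof_coord D ?n j B) R) ?R"
      by (rule zigzag_cof_cone_coord[OF B j R0]) (use True in \<open>simp add: ge_upto_Suc\<close>)
    ultimately have "zigzag ?n (ge_upto m (Suc j)) B (FO (cof_upto m (Suc j) B) X) ?R"
      using X F(2) True by (simp add: cof_upto_Suc C_def)
    thus ?thesis using 1 2 3 by (intro bexI[of _ ?R]) simp_all
  qed
qed

section \<open>Vanishing of total cones, vertex by vertex\<close>

lemma functor_ones_fun: "is_functor (ones_fun m)"
  unfolding ones_fun_def
proof (rule functor_poset)
  show "insert_ones m p \<in> cube_pts (length m)" for p
    by (simp add: cube_pts_def length_insert_ones)
  show "list_all2 (\<le>) (insert_ones m p) (insert_ones m q)"
    if "p \<in> cube_pts (length m - weight m)" "list_all2 (\<le>) p q" for p q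
    using insert_ones_mono[OF that(2)] that(1) by (simp add: cube_pts_def)
qed

text \<open>Zero objects are detected at vertices, and the face \<open>ones_fun m\<close> consists
  of the vertices above m.\<close>

lemma cone_vanishes_iff:
  assumes B: "small_cat U B" and X: "X \<in> Ob (V0 D (prod_cat (cube (length m)) B))"
  shows "cone_vanishes D m B X \<longleftrightarrow>
    (\<forall>p\<in>cube_pts (length m). list_all2 (\<le>) m p \<longrightarrow>
      (\<forall>b\<in>Ob B. zero_at (prod_cat (cube (length m)) B) (FO (cof_multi D m B) X) (Pr (Vx p) b)))"
proof -
  let ?n = "length m" let ?r = "?n - weight m"
  have F: "is_functor (cof_multi D m B)" "Src (cof_multi D m B) = V0 D (prod_cat (cube ?n) B)" "Tgt (cof_multi D m B) = V0 D (prod_cat (cube ?n) B)"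
    using cof_uptoD[OF B, of "length m" m] by (auto simp: cof_multi_eq)
  let ?Y = "FO (cof_multi D m B) X"
  have Y: "?Y \<in> Ob (V0 D (prod_cat (cube ?n) B))" using functorD(3)[OF F(1)] F X by simp
  have o: "small_fun U (par B (ones_fun m))"
    using small_par[OF B small_poset_fun[OF functor_ones_fun[of m, unfolded ones_fun_def] finite_pts(1) finite_pts(1)]]
    by (simp add: ones_fun_def)
  have S: "Src (ones_fun m :: 'a sfun) = cube ?r" "Tgt (ones_fun m :: 'a sfun) = cube ?n" by (simp_all add: ones_fun_def)
  have s: "small_cat U (prod_cat (cube ?r) B)" using small_prod[OF universe small_cube B] .
  have oY: "FO (V1 D (par B (ones_fun m))) ?Y \<in> Ob (V0 D (prod_cat (cube ?r) B))" using V1_Ob[OF o] Y S by simp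
  have "cone_vanishes D m B X \<longleftrightarrow> zero_object (V0 D (prod_cat (cube ?r) B)) (FO (V1 D (par B (ones_fun m))) ?Y)"
    using X F by (simp add: cone_vanishes_def cone_multi_def mres_def)
  also have "\<dots> \<longleftrightarrow> (\<forall>x\<in>Ob (prod_cat (cube ?r) B). zero_at (prod_cat (cube ?r) B) (FO (V1 D (par B (ones_fun m))) ?Y) x)"
    using zero_object_iff[OF s oY] .
  also have "\<dots> \<longleftrightarrow> (\<forall>q\<in>cube_pts ?r. \<forall>b\<in>Ob B. zero_at (prod_cat (cube ?r) B) (FO (V1 D (par B (ones_fun m))) ?Y) (Pr (Vx q) b))"
    by auto
  also have "\<dots> \<longleftrightarrow> (\<forall>q\<in>cube_pts ?r. \<forall>b\<in>Ob B. zero_at (prod_cat (cube ?n) B) ?Y (Pr (Vx (insert_ones m q)) b))"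
  proof (intro ball_cong refl)
    fix q b assume q: "q \<in> cube_pts ?r" and b: "b \<in> Ob B"
    have "FO (par B (ones_fun m)) (Pr (Vx q) b) = Pr (Vx (insert_ones m q)) b"
      using q b by (simp add: ones_fun_def)
    thus "zero_at (prod_cat (cube ?r) B) (FO (V1 D (par B (ones_fun m))) ?Y) (Pr (Vx q) b) \<longleftrightarrow>
        zero_at (prod_cat (cube ?n) B) ?Y (Pr (Vx (insert_ones m q)) b)"
      using zero_at_V1[OF o, of ?Y "Pr (Vx q) b"] Y S q b by simp
  qed
  also have "\<dots> \<longleftrightarrow> (\<forall>p\<in>cube_pts ?n. list_all2 (\<le>) m p \<longrightarrow> (\<forall>b\<in>Ob B. zero_at (prod_cat (cube ?n) B) ?Y (Pr (Vx p) b)))"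
    (is "?A \<longleftrightarrow> ?Q")
  proof
    show ?Q if A: ?A
    proof (intro ballI impI)
      fix p b assume p: "p \<in> cube_pts ?n" "list_all2 (\<le>) m p" and b: "b \<in> Ob B"
      obtain q where "length q = ?r" "insert_ones m q = p" using insert_ones_surj[OF p(2)] by auto
      thus "zero_at (prod_cat (cube ?n) B) ?Y (Pr (Vx p) b)" using A b by (auto simp: cube_pts_def)
    qed
    show ?A if Q: ?Q
      using Q insert_ones_ge[of m] length_insert_ones[of m] by (simp add: cube_pts_def)
  qed
  finally show ?thesis .
qed

section \<open>Cotruncated cubes\<close>

lemma functor_trunc_incl: "is_functor (trunc_incl n k)"
  unfolding trunc_incl_def by (rule functor_poset) (auto simp: trunc_pts_def)

lemma small_trunc: "small_cat U B \<Longrightarrow> small_fun U (par B (trunc_incl n k))"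
  using small_par[OF _ small_poset_fun[OF functor_trunc_incl[of n k, unfolded trunc_incl_def]
      finite_subset[OF _ finite_pts(1)[of n]] finite_pts(1)]]
  by (auto simp: trunc_incl_def trunc_pts_def)

lemma trunc_simps [simp]: "Src (trunc_incl n k) = poset_cat (trunc_pts n k)" "Tgt (trunc_incl n k) = cube n"
  by (simp_all add: trunc_incl_def)

lemma FO_trunc: "p \<in> trunc_pts n k \<Longrightarrow> b \<in> Ob B \<Longrightarrow> FO (par B (trunc_incl n k)) (Pr (Vx p) b) = Pr (Vx p) b"
  by (simp add: trunc_incl_def)

lemma cotruncated_iff:
  "cotruncated D n k B X \<longleftrightarrow> (\<exists>Y\<in>Ob (V0 D (prod_cat (poset_cat (trunc_pts n k)) B)).
     isomorphic (V0 D (prod_cat (cube n) B)) (FO (lkan D (par B (trunc_incl n k))) Y) X)"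
  by (simp add: cotruncated_def mlan_def)

text \<open>If X comes from Y, arrows X -> V correspond to arrows from Y to the restriction of V,
  which is zero by \<open>z\<close>. The count of arrows is carried along as locality of 0 ->
  Y.\<close>

lemma cotruncated_unique_arrow:
  assumes B: "small_cat U B" and c: "cotruncated D n k B X" and V: "V \<in> Ob (V0 D (prod_cat (cube n) B))"
    and z: "\<And>p b. p \<in> trunc_pts n k \<Longrightarrow> b \<in> Ob B \<Longrightarrow> zero_at (prod_cat (cube n) B) V (Pr (Vx p) b)"
  shows "\<exists>!f. f \<in> Hom (V0 D (prod_cat (cube n) B)) X V"
proof -
  let ?C = "V0 D (prod_cat (cube n) B)" and ?u = "par B (trunc_incl n k)"
  let ?T = "prod_cat (poset_cat (trunc_pts n k)) B"
  note u = small_trunc[OF B, of n k]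
  have s: "small_cat U (prod_cat (cube n) B)" "small_cat U ?T" using small_funD(2,3)[OF u] by auto
  note C = category_V0[OF s(1)]
  obtain Y g where Y: "Y \<in> Ob (V0 D ?T)" and g: "g \<in> Hom ?C (FO (lkan D ?u) Y) X" "invertible ?C g"
    using c unfolding cotruncated_iff isomorphic_def by auto
  let ?uV = "FO (V1 D ?u) V"
  have uV: "?uV \<in> Ob (V0 D ?T)" using V1_Ob[OF u] V by simp
  have "zero_at ?T ?uV x" if x0: "x \<in> Ob ?T" for x
  proof -
    obtain p b where x: "x = Pr (Vx p) b" "p \<in> trunc_pts n k" "b \<in> Ob B" using x0 by auto
    show ?thesis using zero_at_V1[OF u, of V x] V x x0 FO_trunc[OF x(2,3)] z[OF x(2,3)] by simp
  qed
  hence zuV: "zero_object (V0 D ?T) ?uV" using zero_object_iff[OF s(2) uV] by blast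
  obtain o' where o: "zero_object (V0 D ?T) o'" using ex_zero[OF s(2)] by auto
  obtain h where h: "h \<in> Hom (V0 D ?T) o' Y" using zero_objectD(2)[OF o Y] by auto
  have l: "local_at (V0 D ?T) h ?uV" using local_at_zero_object[OF category_V0[OF s(2)] h zuV] .
  have l2: "local_at ?C (FA (lkan D ?u) h) V" using local_at_lkan[OF u, of h o' Y V] h V l by simp
  have zo: "zero_object ?C (FO (lkan D ?u) o')" using lkan_zero[OF u] o by simp
  have Lh: "FA (lkan D ?u) h \<in> Hom ?C (FO (lkan D ?u) o') (FO (lkan D ?u) Y)" using lkan_Hom[OF u] h by simp
  have "\<exists>!f. f \<in> Hom ?C (FO (lkan D ?u) Y) V" using local_at_from_zero[OF C zo Lh V] l2 by simp
  \<comment> \<open>X is merely isomorphic to a left Kan extension; the isomorphism g carries the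
    uniqueness over.\<close>
  moreover have "local_at ?C (FA (lkan D ?u) h) V \<longleftrightarrow> local_at ?C (Cmp ?C g (FA (lkan D ?u) h)) V"
    using local_at_from_zero[OF C zo Lh V] local_at_from_zero[OF C zo Cmp_Hom[OF C g(1) Lh] V]
      local_atD[OF C local_at_invertible[OF C g(1,2), of V] g(1)] Cmp_Hom[OF C _ g(1)] by metis
  ultimately show ?thesis using local_at_from_zero[OF C zo Cmp_Hom[OF C g(1) Lh] V] l2 by simp
qed

lemma cotruncated_cone_vanishes:
  assumes B: "small_cat U B" and X: "X \<in> Ob (V0 D (prod_cat (cube n) B))" and c: "cotruncated D n k B X"
    and m: "length m = n" "weight m = k + 1"
  shows "cone_vanishes D m B X"
proof -
  let ?C = "V0 D (prod_cat (cube n) B)"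
  have s: "small_cat U (prod_cat (cube n) B)" using small_prod[OF universe small_cube B] .
  have X': "X \<in> Ob (V0 D (prod_cat (cube (length m)) B))" using X m by simp
  obtain R where R: "R \<in> Ob ?C"
    "\<forall>p\<in>cube_pts n. \<not> ge_upto m n p \<longrightarrow> (\<forall>b\<in>Ob B. zero_at (prod_cat (cube n) B) R (Pr (Vx p) b))"
    "\<exists>!f. f \<in> Hom ?C X R \<Longrightarrow> \<exists>!f. f \<in> Hom ?C R R"
    "zigzag n (ge_upto m n) B (FO (cof_upto m n B) X) R"
    using total_cone_reflection[OF B X', of "length m"] m(1) by auto
  have ge: "ge_upto m n p \<longleftrightarrow> list_all2 (\<le>) m p" if "p \<in> cube_pts n" for p
    using ge_upto_length[of m p] that m(1) by (simp add: cube_pts_def)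
  have "\<exists>!f. f \<in> Hom ?C X R"
  proof (rule cotruncated_unique_arrow[OF B c R(1)])
    fix p b assume p: "p \<in> trunc_pts n k" and b: "b \<in> Ob B"
    hence "p \<in> cube_pts n" "weight p \<le> k" by (auto simp: trunc_pts_def)
    \<comment> \<open>A vertex of weight at most k cannot lie above m, whose weight is k +
      1.\<close>
    moreover have "\<not> list_all2 (\<le>) m p" using weight_mono[of m p] m(2) \<open>weight p \<le> k\<close> by auto
    ultimately show "zero_at (prod_cat (cube n) B) R (Pr (Vx p) b)" using R(2) ge b by blast
  qed
  \<comment> \<open>R is itself supported above m, so it is an admissible target of its own
    universal property. It then has a single endomorphism and is zero.\<close>
  hence u: "\<exists>!f. f \<in> Hom ?C R R" using R(3) by blast
  obtain o' where o: "zero_object ?C o'" using ex_zero[OF s] by auto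
  have zR: "zero_object ?C R" using zero_object_unique_endo[OF category_V0[OF s] o R(1) u] .
  have "zero_at (prod_cat (cube n) B) (FO (cof_multi D m B) X) (Pr (Vx p) b)"
    if p: "p \<in> cube_pts n" "list_all2 (\<le>) m p" "b \<in> Ob B" for p b
    using zigzag_zero_at[OF B R(4) p(1) _ p(3)] ge[OF p(1)] p zero_object_zero_at[OF s zR] m(1) by (simp add: cof_multi_eq)
  thus ?thesis using cone_vanishes_iff[OF B X'] m(1) by blast
qed

text \<open>Taking the cofiber in direction j at q consults q and its neighbour
  \<open>q[j := False]\<close>. Both stay strictly below p, so p itself never enters.\<close>

lemma cof_upto_iso_at:
  assumes B: "small_cat U B" and g: "g \<in> Hom (V0 D (prod_cat (cube (length m)) B)) X Y" and b: "b \<in> Ob B"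
    and i: "\<And>q. q \<in> cube_pts (length m) \<Longrightarrow> list_all2 (\<le>) q p \<Longrightarrow> q \<noteq> p \<Longrightarrow> iso_at (prod_cat (cube (length m)) B) g (Pr (Vx q) b)"
    and j: "j \<le> length m" and q: "q \<in> cube_pts (length m)" "list_all2 (\<le>) q p" "q \<noteq> p" "ge_upto m j q"
  shows "iso_at (prod_cat (cube (length m)) B) (FA (cof_upto m j B) g) (Pr (Vx q) b)"
  using j q
proof (induction j arbitrary: q)
  case 0
  show ?case using i[OF 0(2-4)] HomD(1)[OF g] by (simp add: cof_upto_0)
next
  case (Suc j)
  let ?n = "length m"
  have j: "j < ?n" using Suc.prems(1) by simp
  have F: "is_functor (cof_upto m j B)" "Src (cof_upto m j B) = V0 D (prod_cat (cube ?n) B)" "Tgt (cof_upto m j B) = V0 D (prod_cat (cube ?n) B)"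
    using cof_uptoD[OF B, of j m] j by auto
  have gj: "FA (cof_upto m j B) g \<in> Hom (V0 D (prod_cat (cube ?n) B)) (FO (cof_upto m j B) X) (FO (cof_upto m j B) Y)"
    using functorD(4)[OF F(1)] F g by simp
  show ?case
  proof (cases "m ! j")
    case False
    thus ?thesis using Suc.IH[OF _ Suc.prems(2-4)] Suc.prems(1,5) by (simp add: cof_upto_Suc ge_upto_Suc)
  next
    case True
    hence qj: "q ! j" "ge_upto m j q" using Suc.prems(5) by (auto simp: ge_upto_Suc)
    have 1: "iso_at (prod_cat (cube ?n) B) (FA (cof_upto m j B) g) (Pr (Vx q) b)"
      using Suc.IH[OF _ Suc.prems(2-4) qj(2)] Suc.prems(1) by simp
    have lt: "list_all2 (\<le>) (q[j := False]) p" using ble_trans[OF ble_update_False Suc.prems(3)] .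
    have "q[j := False] \<noteq> p"
    proof
      assume "q[j := False] = p"
      hence "q = p" using ble_antisym[OF Suc.prems(3)] ble_update_False by metis
      thus False using Suc.prems(4) by simp
    qed
    hence 2: "iso_at (prod_cat (cube ?n) B) (FA (cof_upto m j B) g) (Pr (Vx (q[j := False])) b)"
      using Suc.IH[OF _ _ lt] Suc.prems(1,2) qj(2) by (simp add: ge_upto_update cube_pts_def)
    show ?thesis
      using cof_coord_iso_at[OF j B gj Suc.prems(2) qj(1) b 1 2] True HomD(1)[OF g] F by (simp add: cof_upto_Suc)
  qed
qed

text \<open>Downward induction on j, from the full iterated cofiber at p, where invertibility is
  \<open>top\<close>, back to g, undoing one coordinate at a time. Undoing direction j requires
  invertibility at the neighbour of p in that direction, which lies strictly below p.\<close>

lemma stable_iso_at_vertex: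
  assumes st: "stable_derivator U D" and B: "small_cat U B"
    and g: "g \<in> Hom (V0 D (prod_cat (cube (length m)) B)) X Y" and b: "b \<in> Ob B"
    and p: "p \<in> cube_pts (length m)" "list_all2 (\<le>) m p"
    and i: "\<And>q. q \<in> cube_pts (length m) \<Longrightarrow> list_all2 (\<le>) q p \<Longrightarrow> q \<noteq> p \<Longrightarrow> iso_at (prod_cat (cube (length m)) B) g (Pr (Vx q) b)"
    and top: "iso_at (prod_cat (cube (length m)) B) (FA (cof_multi D m B) g) (Pr (Vx p) b)"
  shows "iso_at (prod_cat (cube (length m)) B) g (Pr (Vx p) b)"
proof -
  let ?n = "length m"
  have "iso_at (prod_cat (cube ?n) B) (FA (cof_upto m 0 B) g) (Pr (Vx p) b)"
  proof (rule inc_induct[of 0 ?n])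
    show "iso_at (prod_cat (cube ?n) B) (FA (cof_upto m ?n B) g) (Pr (Vx p) b)" using top by (simp add: cof_multi_eq)
    fix j assume j: "j < ?n" and IH: "iso_at (prod_cat (cube ?n) B) (FA (cof_upto m (Suc j) B) g) (Pr (Vx p) b)"
    have F: "is_functor (cof_upto m j B)" "Src (cof_upto m j B) = V0 D (prod_cat (cube ?n) B)" "Tgt (cof_upto m j B) = V0 D (prod_cat (cube ?n) B)"
      using cof_uptoD[OF B, of j m] j by auto
    have gj: "FA (cof_upto m j B) g \<in> Hom (V0 D (prod_cat (cube ?n) B)) (FO (cof_upto m j B) X) (FO (cof_upto m j B) Y)"
      using functorD(4)[OF F(1)] F g by simp
    show "iso_at (prod_cat (cube ?n) B) (FA (cof_upto m j B) g) (Pr (Vx p) b)"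
    proof (cases "m ! j")
      case False
      thus ?thesis using IH by (simp add: cof_upto_Suc)
    next
      case True
      have len: "length p = ?n" using p(1) by (simp add: cube_pts_def)
      have pj: "p ! j" "\<And>l. l < ?n \<Longrightarrow> m ! l \<Longrightarrow> p ! l" using p(2) j True by (auto simp: ble_iff)
      \<comment> \<open>m_j = 1 and m \<le> p force p_j = 1, so the neighbour is a different
        vertex.\<close>
      have "p[j := False] \<noteq> p" using len pj(1) j by (metis nth_list_update_eq)
      hence q: "p[j := False] \<in> cube_pts ?n" "p[j := False] \<noteq> p" "ge_upto m j (p[j := False])"
        using len pj(2) j by (simp_all add: cube_pts_def ge_upto_update) (simp add: ge_upto_def)
      have 0: "iso_at (prod_cat (cube ?n) B) (FA (cof_upto m j B) g) (Pr (Vx (p[j := False])) b)"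
        using cof_upto_iso_at[OF B g b i _ q(1) ble_update_False q(2,3)] j by simp
      have "iso_at (prod_cat (cube ?n) B) (FA (cof_coord D ?n j B) (FA (cof_upto m j B) g)) (Pr (Vx p) b)"
        using IH True HomD(1)[OF g] F by (simp add: cof_upto_Suc)
      thus ?thesis using stable_cof_coord_iso_at[OF j B st gj p(1) pj(1) b 0] by simp
    qed
  qed simp
  thus ?thesis using HomD(1)[OF g] by (simp add: cof_upto_0)
qed

lemma cone_vanishes_cotruncated:
  assumes st: "stable_derivator U D" and B: "small_cat U B" and X: "X \<in> Ob (V0 D (prod_cat (cube n) B))"
    and v: "\<And>m. length m = n \<Longrightarrow> weight m = k + 1 \<Longrightarrow> cone_vanishes D m B X"
  shows "cotruncated D n k B X"
proof -
  let ?C = "V0 D (prod_cat (cube n) B)" and ?u = "par B (trunc_incl n k)"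
  let ?T = "prod_cat (poset_cat (trunc_pts n k)) B"
  note u = small_trunc[OF B, of n k]
  have s: "small_cat U (prod_cat (cube n) B)" "small_cat U ?T" using small_funD(2,3)[OF u] by auto
  note C = category_V0[OF s(1)]
  have ff: "fully_faithful ?u"
    unfolding trunc_incl_def
    by (rule fully_faithful_par_poset[OF functor_trunc_incl[unfolded trunc_incl_def] small_catD[OF B]])
  let ?Y = "FO (V1 D ?u) X" and ?g = "NC (lkan_counit D ?u) X"
  have Y: "?Y \<in> Ob (V0 D ?T)" using V1_Ob[OF u] X by simp
  let ?X' = "FO (lkan D ?u) ?Y"
  have g: "?g \<in> Hom ?C ?X' X" using lkan_unit(3)[OF u] X by simp
  have X': "?X' \<in> Ob ?C" using lkan_Ob[OF u] Y by simp
  have "isomorphic ?C ?X' ?X'"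
    unfolding isomorphic_def using Id_Hom[OF C X'] invertible_Id[OF C X'] by blast
  hence c': "cotruncated D n k B ?X'" unfolding cotruncated_iff using Y by blast
  \<comment> \<open>Induction on the weight stands in for the choice of a minimal vertex, since
    strictly smaller vertices have strictly smaller weight.\<close>
  have "\<forall>p. weight p = w \<longrightarrow> p \<in> cube_pts n \<longrightarrow> (\<forall>b\<in>Ob B. iso_at (prod_cat (cube n) B) ?g (Pr (Vx p) b))" for w
  proof (induction w rule: less_induct)
    case (less w)
    show ?case
    proof (intro allI impI ballI)
      fix p b assume w: "weight p = w" and p: "p \<in> cube_pts n" and b: "b \<in> Ob B"
      show "iso_at (prod_cat (cube n) B) ?g (Pr (Vx p) b)"
      proof (cases "weight p \<le> k")
        case True
        hence pt: "p \<in> trunc_pts n k" using p by (simp add: trunc_pts_def)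
        thus ?thesis
          using lkan_counit_iso_at_image[OF u ff, of X "Pr (Vx p) b"] X b FO_trunc[OF pt b] by simp
      next
        case False
        hence "k + 1 \<le> weight p" by simp
        \<comment> \<open>The weight of p leaves room for such an m below p, and then p lies on the
          face on which the cone for m is read off.\<close>
        then obtain m where m: "list_all2 (\<le>) m p" "weight m = k + 1" using ex_ble_weight by blast
        have len: "length m = n" using ble_length[OF m(1)] p by (simp add: cube_pts_def)
        let ?F = "cof_multi D m B"
        have F: "is_functor ?F" "Src ?F = ?C" "Tgt ?F = ?C"
          using cof_uptoD[OF B, of "length m" m] len by (auto simp: cof_multi_eq)
        have Fg: "FA ?F ?g \<in> Hom ?C (FO ?F ?X') (FO ?F X)" using functorD(4)[OF F(1)] F g by simp
        have z: "zero_at (prod_cat (cube n) B) (FO ?F X) (Pr (Vx p) b)"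
          using v[OF len m(2)] cone_vanishes_iff[OF B, of X m] X len p m(1) b by blast
        have z': "zero_at (prod_cat (cube n) B) (FO ?F ?X') (Pr (Vx p) b)"
          using cotruncated_cone_vanishes[OF B X' c' len m(2)] cone_vanishes_iff[OF B, of ?X' m] X' len p m(1) b by blast
        have pb: "Pr (Vx p) b \<in> Ob (prod_cat (cube n) B)" using p b by simp
        \<comment> \<open>Both cones vanish at p, and an arrow between objects that vanish there is
          invertible there.\<close>
        have top: "iso_at (prod_cat (cube n) B) (FA ?F ?g) (Pr (Vx p) b)"
          using iso_at_zero[OF s(1) pb Fg z' z] .
        have "iso_at (prod_cat (cube n) B) ?g (Pr (Vx q) b)" if q: "q \<in> cube_pts n" "list_all2 (\<le>) q p" "q \<noteq> p" for q
          using less.IH[of "weight q"] weight_strict_mono[OF q(2,3)] w q(1) b by blast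
        thus ?thesis
          using stable_iso_at_vertex[OF st B, of ?g m ?X' X b p] g b p m(1) top len by blast
      qed
    qed
  qed
  hence "invertible ?C ?g" using invertible_iff[OF s(1) g] by auto
  thus ?thesis unfolding cotruncated_iff isomorphic_def using Y g by blast
qed

end

theorem proposition9p2:
  fixes U :: "'a code set \<Rightarrow> bool"
    and D :: "('a, 'o, 'm) pder"
    and B :: "'a scat"
    and X :: 'o
    and n k :: nat
  assumes "universe U"
    and "derivator U D"
    and "pointed D"
    and "n \<ge> 1"
    and "1 \<le> k" and "k \<le> n"
    and "small_cat U B"
    and "X \<in> Ob (V0 (shift (cube n) D) B)"
  shows "(cotruncated D n k B X \<longrightarrow>
            (\<forall>m. length m = n \<and> weight m = k + 1 \<longrightarrow> cone_vanishes D m B X)) \<and>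
         (stable_derivator U D \<longrightarrow>
            (cotruncated D n k B X \<longleftrightarrow>
              (\<forall>m. length m = n \<and> weight m = k + 1 \<longrightarrow> cone_vanishes D m B X)))"
proof -
  interpret pointed_derivator U D by unfold_locales (rule assms)+
  have X: "X \<in> Ob (V0 D (prod_cat (cube n) B))" using assms(8) by simp
  show ?thesis
    using cotruncated_cone_vanishes[OF assms(7) X] cone_vanishes_cotruncated[OF _ assms(7) X] by blast
qed

end
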